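(* Let $W=\Sigma_1\times\cdots\times\Sigma_n$, where each $\Sigma_i$ is a two-dimensional symplectic surface of positive genus (with or without boundary). Then $w_G(W\times\mathbb C,\omega_{\rm prod})=\infty$.
   Context: $W\times\mathbb C$ carries the product symplectic form $\omega_{\rm prod}$ of the symplectic forms on the $\Sigma_i$ and $\omega_{\rm std}$ on $\mathbb C$. The Gromov width of a $2m$-dimensional symplectic manifold is $w_G(M,\omega)=\sup\{a\mid(B^{2m}(a),\omega_{\rm std})\text{ embeds symplectically into }(M,\omega)\}$, where $B^{2m}(a)=\{z\in\mathbb C^m\mid\pi\sum_j|z_j|^2<a\}$; if $M$ has boundary or corners, $M$ is replaced by its interior. *)

theory Defs
  imports "HOL-Analysis.Analysis"
begin

section \<open>Smooth maps\<close>

primrec Ck_on :: "nat \<Rightarrow> 'e::euclidean_space set \<Rightarrow> ('e \<Rightarrow> 'f::euclidean_space) \<Rightarrow> bool" where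
  "Ck_on 0 U f \<longleftrightarrow> continuous_on U f"
| "Ck_on (Suc k) U f \<longleftrightarrow> (\<forall>x\<in>U. f differentiable (at x)) \<and>
     (\<forall>v. Ck_on k U (\<lambda>x. frechet_derivative f (at x) v))"

text \<open>On a set that is not open (such as a relatively open subset of a half space), smooth means:
  locally the restriction of a smooth map defined on an open set.\<close>

definition smooth_on :: "'e::euclidean_space set \<Rightarrow> ('e \<Rightarrow> 'f::euclidean_space) \<Rightarrow> bool" where
  "smooth_on S f \<longleftrightarrow>
     (\<forall>x\<in>S. \<exists>U g. open U \<and> x \<in> U \<and> (\<forall>k. Ck_on k U g) \<and> (\<forall>y\<in>U \<inter> S. g y = f y))"


section \<open>Manifolds with boundary and corners\<close>

text \<open>A topological space with an atlas; the charts are indexed by a set, so that a differential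
  form can be given by its local representatives, one for each index.\<close>

record ('a, 'c, 'e) mfd =
  mtop :: "'a topology"
  charts :: "'c set"
  cdom :: "'c \<Rightarrow> 'a set"
  cmap :: "'c \<Rightarrow> 'a \<Rightarrow> 'e"

definition cimg :: "('a, 'c, 'e) mfd \<Rightarrow> 'c \<Rightarrow> 'e set" where
  "cimg M c = cmap M c ` cdom M c"

definition overlap :: "('a, 'c, 'e) mfd \<Rightarrow> 'c \<Rightarrow> 'c \<Rightarrow> 'e set" where
  "overlap M c d = cmap M c ` (cdom M c \<inter> cdom M d)"

definition transition :: "('a, 'c, 'e) mfd \<Rightarrow> 'c \<Rightarrow> 'c \<Rightarrow> 'e \<Rightarrow> 'e" where
  "transition M c d = cmap M d \<circ> inv_into (cdom M c) (cmap M c)"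

text \<open>The local model for corners of codimension \<open>k\<close>: \<open>card B = k\<close> coordinates are constrained
  to be nonnegative, the others are free.\<close>

definition sector :: "'e::euclidean_space set \<Rightarrow> 'e set" where
  "sector B = {x. \<forall>b\<in>B. 0 \<le> x \<bullet> b}"

text \<open>Manifolds whose corners have codimension at most \<open>k\<close>: the case \<open>k = 0\<close> is that of
  manifolds without boundary, \<open>k = 1\<close> that of manifolds with (possibly empty) boundary.\<close>

definition smooth_manifold :: "nat \<Rightarrow> ('a, 'c, 'e::euclidean_space) mfd \<Rightarrow> bool" where
  "smooth_manifold k M \<longleftrightarrow>
     Hausdorff_space (mtop M) \<and> second_countable (mtop M) \<and>
     (\<Union>c\<in>charts M. cdom M c) = topspace (mtop M) \<and>
     (\<forall>c\<in>charts M.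
        openin (mtop M) (cdom M c) \<and>
        homeomorphic_map (subtopology (mtop M) (cdom M c)) (top_of_set (cimg M c)) (cmap M c) \<and>
        (\<exists>B\<subseteq>Basis. card B \<le> k \<and> openin (top_of_set (sector B)) (cimg M c))) \<and>
     (\<forall>c\<in>charts M. \<forall>d\<in>charts M. smooth_on (overlap M c d) (transition M c d))"

definition mfd_interior :: "('a, 'c, 'e::euclidean_space) mfd \<Rightarrow> 'a set" where
  "mfd_interior M = {x. \<exists>c\<in>charts M. x \<in> cdom M c \<and> cmap M c x \<in> interior (cimg M c)}"


section \<open>Symplectic forms\<close>

text \<open>A 2-form is represented by its coefficients in the charts: \<open>\<omega> c p v w\<close> is the value at the
  point with coordinates \<open>p\<close> in the chart \<open>c\<close>, on the tangent vectors with coordinates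
  \<open>v\<close> and \<open>w\<close>. The derivatives below, taken within chart images and overlaps, are unique
  also at boundary points, because these sets are relatively open in a sector.\<close>

type_synonym ('c, 'e) form2 = "'c \<Rightarrow> 'e \<Rightarrow> 'e \<Rightarrow> 'e \<Rightarrow> real"

definition smooth_form2 ::
    "('a, 'c, 'e::euclidean_space) mfd \<Rightarrow> ('c, 'e) form2 \<Rightarrow> bool" where
  "smooth_form2 M \<omega> \<longleftrightarrow>
     (\<forall>c\<in>charts M.
        (\<forall>p\<in>cimg M c. bilinear (\<omega> c p) \<and> (\<forall>v. \<omega> c p v v = 0)) \<and>
        (\<forall>v w. smooth_on (cimg M c) (\<lambda>p. \<omega> c p v w))) \<and>
     (\<forall>c\<in>charts M. \<forall>d\<in>charts M. \<forall>p\<in>overlap M c d. \<forall>v w.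
        let T = transition M c d; T' = frechet_derivative T (at p within overlap M c d)
        in \<omega> c p v w = \<omega> d (T p) (T' v) (T' w))"

text \<open>The exterior derivative, evaluated on constant (hence commuting) vector fields of the
  chart \<open>c\<close>.\<close>

definition ext_deriv2 ::
    "('a, 'c, 'e::euclidean_space) mfd \<Rightarrow> ('c, 'e) form2 \<Rightarrow> 'c \<Rightarrow> 'e \<Rightarrow> 'e \<Rightarrow> 'e \<Rightarrow> 'e \<Rightarrow> real" where
  "ext_deriv2 M \<omega> c p u v w =
     (let D = (\<lambda>f :: 'e \<Rightarrow> real. frechet_derivative f (at p within cimg M c))
      in D (\<lambda>q. \<omega> c q v w) u - D (\<lambda>q. \<omega> c q u w) v + D (\<lambda>q. \<omega> c q u v) w)"

definition symplectic_form ::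
    "('a, 'c, 'e::euclidean_space) mfd \<Rightarrow> ('c, 'e) form2 \<Rightarrow> bool" where
  "symplectic_form M \<omega> \<longleftrightarrow> smooth_form2 M \<omega> \<and>
     (\<forall>c\<in>charts M. \<forall>p\<in>cimg M c.
        (\<forall>u v w. ext_deriv2 M \<omega> c p u v w = 0) \<and>
        (\<forall>v. v \<noteq> 0 \<longrightarrow> (\<exists>w. \<omega> c p v w \<noteq> 0)))"


section \<open>Surfaces and their genus\<close>

text \<open>The type \<^typ>\<open>complex\<close> serves as the real model plane.\<close>

definition symplectic_surface :: "('a, 'c, complex) mfd \<Rightarrow> ('c, complex) form2 \<Rightarrow> bool" where
  "symplectic_surface S \<omega> \<longleftrightarrow>
     smooth_manifold 1 S \<and> connected_space (mtop S) \<and> symplectic_form S \<omega>"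

definition simple_closed_curve :: "'a topology \<Rightarrow> 'a set \<Rightarrow> bool" where
  "simple_closed_curve X C \<longleftrightarrow>
     (\<exists>f. embedding_map (top_of_set (sphere (0::complex) 1)) X f \<and> C = f ` sphere 0 1)"

text \<open>The genus of a connected orientable surface: the maximal number of disjoint simple closed
  curves that together do not disconnect it. The curves must lie in the interior, since removing
  a boundary circle never disconnects. Compactness is not assumed, so the value may be infinite.\<close>

definition genus :: "('a, 'c, complex) mfd \<Rightarrow> enat" where
  "genus S = Sup {enat (card F) | F. finite F \<and> disjoint F \<and>
     (\<forall>C\<in>F. simple_closed_curve (mtop S) C \<and> C \<subseteq> mfd_interior S) \<and>
     connectedin (mtop S) (topspace (mtop S) - \<Union>F)}"


section \<open>Products and the standard symplectic structure\<close>

definition Pi_mfd ::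
    "('n::finite \<Rightarrow> ('a, 'c, 'e::euclidean_space) mfd) \<Rightarrow> ('n \<Rightarrow> 'a, 'n \<Rightarrow> 'c, 'e ^ 'n) mfd" where
  "Pi_mfd M = \<lparr>mtop = product_topology (\<lambda>i. mtop (M i)) UNIV,
     charts = {c. \<forall>i. c i \<in> charts (M i)},
     cdom = (\<lambda>c. {x. \<forall>i. x i \<in> cdom (M i) (c i)}),
     cmap = (\<lambda>c x. \<chi> i. cmap (M i) (c i) (x i))\<rparr>"

definition Pi_form2 ::
    "('n::finite \<Rightarrow> ('c, 'e::euclidean_space) form2) \<Rightarrow> ('n \<Rightarrow> 'c, 'e ^ 'n) form2" where
  "Pi_form2 \<omega> = (\<lambda>c p v w. \<Sum>i\<in>UNIV. \<omega> i (c i) (p $ i) (v $ i) (w $ i))"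

definition prod_mfd ::
    "('a, 'c, 'e::euclidean_space) mfd \<Rightarrow> ('b, 'd, 'f::euclidean_space) mfd
      \<Rightarrow> ('a \<times> 'b, 'c \<times> 'd, 'e \<times> 'f) mfd" where
  "prod_mfd M N = \<lparr>mtop = prod_topology (mtop M) (mtop N),
     charts = charts M \<times> charts N,
     cdom = (\<lambda>(c, d). cdom M c \<times> cdom N d),
     cmap = (\<lambda>(c, d) (x, y). (cmap M c x, cmap N d y))\<rparr>"

definition prod_form2 ::
    "('c, 'e::euclidean_space) form2 \<Rightarrow> ('d, 'f::euclidean_space) form2
      \<Rightarrow> ('c \<times> 'd, 'e \<times> 'f) form2" where
  "prod_form2 \<omega> \<eta> =
     (\<lambda>(c, d) (p, q) (v, v') (w, w'). \<omega> c p v w + \<eta> d q v' w')"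

definition complex_mfd :: "(complex, unit, complex) mfd" where
  "complex_mfd = \<lparr>mtop = euclidean, charts = UNIV, cdom = (\<lambda>_. UNIV), cmap = (\<lambda>_ z. z)\<rparr>"

text \<open>\<open>dx \<and> dy\<close> on the complex plane, and its sum over the coordinates of \<open>\<complex>\<^sup>m\<close>.\<close>

definition area_form :: "complex \<Rightarrow> complex \<Rightarrow> real" where
  "area_form v w = Re v * Im w - Im v * Re w"

definition complex_form2 :: "(unit, complex) form2" where
  "complex_form2 = (\<lambda>_ _. area_form)"

definition std_form :: "complex ^ 'm \<Rightarrow> complex ^ 'm \<Rightarrow> real" where
  "std_form v w = (\<Sum>j\<in>UNIV. area_form (v $ j) (w $ j))"


section \<open>The Gromov width\<close>

definition std_ball :: "real \<Rightarrow> (complex ^ 'm) set" where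
  "std_ball a = {z. pi * (\<Sum>j\<in>UNIV. (cmod (z $ j))\<^sup>2) < a}"

definition symplectic_ball_embedding ::
    "real \<Rightarrow> ('a, 'c, 'e::euclidean_space) mfd \<Rightarrow> ('c, 'e) form2 \<Rightarrow> (complex ^ 'm \<Rightarrow> 'a) \<Rightarrow> bool" where
  "symplectic_ball_embedding a M \<omega> f \<longleftrightarrow>
     embedding_map (top_of_set (std_ball a)) (subtopology (mtop M) (mfd_interior M)) f \<and>
     (\<forall>c\<in>charts M.
        smooth_on {z \<in> std_ball a. f z \<in> cdom M c} (cmap M c \<circ> f) \<and>
        (\<forall>z\<in>std_ball a. f z \<in> cdom M c \<longrightarrow>
           (let D = frechet_derivative (cmap M c \<circ> f) (at z)
            in inj D \<and> (\<forall>v w. \<omega> c (cmap M c (f z)) (D v) (D w) = std_form v w))))"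

text \<open>The type argument is the index type of the coordinates of \<open>\<complex>\<^sup>m\<close>; to be used with
  \<open>2 * CARD('m) = DIM('e)\<close>, the dimension of the manifold.\<close>

definition gromov_width ::
    "'m::finite itself \<Rightarrow> ('a, 'c, 'e::euclidean_space) mfd \<Rightarrow> ('c, 'e) form2 \<Rightarrow> ennreal" where
  "gromov_width _ M \<omega> =
     Sup {ennreal a | a. 0 < a \<and> (\<exists>f :: complex ^ 'm \<Rightarrow> 'a. symplectic_ball_embedding a M \<omega> f)}"

end

theory Submission
  imports Defs "HOL-Complex_Analysis.Complex_Analysis"
begin

text \<open>For one surface \<open>\<Sigma>\<close> it suffices to embed \<open>K \<times> K\<close> symplectically into \<open>\<Sigma> \<times> \<complex>\<close> for every square
\<open>K\<close>, with bounded \<open>\<complex>\<close>-component: the \<open>\<complex>\<close>-component then serves as input for the next factor, and large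
cubes contain large balls. A nonseparating curve in the interior of \<open>\<Sigma>\<close> is dual to a smooth function
\<open>h\<close> to the punctured plane that equals 1 off a compact set and has no logarithm. On the cyclic cover where
\<open>r = arg h\<close> becomes single valued the area is infinite, and discs can be pushed over many translates of a
box, so large squares embed there, preserving area. They do not embed in \<open>\<Sigma>\<close>, but
\<open>(q, x + i y) \<mapsto> (\<Phi>\<^sub>y q, x + \<phi> r + i y)\<close> separates the sheets: \<open>\<phi> (r + 2 \<pi>) - \<phi> r\<close> exceeds the width of \<open>K\<close>,
and \<open>\<Phi>\<close> is the flow of the multivalued Hamiltonian \<open>\<phi> r\<close>, whose differential descends to \<open>\<Sigma>\<close> and is supported
near one regular level of \<open>arg h\<close>.\<close>

section \<open>Calculus of smooth maps\<close>

text \<open>Large area suffices for large squares: an embedded disc can be made to engulf many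
  disjoint discs, and an explicit rearrangement then makes its density constant. Genus enters
  through the cover, which has infinite area even when the surface has very little. The obstacle is
  that the sheets of the cover overlap in \<Sigma>, and only the factor \<complex> has room to pull
  them apart. Moving x by a function of r alone is not symplectic; letting y be the time of the flow
  of the same function produces the opposite error term, and since the flow preserves r, both
  corrections can be repeated in small steps. Regularity of the level matters because near it there
  are area-preserving coordinates with imaginary part r, in which the flow is horizontal with a
  speed depending only on the height. So no differential equation is solved: compactness leaves
  finitely many such boxes, and a long flow time is cut into steps that stay inside a box. Surfaces
  with boundary are replaced by their interiors, which remain connected when the curves are
  removed.\<close>

abbreviation dd :: "('e::euclidean_space => 'f::euclidean_space) => 'e => 'e => 'f" where
 "dd f x \<equiv> frechet_derivative f (at x)"

lemma dd_eqI: "(f has_derivative f') (at x) ==> dd f x = f'"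
 by (rule frechet_derivative_at[symmetric])

lemma dd_cong:
 assumes "open U" "x \<in> U" "\<And>y. y \<in> U ==> f y = g y"
 shows "dd f x = dd g x" and "f differentiable (at x) \<longleftrightarrow> g differentiable (at x)"
proof -
 have *: "(f has_derivative D) (at x) \<longleftrightarrow> (g has_derivative D) (at x)" for D
  using assms by (metis has_derivative_transform_within_open)
 thus "dd f x = dd g x" "f differentiable (at x) \<longleftrightarrow> g differentiable (at x)"
  by (auto simp: frechet_derivative_def differentiable_def)
qed

lemma Ck_cong:
 assumes "open U" "\<And>y. y \<in> U ==> f y = g y"
 shows "Ck_on k U f \<longleftrightarrow> Ck_on k U g"
 using assms
proof (induction k arbitrary: f g)
 case 0
 thus ?case by (metis Ck_on.simps(1) continuous_on_cong)
next
 case (Suc k)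
 have "dd f x v = dd g x v" if "x \<in> U" for x v
  by (simp add: dd_cong(1)[OF Suc.prems(1) that Suc.prems(2)])
 hence "Ck_on k U (\<lambda>x. dd f x v) \<longleftrightarrow> Ck_on k U (\<lambda>x. dd g x v)" for v
  by (intro Suc.IH Suc.prems(1))
 moreover have "(\<forall>x\<in>U. f differentiable (at x)) \<longleftrightarrow> (\<forall>x\<in>U. g differentiable (at x))"
  by (intro ball_cong refl dd_cong(2)[OF Suc.prems(1) _ Suc.prems(2)])
 ultimately show ?case by (simp only: Ck_on.simps)
qed

lemma Ck_subset: "Ck_on k U f ==> V \<subseteq> U ==> Ck_on k V f"
 by (induction k arbitrary: f) (auto intro: continuous_on_subset)

lemma Ck_cont: "Ck_on k U f ==> continuous_on U f"
 by (cases k) (auto simp: differentiable_imp_continuous_within continuous_at_imp_continuous_on)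

lemma Ck_Suc_D: "Ck_on (Suc k) U f ==> Ck_on k U f"
proof (induction k arbitrary: f)
 case 0 thus ?case using Ck_cont by (metis Ck_on.simps(1))
qed auto

lemma Ck_local:
 assumes "\<And>x. x \<in> U ==> \<exists>V. open V \<and> x \<in> V \<and> Ck_on k V f"
 shows "Ck_on k U f"
 using assms
proof (induction k arbitrary: f)
 case 0
 show ?case
  unfolding Ck_on.simps
 proof (rule continuous_at_imp_continuous_on, rule ballI)
  fix x assume "x \<in> U"
  then obtain V where "open V" "x \<in> V" "continuous_on V f"
   using 0[of x] unfolding Ck_on.simps by blast
  thus "isCont f x" by (simp add: continuous_on_eq_continuous_at)
 qed
next
 case (Suc k)
 have "Ck_on k U (\<lambda>x. dd f x v)" for v
 proof (rule Suc.IH)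
  fix x assume "x \<in> U"
  from Suc.prems[OF this] show "\<exists>V. open V \<and> x \<in> V \<and> Ck_on k V (\<lambda>x. dd f x v)"
   unfolding Ck_on.simps by blast
 qed
 moreover have "f differentiable (at x)" if "x \<in> U" for x
  using Suc.prems[OF that] by auto
 ultimately show ?case by (simp only: Ck_on.simps) blast
qed

lemma Ck_dd_cong:
 assumes "open U" "\<And>x v. x \<in> U ==> dd f x v = D x v" "Ck_on k U (\<lambda>x. D x v)"
 shows "Ck_on k U (\<lambda>x. dd f x v)"
 using Ck_cong[OF assms(1), of "\<lambda>x. dd f x v" "\<lambda>x. D x v"] assms by blast

lemma Ck_const: "Ck_on k U (\<lambda>x. c)"
 by (induction k arbitrary: c) auto

lemma Ck_linear: "bounded_linear f ==> Ck_on k U f"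
proof (induction k)
 case 0 thus ?case by (simp add: linear_continuous_on)
next
 case (Suc k)
 have "dd f x v = f v" for x v
  using dd_eqI[OF bounded_linear.has_derivative[OF Suc.prems has_derivative_ident]] by metis
 thus ?case
  using Suc.prems by (auto simp: bounded_linear_imp_differentiable Ck_const)
qed

lemma Ck_add:
 assumes "open U" "Ck_on k U f" "Ck_on k U g"
 shows "Ck_on k U (\<lambda>x. f x + g x)"
 using assms(2,3)
proof (induction k arbitrary: f g)
 case 0 thus ?case by (auto intro: continuous_intros)
next
 case (Suc k)
 have d: "dd (\<lambda>x. f x + g x) x v = dd f x v + dd g x v" if "x \<in> U" for x v
  using Suc.prems that
  by (subst dd_eqI[OF has_derivative_add[OF frechet_derivative_works[THEN iffD1] frechet_derivative_works[THEN iffD1]]]) auto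
 have "Ck_on k U (\<lambda>x. dd (\<lambda>x. f x + g x) x v)" for v
  using Ck_cong[OF assms(1) d] Suc by fastforce
 thus ?case using Suc.prems by auto
qed

lemma Ck_bilinear:
 assumes "bounded_bilinear B" "open U" "Ck_on k U f" "Ck_on k U g"
 shows "Ck_on k U (\<lambda>x. B (f x) (g x))"
 using assms(3,4)
proof (induction k arbitrary: f g)
 case 0 thus ?case
  by (auto intro: bounded_bilinear.continuous_on[OF assms(1)])
next
 case (Suc k)
 have D: "((\<lambda>x. B (f x) (g x)) has_derivative (\<lambda>h. B (f x) (dd g x h) + B (dd f x h) (g x))) (at x)" if "x \<in> U" for x
  using Suc.prems that
  by (intro bounded_bilinear.FDERIV[OF assms(1)]) (auto simp: frechet_derivative_works[symmetric])
 have d: "dd (\<lambda>x. B (f x) (g x)) x v = B (f x) (dd g x v) + B (dd f x v) (g x)" if "x \<in> U" for x v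
  using dd_eqI[OF D[OF that]] by metis
 have "Ck_on k U (\<lambda>x. B (f x) (dd g x v) + B (dd f x v) (g x))" for v
  by (intro Ck_add assms Suc.IH Ck_Suc_D[OF Suc.prems(1)] Ck_Suc_D[OF Suc.prems(2)])
    (use Suc.prems in auto)
 hence "Ck_on k U (\<lambda>x. dd (\<lambda>x. B (f x) (g x)) x v)" for v
  using Ck_dd_cong[OF assms(2) d] by blast
 thus ?case using D by (auto simp: differentiable_def)
qed

lemma Ck_lin_comp:
 assumes "bounded_linear L" "open U" "Ck_on k U f"
 shows "Ck_on k U (\<lambda>x. L (f x))"
 using assms(3)
proof (induction k arbitrary: f)
 case 0 thus ?case
  using bounded_linear.continuous_on[OF assms(1)] by auto
next
 case (Suc k)
 have D: "((\<lambda>x. L (f x)) has_derivative (\<lambda>h. L (dd f x h))) (at x)" if "x \<in> U" for x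
  using Suc.prems that
  by (intro bounded_linear.has_derivative[OF assms(1)]) (auto simp: frechet_derivative_works[symmetric])
 have d: "dd (\<lambda>x. L (f x)) x v = L (dd f x v)" if "x \<in> U" for x v
  using dd_eqI[OF D[OF that]] by metis
 have "Ck_on k U (\<lambda>x. dd (\<lambda>x. L (f x)) x v)" for v
  by (rule Ck_dd_cong[OF assms(2) d]) (use Suc in auto)
 thus ?case using D by (auto simp: differentiable_def)
qed

lemma Ck_sum:
 assumes "open U" "\<And>i. i \<in> I ==> Ck_on k U (f i)"
 shows "Ck_on k U (\<lambda>x. \<Sum>i\<in>I. f i x)"
proof (cases "finite I")
 case True
 thus ?thesis using assms(2)
  by (induction) (auto simp: Ck_const intro!: Ck_add assms(1))
qed (simp add: Ck_const)

lemma dd_linear: "f differentiable (at x) ==> linear (dd f x)"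
 using frechet_derivative_works has_derivative_linear by blast

lemma dd_compose:
 assumes "g differentiable (at x)" "f differentiable (at (g x))"
 shows "(f \<circ> g) differentiable (at x)" "dd (f \<circ> g) x = (\<lambda>v. dd f (g x) (dd g x v))"
proof -
 have D: "((f \<circ> g) has_derivative (dd f (g x) \<circ> dd g x)) (at x)"
  using assms by (intro diff_chain_at) (auto simp: frechet_derivative_works[symmetric])
 show "(f \<circ> g) differentiable (at x)" using D differentiable_def by blast
 show "dd (f \<circ> g) x = (\<lambda>v. dd f (g x) (dd g x v))" using dd_eqI[OF D] by (auto simp: o_def)
qed

lemma Ck_compose:
 fixes f :: "'f::euclidean_space => 'g::euclidean_space" and g :: "'e::euclidean_space => 'f"
 assumes "open U" "Ck_on k V f" "Ck_on k U g" "g ` U \<subseteq> V"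
 shows "Ck_on k U (f \<circ> g)"
 using assms(2,3)
proof (induction k arbitrary: f)
 case 0 thus ?case using assms(4) by (metis Ck_on.simps(1) continuous_on_compose continuous_on_subset)
next
 case (Suc k)
 have df: "f differentiable (at (g x))" and dg: "g differentiable (at x)" if "x \<in> U" for x
  using Suc.prems that assms(4) by auto
 \<comment> \<open>\<open>Ck_on\<close> controls the derivative of f only in fixed directions,
   whereas the direction \<open>dd g x v\<close> moves with x; expanding it in the basis leaves
   fixed directions with varying coefficients.\<close>
 have d: "dd (f \<circ> g) x v = (\<Sum>b\<in>Basis. (dd g x v \<bullet> b) *\<^sub>R (((\<lambda>y. dd f y b) \<circ> g) x))" if "x \<in> U" for x v
 proof -
  have "dd (f \<circ> g) x v = dd f (g x) (\<Sum>b\<in>Basis. (dd g x v \<bullet> b) *\<^sub>R b)"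
   using dd_compose(2)[OF dg df] that by (simp add: euclidean_representation)
  also have "\<dots> = (\<Sum>b\<in>Basis. (dd g x v \<bullet> b) *\<^sub>R dd f (g x) b)"
   using dd_linear[OF df[OF that]] by (simp add: linear_sum linear_scale)
  finally show ?thesis by simp
 qed
 have "Ck_on k U (\<lambda>x. \<Sum>b\<in>Basis. (dd g x v \<bullet> b) *\<^sub>R (((\<lambda>y. dd f y b) \<circ> g) x))" for v
 proof (rule Ck_sum[OF assms(1)], rule Ck_bilinear[OF bounded_bilinear_scaleR assms(1)])
  fix b :: 'f
  show "Ck_on k U (\<lambda>x. dd g x v \<bullet> b)"
   by (rule Ck_lin_comp[OF bounded_linear_inner_left assms(1)]) (use Suc.prems(2) in simp)
  show "Ck_on k U ((\<lambda>y. dd f y b) \<circ> g)"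
   by (rule Suc.IH[OF _ Ck_Suc_D[OF Suc.prems(2)]]) (use Suc.prems(1) in simp)
 qed
 hence "Ck_on k U (\<lambda>x. dd (f \<circ> g) x v)" for v
  using Ck_dd_cong[OF assms(1) d] by blast
 moreover have "(f \<circ> g) differentiable (at x)" if "x \<in> U" for x
  using dd_compose(1)[OF dg df] that by blast
 ultimately show ?case by (simp only: Ck_on.simps) blast
qed

text \<open>Unlike \<open>smooth_on\<close>, this includes openness of the domain, so that
  derivatives at points of \<open>U\<close> depend only on the values on \<open>U\<close>.\<close>

definition smooth :: "'e::euclidean_space set => ('e => 'f::euclidean_space) => bool" where
 "smooth U f \<longleftrightarrow> open U \<and> (\<forall>k. Ck_on k U f)"

lemma smooth_open: "smooth U f ==> open U" by (simp add: smooth_def)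

lemma smooth_diff: "smooth U f ==> x \<in> U ==> f differentiable (at x)"
 unfolding smooth_def using Ck_on.simps(2)[of 0 U f] by blast

lemma smooth_der: "smooth U f ==> x \<in> U ==> (f has_derivative dd f x) (at x)"
 by (simp add: frechet_derivative_works[symmetric] smooth_diff)

lemma smooth_dd: "smooth U f ==> smooth U (\<lambda>x. dd f x v)"
 unfolding smooth_def using Ck_on.simps(2)[of _ U f] by blast

lemma smooth_cont: "smooth U f ==> continuous_on U f"
 unfolding smooth_def using Ck_cont by blast

lemma smooth_subset: "smooth U f ==> open V ==> V \<subseteq> U ==> smooth V f"
 unfolding smooth_def using Ck_subset by blast

lemma smooth_cong: "smooth U f ==> (\<And>x. x \<in> U ==> f x = g x) ==> smooth U g"
 unfolding smooth_def using Ck_cong by blast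

lemma smooth_vimage:
 assumes "smooth N l" "open M" shows "open (N \<inter> l -` M)"
 using continuous_open_preimage[OF smooth_cont[OF assms(1)] smooth_open[OF assms(1)] assms(2)] .

lemma smooth_local:
 assumes "\<And>x. x \<in> U ==> \<exists>V. x \<in> V \<and> V \<subseteq> U \<and> smooth V f"
 shows "smooth U f"
proof -
 have "open U" using assms by (subst open_subopen) (metis smooth_def)
 moreover have "Ck_on k U f" for k
  by (rule Ck_local) (metis assms smooth_def)
 ultimately show ?thesis unfolding smooth_def by blast
qed

lemma smooth_Un: "smooth U f ==> smooth V f ==> smooth (U \<union> V) f"
 by (rule smooth_local) blast

lemma smooth_const: "open U ==> smooth U (\<lambda>x. c)"
 by (simp add: smooth_def Ck_const)

lemma smooth_linear: "open U ==> bounded_linear f ==> smooth U f"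
 by (simp add: smooth_def Ck_linear)

lemma smooth_ident: "open U ==> smooth U (\<lambda>x. x)"
 by (simp add: smooth_linear bounded_linear_ident)

lemma smooth_add: "smooth U f ==> smooth U g ==> smooth U (\<lambda>x. f x + g x)"
 by (simp add: smooth_def Ck_add)

lemma smooth_bilinear:
 "bounded_bilinear B ==> smooth U f ==> smooth U g ==> smooth U (\<lambda>x. B (f x) (g x))"
 by (simp add: smooth_def Ck_bilinear)

lemmas smooth_mult = smooth_bilinear[OF bounded_bilinear_mult]
lemma smooth_lin_comp: "bounded_linear L ==> smooth U f ==> smooth U (\<lambda>x. L (f x))"
 by (simp add: smooth_def Ck_lin_comp)

lemmas smooth_Re = smooth_lin_comp[OF bounded_linear_Re]
lemmas smooth_Im = smooth_lin_comp[OF bounded_linear_Im]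
lemmas smooth_fst = smooth_lin_comp[OF bounded_linear_fst]
lemmas smooth_snd = smooth_lin_comp[OF bounded_linear_snd]
lemmas smooth_of_real = smooth_lin_comp[OF bounded_linear_of_real]
lemmas smooth_cnj = smooth_lin_comp[OF bounded_linear_cnj]
lemmas smooth_minus = smooth_lin_comp[OF bounded_linear_minus[OF bounded_linear_ident]]

lemma smooth_diff': "smooth U f ==> smooth U g ==> smooth U (\<lambda>x. f x - g x)"
 using smooth_add[OF _ smooth_minus, of U f g] by simp

lemma smooth_sum:
 "open U ==> (\<And>i. i \<in> I ==> smooth U (f i)) ==> smooth U (\<lambda>x. \<Sum>i\<in>I. f i x)"
 by (simp add: smooth_def Ck_sum)

lemma smooth_Pair:
 assumes "smooth U f" "smooth U g" shows "smooth U (\<lambda>x. (f x, g x))"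
proof -
 have "bounded_linear (\<lambda>x::'b. (x, 0::'c))" "bounded_linear (\<lambda>x::'c. (0::'b, x))"
  by (auto intro!: bounded_linear_Pair bounded_linear_ident bounded_linear_zero)
 from smooth_add[OF smooth_lin_comp[OF this(1) assms(1)] smooth_lin_comp[OF this(2) assms(2)]]
 show ?thesis by simp
qed

lemma smooth_Complex:
 assumes "smooth U f" "smooth U g" shows "smooth U (\<lambda>x. Complex (f x) (g x))"
proof -
 have "smooth U (\<lambda>x. of_real (f x) + of_real (g x) * \<i>)"
  using assms by (intro smooth_add smooth_mult smooth_of_real smooth_const) (auto simp: smooth_def)
 thus ?thesis by (rule smooth_cong) (simp add: complex_eq_iff)
qed

lemma smooth_compose:
 assumes "smooth V f" "smooth U g" "g ` U \<subseteq> V"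
 shows "smooth U (\<lambda>x. f (g x))"
 using assms Ck_compose[of U _ V f g] by (auto simp: smooth_def o_def)

text \<open>Spares an induction on the order for families closed under directional derivatives:
  holomorphic functions, polynomials in 1/x times exp (-1/x), and integrals depending on a
  parameter.\<close>

lemma smooth_coinduct:
 assumes "open U" "P f"
  and "\<And>f. P f ==> (\<forall>x\<in>U. f differentiable (at x)) \<and> (\<forall>v. \<exists>g. P g \<and> (\<forall>x\<in>U. dd f x v = g x))"
 shows "smooth U f"
proof -
 have "Ck_on k U f" if "P f" for k f
  using that
 proof (induction k arbitrary: f)
  case 0
  thus ?case using assms(3)
   by (simp add: continuous_at_imp_continuous_on differentiable_imp_continuous_within)
 next
  case (Suc k)
  have "Ck_on k U (\<lambda>x. dd f x v)" for v
  proof -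
   obtain g where "P g" "\<forall>x\<in>U. dd f x v = g x" using assms(3)[OF Suc.prems] by blast
   thus ?thesis
    using Ck_cong[OF assms(1), of "\<lambda>x. dd f x v" g] Suc.IH by blast
  qed
  thus ?case using assms(3)[OF Suc.prems] by simp
 qed
 thus ?thesis using assms by (simp add: smooth_def)
qed

lemma smooth_holomorphic:
 assumes "f holomorphic_on U" "open U" shows "smooth U f"
proof (rule smooth_coinduct[where P = "\<lambda>f. f holomorphic_on U"])
 fix f assume f: "f holomorphic_on U"
 have D: "(f has_derivative (\<lambda>v. deriv f x * v)) (at x)" if "x \<in> U" for x
  using f assms(2) that by (metis has_field_derivative_def holomorphic_derivI)
 thus "(\<forall>x\<in>U. f differentiable (at x)) \<and> (\<forall>v. \<exists>g. g holomorphic_on U \<and> (\<forall>x\<in>U. dd f x v = g x))"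
 proof (intro conjI ballI allI)
  fix v
  have "(\<lambda>x. deriv f x * v) holomorphic_on U"
   using f assms(2) by (intro holomorphic_intros holomorphic_deriv)
  moreover have "dd f x v = deriv f x * v" if "x \<in> U" for x
   using dd_eqI[OF D[OF that]] by simp
  ultimately show "\<exists>g. g holomorphic_on U \<and> (\<forall>x\<in>U. dd f x v = g x)"
   by blast
 qed (auto simp: differentiable_def)
qed (use assms in auto)

lemmas smooth_hol_comp = smooth_compose[OF smooth_holomorphic]

lemma smooth_exp: "smooth U f ==> smooth U (\<lambda>x. exp (f x :: complex))"
 by (rule smooth_hol_comp[of exp UNIV]) (auto intro: holomorphic_intros)

lemma smooth_Ln: "smooth U f ==> (\<And>x. x \<in> U ==> f x \<notin> \<real>\<^sub>\<le>\<^sub>0) ==> smooth U (\<lambda>x. Ln (f x))"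
 by (rule smooth_hol_comp[of Ln "- \<real>\<^sub>\<le>\<^sub>0"]) (auto intro!: holomorphic_intros)

lemma smooth_recip: "smooth U f ==> (\<And>x. x \<in> U ==> f x \<noteq> 0) ==> smooth U (\<lambda>x. inverse (f x :: complex))"
 by (rule smooth_hol_comp[of inverse "- {0}"]) (auto intro!: holomorphic_intros)

lemma smooth_divide: "smooth U f ==> smooth U g ==> (\<And>x. x \<in> U ==> g x \<noteq> 0)
  ==> smooth U (\<lambda>x. f x / (g x :: complex))"
 unfolding divide_inverse by (intro smooth_mult smooth_recip)

lemma smooth_divide_real:
 assumes "smooth U f" "smooth U g" "\<And>x. x \<in> U ==> g x \<noteq> 0"
  shows "smooth U (\<lambda>x. f x / (g x :: real))"
proof -
 have "smooth U (\<lambda>x. Re (complex_of_real (f x) / of_real (g x)))"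
  using assms by (intro smooth_Re smooth_divide smooth_of_real) auto
 thus ?thesis by (rule smooth_cong) (metis Re_complex_of_real of_real_divide)
qed

subsection \<open>Planar maps and their Jacobians\<close>

definition jac :: "(complex => complex) => complex => real" where
 "jac f z = area_form (dd f z 1) (dd f z \<i>)"

lemma area_form_linear:
 assumes "linear D"
 shows "area_form (D u) (D v) = area_form (D 1) (D \<i>) * area_form u v"
proof -
 have D: "D w = Re w *\<^sub>R D 1 + Im w *\<^sub>R D \<i>" for w
 proof -
  have "w = Re w *\<^sub>R 1 + Im w *\<^sub>R \<i>" by (simp add: complex_eq_iff)
  thus ?thesis using linear_add[OF assms] linear_scale[OF assms] by metis
 qed
 show ?thesis
  by (subst D[of u], subst D[of v]) (simp add: area_form_def algebra_simps)
qed

lemma area_form_dd: "f differentiable (at z) ==> area_form (dd f z u) (dd f z v) = jac f z * area_form u v"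
 unfolding jac_def by (rule area_form_linear[OF dd_linear])

lemma jac_compose:
 assumes "g differentiable (at x)" "f differentiable (at (g x))"
 shows "jac (\<lambda>x. f (g x)) x = jac f (g x) * jac g x"
using dd_compose(2)[OF assms] by (auto simp: o_def jac_def[of "\<lambda>x. f (g x)"] jac_def[of g] area_form_dd[OF assms(2)])

lemma jac_cong: "open U ==> x \<in> U ==> (\<And>y. y \<in> U ==> f y = g y) ==> jac f x = jac g x"
 unfolding jac_def using dd_cong(1)[of U x f g] by simp

lemma jac_ident: "jac (\<lambda>x. x) z = 1"
 unfolding jac_def using dd_eqI[OF has_derivative_ident, of z] by (simp add: area_form_def)

lemma jac_affine: "jac (\<lambda>x. p + e * x) z = (cmod e)\<^sup>2"
proof -
 have "((\<lambda>x. p + e * x) has_derivative (\<lambda>h. e * h)) (at z)"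
  by (auto intro!: derivative_eq_intros)
 from dd_eqI[OF this] show ?thesis
  by (simp add: jac_def area_form_def cmod_power2) (simp add: power2_eq_square)
qed

lemma smooth_area_form:
 "smooth U f ==> smooth U g ==> smooth U (\<lambda>x. area_form (f x) (g x))"
 unfolding area_form_def by (intro smooth_diff' smooth_mult smooth_Re smooth_Im)

lemma smooth_jac: "smooth U f ==> smooth U (jac f)"
 using smooth_area_form[OF smooth_dd smooth_dd, of U f f 1 \<i>] by (simp add: jac_def[abs_def])

lemma dd_complex: "f differentiable (at z) ==> dd f z w = Re w *\<^sub>R dd f z 1 + Im w *\<^sub>R dd f z \<i>"
proof -
 assume "f differentiable (at z)"
 have "w = Re w *\<^sub>R 1 + Im w *\<^sub>R \<i>" by (simp add: complex_eq_iff)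
 thus ?thesis
  using linear_add[OF dd_linear[OF \<open>f differentiable (at z)\<close>]]
   linear_scale[OF dd_linear[OF \<open>f differentiable (at z)\<close>]] by metis
qed

text \<open>Cramer's rule for the inverse of \<open>dd G z\<close>. The explicit formula makes its
  smooth dependence on z evident.\<close>

definition jinv :: "(complex => complex) => complex => complex => complex" where
 "jinv G z v = Complex (area_form v (dd G z \<i>) / jac G z) (area_form (dd G z 1) v / jac G z)"

lemma bounded_linear_jinv: "bounded_linear (jinv G z)"
proof -
 have "linear (jinv G z)"
  by (rule linearI) (auto simp: jinv_def area_form_def complex_eq_iff algebra_simps add_divide_distrib diff_divide_distrib)
 thus ?thesis by (simp add: linear_conv_bounded_linear)
qed

lemma jinv_dd:
 assumes "G differentiable (at z)" "jac G z \<noteq> 0"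
 shows "jinv G z (dd G z w) = w"
using area_form_dd[OF assms(1)] assms(2) by (auto simp: area_form_def jinv_def complex_eq_iff)

lemma jinv_area:
 assumes "jac G z \<noteq> 0"
 shows "area_form (jinv G z 1) (jinv G z \<i>) = 1 / jac G z"
proof -
 have "area_form (jinv G z 1) (jinv G z \<i>) = (jac G z) / (jac G z * jac G z)"
  by (simp add: jinv_def area_form_def jac_def algebra_simps diff_divide_distrib)
 thus ?thesis using assms by simp
qed

text \<open>Invariance of domain makes H continuous on an open set, so the inverse function rule
  gives its derivative \<open>jinv G (H y)\<close>. This is a smooth function composed with H, so
  each order of differentiability of H yields the next.\<close>

lemma smooth_inverse:
 assumes sm: "smooth U G" and inj: "inj_on G U" and nz: "\<And>z. z \<in> U ==> jac G z \<noteq> 0"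
  and H: "\<And>z. z \<in> U ==> H (G z) = z"
 shows "smooth (G ` U) H" and "\<And>z. z \<in> U ==> jac H (G z) = 1 / jac G z"
proof -
 have oU: "open U" and cG: "continuous_on U G" using sm smooth_open smooth_cont by auto
 have oV: "open (G ` U)" by (rule invariance_of_domain[OF cG oU inj])
 have cH: "continuous_on (G ` U) H"
  by (rule continuous_on_inverse_open[OF oU cG _ H]) auto
 have D: "(H has_derivative jinv G (H y)) (at y)" if y: "y \<in> G ` U" for y
 proof (rule has_derivative_inverse_basic[OF _ bounded_linear_jinv])
  have Hy: "H y \<in> U" using y H by auto
  show "(G has_derivative dd G (H y)) (at (H y))" by (rule smooth_der[OF sm Hy])
  show "jinv G (H y) \<circ> dd G (H y) = id"
   using jinv_dd[OF smooth_diff[OF sm Hy] nz[OF Hy]] by auto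
  show "continuous (at y) H" using continuous_on_eq_continuous_at[THEN iffD1, rule_format, OF oV cH y] .
  show "open (G ` U)" "y \<in> G ` U" by fact+
  show "G (H z) = z" if "z \<in> G ` U" for z using that H by auto
 qed
 have smE: "smooth U (\<lambda>z. jinv G z v)" for v
  unfolding jinv_def
  by (intro smooth_Complex smooth_divide_real smooth_area_form smooth_dd[OF sm] smooth_jac[OF sm]
    smooth_const[OF oU] nz)
 have "Ck_on k (G ` U) H" for k
 proof (induction k)
  case 0 thus ?case using cH by simp
 next
  case (Suc k)
  have "Ck_on k (G ` U) (\<lambda>y. jinv G (H y) v)" for v
  proof -
   have "Ck_on k (G ` U) ((\<lambda>z. jinv G z v) \<circ> H)"
   using smE[of v] H Ck_compose[OF oV _ Suc] by (fastforce simp: smooth_def)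
   thus ?thesis by (simp add: o_def)
  qed
  moreover have "dd H y v = jinv G (H y) v" if "y \<in> G ` U" for y v
   using dd_eqI[OF D[OF that]] by simp
  ultimately have "Ck_on k (G ` U) (\<lambda>y. dd H y v)" for v
   using Ck_dd_cong[OF oV, of H "\<lambda>y v. jinv G (H y) v" k v] by blast
  thus ?case using D unfolding Ck_on.simps differentiable_def by blast
 qed
 thus "smooth (G ` U) H" using oV by (simp add: smooth_def)
 show "jac H (G z) = 1 / jac G z" if z: "z \<in> U" for z
 using dd_eqI[OF D[of "G z"]] z H jinv_area[OF nz[OF z]] by (auto simp: jac_def)
qed

text \<open>The factor \<open>sgn (jac G p)\<close> expresses that the Jacobian keeps on the ball
  the sign that it has at p, whichever that is; in particular it does not vanish there.\<close>

lemma local_injective: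
 assumes sm: "smooth U G" and p: "p \<in> U" and nz: "jac G p \<noteq> 0"
 obtains r where "r > 0" "ball p r \<subseteq> U" "inj_on G (ball p r)" "\<And>z. z \<in> ball p r ==> 0 < jac G z * sgn (jac G p)"
proof -
 have oU: "open U" using sm smooth_open by auto
 have cont: "isCont (\<lambda>x. dd G x v) p" for v
  using smooth_cont[OF smooth_dd[OF sm]] oU p continuous_on_eq_continuous_at by blast
 obtain r where r: "r > 0" "ball p r \<subseteq> U" "inj_on G (ball p r)"
 proof (rule has_derivative_locally_injective[OF p oU bounded_linear_jinv, of G p "dd G" G])
  show "jinv G p \<circ> dd G p = id"
   using jinv_dd[OF smooth_diff[OF sm p] nz] by auto
  show "(G has_derivative dd G x) (at x)" if "x \<in> U" for x using smooth_der[OF sm that] .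
  fix e :: real assume e: "e > 0"
  obtain d0 where d0: "d0 > 0" "ball p d0 \<subseteq> U" using oU p openE by blast
  obtain d1 where d1: "d1 > 0" "\<And>x. dist x p < d1 ==> dist (dd G x 1) (dd G p 1) < e/3"
   using cont[of 1] e unfolding continuous_at_eps_delta by (metis divide_pos_pos zero_less_numeral)
  obtain d2 where d2: "d2 > 0" "\<And>x. dist x p < d2 ==> dist (dd G x \<i>) (dd G p \<i>) < e/3"
   using cont[of \<i>] e unfolding continuous_at_eps_delta by (metis divide_pos_pos zero_less_numeral)
  show "\<exists>d>0. \<forall>x. dist p x < d --> onorm (\<lambda>v. dd G x v - dd G p v) < e"
  proof (intro exI[of _ "min d0 (min d1 d2)"] conjI allI impI)
   show "min d0 (min d1 d2) > 0" using d0 d1 d2 by auto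
   fix x assume x: "dist p x < min d0 (min d1 d2)"
   hence xU: "x \<in> U" using d0 by auto
   have "cmod (dd G x v - dd G p v) \<le> (2*e/3) * cmod v" for v
   proof -
    have e: "dd G x v - dd G p v = Re v *\<^sub>R (dd G x 1 - dd G p 1) + Im v *\<^sub>R (dd G x \<i> - dd G p \<i>)"
     unfolding dd_complex[OF smooth_diff[OF sm xU], of v] dd_complex[OF smooth_diff[OF sm p], of v]
     by (simp add: algebra_simps)
    have "cmod (dd G x v - dd G p v) \<le> \<bar>Re v\<bar> * cmod (dd G x 1 - dd G p 1) + \<bar>Im v\<bar> * cmod (dd G x \<i> - dd G p \<i>)"
     unfolding e by (rule order_trans[OF norm_triangle_ineq]) simp
    also have "\<dots> \<le> cmod v * (e/3) + cmod v * (e/3)"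
    proof (intro add_mono mult_mono abs_Re_le_cmod abs_Im_le_cmod)
     have "dist x p < d1" "dist x p < d2" using x by (auto simp: dist_commute)
     thus "cmod (dd G x 1 - dd G p 1) \<le> e/3" "cmod (dd G x \<i> - dd G p \<i>) \<le> e/3"
      using d1(2)[of x] d2(2)[of x] by (auto simp: dist_norm)
    qed auto
    finally show ?thesis by (simp add: field_simps)
   qed
   hence "onorm (\<lambda>v. dd G x v - dd G p v) \<le> 2*e/3" by (rule onorm_le)
   thus "onorm (\<lambda>v. dd G x v - dd G p v) < e" using e by auto
  qed
 qed auto
 have "isCont (\<lambda>z. jac G z * sgn (jac G p)) p"
  using smooth_cont[OF smooth_jac[OF sm]] oU p continuous_on_eq_continuous_at by (intro continuous_intros) blast
 moreover have "0 < jac G p * sgn (jac G p)" using nz by (auto simp: sgn_if)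
 ultimately obtain d where d: "d > 0" "\<And>z. dist z p < d ==> dist (jac G z * sgn (jac G p)) (jac G p * sgn (jac G p)) < jac G p * sgn (jac G p)"
  unfolding continuous_at_eps_delta by metis
 show ?thesis
 proof (rule that[of "min r d"])
  show "min r d > 0" "ball p (min r d) \<subseteq> U" using r d by auto
  show "inj_on G (ball p (min r d))" using r(3) by (rule inj_on_subset) auto
  show "0 < jac G z * sgn (jac G p)" if "z \<in> ball p (min r d)" for z
   using d(2)[of z] that by (auto simp: dist_commute dist_real_def)
 qed
qed

subsection \<open>Cut-off functions\<close>

definition flat :: "real => real" where "flat x = (if x > 0 then exp (- (1/x)) else 0)"

lemma tendsto_poly_exp: "((\<lambda>u. poly p u / exp u) \<longlongrightarrow> 0) (at_top :: real filter)"
proof -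
 have "(\<lambda>u. poly p u / exp u) = (\<lambda>u. \<Sum>i\<le>degree p. coeff p i * (u ^ i / exp u))"
  by (simp add: poly_altdef sum_divide_distrib)
 moreover have "((\<lambda>u. \<Sum>i\<le>degree p. coeff p i * (u ^ i / exp u)) \<longlongrightarrow> (\<Sum>i\<le>degree p. coeff p i * 0)) at_top"
  by (intro tendsto_intros tendsto_power_div_exp_0)
 ultimately show ?thesis by simp
qed

text \<open>The derivative of p (1/x) exp (-1/x) is x^-2 (p - p') (1/x) exp (-1/x), whence the
  factor \<open>[:0,0,1:]\<close>. At 0 the difference quotient from the right is a polynomial in
  1/h divided by exp (1/h).\<close>

lemma flat_poly_deriv:
 fixes p :: "real poly"
 defines "q \<equiv> [:0,0,1:] * (p - pderiv p)"
 shows "((\<lambda>x. if x > 0 then poly p (1/x) * exp (- (1/x)) else 0) has_real_derivative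
   (if x > 0 then poly q (1/x) * exp (- (1/x)) else 0)) (at x)"
proof -
 let ?f = "\<lambda>x. if x > 0 then poly p (1/x) * exp (- (1/x)) else (0::real)"
 consider "x > 0" | "x < 0" | "x = 0" by linarith
 thus ?thesis
 proof cases
  case 1
  have "((\<lambda>x. poly p (1/x) * exp (- (1/x))) has_real_derivative poly q (1/x) * exp (- (1/x))) (at x)"
   using 1 unfolding q_def
   by (auto intro!: derivative_eq_intros simp: field_simps power2_eq_square)
  thus ?thesis
   using 1 by (auto intro!: has_field_derivative_transform_within[where d = x and f = "\<lambda>x. poly p (1/x) * exp (- (1/x))"] simp: dist_real_def)
 next
  case 2
  have "((\<lambda>x. 0) has_real_derivative 0) (at x)" by simp
  hence "(?f has_real_derivative 0) (at x)"
   by (rule has_field_derivative_transform_within[where d = "-x"]) (use 2 in \<open>auto simp: dist_real_def\<close>)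
  thus ?thesis using 2 by simp
 next
  case 3
  have R: "((\<lambda>h. ?f h / h) \<longlongrightarrow> 0) (at_right 0)"
  proof -
   have "((\<lambda>h. poly (pCons 0 p) (inverse h) / exp (inverse h)) \<longlongrightarrow> 0) (at_right 0)"
    by (rule filterlim_compose[OF tendsto_poly_exp filterlim_inverse_at_top_right])
   thus ?thesis
   proof (rule Lim_transform_eventually)
    show "\<forall>\<^sub>F h in at_right 0. poly (pCons 0 p) (inverse h) / exp (inverse h) = ?f h / h"
     by (rule eventually_at_right_less[THEN eventually_mono]) (simp add: field_simps exp_minus)
   qed
  qed
  have L: "((\<lambda>h. ?f h / h) \<longlongrightarrow> 0) (at_left 0)"
   by (rule tendsto_eventually) (simp add: eventually_at_left_field, meson less_numeral_extra(1) neg_less_0_iff_less)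
  have "((\<lambda>h. ?f h / h) \<longlongrightarrow> 0) (at 0)" using R L by (simp add: filterlim_split_at)
  hence "(?f has_real_derivative 0) (at 0)"
   unfolding DERIV_def by (rule back_subst[of "\<lambda>g. (g \<longlongrightarrow> 0) (at 0)"]) (simp add: fun_eq_iff)
  thus ?thesis using 3 by simp
 qed
qed

lemma smooth_flat: "smooth UNIV flat"
proof (rule smooth_coinduct[where P = "\<lambda>f. \<exists>p. f = (\<lambda>x. if x > 0 then poly p (1/x) * exp (- (1/x)) else 0)"])
 show "\<exists>p. flat = (\<lambda>x. if x > 0 then poly p (1/x) * exp (- (1/x)) else 0)"
  by (rule exI[of _ 1]) (auto simp: flat_def)
 fix f assume "\<exists>p. f = (\<lambda>x::real. if x > 0 then poly p (1/x) * exp (- (1/x)) else 0)"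
 then obtain p where f: "f = (\<lambda>x. if x > 0 then poly p (1/x) * exp (- (1/x)) else 0)" by blast
 let ?q = "[:0,0,1:] * (p - pderiv p)"
 have D: "(f has_derivative (\<lambda>v. v * (if x > 0 then poly ?q (1/x) * exp (- (1/x)) else 0))) (at x)" for x
  using flat_poly_deriv[of p x] unfolding f has_field_derivative_def
  by (rule back_subst[of "\<lambda>g. (_ has_derivative g) _"]) (simp add: fun_eq_iff)
 have "dd f x v = (if x > 0 then poly (smult v ?q) (1/x) * exp (- (1/x)) else 0)" for x v
  using dd_eqI[OF D[of x]] by simp
 thus "(\<forall>x\<in>UNIV. f differentiable at x) \<and> (\<forall>v. \<exists>g. (\<exists>p. g = (\<lambda>x. if x > 0 then poly p (1/x) * exp (- (1/x)) else 0)) \<and> (\<forall>x\<in>UNIV. dd f x v = g x))"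
  using D unfolding differentiable_def by blast
qed auto

lemma flat_nonneg: "0 \<le> flat x" by (simp add: flat_def)
lemma flat_pos: "0 < flat x \<longleftrightarrow> 0 < x" by (simp add: flat_def)
lemma flat_mono: "x \<le> y ==> flat x \<le> flat y"
 by (auto simp: flat_def frac_le)

definition sstep :: "real => real" where "sstep x = flat x / (flat x + flat (1 - x))"

lemma sstep_denom: "0 < flat x + flat (1 - x)"
 using flat_nonneg[of x] flat_nonneg[of "1-x"] flat_pos[of x] flat_pos[of "1-x"]
 by (cases "x > 0") auto

lemma smooth_sstep: "smooth UNIV sstep"
proof -
 have "smooth UNIV (\<lambda>x. flat (1 - x))"
  by (rule smooth_compose[OF smooth_flat]) (auto intro!: smooth_diff' smooth_const smooth_ident)
 hence "smooth UNIV (\<lambda>x. flat x / (flat x + flat (1 - x)))"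
  using sstep_denom by (intro smooth_divide_real smooth_add smooth_flat) (auto simp: less_imp_neq[symmetric])
 thus ?thesis by (simp add: sstep_def[abs_def])
qed

lemma sstep_0: "x \<le> 0 ==> sstep x = 0" by (simp add: sstep_def flat_def)
lemma sstep_1: "1 \<le> x ==> sstep x = 1" by (auto simp: sstep_def flat_def)
lemma sstep_range: "0 \<le> sstep x" "sstep x \<le> 1"
 using sstep_denom[of x] flat_nonneg[of x] flat_nonneg[of "1-x"] by (auto simp: sstep_def field_simps)

lemma sstep_mono: "x \<le> y ==> sstep x \<le> sstep y"
proof -
 assume xy: "x \<le> y"
 have "flat x * flat (1 - y) \<le> flat y * flat (1 - x)"
  using xy by (intro mult_mono flat_mono flat_nonneg) auto
 hence "flat x * (flat y + flat (1 - y)) \<le> flat y * (flat x + flat (1 - x))"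
  by (simp add: algebra_simps)
 thus ?thesis
  unfolding sstep_def using sstep_denom[of x] sstep_denom[of y]
  by (simp add: pos_divide_le_eq pos_le_divide_eq)
qed

lemma smooth_norm2: "open U ==> smooth U (\<lambda>z::complex. (cmod (z - c))\<^sup>2)"
proof -
 assume U: "open U"
 have "smooth U (\<lambda>z. Re (z - c) * Re (z - c) + Im (z - c) * Im (z - c))"
  using U by (intro smooth_add smooth_mult smooth_Re smooth_Im smooth_diff' smooth_ident smooth_const)
 thus ?thesis by (rule smooth_cong) (simp add: cmod_power2, simp add: power2_eq_square)
qed

lemma bump:
 assumes "0 \<le> r1" "r1 < r2"
 obtains \<psi> :: "complex => real" where "smooth UNIV \<psi>" "\<And>z. 0 \<le> \<psi> z \<and> \<psi> z \<le> 1"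
  "\<And>z. cmod (z - c) \<le> r1 ==> \<psi> z = 1" "\<And>z. r2 \<le> cmod (z - c) ==> \<psi> z = 0"
proof
 \<comment> \<open>Squared distances, because the distance itself is not differentiable at the
   centre.\<close>
 let ?\<psi> = "\<lambda>z. sstep ((r2\<^sup>2 - (cmod (z - c))\<^sup>2) / (r2\<^sup>2 - r1\<^sup>2))"
 have pos: "r2\<^sup>2 - r1\<^sup>2 > 0" using assms by (simp add: power_strict_mono)
 show "smooth UNIV ?\<psi>"
  using pos by (intro smooth_compose[OF smooth_sstep] smooth_divide_real smooth_diff' smooth_const smooth_norm2) auto
 show "0 \<le> ?\<psi> z \<and> ?\<psi> z \<le> 1" for z using sstep_range by auto
 show "?\<psi> z = 1" if "cmod (z - c) \<le> r1" for z
  using that pos by (intro sstep_1) (simp add: power_mono)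
 show "?\<psi> z = 0" if "r2 \<le> cmod (z - c)" for z
  using that pos assms by (intro sstep_0) (simp add: power_mono divide_nonpos_pos)
qed

subsection \<open>Integrals depending on a parameter\<close>

lemma param_integral:
 fixes F :: "'e::euclidean_space \<times> real => real"
 assumes sm: "smooth W F" and oU: "open U" and UW: "U \<times> {0..1} \<subseteq> W" and x0: "x0 \<in> U"
 shows "((\<lambda>x. integral {0..1} (\<lambda>t. F (x,t))) has_derivative (\<lambda>v. integral {0..1} (\<lambda>t. dd F (x0,t) (v,0)))) (at x0)"
proof -
 obtain r where r: "r > 0" "ball x0 r \<subseteq> U" using oU x0 openE by blast
 let ?B = "ball x0 r"
 \<comment> \<open>The rule for differentiating under the integral asks for a continuous family of
   bounded linear maps; outside \<open>W\<close>, where F is not controlled, a default value is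
   taken.\<close>
 define fx where "fx x t = (if (x,t) \<in> W then Blinfun (\<lambda>v. dd F (x,t) (v,0)) else 0)" for x t
 have bl: "bounded_linear (\<lambda>v. dd F (x,t) (v,0))" if "(x,t) \<in> W" for x t
 using smooth_der[OF sm that] has_derivative_bounded_linear bounded_linear_compose bounded_linear_Pair bounded_linear_ident bounded_linear_zero by blast
 have app: "blinfun_apply (fx x t) v = dd F (x,t) (v,0)" if "(x,t) \<in> W" for x t v
  using bounded_linear_Blinfun_apply[OF bl[OF that]] that by (simp add: fx_def)
 have BW: "(x,t) \<in> W" if "x \<in> ?B" "t \<in> {0..1}" for x t using that r UW by blast
 have cF: "continuous_on (?B \<times> {0..1}) (\<lambda>p. dd F p v)" for v
  by (rule continuous_on_subset[OF smooth_cont[OF smooth_dd[OF sm]]]) (use BW in auto)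
 have cfx: "continuous_on (?B \<times> cbox 0 1) (\<lambda>(x, t). fx x t)"
 proof (rule continuous_on_blinfun_componentwise)
  fix i :: 'e
  have "continuous_on (?B \<times> cbox 0 1) (\<lambda>p. dd F p (i,0))" using cF by simp
  thus "continuous_on (?B \<times> cbox 0 1) (\<lambda>p. blinfun_apply (case p of (x,t) => fx x t) i)"
   by (rule continuous_on_eq) (use app BW in auto)
 qed
 have "((\<lambda>x. integral (cbox 0 1) (\<lambda>t. F (x,t))) has_derivative blinfun_apply (integral (cbox 0 1) (fx x0))) (at x0 within ?B)"
 proof (rule leibniz_rule[OF _ _ cfx])
  fix x t assume x: "x \<in> ?B" and t: "t \<in> cbox 0 (1::real)"
  have "((\<lambda>x. F (x,t)) has_derivative (\<lambda>v. dd F (x,t) (v,0))) (at x)"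
   using BW[OF x] t
   by (intro has_derivative_compose[of "\<lambda>x. (x,t)" "\<lambda>v. (v,0)" x UNIV F, simplified] smooth_der[OF sm]
      has_derivative_Pair has_derivative_ident has_derivative_const) auto
  moreover have "blinfun_apply (fx x t) = (\<lambda>v. dd F (x,t) (v,0))"
   using app BW[OF x] t by auto
  ultimately show "((\<lambda>x. F (x,t)) has_derivative blinfun_apply (fx x t)) (at x within ?B)"
   by (simp only:) (rule has_derivative_at_withinI)
 next
  fix x assume x: "x \<in> ?B"
  have "continuous_on (cbox 0 1) (\<lambda>t. F (x,t))"
   by (rule continuous_on_compose2[OF smooth_cont[OF sm]]) (use BW[OF x] in \<open>auto intro!: continuous_intros\<close>)
  thus "(\<lambda>t. F (x,t)) integrable_on cbox 0 1" by (rule integrable_continuous)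
 qed (use r in auto)
 hence "((\<lambda>x. integral {0..1} (\<lambda>t. F (x,t))) has_derivative blinfun_apply (integral {0..1} (fx x0))) (at x0)"
  using r at_within_open[of x0 ?B] by simp
 moreover have "blinfun_apply (integral {0..1} (fx x0)) v = integral {0..1} (\<lambda>t. dd F (x0,t) (v,0))" for v
 proof -
  have "continuous_on {0..1} (fx x0)"
   using continuous_on_compose2[OF cfx, of "{0..1}" "\<lambda>t. (x0,t)"] r
   by (fastforce intro!: continuous_on_Pair continuous_on_const continuous_on_id)
  hence "fx x0 integrable_on {0..1}" by (rule integrable_continuous_interval)
  hence "blinfun_apply (integral {0..1} (fx x0)) v = integral {0..1} (\<lambda>t. blinfun_apply (fx x0 t) v)"
   by (rule blinfun_apply_integral)
  also have "\<dots> = integral {0..1} (\<lambda>t. dd F (x0,t) (v,0))"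
   by (rule integral_cong) (use app BW r in auto)
  finally show ?thesis .
 qed
 ultimately show ?thesis
  by (metis (no_types, lifting) ext)
qed

lemma smooth_param_integral:
 fixes F :: "'e::euclidean_space \<times> real => real"
 assumes sm: "smooth W F" and oU: "open U" and UW: "U \<times> {0..1} \<subseteq> W"
 shows "smooth U (\<lambda>x. integral {0..1} (\<lambda>t. F (x,t)))"
proof (rule smooth_coinduct[where P = "\<lambda>f. \<exists>F. smooth W F \<and> f = (\<lambda>x. integral {0..1} (\<lambda>t. F (x,t)))", OF oU])
 fix f :: "'e => real" assume "\<exists>F. smooth W F \<and> f = (\<lambda>x. integral {0..1} (\<lambda>t. F (x,t)))"
 then obtain F where F: "smooth W F" "f = (\<lambda>x. integral {0..1} (\<lambda>t. F (x,t)))" by blast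
 note D = param_integral[OF F(1) oU UW]
 show "(\<forall>x\<in>U. f differentiable at x) \<and> (\<forall>v. \<exists>g. (\<exists>F. smooth W F \<and> g = (\<lambda>x. integral {0..1} (\<lambda>t. F (x,t)))) \<and> (\<forall>x\<in>U. dd f x v = g x))"
 proof (intro conjI ballI allI)
  show "f differentiable at x" if "x \<in> U" for x using D[OF that] F(2) differentiable_def by blast
  fix v
  have "dd f x v = integral {0..1} (\<lambda>t. (\<lambda>p. dd F p (v,0)) (x,t))" if "x \<in> U" for x
   using dd_eqI[OF D[OF that]] F(2) by simp
  thus "\<exists>g. (\<exists>F. smooth W F \<and> g = (\<lambda>x. integral {0..1} (\<lambda>t. F (x,t)))) \<and> (\<forall>x\<in>U. dd f x v = g x)"
   using smooth_dd[OF F(1), of "(v,0)"] by blast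
 qed
qed (use sm in blast)

subsection \<open>Area-preserving normal forms\<close>

lemma has_real_derivative_line:
 fixes f :: "complex => real"
 assumes "f differentiable (at (z + of_real s * e))"
 shows "((\<lambda>s. f (z + of_real s * e)) has_real_derivative dd f (z + of_real s * e) e) (at s)"
proof -
 have "((\<lambda>s. z + of_real s * e) has_derivative (\<lambda>h. of_real h * e)) (at s)"
  by (auto intro!: derivative_eq_intros)
 from diff_chain_at[OF this frechet_derivative_works[THEN iffD1, OF assms]]
 have "((\<lambda>s. f (z + of_real s * e)) has_derivative (\<lambda>h. dd f (z + of_real s * e) (of_real h * e))) (at s)"
  by (simp add: o_def)
 moreover have "(\<lambda>h. dd f (z + of_real s * e) (of_real h * e)) = (*) (dd f (z + of_real s * e) e)"
  using linear_scale[OF dd_linear[OF assms]] by (auto simp: scaleR_conv_of_real[symmetric])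
 ultimately show ?thesis by (simp add: has_field_derivative_def)
qed

lemma jac_Complex:
 fixes f g :: "complex => real"
 assumes "f differentiable (at z)" "g differentiable (at z)"
 shows "jac (\<lambda>z. Complex (f z) (g z)) z = dd f z 1 * dd g z \<i> - dd g z 1 * dd f z \<i>"
proof -
 have "((\<lambda>z. of_real (f z) + of_real (g z) * \<i>) has_derivative (\<lambda>v. of_real (dd f z v) + of_real (dd g z v) * \<i>)) (at z)"
  using assms by (auto intro!: derivative_eq_intros bounded_linear.has_derivative[OF bounded_linear_of_real] simp: frechet_derivative_works[symmetric])
 hence "((\<lambda>z. Complex (f z) (g z)) has_derivative (\<lambda>v. Complex (dd f z v) (dd g z v))) (at z)"
  by (simp add: Complex_eq mult.commute)
 from dd_eqI[OF this] show ?thesis by (simp add: jac_def area_form_def)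
qed

text \<open>T is the integral of \<sigma> along the horizontal segment from the imaginary axis to v;
  substituting t Re v for the variable fixes the interval of integration. By the product rule the
  horizontal derivative of T is the integral over [0,1] of the t-derivative of t \<sigma> (t x, y),
  hence \<sigma>.\<close>

lemma fiber_integral:
 fixes \<sigma> :: "complex => real"
 defines "T \<equiv> \<lambda>v. Re v * integral {0..1} (\<lambda>t. \<sigma> (Complex (t * Re v) (Im v)))"
 assumes sm: "smooth V \<sigma>" and oU: "open U"
  and UV: "\<And>v t. v \<in> U ==> t \<in> {0..1} ==> Complex (t * Re v) (Im v) \<in> V"
 shows "smooth U T" and "\<And>v. v \<in> U ==> dd T v 1 = \<sigma> v"
proof -
 define g where "g = (\<lambda>p::complex \<times> real. Complex (snd p * Re (fst p)) (Im (fst p)))"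
 have smg: "smooth UNIV g" unfolding g_def
  by (intro smooth_Complex smooth_mult smooth_Re smooth_Im smooth_fst smooth_snd smooth_ident open_UNIV)
 define W where "W = g -` V"
 have oV: "open V" using sm smooth_open by auto
 have oW: "open W" unfolding W_def
  by (rule open_vimage[OF oV smooth_cont[OF smg]])
 have smF: "smooth W (\<lambda>p. \<sigma> (g p))"
  by (rule smooth_compose[OF sm smooth_subset[OF smg oW]]) (auto simp: W_def)
 have UW: "U \<times> {0..1} \<subseteq> W" using UV by (auto simp: W_def g_def)
 define I where "I = (\<lambda>v. integral {0..1} (\<lambda>t. \<sigma> (g (v,t))))"
 have T: "T = (\<lambda>v. Re v * I v)" by (simp add: T_def I_def g_def)
 have smI: "smooth U I" unfolding I_def by (rule smooth_param_integral[OF smF oU UW])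
 show "smooth U T" unfolding T by (intro smooth_mult smooth_Re smooth_ident oU smI)
 fix v assume v: "v \<in> U"
 have gV: "g (v,t) \<in> V" if "t \<in> {0..1}" for t using UV[OF v that] by (simp add: g_def)
 have dF: "dd (\<lambda>p. \<sigma> (g p)) (v,t) (1,0) = t * dd \<sigma> (g (v,t)) 1" if t: "t \<in> {0..1}" for t
 proof -
  have "(g has_derivative (\<lambda>h. Complex (snd h * Re v + t * Re (fst h)) (Im (fst h)))) (at (v,t))"
  proof -
   have "((\<lambda>p. of_real (snd p * Re (fst p)) + of_real (Im (fst p)) * \<i>) has_derivative
     (\<lambda>h. of_real (snd h * Re v + t * Re (fst h)) + of_real (Im (fst h)) * \<i>)) (at (v,t))"
    by (auto intro!: derivative_eq_intros bounded_linear.has_derivative[OF bounded_linear_of_real]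
      bounded_linear.has_derivative[OF bounded_linear_Re] bounded_linear.has_derivative[OF bounded_linear_Im])
   thus ?thesis by (simp add: g_def Complex_eq algebra_simps)
  qed
  from diff_chain_at[OF this smooth_der[OF sm gV[OF t]]]
  have "((\<lambda>p. \<sigma> (g p)) has_derivative (\<lambda>h. dd \<sigma> (g (v,t)) (Complex (snd h * Re v + t * Re (fst h)) (Im (fst h))))) (at (v,t))"
   by (simp add: o_def)
  from dd_eqI[OF this] have "dd (\<lambda>p. \<sigma> (g p)) (v,t) (1,0) = dd \<sigma> (g (v,t)) (t *\<^sub>R 1)"
   by (simp add: Complex_eq scaleR_conv_of_real)
  thus ?thesis
   using linear_scale[OF dd_linear[OF smooth_diff[OF sm gV[OF t]]], of t 1] by simp
 qed
 have dI: "dd I v 1 = integral {0..1} (\<lambda>t. t * dd \<sigma> (g (v,t)) 1)"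
 proof -
  have "dd I v 1 = integral {0..1} (\<lambda>t. dd (\<lambda>p. \<sigma> (g p)) (v,t) (1,0))"
   using dd_eqI[OF param_integral[OF smF oU UW v]] by (simp add: I_def)
  also have "\<dots> = integral {0..1} (\<lambda>t. t * dd \<sigma> (g (v,t)) 1)"
   by (rule integral_cong) (rule dF)
  finally show ?thesis .
 qed
 have dT: "dd T v 1 = I v + Re v * dd I v 1"
 proof -
  have "(T has_derivative (\<lambda>h. Re v * dd I v h + Re h * I v)) (at v)"
   unfolding T
   by (intro has_derivative_mult smooth_der[OF smI v] bounded_linear.has_derivative[OF bounded_linear_Re] has_derivative_ident)
  from dd_eqI[OF this] show ?thesis by simp
 qed
 have cg: "continuous_on {0..1} (\<lambda>t. g (v,t))"
  by (rule continuous_on_compose2[OF smooth_cont[OF smg]]) (auto intro!: continuous_intros)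
 have c1: "continuous_on {0..1} (\<lambda>t. \<sigma> (g (v,t)))"
  by (rule continuous_on_compose2[OF smooth_cont[OF sm] cg]) (use gV in auto)
 have c2: "continuous_on {0..1} (\<lambda>t. dd \<sigma> (g (v,t)) 1)"
  by (rule continuous_on_compose2[OF smooth_cont[OF smooth_dd[OF sm]] cg]) (use gV in auto)
 have "((\<lambda>t. \<sigma> (g (v,t)) + Re v * (t * dd \<sigma> (g (v,t)) 1)) has_integral (1 * \<sigma> (g (v,1)) - 0 * \<sigma> (g (v,0)))) {0..1}"
 proof (rule fundamental_theorem_of_calculus)
  fix t assume t: "t \<in> {0..1::real}"
  have gl: "g (v,s) = Complex 0 (Im v) + of_real s * of_real (Re v)" for s
   by (simp add: g_def complex_eq_iff)
  have "((\<lambda>t. \<sigma> (g (v,t))) has_real_derivative dd \<sigma> (g (v,t)) (of_real (Re v))) (at t)"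
   using has_real_derivative_line[of \<sigma> "Complex 0 (Im v)" t "of_real (Re v)"] smooth_diff[OF sm gV[OF t]]
   by (simp add: gl)
  moreover have "dd \<sigma> (g (v,t)) (of_real (Re v)) = Re v * dd \<sigma> (g (v,t)) 1"
   using linear_scale[OF dd_linear[OF smooth_diff[OF sm gV[OF t]]], of "Re v" 1] by (simp add: scaleR_conv_of_real)
  ultimately have "((\<lambda>t. t * \<sigma> (g (v,t))) has_real_derivative (\<sigma> (g (v,t)) + Re v * (t * dd \<sigma> (g (v,t)) 1))) (at t)"
   by (auto intro!: derivative_eq_intros)
  thus "((\<lambda>t. t * \<sigma> (g (v,t))) has_vector_derivative (\<sigma> (g (v,t)) + Re v * (t * dd \<sigma> (g (v,t)) 1))) (at t within {0..1})"
   by (simp add: has_real_derivative_iff_has_vector_derivative has_vector_derivative_at_within)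
 qed auto
 hence "integral {0..1} (\<lambda>t. \<sigma> (g (v,t)) + Re v * (t * dd \<sigma> (g (v,t)) 1)) = \<sigma> (g (v,1))"
  by (simp add: integral_unique)
 also have "integral {0..1} (\<lambda>t. \<sigma> (g (v,t)) + Re v * (t * dd \<sigma> (g (v,t)) 1))
   = I v + Re v * integral {0..1} (\<lambda>t. t * dd \<sigma> (g (v,t)) 1)"
  unfolding I_def
  by (subst integral_add) (auto intro!: integrable_continuous_interval continuous_intros c1 c2)
 also have "\<dots> = I v + Re v * dd I v 1" by (simp only: dI)
 finally show "dd T v 1 = \<sigma> v" using dT by (simp add: g_def)
qed

lemma jac_graph:
 assumes "smooth U H" "z \<in> U"
 shows "jac (\<lambda>w. Complex (Re w) (H w)) z = dd H z \<i>" "jac (\<lambda>w. Complex (H w) (Im w)) z = dd H z 1"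
proof -
 have R: "Re differentiable (at z)" "dd Re z = Re"
  using bounded_linear_imp_has_derivative[OF bounded_linear_Re] dd_eqI differentiable_def by blast+
 have I: "Im differentiable (at z)" "dd Im z = Im"
  using bounded_linear_imp_has_derivative[OF bounded_linear_Im] dd_eqI differentiable_def by blast+
 show "jac (\<lambda>w. Complex (Re w) (H w)) z = dd H z \<i>" "jac (\<lambda>w. Complex (H w) (Im w)) z = dd H z 1"
  using jac_Complex[OF R(1) smooth_diff[OF assms]] jac_Complex[OF smooth_diff[OF assms] I(1)] by (simp_all add: R I)
qed

text \<open>The coordinate \<open>T\<close> conjugate to \<open>H\<close> is obtained by integrating the density along the level
 sets of \<open>H\<close>.\<close>

lemma darboux_box:
 fixes \<rho> H :: "complex => real"
 assumes sr: "smooth W \<rho>" and sH: "smooth W H" and p: "p \<in> W"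
  and pos: "\<And>z. z \<in> W ==> 0 < \<rho> z" and reg: "dd H p v0 \<noteq> 0"
 obtains r \<xi> where "0 < r" "smooth (ball (Complex 0 (H p)) r) \<xi>" "inj_on \<xi> (ball (Complex 0 (H p)) r)"
  "\<xi> (Complex 0 (H p)) = p" "\<xi> ` ball (Complex 0 (H p)) r \<subseteq> W"
  "\<And>w. w \<in> ball (Complex 0 (H p)) r ==> H (\<xi> w) = Im w \<and> \<rho> (\<xi> w) * jac \<xi> w = 1"
proof -
 have oW: "open W" using sr smooth_open by auto
 \<comment> \<open>After a rotation of the plane the derivative of H in the imaginary direction is
   nonzero, so H can replace the imaginary coordinate.\<close>
 obtain e :: complex where e: "cmod e = 1" "dd H p (e * \<i>) \<noteq> 0"
 proof (cases "dd H p \<i> = 0")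
  case False thus ?thesis using that[of 1] by auto
 next
  case True
  have l: "linear (dd H p)" by (rule dd_linear[OF smooth_diff[OF sH p]])
  have "v0 = Re v0 *\<^sub>R 1 + Im v0 *\<^sub>R \<i>" by (simp add: complex_eq_iff)
  hence "dd H p v0 = Re v0 *\<^sub>R dd H p 1 + Im v0 *\<^sub>R dd H p \<i>"
   using linear_add[OF l] linear_scale[OF l] by metis
  hence "dd H p 1 \<noteq> 0" using True reg by auto
  hence "dd H p (\<i> * \<i>) \<noteq> 0" using linear_neg[OF l, of 1] by simp
  thus ?thesis using that[of \<i>] by auto
 qed
 define L where "L = (\<lambda>w. p + e * w)"
 have smL: "smooth UNIV L" unfolding L_def
  by (intro smooth_add smooth_mult smooth_const smooth_ident open_UNIV)
 define W1 where "W1 = L -` W"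
 have oW1: "open W1" unfolding W1_def by (rule open_vimage[OF oW smooth_cont[OF smL]])
 have LW: "L ` W1 \<subseteq> W" by (auto simp: W1_def)
 have z0: "0 \<in> W1" using p by (simp add: W1_def L_def)
 have smL1: "smooth W1 L" by (rule smooth_subset[OF smL oW1]) auto
 define H1 where "H1 = (\<lambda>w. H (L w))"
 define \<rho>1 where "\<rho>1 = (\<lambda>w. \<rho> (L w))"
 have sH1: "smooth W1 H1" unfolding H1_def by (rule smooth_compose[OF sH smL1 LW])
 have sr1: "smooth W1 \<rho>1" unfolding \<rho>1_def by (rule smooth_compose[OF sr smL1 LW])
 have dH1: "dd H1 0 \<i> = dd H p (e * \<i>)"
 proof -
  have "(L has_derivative (\<lambda>h. e * h)) (at 0)" unfolding L_def by (auto intro!: derivative_eq_intros)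
  moreover have "(H has_derivative dd H p) (at (L 0))" using smooth_der[OF sH p] by (simp add: L_def)
  ultimately have "(H1 has_derivative (\<lambda>h. dd H p (e * h))) (at 0)"
   using diff_chain_at[of L _ 0 H] by (simp add: H1_def o_def)
  from dd_eqI[OF this] show ?thesis by simp
 qed
 define G where "G = (\<lambda>w. Complex (Re w) (H1 w))"
 have sG: "smooth W1 G" unfolding G_def
  by (intro smooth_Complex smooth_Re smooth_ident oW1 sH1)
 have "jac G 0 \<noteq> 0" using jac_graph(1)[OF sH1 z0] dH1 e by (simp add: G_def)
 then obtain r1 where r1: "r1 > 0" "ball 0 r1 \<subseteq> W1" "inj_on G (ball 0 r1)" "\<And>z. z \<in> ball 0 r1 ==> 0 < jac G z * sgn (jac G 0)"
  using local_injective[OF sG z0] by metis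
 let ?B = "ball (0::complex) r1"
 have sGB: "smooth ?B G" by (rule smooth_subset[OF sG _ r1(2)]) auto
 have nzG: "jac G z \<noteq> 0" if "z \<in> ?B" for z using r1(4)[OF that] by auto
 define Gi where "Gi = inv_into ?B G"
 have GiG: "Gi (G z) = z" if "z \<in> ?B" for z using that r1(3) by (simp add: Gi_def)
 define V1 where "V1 = G ` ?B"
 have sGi: "smooth V1 Gi" and jGi: "\<And>z. z \<in> ?B ==> jac Gi (G z) = 1 / jac G z"
  unfolding V1_def using smooth_inverse[OF sGB r1(3) nzG GiG] by auto
 have GiV: "Gi v \<in> ?B" "G (Gi v) = v" if "v \<in> V1" for v using that GiG by (auto simp: V1_def)
 define c where "c = Complex 0 (H p)"
 have G0: "G 0 = c" by (simp add: G_def H1_def L_def c_def)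
 have cV: "c \<in> V1" using G0 r1(1) by (force simp: V1_def)
 \<comment> \<open>The density \<rho> in the coordinates (Re, H), with a negative sign if these
   reverse the orientation.\<close>
 define \<sigma> where "\<sigma> = (\<lambda>v. \<rho>1 (Gi v) / jac G (Gi v))"
 have GiB: "Gi ` V1 \<subseteq> ?B" using GiV by auto
 have sS: "smooth V1 \<sigma>" unfolding \<sigma>_def
  by (intro smooth_divide_real smooth_compose[OF smooth_subset[OF sr1 _ r1(2)] sGi GiB]
    smooth_compose[OF smooth_jac[OF sGB] sGi GiB] nzG GiV open_ball)
 have snz: "\<sigma> v \<noteq> 0" if "v \<in> V1" for v
  using nzG[OF GiV(1)[OF that]] pos[of "L (Gi v)"] LW r1(2) GiV(1)[OF that] unfolding \<sigma>_def \<rho>1_def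
  by (metis divide_eq_0_iff image_subset_iff order_less_irrefl subsetD)
 obtain r2 where r2: "r2 > 0" "ball c r2 \<subseteq> V1" using sGi cV smooth_open openE by metis
 define T where "T = (\<lambda>v. Re v * integral {0..1} (\<lambda>t. \<sigma> (Complex (t * Re v) (Im v))))"
 have inV: "Complex (t * Re v) (Im v) \<in> V1" if "v \<in> ball c r2" "t \<in> {0..1}" for v t
 proof -
  have "cmod (Complex (t * Re v) (Im v) - c) \<le> cmod (v - c)"
   unfolding cmod_def c_def using that(2) by (auto simp: power_mult_distrib mult_left_le_one_le power_le_one)
  thus ?thesis using that r2(2) by (auto simp: dist_norm norm_minus_commute)
 qed
 have sT: "smooth (ball c r2) T" and dT: "\<And>v. v \<in> ball c r2 ==> dd T v 1 = \<sigma> v"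
  unfolding T_def using fiber_integral[OF sS open_ball inV] by auto
 \<comment> \<open>N keeps the height and has Jacobian \<sigma>, so its inverse makes the density
   constant without disturbing H.\<close>
 define N where "N = (\<lambda>v. Complex (T v) (Im v))"
 have sN: "smooth (ball c r2) N" unfolding N_def
  by (intro smooth_Complex smooth_Im smooth_ident sT open_ball)
 have jN: "jac N v = \<sigma> v" if "v \<in> ball c r2" for v
  using jac_graph(2)[OF sT that] dT[OF that] by (simp add: N_def)
 have cB: "c \<in> ball c r2" using r2 by auto
 hence "jac N c \<noteq> 0" using jN snz cV by auto
 then obtain r3 where r3: "r3 > 0" "ball c r3 \<subseteq> ball c r2" "inj_on N (ball c r3)"
  using local_injective[OF sN cB] by metis
 let ?C = "ball c r3"
 have sNC: "smooth ?C N" by (rule smooth_subset[OF sN _ r3(2)]) auto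
 have CV: "?C \<subseteq> V1" using r3(2) r2(2) by auto
 have nzN: "jac N v \<noteq> 0" if "v \<in> ?C" for v using jN snz CV r3(2) that by (metis subsetD)
 define Ni where "Ni = inv_into ?C N"
 have NiN: "Ni (N z) = z" if "z \<in> ?C" for z using that r3(3) by (simp add: Ni_def)
 have sNi: "smooth (N ` ?C) Ni" and jNi: "\<And>z. z \<in> ?C ==> jac Ni (N z) = 1 / jac N z"
  using smooth_inverse[OF sNC r3(3) nzN NiN] by auto
 have N0: "N c = c" by (simp add: N_def T_def c_def)
 have "c \<in> N ` ?C" using N0 r3(1) image_eqI[of c N c ?C] by simp
 then obtain r where r: "r > 0" "ball c r \<subseteq> N ` ?C" using smooth_open[OF sNi] openE by metis
 have NiC: "Ni w \<in> ?C" "N (Ni w) = w" if "w \<in> ball c r" for w using that r(2) NiN by auto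
 define \<xi> where "\<xi> = (\<lambda>w. L (Gi (Ni w)))"
 have sNi': "smooth (ball c r) Ni" by (rule smooth_subset[OF sNi _ r(2)]) auto
 have sGN: "smooth (ball c r) (\<lambda>w. Gi (Ni w))"
  by (rule smooth_compose[OF sGi sNi']) (use NiC CV in auto)
 show ?thesis
 proof (rule that[of r \<xi>, folded c_def])
  show "0 < r" by fact
  show "smooth (ball c r) \<xi>" unfolding \<xi>_def
   by (rule smooth_compose[OF smL sGN]) auto
  show "inj_on \<xi> (ball c r)"
  proof (rule inj_onI)
   fix w w' assume w: "w \<in> ball c r" "w' \<in> ball c r" and eq: "\<xi> w = \<xi> w'"
   have "e \<noteq> 0" using e by auto
   hence "Gi (Ni w) = Gi (Ni w')" using eq by (simp add: \<xi>_def L_def)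
   hence "Ni w = Ni w'" using GiV(2) NiC(1) w CV by (metis subsetD)
   thus "w = w'" using NiC(2) w by metis
  qed
  show "\<xi> c = p"
  using NiN[of c] N0 r3(1) GiG[of 0] G0 r1(1) by (auto simp: \<xi>_def L_def)
  have in1: "Gi (Ni w) \<in> ?B" if "w \<in> ball c r" for w using NiC(1)[OF that] CV GiV(1) by auto
  thus "\<xi> ` ball c r \<subseteq> W" using r1(2) LW unfolding \<xi>_def by blast
  fix w assume w: "w \<in> ball c r"
  have NV: "Ni w \<in> V1" using NiC(1)[OF w] CV by auto
  have "H (\<xi> w) = Im (G (Gi (Ni w)))" by (simp add: \<xi>_def G_def H1_def)
  also have "\<dots> = Im (N (Ni w))" using GiV(2)[OF NV] by (simp add: N_def)
  finally have 1: "H (\<xi> w) = Im w" using NiC(2)[OF w] by simp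
  have jL: "jac L z = 1" for z unfolding L_def jac_affine using e by simp
  have d1: "Ni differentiable (at w)" by (rule smooth_diff[OF sNi' w])
  have d2: "Gi differentiable (at (Ni w))" by (rule smooth_diff[OF sGi NV])
  have d3: "(\<lambda>w. Gi (Ni w)) differentiable (at w)" by (rule smooth_diff[OF sGN w])
  have "jac \<xi> w = jac (\<lambda>w. Gi (Ni w)) w"
   unfolding \<xi>_def using jac_compose[OF d3, of L] smooth_diff[OF smL] jL by simp
  also have "\<dots> = jac Gi (Ni w) * jac Ni w" by (rule jac_compose[OF d1 d2])
  also have "jac Gi (Ni w) = 1 / jac G (Gi (Ni w))" using jGi[OF in1[OF w]] GiV(2)[OF NV] by simp
  also have "jac Ni w = 1 / \<sigma> (Ni w)" using jNi[OF NiC(1)[OF w]] NiC[OF w] jN r3(2) by (metis subsetD)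
  finally have "jac \<xi> w = 1 / jac G (Gi (Ni w)) * (1 / \<sigma> (Ni w))" .
  moreover have "\<rho> (\<xi> w) = \<sigma> (Ni w) * jac G (Gi (Ni w))"
   using nzG[OF in1[OF w]] by (simp add: \<sigma>_def \<rho>1_def \<xi>_def)
  ultimately have "\<rho> (\<xi> w) * jac \<xi> w = 1" using snz[OF NV] nzG[OF in1[OF w]] by simp
  thus "H (\<xi> w) = Im w \<and> \<rho> (\<xi> w) * jac \<xi> w = 1" using 1 by simp
 qed
qed

text \<open>Knothe's rearrangement. The second coordinate M is the mass of all rows below, the first
  one the fraction T / R of its own row that lies to the left. The map is triangular, so its
  Jacobian is (\<mu> / R) times R. Rows are normalised to width 1, and the height A is the total
  mass. The margin of \<open>W\<close> around \<open>Q\<close> makes all quantities smooth up to the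
  boundary of the unit square.\<close>

lemma knothe:
 fixes \<mu> :: "complex => real"
 defines "W \<equiv> box (Complex (-1) (-1)) (Complex 2 2)" and "Q \<equiv> box 0 (Complex 1 1)"
 assumes sm: "smooth W \<mu>" and pos: "\<And>z. z \<in> W ==> 0 < \<mu> z"
 obtains A K where "0 < A" "smooth Q K" "inj_on K Q" "K ` Q = box 0 (Complex 1 A)" "\<And>z. z \<in> Q ==> jac K z = \<mu> z"
proof -
 have oW: "open W" unfolding W_def by (rule open_box)
 have Wi: "z \<in> W \<longleftrightarrow> -1 < Re z \<and> Re z < 2 \<and> -1 < Im z \<and> Im z < 2" for z
  by (auto simp: W_def in_box_complex_iff)
 have Qi: "z \<in> Q \<longleftrightarrow> 0 < Re z \<and> Re z < 1 \<and> 0 < Im z \<and> Im z < 1" for z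
  by (auto simp: Q_def in_box_complex_iff)
 have QW: "Q \<subseteq> W" by (auto simp: Qi Wi)
 have oQ: "open Q" unfolding Q_def by (rule open_box)
 \<comment> \<open>Horizontal segments from the imaginary axis stay in \<open>W\<close>, as
   \<open>fiber_integral\<close> requires.\<close>
 have prodlt: "t * x < 2" "-1 < t * x" if "t \<in> {0..1}" "-1 < x" "x < 2" for t x :: real
 proof -
  have "t * x \<le> max 0 x" using that by (cases "x \<ge> 0") (auto simp: mult_left_le_one_le mult_nonneg_nonpos)
  thus "t * x < 2" using that by auto
  have "t * (-x) \<le> max 0 (-x)"
  proof (cases "x \<le> 0")
   case True
   hence "t * (-x) \<le> -x" using that by (intro mult_left_le_one_le) auto
   thus ?thesis by simp
  qed (use that in auto)
  thus "-1 < t * x" using that by auto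
 qed
 define T where "T = (\<lambda>v. Re v * integral {0..1} (\<lambda>t. \<mu> (Complex (t * Re v) (Im v))))"
 have sT: "smooth W T" and dT: "\<And>v. v \<in> W ==> dd T v 1 = \<mu> v"
  unfolding T_def using fiber_integral[OF sm oW] prodlt by (auto simp: Wi)
 define R where "R = (\<lambda>z. T (Complex 1 (Im z)))"
 have sR: "smooth W R" unfolding R_def
  by (rule smooth_compose[OF sT], intro smooth_Complex smooth_const smooth_Im smooth_ident oW)
    (auto simp: Wi)
 have Tline: "((\<lambda>s. T (Complex s y)) has_real_derivative \<mu> (Complex s y)) (at s)" if "Complex s y \<in> W" for s y
 proof -
  have e: "Complex s y = Complex 0 y + of_real s * 1" for s by (simp add: complex_eq_iff)
  show ?thesis
   using has_real_derivative_line[of T "Complex 0 y" s 1] smooth_diff[OF sT that] dT[OF that]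
   by (simp only: e[symmetric])
 qed
 have Tmono: "T (Complex s y) < T (Complex s' y)" if "s < s'" "0 \<le> s" "s' \<le> 1" "-1 < y" "y < 2" for s s' y
 proof (rule DERIV_pos_imp_increasing[OF that(1)])
  fix x assume "s \<le> x" "x \<le> s'"
  hence "Complex x y \<in> W" using that by (simp add: Wi)
  thus "\<exists>d. ((\<lambda>s. T (Complex s y)) has_real_derivative d) (at x) \<and> 0 < d"
   using Tline pos by blast
 qed
 have T0: "T (Complex 0 y) = 0" for y by (simp add: T_def)
 have Rpos: "0 < R z" if "z \<in> W" for z
  using Tmono[of 0 1 "Im z"] T0 that by (simp add: R_def Wi)
 have dR0: "dd R z 1 = 0" if "z \<in> W" for z
 proof -
  have "((\<lambda>s. R (z + of_real s * 1)) has_real_derivative dd R (z + of_real 0 * 1) 1) (at 0)"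
   by (rule has_real_derivative_line) (use smooth_diff[OF sR that] in simp)
  moreover have "(\<lambda>s. R (z + of_real s * 1)) = (\<lambda>s. R z)" by (simp add: R_def)
  ultimately have "((\<lambda>s. R z) has_real_derivative dd R z 1) (at 0)" by simp
  thus ?thesis using DERIV_unique[OF _ DERIV_const] by blast
 qed
 \<comment> \<open>\<open>fiber_integral\<close> integrates in the real direction, so the row mass,
   a function of the height, is first made a function of the real part.\<close>
 define R' where "R' = (\<lambda>z. R (Complex 0 (Re z)))"
 define W' where "W' = {z. -1 < Re z \<and> Re z < 2}"
 have oW': "open W'" unfolding W'_def by (intro open_Collect_conj open_halfspace_Re_gt open_halfspace_Re_lt)
 have sR': "smooth W' R'" unfolding R'_def
  by (rule smooth_compose[OF sR], intro smooth_Complex smooth_const smooth_Re smooth_ident oW')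
    (auto simp: Wi W'_def)
 define M' where "M' = (\<lambda>v. Re v * integral {0..1} (\<lambda>t. R' (Complex (t * Re v) (Im v))))"
 have sM': "smooth W' M'" and dM': "\<And>v. v \<in> W' ==> dd M' v 1 = R' v"
  unfolding M'_def using fiber_integral[OF sR' oW'] prodlt by (auto simp: W'_def)
 define M where "M = (\<lambda>y. M' (of_real y))"
 have dM: "(M has_real_derivative R (Complex 0 y)) (at y)" if "-1 < y" "y < 2" for y
  using has_real_derivative_line[of M' 0 y 1] smooth_diff[OF sM', of "of_real y"] dM'[of "of_real y"] that
  by (simp add: M_def[abs_def] W'_def R'_def)
 define m where "m = (\<lambda>z. M (Im z))"
 have smm: "smooth W m" unfolding m_def M_def
  by (rule smooth_compose[OF sM'], intro smooth_of_real smooth_Im smooth_ident oW)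
    (auto simp: Wi W'_def)
 have dm1: "dd m z 1 = 0" if "z \<in> W" for z
 proof -
  have "((\<lambda>s. m (z + of_real s * 1)) has_real_derivative dd m (z + of_real 0 * 1) 1) (at 0)"
   by (rule has_real_derivative_line) (use smooth_diff[OF smm that] in simp)
  moreover have "(\<lambda>s. m (z + of_real s * 1)) = (\<lambda>s. m z)" by (simp add: m_def)
  ultimately have "((\<lambda>s. m z) has_real_derivative dd m z 1) (at 0)" by simp
  thus ?thesis using DERIV_unique[OF _ DERIV_const] by blast
 qed
 have dmi: "dd m z \<i> = R z" if "z \<in> W" for z
 proof -
  have "((\<lambda>s. m (z + of_real s * \<i>)) has_real_derivative dd m (z + of_real 0 * \<i>) \<i>) (at 0)"
   by (rule has_real_derivative_line) (use smooth_diff[OF smm that] in simp)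
  moreover have "(\<lambda>s. m (z + of_real s * \<i>)) = (\<lambda>s. M (Im z + s))" by (simp add: m_def)
  moreover have "((\<lambda>s. M (Im z + s)) has_real_derivative R (Complex 0 (Im z + 0))) (at 0)"
  proof -
   have "(M has_real_derivative R (Complex 0 (Im z + 0))) (at (Im z + 0))"
    using dM[of "Im z"] that by (auto simp: Wi)
   hence "((\<lambda>s. M (Im z + s)) has_real_derivative R (Complex 0 (Im z + 0)) * 1) (at 0)"
    by (rule DERIV_chain2) (auto intro!: derivative_eq_intros)
   thus ?thesis by simp
  qed
  ultimately show ?thesis using DERIV_unique by (fastforce simp: R_def)
 qed
 define q where "q = (\<lambda>z. T z / R z)"
 have sq: "smooth W q" unfolding q_def using Rpos by (intro smooth_divide_real sT sR) fastforce
 have dq: "dd q z 1 = \<mu> z / R z" if z: "z \<in> W" for z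
 proof -
  have nz: "R z \<noteq> 0" using Rpos[OF z] by simp
  have "T z = q z * R z" if "z \<in> W" for z using Rpos[OF that] by (simp add: q_def)
  hence "dd T z 1 = dd (\<lambda>z. q z * R z) z 1" using dd_cong(1)[OF oW z, of T "\<lambda>z. q z * R z"] by simp
  also have "dd (\<lambda>z. q z * R z) z 1 = q z * dd R z 1 + dd q z 1 * R z"
   using dd_eqI[OF has_derivative_mult[OF smooth_der[OF sq z] smooth_der[OF sR z]]] by simp
  finally show ?thesis using dT[OF z] dR0[OF z] nz by (simp add: field_simps)
 qed
 define K where "K = (\<lambda>z. Complex (q z) (m z))"
 define A where "A = M 1"
 have Mmono: "M s < M s'" if "s < s'" "0 \<le> s" "s' \<le> 1" for s s'
 proof (rule DERIV_pos_imp_increasing[OF that(1)])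
  fix x assume "s \<le> x" "x \<le> s'"
  thus "\<exists>d. (M has_real_derivative d) (at x) \<and> 0 < d"
   using dM[of x] Rpos[of "Complex 0 x"] that by (intro exI[of _ "R (Complex 0 x)"]) (auto simp: Wi)
 qed
 have M0: "M 0 = 0" by (simp add: M_def M'_def)
 have cM: "continuous_on {0..1} M"
  by (intro continuous_at_imp_continuous_on ballI DERIV_isCont[OF dM]) auto
 have qi: "q (Complex x y) = T (Complex x y) / R (Complex 0 y)" for x y by (simp add: q_def R_def)
 show ?thesis
 proof (rule that[of A K])
  show "0 < A" using Mmono[of 0 1] M0 by (simp add: A_def)
  show "smooth Q K" unfolding K_def
   by (intro smooth_Complex smooth_subset[OF sq oQ QW] smooth_subset[OF smm oQ QW])
  show "jac K z = \<mu> z" if "z \<in> Q" for z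
  proof -
   have z: "z \<in> W" using that QW by auto
   show ?thesis unfolding K_def
    using jac_Complex[OF smooth_diff[OF sq z] smooth_diff[OF smm z]] dm1[OF z] dmi[OF z] dq[OF z] Rpos[OF z] by simp
  qed
  show "inj_on K Q"
  proof (rule inj_onI)
   fix z w assume z: "z \<in> Q" "w \<in> Q" and eq: "K z = K w"
   hence e: "M (Im z) = M (Im w)" "q z = q w" by (auto simp: K_def m_def)
   have im: "Im z = Im w"
    using Mmono[of "Im z" "Im w"] Mmono[of "Im w" "Im z"] e(1) z by (auto simp: Qi) (metis less_imp_neq linorder_neqE_linordered_idom less_eq_real_def)
   have Rz: "R z = R w" "R z > 0" using im Rpos z QW by (auto simp: R_def)
   hence "T z = T w" using e(2) by (simp add: q_def)
   hence "T (Complex (Re z) (Im z)) = T (Complex (Re w) (Im z))" unfolding im by (metis complex_surj im)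
   hence "Re z = Re w"
    using Tmono[of "Re z" "Re w" "Im z"] Tmono[of "Re w" "Re z" "Im z"] z by (auto simp: Qi) (metis less_imp_neq linorder_neqE_linordered_idom less_eq_real_def order_less_trans zero_less_one neg_less_0_iff_less)
   thus "z = w" using im by (simp add: complex_eq_iff)
  qed
  show "K ` Q = box 0 (Complex 1 A)"
  proof (intro set_eqI iffI)
   fix w assume "w \<in> K ` Q"
   then obtain z where z: "z \<in> Q" "w = K z" by auto
   have "0 < M (Im z)" "M (Im z) < A"
    using Mmono[of 0 "Im z"] Mmono[of "Im z" 1] M0 z by (auto simp: Qi A_def)
   moreover have "0 < T z" "T z < R z"
    using Tmono[of 0 "Re z" "Im z"] Tmono[of "Re z" 1 "Im z"] T0 z by (auto simp: Qi R_def)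
   ultimately show "w \<in> box 0 (Complex 1 A)" using z by (auto simp: in_box_complex_iff K_def m_def q_def)
  next
   fix w assume "w \<in> box 0 (Complex 1 A)"
   hence w: "0 < Re w" "Re w < 1" "0 < Im w" "Im w < A" by (auto simp: in_box_complex_iff)
   obtain y where y: "0 \<le> y" "y \<le> 1" "M y = Im w"
    using IVT'[of M 0 "Im w" 1] M0 w cM by (auto simp: A_def)
   hence y': "0 < y" "y < 1" using w M0 by (auto simp: A_def less_eq_real_def)
   define g where "g = (\<lambda>s. T (Complex s y))"
   have cg: "continuous_on {0..1} g" unfolding g_def
    by (intro continuous_at_imp_continuous_on ballI DERIV_isCont[OF Tline]) (use y' in \<open>auto simp: Wi\<close>)
   have Ry: "R (Complex 0 y) > 0" using Rpos[of "Complex 0 y"] y' by (simp add: Wi)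
   have g1: "g 1 = R (Complex 0 y)" by (simp add: g_def R_def)
   obtain x where x: "0 \<le> x" "x \<le> 1" "g x = Re w * R (Complex 0 y)"
    using IVT'[of g 0 "Re w * R (Complex 0 y)" 1] T0 w cg g1 Ry by (auto simp: g_def)
   hence x': "0 < x" "x < 1" using w T0 Ry g1 by (auto simp: g_def less_eq_real_def)
   have "K (Complex x y) = w" using x(3) y(3) Ry by (simp add: K_def m_def qi g_def complex_eq_iff)
   moreover have "Complex x y \<in> Q" using x' y' by (simp add: Qi)
   ultimately show "w \<in> K ` Q" by blast
  qed
 qed
qed

lemma connectedin_split:
 assumes "connectedin Y S" "openin Y A" "openin Y B" "S \<subseteq> A \<union> B" "A \<inter> B \<inter> S = {}" "A \<inter> S \<noteq> {}"
 shows "B \<inter> S = {}"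
 using assms unfolding connectedin by blast

section \<open>Surfaces with an area form\<close>

text \<open>\<open>P\<close> is a set of local parametrizations \<open>(U, \<xi>)\<close> pulling the area form back to the standard one.\<close>

locale osurf =
 fixes X :: "'a topology" and P :: "(complex set \<times> (complex => 'a)) set"
 assumes haus: "Hausdorff_space X"
  and cover: "x \<in> topspace X ==> \<exists>U \<xi>. (U, \<xi>) \<in> P \<and> x \<in> \<xi> ` U"
  and par_open: "(U, \<xi>) \<in> P ==> open U"
  and par_inj: "(U, \<xi>) \<in> P ==> inj_on \<xi> U"
  and par_cont: "(U, \<xi>) \<in> P ==> continuous_map (top_of_set U) X \<xi>"
  and par_openmap: "(U, \<xi>) \<in> P ==> open N ==> N \<subseteq> U ==> openin X (\<xi> ` N)"
  and par_trans: "(U, \<xi>) \<in> P ==> (V, \<xi>') \<in> P ==> p \<in> U ==> q \<in> V ==> \<xi> p = \<xi>' q ==>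
    \<exists>N t. p \<in> N \<and> N \<subseteq> U \<and> smooth N t \<and> t ` N \<subseteq> V \<and> (\<forall>x\<in>N. \<xi>' (t x) = \<xi> x \<and> jac t x = 1)"
begin

lemma par_in: "(U, \<xi>) \<in> P ==> p \<in> U ==> \<xi> p \<in> topspace X"
 using continuous_map_image_subset_topspace[OF par_cont] by fastforce

lemma par_vimage:
 assumes "(U, \<xi>) \<in> P" "openin X O'" shows "open {p \<in> U. \<xi> p \<in> O'}"
 using openin_continuous_map_preimage[OF par_cont[OF assms(1)] assms(2)] par_open[OF assms(1)]
 by (simp add: openin_open_eq)

lemma par_compact:
 assumes "(U, \<xi>) \<in> P" "compact K" "K \<subseteq> U" shows "closedin X (\<xi> ` K)"
proof -
 have "compactin (top_of_set U) K" using assms(2,3) by (simp add: compactin_subtopology)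
 hence "compactin X (\<xi> ` K)" by (rule image_compactin[OF _ par_cont[OF assms(1)]])
 thus ?thesis using haus compactin_imp_closedin by blast
qed

lemma chart_ball:
 assumes "openin X O'" "x \<in> O'"
 obtains V \<xi> c R where "(V, \<xi>) \<in> P" "0 < R" "cball c R \<subseteq> V" "\<xi> c = x" "\<xi> ` cball c R \<subseteq> O'"
proof -
 have "x \<in> topspace X" using assms openin_subset by blast
 then obtain V \<xi> c where V: "(V, \<xi>) \<in> P" "c \<in> V" "\<xi> c = x" using cover by blast
 have "open {p \<in> V. \<xi> p \<in> O'}" by (rule par_vimage[OF V(1) assms(1)])
 moreover have "c \<in> {p \<in> V. \<xi> p \<in> O'}" using V assms by auto
 ultimately obtain R where "R > 0" "cball c R \<subseteq> {p \<in> V. \<xi> p \<in> O'}"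
  using open_contains_cball by blast
 thus ?thesis using that[OF V(1), of R c] V by blast
qed

subsection \<open>Maps from the plane into a surface\<close>

text \<open>The pull-back of the area form under j is \<mu> times dx \<and> dy. It is phrased
  through local lifts l to parametrizations; \<mu> may have any sign or vanish, and j need not be
  injective.\<close>

definition dens :: "complex set => (complex => 'a) => (complex => real) => bool" where
 "dens U j \<mu> \<longleftrightarrow> (\<forall>p\<in>U. \<exists>V \<xi> N l. (V, \<xi>) \<in> P \<and> p \<in> N \<and> N \<subseteq> U \<and> smooth N l \<and> l ` N \<subseteq> V \<and>
   (\<forall>x\<in>N. j x = \<xi> (l x) \<and> jac l x = \<mu> x))"

lemma densE:
 assumes "dens U j \<mu>" "p \<in> U"
 obtains V \<xi> N l where "(V, \<xi>) \<in> P" "p \<in> N" "N \<subseteq> U" "smooth N l" "l ` N \<subseteq> V"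
  "\<And>x. x \<in> N ==> j x = \<xi> (l x)" "\<And>x. x \<in> N ==> jac l x = \<mu> x"
proof -
 from assms(1)[unfolded dens_def, THEN bspec, OF assms(2)]
 obtain V \<xi> N l where "(V, \<xi>) \<in> P \<and> p \<in> N \<and> N \<subseteq> U \<and> smooth N l \<and> l ` N \<subseteq> V \<and>
   (\<forall>x\<in>N. j x = \<xi> (l x) \<and> jac l x = \<mu> x)" by (elim exE) (rule that)
 thus thesis by (intro that[of V \<xi> N l]) auto
qed

lemma dens_open: assumes "dens U j \<mu>" shows "open U"
proof (subst open_subopen, rule ballI)
 fix p assume "p \<in> U"
 then obtain V \<xi> N l where "(V, \<xi>) \<in> P" "p \<in> N" "N \<subseteq> U" "smooth N l" "l ` N \<subseteq> V"
  "\<And>x. x \<in> N ==> j x = \<xi> (l x)" "\<And>x. x \<in> N ==> jac l x = \<mu> x"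
  by (rule densE[OF assms]) (rule that)
 hence "p \<in> N" "N \<subseteq> U" "open N" using smooth_open by auto
 thus "\<exists>T. open T \<and> p \<in> T \<and> T \<subseteq> U" by blast
qed

lemma dens_par: assumes "(U, \<xi>) \<in> P" shows "dens U \<xi> (\<lambda>_. 1)"
 unfolding dens_def
proof
 fix p assume "p \<in> U"
 thus "\<exists>V \<xi>' N l. (V, \<xi>') \<in> P \<and> p \<in> N \<and> N \<subseteq> U \<and> smooth N l \<and> l ` N \<subseteq> V \<and> (\<forall>x\<in>N. \<xi> x = \<xi>' (l x) \<and> jac l x = 1)"
  using assms by (intro exI[of _ U] exI[of _ \<xi>] exI[of _ "\<lambda>x. x"]) (auto simp: jac_ident intro!: smooth_ident par_open)
qed

lemma dens_compose:
 assumes "dens U j \<mu>" "smooth N g" "g ` N \<subseteq> U"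
 shows "dens N (\<lambda>x. j (g x)) (\<lambda>x. \<mu> (g x) * jac g x)"
 unfolding dens_def
proof
 fix p assume p: "p \<in> N"
 obtain V \<xi> N' l where l: "(V, \<xi>) \<in> P" "g p \<in> N'" "N' \<subseteq> U" "smooth N' l" "l ` N' \<subseteq> V"
  "\<And>x. x \<in> N' ==> j x = \<xi> (l x)" "\<And>x. x \<in> N' ==> jac l x = \<mu> x"
  by (rule densE[OF assms(1), of "g p"]) (use p assms(3) in blast, rule that)
 let ?M = "N \<inter> g -` N'"
 have oM: "open ?M"
  using smooth_vimage[OF assms(2) smooth_open[OF l(4)]] by simp
 have sg: "smooth ?M g" by (rule smooth_subset[OF assms(2) oM]) auto
 have "smooth ?M (\<lambda>x. l (g x))" by (rule smooth_compose[OF l(4) sg]) auto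
 moreover have "jac (\<lambda>x. l (g x)) x = \<mu> (g x) * jac g x" if "x \<in> ?M" for x
  using jac_compose[OF smooth_diff[OF sg that], of l] smooth_diff[OF l(4), of "g x"] l(7)[of "g x"] that by simp
 ultimately show "\<exists>V \<xi> N' l. (V, \<xi>) \<in> P \<and> p \<in> N' \<and> N' \<subseteq> N \<and> smooth N' l \<and> l ` N' \<subseteq> V \<and>
   (\<forall>x\<in>N'. j (g x) = \<xi> (l x) \<and> jac l x = \<mu> (g x) * jac g x)"
  using l p by (intro exI[of _ V] exI[of _ \<xi>] exI[of _ ?M] exI[of _ "\<lambda>x. l (g x)"]) auto
qed

lemma dens_subset: assumes "dens U j \<mu>" "open V" "V \<subseteq> U" shows "dens V j \<mu>"
 using dens_compose[OF assms(1) smooth_ident[OF assms(2)]] assms(3) by (simp add: jac_ident)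

lemma dens_local: assumes "\<And>p. p \<in> U ==> \<exists>V. p \<in> V \<and> V \<subseteq> U \<and> dens V j \<mu>" shows "dens U j \<mu>"
 unfolding dens_def
proof
 fix p assume "p \<in> U"
 then obtain V where V: "p \<in> V" "V \<subseteq> U" "dens V j \<mu>" using assms by blast
 obtain V' \<xi> N l where "(V', \<xi>) \<in> P" "p \<in> N" "N \<subseteq> V" "smooth N l" "l ` N \<subseteq> V'"
  "\<And>x. x \<in> N ==> j x = \<xi> (l x)" "\<And>x. x \<in> N ==> jac l x = \<mu> x"
  by (rule densE[OF V(3,1)]) (rule that)
 thus "\<exists>V \<xi> N l. (V, \<xi>) \<in> P \<and> p \<in> N \<and> N \<subseteq> U \<and> smooth N l \<and> l ` N \<subseteq> V \<and>
   (\<forall>x\<in>N. j x = \<xi> (l x) \<and> jac l x = \<mu> x)"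
  using V(2) by (intro exI[of _ V'] exI[of _ \<xi>] exI[of _ N] exI[of _ l]) auto
qed

lemma dens_cong: assumes "dens U j \<mu>" "\<And>x. x \<in> U ==> j x = j' x" "\<And>x. x \<in> U ==> \<mu> x = \<mu>' x" shows "dens U j' \<mu>'"
 unfolding dens_def
proof
 fix p assume "p \<in> U"
 then obtain V \<xi> N l where "(V, \<xi>) \<in> P" "p \<in> N" "N \<subseteq> U" "smooth N l" "l ` N \<subseteq> V"
  "\<And>x. x \<in> N ==> j x = \<xi> (l x)" "\<And>x. x \<in> N ==> jac l x = \<mu> x"
  by (rule densE[OF assms(1)]) (rule that)
 thus "\<exists>V \<xi> N l. (V, \<xi>) \<in> P \<and> p \<in> N \<and> N \<subseteq> U \<and> smooth N l \<and> l ` N \<subseteq> V \<and>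
   (\<forall>x\<in>N. j' x = \<xi> (l x) \<and> jac l x = \<mu>' x)"
  using assms(2,3) by (intro exI[of _ V] exI[of _ \<xi>] exI[of _ N] exI[of _ l]) (auto simp: subset_iff)
qed

text \<open>\<open>dens\<close> provides a lift to some parametrization. Transition maps preserve
  area, so it can be moved to any prescribed one whose image contains \<open>j p\<close>.\<close>

lemma dens_lift:
 assumes "dens U j \<mu>" "p \<in> U" "(V, \<xi>) \<in> P" "q \<in> V" "j p = \<xi> q"
 obtains N l where "p \<in> N" "N \<subseteq> U" "smooth N l" "l ` N \<subseteq> V" "l p = q"
  "\<And>x. x \<in> N ==> j x = \<xi> (l x)" "\<And>x. x \<in> N ==> jac l x = \<mu> x"
proof -
 obtain V' \<xi>' N' l where l: "(V', \<xi>') \<in> P" "p \<in> N'" "N' \<subseteq> U" "smooth N' l" "l ` N' \<subseteq> V'"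
  "\<And>x. x \<in> N' ==> j x = \<xi>' (l x)" "\<And>x. x \<in> N' ==> jac l x = \<mu> x"
  by (rule densE[OF assms(1,2)]) (rule that)
 have "l p \<in> V'" "\<xi>' (l p) = \<xi> q" using l assms(5) by auto
 from par_trans[OF l(1) assms(3) this(1) assms(4) this(2)]
 obtain M t where t: "l p \<in> M" "M \<subseteq> V'" "smooth M t" "t ` M \<subseteq> V" "\<And>x. x \<in> M ==> \<xi> (t x) = \<xi>' x" "\<And>x. x \<in> M ==> jac t x = 1"
  by blast
 let ?N = "N' \<inter> l -` M"
 have oN: "open ?N"
  using smooth_vimage[OF l(4) smooth_open[OF t(3)]] by simp
 have sl: "smooth ?N l" by (rule smooth_subset[OF l(4) oN]) auto
 show ?thesis
 proof (rule that[of ?N "\<lambda>x. t (l x)"])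
  show "p \<in> ?N" "?N \<subseteq> U" using l t by auto
  show "smooth ?N (\<lambda>x. t (l x))" by (rule smooth_compose[OF t(3) sl]) auto
  show "(\<lambda>x. t (l x)) ` ?N \<subseteq> V" using t by auto
  show "j x = \<xi> (t (l x))" if "x \<in> ?N" for x using that t l by auto
  show "jac (\<lambda>x. t (l x)) x = \<mu> x" if "x \<in> ?N" for x
   using jac_compose[OF smooth_diff[OF sl that], of t] smooth_diff[OF t(3), of "l x"] l(7)[of x] t(6)[of "l x"] that by simp
  have "\<xi> (t (l p)) = \<xi> q" using t(5)[OF t(1)] l(6)[OF l(2)] assms(5) by simp
  thus "t (l p) = q" using par_inj[OF assms(3)] t(1,4) assms(4) by (meson image_subset_iff inj_onD)
 qed
qed

lemma dens_vimage:
 assumes "dens U j \<mu>" "openin X O'" shows "open {x \<in> U. j x \<in> O'}"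
proof (subst open_subopen, rule ballI)
 fix p assume p: "p \<in> {x \<in> U. j x \<in> O'}"
 obtain V \<xi> N l where l: "(V, \<xi>) \<in> P" "p \<in> N" "N \<subseteq> U" "smooth N l" "l ` N \<subseteq> V"
  "\<And>x. x \<in> N ==> j x = \<xi> (l x)" "\<And>x. x \<in> N ==> jac l x = \<mu> x"
  by (rule densE[OF assms(1), of p]) (use p in simp, rule that)
 let ?M = "N \<inter> l -` {q \<in> V. \<xi> q \<in> O'}"
 have "open ?M"
  using smooth_vimage[OF l(4) par_vimage[OF l(1) assms(2)]] by simp
 moreover have "p \<in> ?M" "?M \<subseteq> {x \<in> U. j x \<in> O'}" using p l(2,3,5,6) by auto
 ultimately show "\<exists>T. open T \<and> p \<in> T \<and> T \<subseteq> {x \<in> U. j x \<in> O'}" by blast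
qed

lemma dens_in: assumes "dens U j \<mu>" "p \<in> U" shows "j p \<in> topspace X"
 using densE[OF assms] par_in by (metis image_subset_iff)

lemma dens_cont: assumes "dens U j \<mu>" shows "continuous_map (top_of_set U) X j"
 unfolding continuous_map_def
 using dens_in[OF assms] dens_vimage[OF assms] by (auto intro: open_openin_trans simp: openin_open_eq dens_open[OF assms])

lemma dens_compact:
 assumes "dens U j \<mu>" "compact K" "K \<subseteq> U" shows "compactin X (j ` K)" "closedin X (j ` K)"
proof -
 have "compactin (top_of_set U) K" using assms(2,3) by (simp add: compactin_subtopology)
 thus "compactin X (j ` K)" by (rule image_compactin[OF _ dens_cont[OF assms(1)]])
 thus "closedin X (j ` K)" using haus compactin_imp_closedin by blast
qed

text \<open>Locally j is an injective planar map followed by a parametrization, so invariance of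
  domain applies.\<close>

lemma dens_openmap:
 assumes "dens U j \<mu>" "\<And>x. x \<in> U ==> \<mu> x \<noteq> 0" "open N" "N \<subseteq> U"
 shows "openin X (j ` N)"
proof (subst openin_subopen, rule ballI)
 fix y assume "y \<in> j ` N"
 then obtain p where p: "p \<in> N" "y = j p" by blast
 have "dens N j \<mu>" by (rule dens_subset[OF assms(1,3,4)])
 then obtain V \<xi> M l where l: "(V, \<xi>) \<in> P" "p \<in> M" "M \<subseteq> N" "smooth M l" "l ` M \<subseteq> V"
  "\<And>x. x \<in> M ==> j x = \<xi> (l x)" "\<And>x. x \<in> M ==> jac l x = \<mu> x"
  by (rule densE[of N j \<mu> p]) (simp, use p in simp, rule that)
 have "jac l p \<noteq> 0" using l(2,3,7) assms(2,4) by auto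
 then obtain r where r: "r > 0" "ball p r \<subseteq> M" "inj_on l (ball p r)" using local_injective[OF l(4,2)] by metis
 have "open (l ` ball p r)"
  by (rule invariance_of_domain[OF continuous_on_subset[OF smooth_cont[OF l(4)] r(2)] open_ball r(3)])
 hence "openin X (\<xi> ` l ` ball p r)" by (rule par_openmap[OF l(1)]) (use r l in blast)
 moreover have "y \<in> \<xi> ` l ` ball p r" using p l(2,6) r by auto
 moreover have "\<xi> ` l ` ball p r \<subseteq> j ` N"
 proof
  fix w assume "w \<in> \<xi> ` l ` ball p r"
  then obtain x where "x \<in> ball p r" "w = \<xi> (l x)" by blast
  hence "x \<in> N" "w = j x" using l(3) l(6)[of x] r(2) by auto
  thus "w \<in> j ` N" by blast
 qed
 ultimately show "\<exists>T. openin X T \<and> y \<in> T \<and> T \<subseteq> j ` N" by blast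
qed

text \<open>Orientation-preserving embeddings: positivity of the density makes j open and fixes the
  sign on which the cancellation in \<open>cross_ratio_log\<close> depends.\<close>

definition emb :: "complex set => (complex => 'a) => bool" where
 "emb U j \<longleftrightarrow> inj_on j U \<and> (\<exists>\<mu>. dens U j \<mu> \<and> (\<forall>x\<in>U. 0 < \<mu> x))"

lemma emb_openmap: "emb U j ==> open N ==> N \<subseteq> U ==> openin X (j ` N)"
 unfolding emb_def using dens_openmap[of U j _ N] by fastforce

end

subsection \<open>Pushing embedded discs around\<close>

text \<open>m is the inverse of a radial contraction \<nu> that shrinks the half disc into the given
  neighbourhood of c and is the identity near the boundary of the disc. So m spreads this
  neighbourhood over the half disc.\<close>

lemma planar_push:
 assumes R: "0 < R" and U: "open U" "c \<in> U"
 obtains m R' where "0 < R'" "R' < R" "smooth UNIV m" "inj m" "\<And>z. 0 < jac m z"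
  "\<And>z. R' \<le> cmod (z - c) ==> m z = z" "m ` ball c R \<subseteq> ball c R" "cball c (R/2) \<subseteq> m ` (U \<inter> ball c R)"
proof -
 obtain \<epsilon>0 where e0: "\<epsilon>0 > 0" "ball c \<epsilon>0 \<subseteq> U" using U openE by blast
 define \<epsilon> where "\<epsilon> = min \<epsilon>0 (R/2)"
 have e: "\<epsilon> > 0" "ball c \<epsilon> \<subseteq> U" "\<epsilon> \<le> R/2" using e0 R by (auto simp: \<epsilon>_def)
 \<comment> \<open>With this factor the disc of radius R/2 shrinks to radius \<epsilon>/2.\<close>
 define \<delta> where "\<delta> = \<epsilon> / R"
 have d: "0 < \<delta>" "\<delta> < 1" using e R by (auto simp: \<delta>_def)
 define u0 u1 where "u0 = (R/2)\<^sup>2" "u1 = (3*R/4)\<^sup>2"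
 have u: "u0 < u1" unfolding u0_u1_def using R by (simp add: power_strict_mono)
 \<comment> \<open>The contraction factor depends on the squared distance s, which is smooth at c.
   It is increasing, so the Jacobian \<tau> (\<tau> + 2 s \<tau>') is positive and \<nu> is
   injective along rays.\<close>
 define \<tau> where "\<tau> = (\<lambda>u. \<delta> + (1 - \<delta>) * sstep ((u - u0) / (u1 - u0)))"
 have st: "smooth UNIV \<tau>" unfolding \<tau>_def
  using u by (intro smooth_add smooth_mult smooth_const smooth_compose[OF smooth_sstep]
   smooth_divide_real smooth_diff' smooth_ident) auto
 have t_ge: "\<delta> \<le> \<tau> x" "\<tau> x \<le> 1" for x
 proof -
  have "0 \<le> (1-\<delta>) * sstep ((x - u0) / (u1 - u0))" "(1-\<delta>) * sstep ((x - u0) / (u1 - u0)) \<le> (1 - \<delta>) * 1"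
   using d sstep_range by (auto intro!: mult_nonneg_nonneg mult_left_mono)
  thus "\<delta> \<le> \<tau> x" "\<tau> x \<le> 1" by (auto simp: \<tau>_def)
 qed
 have t_mono: "\<tau> x \<le> \<tau> y" if "x \<le> y" for x y
  unfolding \<tau>_def using that d u by (intro add_left_mono mult_left_mono sstep_mono divide_right_mono) auto
 have t_0: "\<tau> x = \<delta>" if "x \<le> u0" for x
  unfolding \<tau>_def using that u by (simp add: sstep_0 divide_nonpos_pos)
 have t_1: "\<tau> x = 1" if "u1 \<le> x" for x
  unfolding \<tau>_def using that u by (simp add: sstep_1)
 define t' where "t' = (\<lambda>x. dd \<tau> x 1)"
 have tder: "(\<tau> has_derivative (\<lambda>h. h * t' x)) (at x)" for x
 proof -
  have "(\<tau> has_derivative dd \<tau> x) (at x)" by (rule smooth_der[OF st UNIV_I])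
  moreover have "dd \<tau> x = (\<lambda>h. h * t' x)"
  proof
   fix h
   have "dd \<tau> x (h *\<^sub>R 1) = h *\<^sub>R dd \<tau> x 1"
    by (rule linear_scale[OF dd_linear[OF smooth_diff[OF st UNIV_I]]])
   thus "dd \<tau> x h = h * t' x" by (simp add: t'_def)
  qed
  ultimately show ?thesis by simp
 qed
 have t'pos: "0 \<le> t' x" for x
 proof (rule mono_on_imp_deriv_nonneg[of UNIV \<tau>])
  show "mono_on UNIV \<tau>" by (auto intro: mono_onI t_mono)
  have "(\<lambda>h. h * t' x) = (*) (t' x)" by (simp add: fun_eq_iff mult.commute)
  thus "(\<tau> has_real_derivative t' x) (at x)" using tder[of x] by (simp add: has_field_derivative_def)
 qed auto
 define \<nu> where "\<nu> = (\<lambda>z. c + of_real (\<tau> ((cmod (z - c))\<^sup>2)) * (z - c))"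
 have sn: "smooth UNIV \<nu>" unfolding \<nu>_def
  by (intro smooth_add smooth_mult smooth_const smooth_of_real smooth_compose[OF st smooth_norm2]
    smooth_diff' smooth_ident) auto
 have jn: "0 < jac \<nu> z" for z
 proof -
  define x y where "x = Re (z - c)" "y = Im (z - c)"
  define s where "s = (cmod (z - c))\<^sup>2"
  have sxy: "s = x * x + y * y" unfolding s_def x_y_def cmod_power2 by (simp add: power2_eq_square)
  have D1: "((\<lambda>z. (cmod (z - c))\<^sup>2) has_derivative (\<lambda>h. 2 * (x * Re h + y * Im h))) (at z)"
  proof -
   have "((\<lambda>z. Re (z - c) * Re (z - c) + Im (z - c) * Im (z - c)) has_derivative (\<lambda>h. 2 * (x * Re h + y * Im h))) (at z)"
    by (auto intro!: derivative_eq_intros bounded_linear.has_derivative[OF bounded_linear_Re] bounded_linear.has_derivative[OF bounded_linear_Im]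
      simp: x_y_def algebra_simps)
   moreover have "(\<lambda>z. (cmod (z - c))\<^sup>2) = (\<lambda>z. Re (z - c) * Re (z - c) + Im (z - c) * Im (z - c))"
    unfolding cmod_power2 by (simp add: power2_eq_square)
   ultimately show ?thesis by simp
  qed
  have D2: "((\<lambda>z. \<tau> ((cmod (z - c))\<^sup>2)) has_derivative (\<lambda>h. 2 * (x * Re h + y * Im h) * t' s)) (at z)"
   using diff_chain_at[OF D1 tder] by (simp add: o_def s_def)
  have D3: "(\<nu> has_derivative (\<lambda>h. of_real (\<tau> s) * h + of_real (2 * (x * Re h + y * Im h) * t' s) * (z - c))) (at z)"
  proof -
   have "((\<lambda>z. complex_of_real (\<tau> ((cmod (z - c))\<^sup>2))) has_derivative (\<lambda>h. of_real (2 * (x * Re h + y * Im h) * t' s))) (at z)"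
    by (rule bounded_linear.has_derivative[OF bounded_linear_of_real D2])
   moreover have "((\<lambda>z. z - c) has_derivative (\<lambda>h. h)) (at z)"
    by (auto intro!: derivative_eq_intros)
   ultimately have "((\<lambda>z. of_real (\<tau> ((cmod (z - c))\<^sup>2)) * (z - c)) has_derivative
     (\<lambda>h. of_real (\<tau> ((cmod (z - c))\<^sup>2)) * h + of_real (2 * (x * Re h + y * Im h) * t' s) * (z - c))) (at z)"
    by (rule has_derivative_mult)
   from has_derivative_add[OF has_derivative_const[of c] this] show ?thesis
    by (simp only: \<nu>_def s_def add_0)
  qed
  have "jac \<nu> z = (\<tau> s + 2 * x * t' s * x) * (\<tau> s + 2 * y * t' s * y) - (2 * x * t' s * y) * (2 * y * t' s * x)"
   unfolding jac_def dd_eqI[OF D3] by (simp add: area_form_def x_y_def algebra_simps)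
  also have "\<dots> = \<tau> s * (\<tau> s + 2 * t' s * s)" by (simp add: sxy algebra_simps)
  also have "\<dots> > 0" using t_ge(1)[of s] d(1) t'pos[of s] by (auto intro!: mult_pos_pos add_pos_nonneg simp: s_def)
  finally show ?thesis .
 qed
 have nn: "cmod (\<nu> z - c) = \<tau> ((cmod (z - c))\<^sup>2) * cmod (z - c)" for z
  using t_ge(1)[of "(cmod (z - c))\<^sup>2"] d by (simp add: \<nu>_def norm_mult)
 have nmono: "\<tau> (a\<^sup>2) * a < \<tau> (b\<^sup>2) * b" if "0 \<le> a" "a < b" for a b :: real
 proof -
  have "\<tau> (a\<^sup>2) * a \<le> \<tau> (b\<^sup>2) * a" using that by (intro mult_right_mono t_mono power_mono) auto
  also have "\<dots> < \<tau> (b\<^sup>2) * b" using that t_ge(1)[of "b\<^sup>2"] d by (intro mult_strict_left_mono) auto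
  finally show ?thesis .
 qed
 have ninj: "inj \<nu>"
 proof (rule injI)
  fix z w assume eq: "\<nu> z = \<nu> w"
  hence "cmod (\<nu> z - c) = cmod (\<nu> w - c)" by simp
  hence a: "cmod (z - c) = cmod (w - c)"
   unfolding nn using nmono[of "cmod (z - c)" "cmod (w - c)"] nmono[of "cmod (w - c)" "cmod (z - c)"]
   by (cases rule: linorder_cases[of "cmod (z - c)" "cmod (w - c)"]) auto
  have "of_real (\<tau> ((cmod (z - c))\<^sup>2)) * (z - c) = of_real (\<tau> ((cmod (z - c))\<^sup>2)) * (w - c)"
   using eq a by (simp add: \<nu>_def)
  moreover have "\<tau> ((cmod (z - c))\<^sup>2) \<noteq> 0" using t_ge(1)[of "(cmod (z - c))\<^sup>2"] d by linarith
  ultimately show "z = w" by simp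
 qed
 have nout: "\<nu> z = z" if "3*R/4 \<le> cmod (z - c)" for z
 proof -
  have "u1 \<le> (cmod (z - c))\<^sup>2" unfolding u0_u1_def using that R by (intro power_mono) auto
  thus ?thesis using t_1 by (simp add: \<nu>_def)
 qed
 have nsurj: "\<exists>z. \<nu> z = w" for w
 proof (cases "w = c")
  case True thus ?thesis by (intro exI[of _ c]) (simp add: \<nu>_def)
 next
  case False
  define b where "b = max (cmod (w - c)) R"
  have b: "b \<ge> 0" "cmod (w - c) \<le> b" "R \<le> b" using R by (auto simp: b_def)
  have "u1 \<le> b\<^sup>2" unfolding u0_u1_def using b R by (intro power_mono) auto
  hence tb: "\<tau> (b\<^sup>2) * b = b" using t_1 by simp
  have "continuous_on {0..b} (\<lambda>s. \<tau> (s\<^sup>2) * s)"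
   by (intro continuous_intros continuous_on_compose2[OF smooth_cont[OF st]]) auto
  then obtain s where s: "0 \<le> s" "s \<le> b" "\<tau> (s\<^sup>2) * s = cmod (w - c)"
   using IVT'[of "\<lambda>s. \<tau> (s\<^sup>2) * s" 0 "cmod (w - c)" b] b tb by auto
  define z where "z = c + of_real (s / cmod (w - c)) * (w - c)"
  have "cmod (z - c) = s" using s False by (simp add: z_def norm_mult norm_divide)
  hence "\<nu> z = c + of_real (\<tau> (s\<^sup>2) * s / cmod (w - c)) * (w - c)" by (simp add: \<nu>_def z_def)
  thus ?thesis using s(3) False by (intro exI[of _ z]) simp
 qed
 define m where "m = inv \<nu>"
 have mn: "m (\<nu> z) = z" and nm: "\<nu> (m z) = z" for z
  using ninj nsurj by (auto simp: m_def surj_def intro: surj_f_inv_f[OF surjI] ) (metis f_inv_into_f rangeI)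
 have sm: "smooth (\<nu> ` UNIV) m" and jm: "jac m (\<nu> z) = 1 / jac \<nu> z" for z
  using smooth_inverse[OF sn ninj _ mn] jn by (auto simp: less_imp_neq[symmetric])
 have nU: "\<nu> ` UNIV = UNIV" using nsurj by (metis surj_def)
 have mout: "m z = z" if "3*R/4 \<le> cmod (z - c)" for z using nout[OF that] mn[of z] by simp
 show ?thesis
 proof (rule that[of "3*R/4" m])
  show "0 < 3*R/4" "3*R/4 < R" using R by auto
  show "smooth UNIV m" using sm nU by simp
  show "inj m" using nm by (metis injI)
  show "0 < jac m z" for z using jm[of "m z"] nm[of z] jn[of "m z"] by simp
  show "m z = z" if "3*R/4 \<le> cmod (z - c)" for z by (rule mout[OF that])
  show "m ` ball c R \<subseteq> ball c R"
  proof clarify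
   fix z assume z: "z \<in> ball c R"
   show "m z \<in> ball c R"
   proof (rule ccontr)
    assume "m z \<notin> ball c R"
    hence "R \<le> cmod (m z - c)" by (simp add: dist_norm norm_minus_commute)
    hence "\<nu> (m z) = m z" using R by (intro nout) simp
    thus False using nm[of z] \<open>m z \<notin> ball c R\<close> z by simp
   qed
  qed
  show "cball c (R/2) \<subseteq> m ` (U \<inter> ball c R)"
  proof
   fix z assume "z \<in> cball c (R/2)"
   hence z: "cmod (z - c) \<le> R/2" by (simp add: dist_norm norm_minus_commute)
   hence "(cmod (z - c))\<^sup>2 \<le> u0" unfolding u0_u1_def by (intro power_mono) auto
   hence "cmod (\<nu> z - c) = \<delta> * cmod (z - c)" unfolding nn using t_0 by simp
   also have "\<dots> \<le> \<delta> * (R/2)" using z d by (intro mult_left_mono) auto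
   also have "\<dots> = \<epsilon>/2" using R by (simp add: \<delta>_def)
   finally have "cmod (\<nu> z - c) < \<epsilon>" using e by simp
   hence "\<nu> z \<in> U \<inter> ball c R" using e R by (auto simp: dist_norm norm_minus_commute)
   thus "z \<in> m ` (U \<inter> ball c R)" using mn[of z] by (metis image_eqI)
  qed
 qed
qed

context osurf begin

text \<open>The spreading map of \<open>planar_push\<close>, transplanted by \<xi> and extended by
  the identity, is composed with j. Only points whose image lies in the disc move, and they stay in
  the disc.\<close>

lemma push:
 assumes V: "(V, \<xi>) \<in> P" and R: "0 < R" "cball c R \<subseteq> V" and j: "emb U j" and U0: "open U0" "U0 \<subseteq> U" and c: "\<xi> c \<in> j ` U0"
 obtains j' where "emb U j'" "\<xi> ` cball c (R/2) \<subseteq> j' ` U0" "\<And>x. x \<in> U ==> j x \<notin> \<xi> ` ball c R ==> j' x = j x"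
  "\<And>x. x \<in> U ==> j x \<in> \<xi> ` ball c R ==> j' x \<in> \<xi> ` ball c R"
proof -
 obtain \<mu> where mu: "inj_on j U" "dens U j \<mu>" "\<And>x. x \<in> U ==> 0 < \<mu> x" using j unfolding emb_def by blast
 define G where "G = {p \<in> V. \<xi> p \<in> j ` U0}"
 have oG: "open G" unfolding G_def by (rule par_vimage[OF V emb_openmap[OF j U0]])
 have bV: "ball c R \<subseteq> V" using R(2) by auto
 have cG: "c \<in> G" using c R bV by (auto simp: G_def)
 obtain m R' where m: "0 < R'" "R' < R" "smooth UNIV m" "inj m" "\<And>z. 0 < jac m z"
  "\<And>z. R' \<le> cmod (z - c) ==> m z = z" "m ` ball c R \<subseteq> ball c R" "cball c (R/2) \<subseteq> m ` (G \<inter> ball c R)"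
  using planar_push[OF R(1) oG cG] by metis
 define \<iota> where "\<iota> = inv_into V \<xi>"
 have ik: "\<iota> (\<xi> z) = z" if "z \<in> V" for z using par_inj[OF V] that by (simp add: \<iota>_def)
 define M where "M = (\<lambda>x. if x \<in> \<xi> ` ball c R then \<xi> (m (\<iota> x)) else x)"
 have Mk: "M (\<xi> z) = \<xi> (m z)" if "z \<in> ball c R" for z using that ik bV by (auto simp: M_def)
 have Min: "M x \<in> \<xi> ` ball c R" if "x \<in> \<xi> ` ball c R" for x using that Mk m(7) by auto
 have Mout: "M x = x" if "x \<notin> \<xi> ` ball c R" for x using that by (simp add: M_def)
 have Minj: "x = y" if "M x = M y" for x y
 proof (cases "x \<in> \<xi> ` ball c R \<and> y \<in> \<xi> ` ball c R")
  case True
  then obtain z w where zw: "x = \<xi> z" "z \<in> ball c R" "y = \<xi> w" "w \<in> ball c R" by auto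
  hence "\<xi> (m z) = \<xi> (m w)" using that Mk by auto
  moreover have "m z \<in> V" "m w \<in> V" using zw m(7) bV by blast+
  ultimately have "m z = m w" using par_inj[OF V] by (meson inj_onD)
  thus ?thesis using m(4) zw by (simp add: inj_eq)
 next
  case False thus ?thesis using that Min Mout by metis
 qed
 define \<mu>' where "\<mu>' = (\<lambda>x. if j x \<in> \<xi> ` ball c R then jac m (\<iota> (j x)) * \<mu> x else \<mu> x)"
 have "dens U (\<lambda>x. M (j x)) \<mu>'"
 proof (rule dens_local)
  fix p assume p: "p \<in> U"
  show "\<exists>N. p \<in> N \<and> N \<subseteq> U \<and> dens N (\<lambda>x. M (j x)) \<mu>'"
  proof (cases "j p \<in> \<xi> ` ball c R")
   case True
   then obtain q where q: "q \<in> ball c R" "j p = \<xi> q" by blast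
   hence "q \<in> V" using bV by auto
   obtain N l where l: "p \<in> N" "N \<subseteq> U" "smooth N l" "l ` N \<subseteq> V" "l p = q"
    "\<And>x. x \<in> N ==> j x = \<xi> (l x)" "\<And>x. x \<in> N ==> jac l x = \<mu> x"
    using dens_lift[OF mu(2) p V \<open>q \<in> V\<close> q(2)] by metis
   let ?N = "N \<inter> l -` ball c R"
   have oN: "open ?N"
    using smooth_vimage[OF l(3) open_ball] by simp
   have sl: "smooth ?N l" by (rule smooth_subset[OF l(3) oN]) auto
   have sml: "smooth ?N (\<lambda>x. m (l x))" by (rule smooth_compose[OF m(3) sl]) auto
   have "dens ?N (\<lambda>x. \<xi> (m (l x))) (\<lambda>x. 1 * jac (\<lambda>x. m (l x)) x)"
    by (rule dens_compose[OF dens_par[OF V] sml]) (use m(7) bV in auto)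
   hence "dens ?N (\<lambda>x. M (j x)) \<mu>'"
   proof (rule dens_cong)
    fix x assume x: "x \<in> ?N"
    show "\<xi> (m (l x)) = M (j x)" using x l(6)[of x] Mk by auto
    have "jac (\<lambda>x. m (l x)) x = jac m (l x) * jac l x"
     using jac_compose[OF smooth_diff[OF sl x]] smooth_diff[OF m(3)] by simp
    thus "1 * jac (\<lambda>x. m (l x)) x = \<mu>' x" using x l(4,6,7) ik by (auto simp: \<mu>'_def)
   qed
   thus ?thesis using l q by (intro exI[of _ ?N]) auto
  next
   \<comment> \<open>m is the identity already from radius R' < R on. The closed disc of radius R'
     is closed in the Hausdorff space \<open>X\<close>, so near p the composition does not change
     j.\<close>
   case False
   have cb: "cball c R' \<subseteq> V" using R(2) m(2) by auto
   have "openin X (topspace X - \<xi> ` cball c R')"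
    using par_compact[OF V compact_cball cb] by blast
   from dens_vimage[OF mu(2) this]
   have oN: "open {x \<in> U. j x \<in> topspace X - \<xi> ` cball c R'}" (is "open ?N") .
   have dN: "dens ?N j \<mu>" by (rule dens_subset[OF mu(2) oN]) auto
   have "dens ?N (\<lambda>x. M (j x)) \<mu>'"
   proof (rule dens_cong[OF dN])
    fix x assume x: "x \<in> ?N"
    have *: "R' < cmod (q - c)" if "q \<in> ball c R" "j x = \<xi> q" for q
    proof (rule ccontr)
     assume "\<not> R' < cmod (q - c)"
     hence "q \<in> cball c R'" by (simp add: dist_norm norm_minus_commute)
     thus False using x that by auto
    qed
    show "j x = M (j x)"
    proof (cases "j x \<in> \<xi> ` ball c R")
     case True
     then obtain q where q: "q \<in> ball c R" "j x = \<xi> q" by blast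
     thus ?thesis using *[OF q] m(6)[of q] Mk[of q] by simp
    qed (simp add: Mout)
    show "\<mu> x = \<mu>' x"
    proof (cases "j x \<in> \<xi> ` ball c R")
     case True
     then obtain q where q: "q \<in> ball c R" "j x = \<xi> q" by blast
     have oE: "open {z. R' < cmod (z - c)}" by (intro open_Collect_less continuous_intros)
     have "jac m q = jac (\<lambda>x. x) q"
      by (rule jac_cong[OF oE]) (use *[OF q] m(6) in auto)
     thus ?thesis using q ik bV by (auto simp: \<mu>'_def jac_ident)
    qed (simp add: \<mu>'_def)
   qed
   moreover have "p \<in> ?N" using p False dens_in[OF mu(2) p] m(2) by auto
   ultimately show ?thesis by (intro exI[of _ ?N]) simp
  qed
 qed
 moreover have "0 < \<mu>' x" if "x \<in> U" for x using mu(3)[OF that] m(5) by (simp add: \<mu>'_def)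
 moreover have "inj_on (\<lambda>x. M (j x)) U" using mu(1) Minj by (meson inj_on_def)
 ultimately have "emb U (\<lambda>x. M (j x))" unfolding emb_def by blast
 moreover have "\<xi> ` cball c (R/2) \<subseteq> (\<lambda>x. M (j x)) ` U0"
 proof
  fix y assume "y \<in> \<xi> ` cball c (R/2)"
  then obtain z where "y = \<xi> z" "z \<in> cball c (R/2)" by blast
  then obtain w where w: "w \<in> G" "w \<in> ball c R" "y = \<xi> (m w)" using m(8) by blast
  then obtain x where "x \<in> U0" "j x = \<xi> w" by (auto simp: G_def)
  thus "y \<in> (\<lambda>x. M (j x)) ` U0" using Mk[OF w(2)] w(3) by (metis image_eqI)
 qed
 ultimately show ?thesis using that[of "\<lambda>x. M (j x)"] Mout Min by blast
qed

lemma push_keep: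
 assumes V: "(V, \<xi>) \<in> P" and R: "0 < R" "cball c R \<subseteq> V" and j: "emb U j" and U0: "open U0" "U0 \<subseteq> U" and c: "\<xi> c \<in> j ` U0"
  and Q: "Q \<subseteq> j ` U0" "Q \<inter> \<xi> ` ball c R = {}"
 obtains j' where "emb U j'" "\<xi> ` cball c (R/2) \<subseteq> j' ` U0" "Q \<subseteq> j' ` U0"
proof -
 obtain j' where j': "emb U j'" "\<xi> ` cball c (R/2) \<subseteq> j' ` U0" "\<And>x. x \<in> U ==> j x \<notin> \<xi> ` ball c R ==> j' x = j x"
  using push[OF V R j U0 c] by metis
 have "Q \<subseteq> j' ` U0"
 proof
  fix y assume y: "y \<in> Q"
  then obtain x where x: "x \<in> U0" "y = j x" using Q by blast
  hence "j' x = j x" using j'(3)[of x] U0 Q y by blast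
  thus "y \<in> j' ` U0" using x by (metis image_eqI)
 qed
 thus ?thesis using that j' by blast
qed

text \<open>The points that can be reached while Q stays covered form an open set, by a push at the
  point, and one that is closed in \<open>O'\<close>, by a push from a nearby reachable
  point.\<close>

lemma reach:
 assumes O': "openin X O'" "connectedin X O'" and j: "emb U j" and U0: "open U0" "U0 \<subseteq> U"
  and ne: "O' \<inter> j ` U0 \<noteq> {}" and Q: "Q \<subseteq> j ` U0" "Q \<inter> O' = {}" and y: "y \<in> O'"
 obtains j' where "emb U j'" "Q \<subseteq> j' ` U0" "y \<in> j' ` U0"
proof -
 define A where "A = {y \<in> O'. \<exists>j'. emb U j' \<and> Q \<subseteq> j' ` U0 \<and> y \<in> j' ` U0}"
 have step: "\<xi> ` cball c (R/2) \<subseteq> A"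
  if asm: "(V, \<xi>) \<in> P" "0 < R" "cball c R \<subseteq> V" "\<xi> ` cball c R \<subseteq> O'" "\<xi> c \<in> A" for V \<xi> R c
 proof -
  obtain j' where j': "emb U j'" "Q \<subseteq> j' ` U0" "\<xi> c \<in> j' ` U0" using asm(5) by (auto simp: A_def)
  have "Q \<inter> \<xi> ` ball c R = {}" using asm(4) Q(2) by (meson ball_subset_cball disjoint_iff image_mono subset_iff)
  from push_keep[OF asm(1-3) j'(1) U0 j'(3,2) this]
  obtain j'' where j'': "emb U j''" "\<xi> ` cball c (R/2) \<subseteq> j'' ` U0" "Q \<subseteq> j'' ` U0" by metis
  have "cball c (R/2) \<subseteq> cball c R" using asm(2) by auto
  thus ?thesis using asm(4) j'' unfolding A_def by blast
 qed
 have oA: "openin X A"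
 proof (subst openin_subopen, rule ballI)
  fix x assume x: "x \<in> A"
  hence "x \<in> O'" by (simp add: A_def)
  then obtain V \<xi> c R where k: "(V, \<xi>) \<in> P" "0 < R" "cball c R \<subseteq> V" "\<xi> c = x" "\<xi> ` cball c R \<subseteq> O'"
   using chart_ball[OF O'(1)] by metis
  have "\<xi> ` cball c (R/2) \<subseteq> A" using step k x by auto
  moreover have "openin X (\<xi> ` ball c (R/2))"
   using k(2,3) by (intro par_openmap[OF k(1)]) auto
  moreover have "x \<in> \<xi> ` ball c (R/2)" using k by auto
  ultimately show "\<exists>T. openin X T \<and> x \<in> T \<and> T \<subseteq> A" by (meson ball_subset_cball image_mono subset_trans)
 qed
 have oB: "openin X (O' - A)"
 proof (subst openin_subopen, rule ballI)
  fix x assume x: "x \<in> O' - A"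
  then obtain V \<xi> c R where k: "(V, \<xi>) \<in> P" "0 < R" "cball c R \<subseteq> V" "\<xi> c = x" "\<xi> ` cball c R \<subseteq> O'"
   using chart_ball[OF O'(1)] by (metis DiffD1)
  \<comment> \<open>A reachable point so close to c would let a push in the disc of radius R/2
    around c' reach c itself.\<close>
  have "\<xi> c' \<notin> A" if c': "c' \<in> ball c (R/4)" for c'
  proof
   assume "\<xi> c' \<in> A"
   have sub: "cball c' (R/2) \<subseteq> cball c R"
   proof
    fix z assume "z \<in> cball c' (R/2)"
    thus "z \<in> cball c R" using c' dist_triangle[of c z c'] k(2) by auto
   qed
   have "\<xi> ` cball c' (R/2/2) \<subseteq> A"
   proof (rule step[OF k(1)])
    show "\<xi> ` cball c' (R/2) \<subseteq> O'" using sub k(5) by (meson image_mono subset_trans)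
   qed (use sub k \<open>\<xi> c' \<in> A\<close> in auto)
   moreover have "c \<in> cball c' (R/2/2)" using c' by (auto simp: dist_commute)
   ultimately have "\<xi> c \<in> A" by blast
   thus False using x k(4) by simp
  qed
  moreover have "openin X (\<xi> ` ball c (R/4))"
   using k(2,3) by (intro par_openmap[OF k(1)]) auto
  moreover have "x \<in> \<xi> ` ball c (R/4)" using k by auto
  moreover have "\<xi> ` ball c (R/4) \<subseteq> O'"
  proof -
   have "ball c (R/4) \<subseteq> cball c R" using k(2) by auto
   thus ?thesis using k(5) by (meson image_mono subset_trans)
  qed
  ultimately show "\<exists>T. openin X T \<and> x \<in> T \<and> T \<subseteq> O' - A" by blast
 qed
 have "A \<inter> O' \<noteq> {}" unfolding A_def using ne j Q by blast
 hence "(O' - A) \<inter> O' = {}"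
  by (intro connectedin_split[OF O'(2) oA oB]) auto
 thus ?thesis using that y by (auto simp: A_def)
qed

text \<open>The annulus around the removed disc is connected, so it lies in one part of any
  separation; adding the disc to that part would separate \<open>O'\<close>.\<close>

lemma connected_minus_disc:
 assumes O': "openin X O'" "connectedin X O'" and V: "(V, \<xi>) \<in> P" and R: "0 < r" "r < R" "cball c R \<subseteq> V" "\<xi> ` cball c R \<subseteq> O'"
 shows "openin X (O' - \<xi> ` cball c r)" "connectedin X (O' - \<xi> ` cball c r)"
proof -
 have clK: "closedin X (\<xi> ` cball c r)" by (rule par_compact[OF V]) (use R in auto)
 thus op: "openin X (O' - \<xi> ` cball c r)" using O'(1) by (simp add: openin_diff)
 define A where "A = {z. r < norm (z - c) \<and> norm (z - c) < R}"
 have "connected A" unfolding A_def by (rule connected_annulus) simp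
 moreover have AV: "A \<subseteq> V" using R by (auto simp: A_def dist_norm norm_minus_commute subset_iff)
 ultimately have cA: "connectedin X (\<xi> ` A)"
  by (intro connectedin_continuous_map_image[OF par_cont[OF V]]) (simp add: connectedin_subtopology)
 have kd: "\<xi> ` ball c R \<subseteq> \<xi> ` A \<union> \<xi> ` cball c r"
 proof clarify
  fix z assume z: "z \<in> ball c R" "\<xi> z \<notin> \<xi> ` cball c r"
  hence "z \<notin> cball c r" by blast
  hence "z \<in> A" using z by (auto simp: A_def dist_norm norm_minus_commute)
  thus "\<xi> z \<in> \<xi> ` A" by blast
 qed
 have AO: "\<xi> ` A \<subseteq> O' - \<xi> ` cball c r"
 proof
  fix y assume "y \<in> \<xi> ` A"
  then obtain z where z: "z \<in> A" "y = \<xi> z" by blast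
  have "z \<in> cball c R" using z by (auto simp: A_def dist_norm norm_minus_commute)
  hence "y \<in> O'" using z R by blast
  moreover have "y \<notin> \<xi> ` cball c r"
  proof
   assume "y \<in> \<xi> ` cball c r"
   then obtain w where w: "w \<in> cball c r" "\<xi> w = \<xi> z" using z by auto
   have "w \<in> V" using w R by auto
   hence "w = z" using par_inj[OF V] w(2) z AV by (meson inj_onD subsetD)
   thus False using w z by (auto simp: A_def dist_norm norm_minus_commute)
  qed
  ultimately show "y \<in> O' - \<xi> ` cball c r" by blast
 qed
 show "connectedin X (O' - \<xi> ` cball c r)"
  unfolding connectedin
 proof (intro conjI notI)
  show "O' - \<xi> ` cball c r \<subseteq> topspace X" using openin_subset[OF O'(1)] by blast
  assume "\<exists>E1 E2. openin X E1 \<and> openin X E2 \<and> O' - \<xi> ` cball c r \<subseteq> E1 \<union> E2 \<and> E1 \<inter> E2 \<inter> (O' - \<xi> ` cball c r) = {} \<and>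
   E1 \<inter> (O' - \<xi> ` cball c r) \<noteq> {} \<and> E2 \<inter> (O' - \<xi> ` cball c r) \<noteq> {}"
  then obtain E1 E2 where E: "openin X E1" "openin X E2" "O' - \<xi> ` cball c r \<subseteq> E1 \<union> E2" "E1 \<inter> E2 \<inter> (O' - \<xi> ` cball c r) = {}"
   "E1 \<inter> (O' - \<xi> ` cball c r) \<noteq> {}" "E2 \<inter> (O' - \<xi> ` cball c r) \<noteq> {}" by blast
  have main: False if "openin X E1" "openin X E2" "O' - \<xi> ` cball c r \<subseteq> E1 \<union> E2" "E1 \<inter> E2 \<inter> (O' - \<xi> ` cball c r) = {}"
   "E2 \<inter> (O' - \<xi> ` cball c r) \<noteq> {}" "E2 \<inter> \<xi> ` A = {}" for E1 E2
  proof -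
   let ?F1 = "(E1 \<inter> (O' - \<xi> ` cball c r)) \<union> \<xi> ` ball c R" and ?F2 = "E2 \<inter> (O' - \<xi> ` cball c r)"
   have "openin X (\<xi> ` ball c R)" by (rule par_openmap[OF V open_ball]) (use R(3) ball_subset_cball in blast)
   hence oF: "openin X ?F1" "openin X ?F2" using that(1,2) op by (intro openin_Un openin_Int; simp)+
   have "\<xi> c \<in> \<xi> ` ball c R" "\<xi> c \<in> O'" using R by auto
   hence b: "\<xi> ` ball c R \<inter> ?F1 \<inter> O' \<noteq> {}" by blast
   have cov: "O' \<subseteq> ?F1 \<union> ?F2"
   proof
    fix y assume y: "y \<in> O'"
    have "cball c r \<subseteq> ball c R" using R by auto
    thus "y \<in> ?F1 \<union> ?F2" using y that(3) by blast
   qed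
   have dis: "?F1 \<inter> ?F2 \<inter> O' = {}" using that(4,6) kd by blast
   have "?F1 \<inter> O' \<noteq> {}" using b by blast
   hence "?F2 \<inter> O' = {}" by (rule connectedin_split[OF O'(2) oF cov dis])
   thus False using that(5) by blast
  qed
  have "E1 \<inter> \<xi> ` A = {} \<or> E2 \<inter> \<xi> ` A = {}"
   using connectedin_split[OF cA E(1,2)] AO E(3,4) by blast
  thus False using main[of E1 E2] main[of E2 E1] E by (metis Int_commute Un_commute)
 qed
qed

end

section \<open>Engulfing finitely many disjoint discs\<close>

context osurf begin

text \<open>The half discs are taken in one after another, starting from a tiny copy of U inside one
  parametrization. Each is approached inside the complement \<open>O' m\<close> of the earlier ones,
  which remains connected, so that these stay covered. Only U0 has to cover; in the application U
  also contains the closure of U0, where the density must be controlled.\<close>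

lemma engulf:
 fixes n :: nat
 assumes conn: "connected_space X" and ne: "topspace X \<noteq> {}"
  and U: "open U" "bounded U" and U0: "open U0" "U0 \<subseteq> U" "U0 \<noteq> {}"
  and fam: "\<And>i. i < n ==> (V i, \<xi> i) \<in> P \<and> 0 < R i \<and> cball (c i) (R i) \<subseteq> V i"
  and disj: "\<And>i k. i < n ==> k < n ==> i \<noteq> k ==> \<xi> i ` cball (c i) (R i) \<inter> \<xi> k ` cball (c k) (R k) = {}"
 shows "\<exists>j. emb U j \<and> (\<forall>i<n. \<xi> i ` cball (c i) (R i / 2) \<subseteq> j ` U0)"
proof -
 define B where "B i = \<xi> i ` cball (c i) (R i / 2)" for i
 define D where "D i = \<xi> i ` cball (c i) (R i)" for i
 have BD: "B i \<subseteq> D i" if "i < n" for i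
  unfolding B_def D_def by (rule image_mono) (use fam[OF that] in auto)
 have DX: "D i \<subseteq> topspace X" if "i < n" for i
  using fam[OF that] par_in unfolding D_def by blast
 define O' where "O' m = topspace X - (\<Union>i<m. B i)" for m
 have DO: "D m \<subseteq> O' m'" if "m < n" "m' \<le> m" for m m'
 proof
  fix y assume y: "y \<in> D m"
  have "y \<notin> B i" if "i < m'" for i
  using BD[of i] \<open>m < n\<close> \<open>m' \<le> m\<close> that y disj[of m i] by (auto simp: D_def)
  thus "y \<in> O' m'" using DX \<open>m < n\<close> y by (auto simp: O'_def)
 qed
 have OO: "openin X (O' m) \<and> connectedin X (O' m)" if "m \<le> n" for m
  using that
 proof (induction m)
  case 0 thus ?case using conn by (simp add: O'_def connectedin_topspace)
 next
  case (Suc m)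
  hence IH: "openin X (O' m)" "connectedin X (O' m)" and m: "m < n" by auto
  have "O' (Suc m) = O' m - \<xi> m ` cball (c m) (R m / 2)"
   by (auto simp: O'_def B_def lessThan_Suc)
  thus ?case
   using connected_minus_disc[OF IH, of "V m" "\<xi> m" "R m / 2" "R m" "c m"] fam[OF m] DO[OF m, of m] by (simp add: D_def)
 qed
 have "\<exists>j. emb U j \<and> (\<forall>i<m. B i \<subseteq> j ` U0)" if "m \<le> n" for m
  using that
 proof (induction m)
  case 0
  obtain x where "x \<in> topspace X" using ne by blast
  then obtain W \<eta> a r where W: "(W, \<eta>) \<in> P" "0 < r" "cball a r \<subseteq> W"
   using chart_ball[of "topspace X" x] by (metis openin_topspace)
  obtain b where b: "\<And>x. x \<in> U ==> cmod x \<le> b" using U(2) bounded_iff by blast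
  \<comment> \<open>Scales the bounded set U into the disc of radius r; the added 1 keeps the
    denominator positive.\<close>
  define \<delta> where "\<delta> = r / (\<bar>b\<bar> + 1)"
  have d: "\<delta> > 0" using W by (simp add: \<delta>_def)
  define g where "g = (\<lambda>x. a + of_real \<delta> * x)"
  have "smooth U g" unfolding g_def
   by (intro smooth_add smooth_mult smooth_const smooth_ident U(1))
  moreover have "g ` U \<subseteq> W"
  proof clarify
   fix x assume "x \<in> U"
   hence "\<delta> * cmod x \<le> \<delta> * (\<bar>b\<bar> + 1)" using b[of x] d by (intro mult_left_mono) auto
   also have "\<dots> = r" by (simp add: \<delta>_def)
   finally have "g x \<in> cball a r" using d by (simp add: g_def dist_norm norm_mult)
   thus "g x \<in> W" using W by blast
  qed
  ultimately have "dens U (\<lambda>x. \<eta> (g x)) (\<lambda>x. 1 * jac g x)" and gW: "g ` U \<subseteq> W"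
   using dens_compose[OF dens_par[OF W(1)]] by auto
  moreover have "0 < 1 * jac g x" for x unfolding g_def jac_affine using d by simp
  moreover have "inj_on (\<lambda>x. \<eta> (g x)) U"
  proof (rule inj_onI)
   fix x y assume "x \<in> U" "y \<in> U" "\<eta> (g x) = \<eta> (g y)"
   hence "g x = g y" using par_inj[OF W(1)] gW by (meson image_subset_iff inj_onD)
   thus "x = y" using d by (simp add: g_def)
  qed
  ultimately have "emb U (\<lambda>x. \<eta> (g x))" unfolding emb_def by blast
  thus ?case by auto
 next
  case (Suc m)
  then obtain j where j: "emb U j" "\<forall>i<m. B i \<subseteq> j ` U0" by auto
  have m: "m < n" using Suc by simp
  define Q where "Q = (\<Union>i<m. B i)"
  have QU: "Q \<subseteq> j ` U0" using j by (auto simp: Q_def)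
  have QO: "Q \<inter> O' m = {}" by (auto simp: Q_def O'_def)
  define y where "y = \<xi> m (c m)"
  have yD: "y \<in> D m" using fam[OF m] by (auto simp: y_def D_def)
  hence yO: "y \<in> O' m" using DO[OF m, of m] by auto
  have clB: "closedin X (B i)" if "i < m" for i
   unfolding B_def by (rule par_compact[of "V i" "\<xi> i"]) (use fam[of i] m that in auto)
  have clQ: "closedin X Q" unfolding Q_def
   by (rule closedin_Union) (auto intro: clB)
  \<comment> \<open>Otherwise the image of U0, which contains Q, and the complement of Q would
    separate the connected surface.\<close>
  have "O' m \<inter> j ` U0 \<noteq> {}"
  proof
   assume e: "O' m \<inter> j ` U0 = {}"
   have oj: "openin X (j ` U0)" by (rule emb_openmap[OF j(1) U0(1,2)])
   have "openin X (topspace X - Q)" using clQ by blast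
   moreover have "topspace X - Q = O' m" by (simp add: Q_def O'_def)
   ultimately have oO: "openin X (O' m)" by simp
   have cov: "topspace X \<subseteq> j ` U0 \<union> O' m" using QU by (auto simp: O'_def Q_def)
   have d: "j ` U0 \<inter> O' m \<inter> topspace X = {}" using e by blast
   have n: "j ` U0 \<inter> topspace X \<noteq> {}" using U0(3) openin_subset[OF oj] by blast
   have "connectedin X (topspace X)" using conn by (simp add: connectedin_topspace)
   hence "O' m \<inter> topspace X = {}" by (rule connectedin_split[OF _ oj oO cov d n])
   thus False using yO by (auto simp: O'_def)
  qed
  then obtain j1 where j1: "emb U j1" "Q \<subseteq> j1 ` U0" "y \<in> j1 ` U0"
   using reach[of "O' m" U j U0 Q y] OO[of m] m j(1) U0 QU QO yO by (metis less_imp_le)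
  have "Q \<inter> \<xi> m ` ball (c m) (R m) = {}"
  using DO[OF m, of m] QO image_mono by (fastforce simp: D_def)
  then obtain j2 where "emb U j2" "\<xi> m ` cball (c m) (R m / 2) \<subseteq> j2 ` U0" "Q \<subseteq> j2 ` U0"
   using push_keep[of "V m" "\<xi> m" "R m" "c m" U j1 U0 Q] fam[OF m] j1 U0 unfolding y_def by metis
  hence "emb U j2" "B i \<subseteq> j2 ` U0" if "i < Suc m" for i
  proof -
   show "B i \<subseteq> j2 ` U0"
   proof (cases "i = m")
    case False
    hence "B i \<subseteq> Q" using that unfolding Q_def by (intro UN_upper) simp
    thus ?thesis using \<open>Q \<subseteq> j2 ` U0\<close> by blast
   qed (use \<open>\<xi> m ` cball (c m) (R m / 2) \<subseteq> j2 ` U0\<close> in \<open>simp add: B_def\<close>)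
  qed
  thus ?case by blast
 qed
 thus ?thesis by (auto simp: B_def)
qed

lemma dens_smooth: assumes "dens U j \<mu>" shows "smooth U \<mu>"
proof (rule smooth_local)
 fix p assume p: "p \<in> U"
 obtain V \<xi> N l where l: "(V, \<xi>) \<in> P" "p \<in> N" "N \<subseteq> U" "smooth N l" "l ` N \<subseteq> V"
  "\<And>x. x \<in> N ==> j x = \<xi> (l x)" "\<And>x. x \<in> N ==> jac l x = \<mu> x"
  by (rule densE[OF assms p]) (rule that)
 have "smooth N \<mu>" by (rule smooth_cong[OF smooth_jac[OF l(4)] l(7)])
 thus "\<exists>V. p \<in> V \<and> V \<subseteq> U \<and> smooth V \<mu>" using l by blast
qed

text \<open>Reads k in the coordinates given by j; by the chain rule the densities are
  divided.\<close>

lemma emb_transition: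
 assumes j: "inj_on j U" "dens U j \<mu>" "\<And>x. x \<in> U ==> 0 < \<mu> x"
  and k: "dens N k \<nu>" "k ` N \<subseteq> j ` U"
 shows "smooth N (\<lambda>x. inv_into U j (k x))"
  and "\<And>x. x \<in> N ==> jac (\<lambda>x. inv_into U j (k x)) x = \<nu> x / \<mu> (inv_into U j (k x))"
proof -
 let ?g = "\<lambda>x. inv_into U j (k x)"
 have gU: "?g x \<in> U" "j (?g x) = k x" if "x \<in> N" for x
  using k(2) that by (auto simp: inv_into_into f_inv_into_f)
 have loc: "\<exists>M. p \<in> M \<and> M \<subseteq> N \<and> smooth M ?g \<and> jac ?g p = \<nu> p / \<mu> (?g p)" if p: "p \<in> N" for p
 proof -
  let ?x = "?g p"
  have jx: "j ?x = k p" and xU: "?x \<in> U" using gU p by auto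
  obtain V \<xi> M l where l: "(V, \<xi>) \<in> P" "?x \<in> M" "M \<subseteq> U" "smooth M l" "l ` M \<subseteq> V"
   "\<And>x. x \<in> M ==> j x = \<xi> (l x)" "\<And>x. x \<in> M ==> jac l x = \<mu> x"
   by (rule densE[OF j(2) xU]) (rule that)
  have "jac l ?x \<noteq> 0" using l(2,7) j(3) xU by force
  then obtain r where r: "r > 0" "ball ?x r \<subseteq> M" "inj_on l (ball ?x r)" using local_injective[OF l(4,2)] by metis
  let ?B = "ball ?x r"
  have sB: "smooth ?B l" by (rule smooth_subset[OF l(4) open_ball r(2)])
  have nz: "jac l z \<noteq> 0" if "z \<in> ?B" for z using l(3) l(7)[of z] r(2) j(3)[of z] that by force
  define li where "li = inv_into ?B l"
  have li: "li (l z) = z" if "z \<in> ?B" for z using r(3) that by (simp add: li_def)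
  have sli: "smooth (l ` ?B) li" and jli: "\<And>z. z \<in> ?B ==> jac li (l z) = 1 / jac l z"
   using smooth_inverse[OF sB r(3) nz li] by auto
  have lx: "l ?x \<in> V" "k p = \<xi> (l ?x)" using l jx by auto
  obtain M' l' where l': "p \<in> M'" "M' \<subseteq> N" "smooth M' l'" "l' ` M' \<subseteq> V" "l' p = l ?x"
   "\<And>x. x \<in> M' ==> k x = \<xi> (l' x)" "\<And>x. x \<in> M' ==> jac l' x = \<nu> x"
   by (rule dens_lift[OF k(1) p l(1) lx]) (rule that)
  let ?M = "M' \<inter> l' -` (l ` ?B)"
  have oM: "open ?M"
   using smooth_vimage[OF l'(3) smooth_open[OF sli]] by simp
  have sl': "smooth ?M l'" by (rule smooth_subset[OF l'(3) oM]) auto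
  have s: "smooth ?M (\<lambda>x. li (l' x))" by (rule smooth_compose[OF sli sl']) auto
  have eq: "li (l' x) = ?g x" if "x \<in> ?M" for x
  proof -
   obtain z where z: "z \<in> ?B" "l' x = l z" using \<open>x \<in> ?M\<close> by auto
   hence "j z = k x" using l'(6)[of x] l(6)[of z] r(2) \<open>x \<in> ?M\<close> by auto
   moreover have "z \<in> U" using z r(2) l(3) by auto
   ultimately have "?g x = z" using j(1) by (metis inv_into_f_f)
   thus ?thesis using z li by simp
  qed
  have sg: "smooth ?M ?g" by (rule smooth_cong[OF s eq])
  have pM: "p \<in> ?M" using l' r by auto
  have "jac ?g p = jac (\<lambda>x. li (l' x)) p" by (rule jac_cong[OF oM pM]) (simp add: eq)
  also have "\<dots> = jac li (l' p) * jac l' p"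
   using smooth_diff[OF sl' pM] smooth_diff[OF sli, of "l' p"] pM by (intro jac_compose) auto
  also have "\<dots> = \<nu> p / \<mu> ?x" using l'(5) l'(7)[OF l'(1)] jli[of ?x] r(1) l(7)[OF l(2)] by simp
  finally show ?thesis using sg pM l'(2) by (intro exI[of _ ?M]) auto
 qed
 show "smooth N ?g" by (rule smooth_local) (use loc in blast)
 show "jac ?g x = \<nu> x / \<mu> (?g x)" if "x \<in> N" for x using loc[OF that] by blast
qed

end

subsection \<open>Area of planar images\<close>

text \<open>Each disc contains a square of side r/2, whose area the maps preserve, and n disjoint
  images fit into a rectangle of area A. Squares instead of discs, because the area of a box is
  immediate.\<close>

lemma planar_area:
 assumes "0 < r" "0 < A"
  and sm: "\<And>i. i < n ==> smooth (ball (c i) r) (G i)" and j1: "\<And>i z. i < n ==> z \<in> ball (c i) r ==> jac (G i) z = 1"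
  and inj: "\<And>i. i < n ==> inj_on (G i) (ball (c i) r)" and im: "\<And>i. i < n ==> G i ` ball (c i) r \<subseteq> box 0 (Complex 1 A)"
  and disj: "\<And>i k. i < n ==> k < n ==> i \<noteq> k ==> G i ` ball (c i) r \<inter> G k ` ball (c k) r = {}"
 shows "real n * (r/2)\<^sup>2 \<le> A"
proof -
 \<comment> \<open>The measure of an image is governed by the determinant of a matrix, so the plane
   is identified with \<open>real^2\<close>.\<close>
 define v :: "real^2 => complex" where "v x = Complex (x$1) (x$2)" for x
 define w :: "complex => real^2" where "w z = (\<chi> i. if i = 1 then Re z else Im z)" for z
 have vw: "v (w z) = z" for z by (simp add: v_def w_def)
 have wv: "w (v x) = x" for x by (simp add: v_def w_def vec_eq_iff forall_2)
 have w12: "w z $ 1 = Re z" "w z $ 2 = Im z" for z by (auto simp: w_def)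
 have lv: "bounded_linear v"
  unfolding linear_conv_bounded_linear[symmetric] by (rule linearI) (auto simp: v_def complex_eq_iff)
 have lw: "bounded_linear w"
  unfolding linear_conv_bounded_linear[symmetric] by (rule linearI) (auto simp: w_def vec_eq_iff)
 define C where "C i = cbox (w (c i)) (w (c i + Complex (r/2) (r/2)))" for i
 have vC: "v x \<in> ball (c i) r" if "x \<in> C i" for x i
 proof -
  have "Re (c i) \<le> x$1" "x$1 \<le> Re (c i) + r/2" "Im (c i) \<le> x$2" "x$2 \<le> Im (c i) + r/2"
   using that by (auto simp: C_def mem_box_cart forall_2 w12)
  hence "\<bar>Re (v x - c i)\<bar> \<le> r/2" "\<bar>Im (v x - c i)\<bar> \<le> r/2" by (auto simp: v_def)
  hence "(cmod (v x - c i))\<^sup>2 \<le> (r/2)\<^sup>2 + (r/2)\<^sup>2"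
   unfolding cmod_power2 by (intro add_mono) (metis power2_abs power_mono abs_ge_zero)+
  also have "\<dots> < r\<^sup>2" using assms(1) by (simp add: power2_eq_square)
  finally have "cmod (v x - c i) < r" using assms(1) by (meson less_le power_less_imp_less_base)
  thus ?thesis by (simp add: dist_norm norm_minus_commute)
 qed
 have cC: "measure lborel (C i) = (r/2)\<^sup>2" for i
 proof -
  have "C i \<noteq> {}" using assms(1) by (auto simp: C_def interval_ne_empty_cart forall_2 w12)
  thus ?thesis unfolding C_def
   by (subst content_cbox_cart) (auto simp: UNIV_2 w12 power2_eq_square)
 qed
 define H where "H i = (\<lambda>x. w (G i (v x)))" for i
 have meas: "H i ` C i \<in> lmeasurable \<and> measure lebesgue (H i ` C i) = (r/2)\<^sup>2" if i: "i < n" for i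
 proof -
  define D where "D x = (\<lambda>h. w (dd (G i) (v x) (v h)))" for x
  have der: "(H i has_derivative D x) (at x within C i)" if "x \<in> C i" for x
  proof -
   have "(G i has_derivative dd (G i) (v x)) (at (v x))" by (rule smooth_der[OF sm[OF i] vC[OF that]])
   hence "((\<lambda>x. G i (v x)) has_derivative (\<lambda>h. dd (G i) (v x) (v h))) (at x)"
    using diff_chain_at[OF bounded_linear_imp_has_derivative[OF lv], of "G i"] by (simp add: o_def)
   from bounded_linear.has_derivative[OF lw this] show ?thesis
    unfolding H_def D_def by (rule has_derivative_at_withinI)
  qed
  have injH: "inj_on (H i) (C i)"
  proof (rule inj_onI)
   fix x y assume "x \<in> C i" "y \<in> C i" "H i x = H i y"
   hence "v x = v y" using vw inj[OF i] vC unfolding H_def by (metis inj_onD)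
   thus "x = y" using wv by metis
  qed
  have "det (matrix (D x)) = 1" if "x \<in> C i" for x
  proof -
   have ax: "v (axis 1 1) = 1" "v (axis 2 1) = \<i>" by (auto simp: v_def axis_def complex_eq_iff)
   have "det (matrix (D x)) = area_form (dd (G i) (v x) 1) (dd (G i) (v x) \<i>)"
    by (simp add: det_2 matrix_def D_def ax w12 area_form_def)
   thus ?thesis using j1[OF i vC[OF that]] by (simp add: jac_def)
  qed
  moreover have "((\<lambda>x. 1) has_integral (r/2)\<^sup>2) (C i)"
   using has_integral_const[of "1::real" "w (c i)" "w (c i + Complex (r/2) (r/2))"] cC[of i] by (simp add: C_def)
  ultimately have "((\<lambda>x. \<bar>det (matrix (D x))\<bar>) has_integral (r/2)\<^sup>2) (C i)"
   by (subst has_integral_cong[where g = "\<lambda>x. 1"]) auto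
  thus ?thesis
   using has_measure_differentiable_image[OF _ der injH, of "(r/2)\<^sup>2"] by (simp add: C_def)
 qed
 have disjH: "disjoint_family_on (\<lambda>i. H i ` C i) {..<n}"
  unfolding disjoint_family_on_def
 proof (intro ballI impI)
  fix i k assume ik: "i \<in> {..<n}" "k \<in> {..<n}" "i \<noteq> k"
  show "H i ` C i \<inter> H k ` C k = {}"
  proof (rule ccontr)
   assume "H i ` C i \<inter> H k ` C k \<noteq> {}"
   then obtain x y where xy: "x \<in> C i" "y \<in> C k" "H i x = H k y" by blast
   hence "G i (v x) = G k (v y)" using vw unfolding H_def by metis
   hence "G i (v x) \<in> G i ` ball (c i) r \<inter> G k ` ball (c k) r"
    using vC[OF xy(1)] vC[OF xy(2)] by blast
   thus False using disj[of i k] ik by auto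
  qed
 qed
 let ?B = "cbox 0 (w (Complex 1 A))"
 have HB: "H i ` C i \<subseteq> ?B" if "i < n" for i
 proof clarify
  fix x assume "x \<in> C i"
  hence "G i (v x) \<in> box 0 (Complex 1 A)" using im[OF that] vC by blast
  thus "H i x \<in> ?B" by (auto simp: H_def mem_box_cart forall_2 w12 in_box_complex_iff less_imp_le)
 qed
 have mB: "measure lebesgue ?B = A"
 proof -
  have "cbox 0 (w (Complex 1 A)) \<noteq> {}" using assms(2) by (auto simp: interval_ne_empty_cart forall_2 w12)
  hence "measure lborel (cbox 0 (w (Complex 1 A))) = A"
   by (subst content_cbox_cart) (auto simp: UNIV_2 w12)
  thus ?thesis by (simp add: measure_completion)
 qed
 have "real n * (r/2)\<^sup>2 = (\<Sum>i<n. measure lebesgue (H i ` C i))" using meas by simp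
 also have "\<dots> = measure lebesgue (\<Union>i<n. H i ` C i)"
 proof (rule measure_finite_Union[symmetric, OF _ _ disjH])
  show "(\<lambda>i. H i ` C i) ` {..<n} \<subseteq> sets lebesgue" using meas by (auto dest: fmeasurableD)
  show "emeasure lebesgue (H i ` C i) \<noteq> \<infinity>" if "i \<in> {..<n}" for i
  proof -
   have "H i ` C i \<in> lmeasurable" using meas that by simp
   from fmeasurableD2[OF this] show ?thesis by (metis infinity_ennreal_def)
  qed
 qed simp
 also have "\<dots> \<le> measure lebesgue ?B"
 proof (rule measure_mono_fmeasurable)
  show "(\<Union>i<n. H i ` C i) \<subseteq> ?B" using HB by blast
  show "(\<Union>i<n. H i ` C i) \<in> sets lebesgue" using meas by (intro sets.finite_UN) (auto simp: fmeasurable_def)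
 qed simp
 finally show ?thesis using mB by simp
qed

section \<open>Large rectangles in a surface with room for many discs\<close>

context osurf begin

text \<open>A square that engulfs n disjoint discs of one radius has total mass at least a fixed
  multiple of n, and Knothe's map turns it into a rectangle of width 1 and that area. The compact
  set \<open>K\<close> serves to bound functions on the rectangle.\<close>

lemma big_rectangle:
 assumes conn: "connected_space X" and \<rho>: "0 < \<rho>"
  and many: "\<And>n::nat. \<exists>V \<xi> c. (\<forall>i<n. (V i, \<xi> i) \<in> P \<and> cball (c i) \<rho> \<subseteq> V i) \<and>
    (\<forall>i<n. \<forall>k<n. i \<noteq> k --> \<xi> i ` cball (c i) \<rho> \<inter> \<xi> k ` cball (c k) \<rho> = {})"
 obtains A J K where "a \<le> A" "0 < A" "inj_on J (box 0 (Complex 1 A))" "dens (box 0 (Complex 1 A)) J (\<lambda>_. 1)"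
  "compactin X K" "J ` box 0 (Complex 1 A) \<subseteq> K"
proof -
 obtain n :: nat where n: "a / (\<rho>/4)\<^sup>2 < real n" using reals_Archimedean2 by blast
 obtain V \<xi> c where F: "(\<forall>i<Suc n. (V i, \<xi> i) \<in> P \<and> cball (c i) \<rho> \<subseteq> V i) \<and>
    (\<forall>i<Suc n. \<forall>k<Suc n. i \<noteq> k --> \<xi> i ` cball (c i) \<rho> \<inter> \<xi> k ` cball (c k) \<rho> = {})"
  using many[of "Suc n"] by (elim exE) (rule that)
 have fam: "\<And>i. i < Suc n ==> (V i, \<xi> i) \<in> P \<and> cball (c i) \<rho> \<subseteq> V i"
  using F by simp
 have disj: "\<And>i k. i < Suc n ==> k < Suc n ==> i \<noteq> k ==> \<xi> i ` cball (c i) \<rho> \<inter> \<xi> k ` cball (c k) \<rho> = {}"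
  using F by simp
 define W where "W = box (Complex (-1) (-1)) (Complex 2 2)"
 define Q where "Q = box 0 (Complex 1 1)"
 have QW: "Q \<subseteq> W" by (auto simp: Q_def W_def in_box_complex_iff)
 have "Complex (1/2) (1/2) \<in> Q" by (simp add: Q_def in_box_complex_iff)
 hence Qne: "Q \<noteq> {}" by blast
 have oW: "open W" "bounded W" "open Q" unfolding W_def Q_def by (auto intro: open_box bounded_box)
 have ne: "topspace X \<noteq> {}"
 proof -
  have "c 0 \<in> V 0" using fam[of 0] \<rho> by auto
  thus ?thesis using par_in[of "V 0" "\<xi> 0" "c 0"] fam[of 0] by auto
 qed
 obtain j where j: "emb W j" "\<forall>i<Suc n. \<xi> i ` cball (c i) (\<rho>/2) \<subseteq> j ` Q"
  using engulf[OF conn ne oW(1,2) oW(3) QW Qne, of "Suc n" V \<xi> "\<lambda>_. \<rho>" c] fam disj \<rho> by auto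
 obtain \<mu> where mu: "inj_on j W" "dens W j \<mu>" "\<And>x. x \<in> W ==> 0 < \<mu> x" using j(1) unfolding emb_def by blast
 obtain A K where K: "0 < A" "smooth Q K" "inj_on K Q" "K ` Q = box 0 (Complex 1 A)" "\<And>z. z \<in> Q ==> jac K z = \<mu> z"
  using knothe[of \<mu>] dens_smooth[OF mu(2)] mu(3) unfolding W_def Q_def by metis
 have nz: "jac K z \<noteq> 0" if "z \<in> Q" for z using K(5)[OF that] mu(3)[of z] QW that by auto
 define Ki where "Ki = inv_into Q K"
 have KiK: "Ki (K z) = z" if "z \<in> Q" for z using K(3) that by (simp add: Ki_def)
 have sKi: "smooth (box 0 (Complex 1 A)) Ki" and jKi: "\<And>z. z \<in> Q ==> jac Ki (K z) = 1 / jac K z"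
  using smooth_inverse[OF K(2,3) nz KiK] K(4) by auto
 have KiQ: "Ki y \<in> Q" "K (Ki y) = y" if "y \<in> box 0 (Complex 1 A)" for y
 proof -
  have "y \<in> K ` Q" using that K(4) by simp
  then obtain z where "z \<in> Q" "y = K z" by blast
  thus "Ki y \<in> Q" "K (Ki y) = y" using KiK by auto
 qed
 define J where "J = (\<lambda>y. j (Ki y))"
 have dQ: "dens Q j \<mu>" by (rule dens_subset[OF mu(2) oW(3) QW])
 have dJ: "dens (box 0 (Complex 1 A)) J (\<lambda>_. 1)"
 proof (rule dens_cong)
  show "dens (box 0 (Complex 1 A)) J (\<lambda>y. \<mu> (Ki y) * jac Ki y)"
   unfolding J_def by (rule dens_compose[OF dQ sKi]) (use KiQ in blast)
  fix y assume y: "y \<in> box 0 (Complex 1 A)"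
  have "jac Ki y = 1 / \<mu> (Ki y)" using jKi[OF KiQ(1)[OF y]] KiQ(2)[OF y] K(5)[OF KiQ(1)[OF y]] by simp
  thus "\<mu> (Ki y) * jac Ki y = 1" using mu(3)[of "Ki y"] KiQ(1)[OF y] QW by auto
 qed auto
 have injJ: "inj_on J (box 0 (Complex 1 A))"
 proof (rule inj_onI)
  fix x y assume xy: "x \<in> box 0 (Complex 1 A)" "y \<in> box 0 (Complex 1 A)" "J x = J y"
  hence "Ki x = Ki y" using mu(1) KiQ(1) QW unfolding J_def by (meson inj_onD subsetD)
  thus "x = y" using KiQ(2) xy by metis
 qed
 \<comment> \<open>The engulfed discs have radius \<rho>/2, so each accounts for a square of side
   \<rho>/4.\<close>
 have "real (Suc n) * ((\<rho>/2)/2)\<^sup>2 \<le> A"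
 proof (rule planar_area[where c = c and G = "\<lambda>i x. K (inv_into Q j (\<xi> i x))"])
  show "0 < \<rho>/2" "0 < A" using \<rho> K by auto
  fix i assume i: "i < Suc n"
  have bV: "ball (c i) (\<rho>/2) \<subseteq> V i" using fam[OF i] \<rho> by auto
  have iQ: "inj_on j Q" using mu(1) QW by (rule inj_on_subset)
  have dk: "dens (ball (c i) (\<rho>/2)) (\<xi> i) (\<lambda>_. 1)"
   using dens_subset[OF dens_par open_ball bV] fam[OF i] by blast
  have kj: "\<xi> i ` ball (c i) (\<rho>/2) \<subseteq> j ` Q"
  using j(2) i image_mono by fastforce
  have mQ: "0 < \<mu> x" if "x \<in> Q" for x using mu(3) QW that by auto
  have t1: "smooth (ball (c i) (\<rho>/2)) (\<lambda>x. inv_into Q j (\<xi> i x))"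
   by (rule emb_transition(1)[OF iQ dQ mQ dk kj])
  have t2: "jac (\<lambda>x. inv_into Q j (\<xi> i x)) z = 1 / \<mu> (inv_into Q j (\<xi> i z))" if "z \<in> ball (c i) (\<rho>/2)" for z
   by (rule emb_transition(2)[OF iQ dQ mQ dk kj that])
  have gQ: "inv_into Q j (\<xi> i x) \<in> Q" "j (inv_into Q j (\<xi> i x)) = \<xi> i x" if "x \<in> ball (c i) (\<rho>/2)" for x
   using kj that by (auto simp: inv_into_into f_inv_into_f image_subset_iff)
  show "smooth (ball (c i) (\<rho>/2)) (\<lambda>x. K (inv_into Q j (\<xi> i x)))"
   by (rule smooth_compose[OF K(2) t1]) (use gQ in auto)
  show "jac (\<lambda>x. K (inv_into Q j (\<xi> i x))) z = 1" if z: "z \<in> ball (c i) (\<rho>/2)" for z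
  using smooth_diff[OF t1 z] smooth_diff[OF K(2) gQ(1)[OF z]] K(5)[OF gQ(1)[OF z]] t2[OF z] mQ[OF gQ(1)[OF z]] jac_compose by fastforce
  show "inj_on (\<lambda>x. K (inv_into Q j (\<xi> i x))) (ball (c i) (\<rho>/2))"
  proof (rule inj_onI)
   fix x y assume xy: "x \<in> ball (c i) (\<rho>/2)" "y \<in> ball (c i) (\<rho>/2)" "K (inv_into Q j (\<xi> i x)) = K (inv_into Q j (\<xi> i y))"
   hence "inv_into Q j (\<xi> i x) = inv_into Q j (\<xi> i y)" using K(3) gQ(1) by (meson inj_onD)
   hence "\<xi> i x = \<xi> i y" using gQ(2) xy by metis
   thus "x = y" using par_inj[of "V i" "\<xi> i"] fam[OF i] bV xy by (meson inj_onD subsetD)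
  qed
  show "(\<lambda>x. K (inv_into Q j (\<xi> i x))) ` ball (c i) (\<rho>/2) \<subseteq> box 0 (Complex 1 A)"
   using gQ(1) K(4) by blast
  fix k assume k: "k < Suc n" "i \<noteq> k"
  show "(\<lambda>x. K (inv_into Q j (\<xi> i x))) ` ball (c i) (\<rho>/2) \<inter> (\<lambda>x. K (inv_into Q j (\<xi> k x))) ` ball (c k) (\<rho>/2) = {}"
  proof (rule ccontr)
   assume "\<not> ?thesis"
   then obtain x y where xy: "x \<in> ball (c i) (\<rho>/2)" "y \<in> ball (c k) (\<rho>/2)" "K (inv_into Q j (\<xi> i x)) = K (inv_into Q j (\<xi> k y))"
    by blast
   have "y \<in> cball (c k) (\<rho>/2)" "x \<in> cball (c i) \<rho>" "y \<in> cball (c k) \<rho>" using xy \<rho> by auto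
   hence ky: "\<xi> k y \<in> j ` Q" using j(2) k(1) by blast
   have "inv_into Q j (\<xi> i x) = inv_into Q j (\<xi> k y)"
    using K(3) gQ(1)[OF xy(1)] inv_into_into[OF ky] xy(3) by (meson inj_onD)
   hence "j (inv_into Q j (\<xi> i x)) = j (inv_into Q j (\<xi> k y))" by (rule arg_cong)
   hence "\<xi> i x = \<xi> k y" by (simp only: gQ(2)[OF xy(1)] f_inv_into_f[OF ky])
   thus False using disj[OF i k(1,2)] \<open>x \<in> cball (c i) \<rho>\<close> \<open>y \<in> cball (c k) \<rho>\<close> by blast
  qed
 qed
 moreover have "a < real n * (\<rho>/4)\<^sup>2" using n \<rho> by (simp add: pos_divide_less_eq)
 moreover have "real n * (\<rho>/4)\<^sup>2 \<le> real (Suc n) * ((\<rho>/2)/2)\<^sup>2" by (simp add: mult_right_mono)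
 ultimately have "a \<le> A" by linarith
 have cW: "cbox 0 (Complex 1 1) \<subseteq> W" by (auto simp: W_def in_box_complex_iff in_cbox_complex_iff)
 have comp: "compactin X (j ` cbox 0 (Complex 1 1))"
  by (rule dens_compact(1)[OF mu(2) compact_cbox cW])
 have "J ` box 0 (Complex 1 A) \<subseteq> j ` cbox 0 (Complex 1 1)"
  using KiQ(1) box_subset_cbox unfolding J_def Q_def by blast
 thus ?thesis using that[OF \<open>a \<le> A\<close> K(1) injJ dJ comp] by blast
qed

end

section \<open>Circle-valued functions on a surface\<close>

subsection \<open>Critical values\<close>

text \<open>By the error term of the trapezoidal rule, \<open>f\<close> is Hoelder continuous with exponent 3 on its critical set.\<close>

lemma critical_cubic:
 fixes f :: "complex => real"
 assumes sm: "smooth U f" and C: "cbox a b \<subseteq> U"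
 obtains C where "0 \<le> C"
  "\<And>z w. z \<in> cbox a b ==> w \<in> cbox a b ==> (\<forall>v. dd f z v = 0) ==> (\<forall>v. dd f w v = 0) ==> \<bar>f w - f z\<bar> \<le> C * cmod (w - z) ^ 3"
proof -
 define D where "D = (\<lambda>(g :: complex => real) v x. dd g x v)"
 have sD: "smooth U (D g v)" if "smooth U g" for g v
  unfolding D_def by (rule smooth_dd[OF that])
 have Dlin: "D g v x = Re v * D g 1 x + Im v * D g \<i> x" if "smooth U g" "x \<in> U" for g v x
 proof -
  have l: "linear (dd g x)" by (rule dd_linear[OF smooth_diff[OF that]])
  have "v = Re v *\<^sub>R 1 + Im v *\<^sub>R \<i>" by (simp add: complex_eq_iff)
  hence "dd g x v = dd g x (Re v *\<^sub>R 1 + Im v *\<^sub>R \<i>)" by simp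
  thus ?thesis by (simp add: D_def linear_add[OF l] linear_scale[OF l])
 qed
 have bnd: "\<exists>M\<ge>0. \<forall>x\<in>cbox a b. \<bar>g x\<bar> \<le> M" if "smooth U g" for g :: "complex => real"
 proof -
  have "compact (g ` cbox a b)"
   by (rule compact_continuous_image[OF continuous_on_subset[OF smooth_cont[OF that] C] compact_cbox])
  then obtain M where "\<forall>y\<in>g ` cbox a b. norm y \<le> M" using compact_imp_bounded bounded_iff by metis
  thus ?thesis by (intro exI[of _ "max M 0"]) auto
 qed
 have dirb: "\<exists>M\<ge>0. \<forall>x\<in>cbox a b. \<forall>v. \<bar>D g v x\<bar> \<le> M * cmod v"
  if asm: "smooth U (D g 1)" "smooth U (D g \<i>)" "smooth U g" for g
 proof -
  obtain M1 M2 where M: "M1 \<ge> 0" "M2 \<ge> 0" "\<forall>x\<in>cbox a b. \<bar>D g 1 x\<bar> \<le> M1" "\<forall>x\<in>cbox a b. \<bar>D g \<i> x\<bar> \<le> M2"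
   using bnd[OF asm(1)] bnd[OF asm(2)] by blast
  show ?thesis
  proof (intro exI[of _ "M1 + M2"] conjI ballI allI)
   fix x v assume x: "x \<in> cbox a b"
   have "\<bar>D g v x\<bar> \<le> \<bar>Re v\<bar> * \<bar>D g 1 x\<bar> + \<bar>Im v\<bar> * \<bar>D g \<i> x\<bar>"
    using Dlin[OF asm(3), of x v] x C by (metis abs_mult abs_triangle_ineq subsetD)
   also have "\<dots> \<le> cmod v * M1 + cmod v * M2"
    using M x by (intro add_mono mult_mono abs_Re_le_cmod abs_Im_le_cmod) auto
   finally show "\<bar>D g v x\<bar> \<le> (M1 + M2) * cmod v" by (simp add: algebra_simps)
  qed (use M in auto)
 qed
 have "\<exists>M\<ge>0. \<forall>x\<in>cbox a b. \<forall>v. \<bar>D (D (D f e1) e2) v x\<bar> \<le> M * cmod v" for e1 e2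
  by (intro dirb sD sm)
 then obtain M where M: "\<And>e1 e2. M e1 e2 \<ge> 0" "\<And>e1 e2 x v. x \<in> cbox a b ==> \<bar>D (D (D f e1) e2) v x\<bar> \<le> M e1 e2 * cmod v"
  by metis
 define C' where "C' = M 1 1 + M 1 \<i> + M \<i> 1 + M \<i> \<i>"
 have third: "\<bar>D (D (D f v) v) v x\<bar> \<le> C' * cmod v ^ 3" if x: "x \<in> cbox a b" for x v
 proof -
  have e1: "D (D f v) v y = Re v * Re v * D (D f 1) 1 y + Re v * Im v * D (D f 1) \<i> y + Im v * Re v * D (D f \<i>) 1 y + Im v * Im v * D (D f \<i>) \<i> y"
   if y: "y \<in> U" for y
  proof -
   have l: "((\<lambda>x. Re v * D f 1 x + Im v * D f \<i> x) has_derivative (\<lambda>h. Re v * dd (D f 1) y h + Im v * dd (D f \<i>) y h)) (at y)"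
    by (intro has_derivative_add has_derivative_mult_right smooth_der[OF sD[OF sm] y])
   have "dd (D f v) y = dd (\<lambda>x. Re v * D f 1 x + Im v * D f \<i> x) y"
    by (rule dd_cong(1)[OF smooth_open[OF sm] y]) (rule Dlin[OF sm])
   hence "D (D f v) v y = Re v * D (D f 1) v y + Im v * D (D f \<i>) v y"
    using dd_eqI[OF l] by (simp add: D_def)
   thus ?thesis using Dlin[OF sD[OF sm] y, of 1 v] Dlin[OF sD[OF sm] y, of \<i> v] by (simp add: algebra_simps)
  qed
  have xU: "x \<in> U" using x C by auto
  have l: "((\<lambda>y. Re v * Re v * D (D f 1) 1 y + Re v * Im v * D (D f 1) \<i> y + Im v * Re v * D (D f \<i>) 1 y + Im v * Im v * D (D f \<i>) \<i> y)
    has_derivative (\<lambda>h. Re v * Re v * dd (D (D f 1) 1) x h + Re v * Im v * dd (D (D f 1) \<i>) x h + Im v * Re v * dd (D (D f \<i>) 1) x h + Im v * Im v * dd (D (D f \<i>) \<i>) x h)) (at x)"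
   by (intro has_derivative_add has_derivative_mult_right smooth_der[OF sD[OF sD[OF sm]] xU])
  have "dd (D (D f v) v) x = dd (\<lambda>y. Re v * Re v * D (D f 1) 1 y + Re v * Im v * D (D f 1) \<i> y + Im v * Re v * D (D f \<i>) 1 y + Im v * Im v * D (D f \<i>) \<i> y) x"
   by (rule dd_cong(1)[OF smooth_open[OF sm] xU]) (rule e1)
  hence eq: "D (D (D f v) v) v x = Re v * Re v * D (D (D f 1) 1) v x + Re v * Im v * D (D (D f 1) \<i>) v x + Im v * Re v * D (D (D f \<i>) 1) v x + Im v * Im v * D (D (D f \<i>) \<i>) v x"
   using dd_eqI[OF l] by (simp add: D_def)
  have t: "\<bar>s * s' * D (D (D f e1) e2) v x\<bar> \<le> cmod v * cmod v * (M e1 e2 * cmod v)"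
   if "\<bar>s\<bar> \<le> cmod v" "\<bar>s'\<bar> \<le> cmod v" for s s' e1 e2
   unfolding abs_mult using that M x by (intro mult_mono) auto
  have "\<bar>D (D (D f v) v) v x\<bar> \<le> cmod v * cmod v * (M 1 1 * cmod v) + cmod v * cmod v * (M 1 \<i> * cmod v)
    + cmod v * cmod v * (M \<i> 1 * cmod v) + cmod v * cmod v * (M \<i> \<i> * cmod v)"
   unfolding eq
   by (intro order_trans[OF abs_triangle_ineq] add_mono t abs_Re_le_cmod abs_Im_le_cmod)
  also have "\<dots> = C' * cmod v ^ 3" by (simp add: C'_def algebra_simps power3_eq_cube)
  finally show ?thesis .
 qed
 show ?thesis
 proof (rule that[of C'])
  show "0 \<le> C'" using M by (simp add: C'_def)
  fix z w assume z: "z \<in> cbox a b" and w: "w \<in> cbox a b" and cz: "\<forall>v. dd f z v = 0" and cw: "\<forall>v. dd f w v = 0"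
  define v where "v = w - z"
  have seg: "z + of_real t * v \<in> cbox a b" if "0 \<le> t" "t \<le> 1" for t
  using convex_box(1)[of a b] z w that by (auto simp: convex_alt v_def scaleR_conv_of_real algebra_simps)
  have line: "((\<lambda>t. g (z + of_real t * v)) has_real_derivative D g v (z + of_real t * v)) (at t)"
   if "smooth U g" "0 \<le> t" "t \<le> 1" for g t
   unfolding D_def by (rule has_real_derivative_line) (use smooth_diff[OF that(1)] seg[OF that(2,3)] C in blast)
  define B where "B = C' * cmod v ^ 3"
  let ?g1 = "\<lambda>t. D f v (z + of_real t * v)" and ?g2 = "\<lambda>t. D (D f v) v (z + of_real t * v)"
  have g10: "?g1 0 = 0" "?g1 1 = 0" using cz cw by (auto simp: D_def v_def)
  \<comment> \<open>By Rolle the second derivative along the segment vanishes somewhere. So the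
    bound on the third derivative bounds the second, then the first, which vanishes at the ends, and
    then the increment of f.\<close>
  have "\<exists>\<xi>. 0 < \<xi> \<and> \<xi> < 1 \<and> ?g1 1 - ?g1 0 = (1 - 0) * ?g2 \<xi>"
   by (rule MVT2) (use line[OF sD[OF sm]] in auto)
  then obtain \<xi> where xi: "0 < \<xi>" "\<xi> < 1" "?g2 \<xi> = 0" using g10 by auto
  have g2: "\<bar>?g2 t\<bar> \<le> B" if t: "0 \<le> t" "t \<le> 1" for t
  proof -
   have "norm (?g2 t - ?g2 \<xi>) \<le> B * norm (t - \<xi>)"
   proof (rule field_differentiable_bound[of "{0..1}" ?g2 "\<lambda>t. D (D (D f v) v) v (z + of_real t * v)"])
    fix s :: real assume s: "s \<in> {0..1}"
    show "(?g2 has_field_derivative D (D (D f v) v) v (z + of_real s * v)) (at s within {0..1})"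
     using line[OF sD[OF sD[OF sm]]] s by (auto intro: has_field_derivative_at_within)
    show "norm (D (D (D f v) v) v (z + of_real s * v)) \<le> B"
     unfolding B_def real_norm_def by (rule third[OF seg]) (use s in auto)
   qed (use t xi in auto)
   also have "\<dots> \<le> B * 1" using t xi \<open>0 \<le> C'\<close> by (intro mult_left_mono) (auto simp: B_def abs_if)
   finally show ?thesis using xi by simp
  qed
  have g1: "\<bar>?g1 t\<bar> \<le> B" if t: "0 \<le> t" "t \<le> 1" for t
  proof -
   have "norm (?g1 t - ?g1 0) \<le> B * norm (t - 0)"
   proof (rule field_differentiable_bound[of "{0..1}" ?g1 ?g2])
    fix s :: real assume s: "s \<in> {0..1}"
    show "(?g1 has_field_derivative ?g2 s) (at s within {0..1})"
     using line[OF sD[OF sm]] s by (auto intro: has_field_derivative_at_within)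
    show "norm (?g2 s) \<le> B" using g2 s by simp
   qed (use t in auto)
   also have "\<dots> \<le> B * 1" using t \<open>0 \<le> C'\<close> by (intro mult_left_mono) (auto simp: B_def)
   finally show ?thesis using g10 by simp
  qed
  have "norm (f (z + of_real 1 * v) - f (z + of_real 0 * v)) \<le> B * norm (1 - 0 :: real)"
  proof (rule field_differentiable_bound[of "{0..1}" "\<lambda>t. f (z + of_real t * v)" ?g1])
   fix s :: real assume s: "s \<in> {0..1}"
   show "((\<lambda>t. f (z + of_real t * v)) has_field_derivative ?g1 s) (at s within {0..1})"
    using line[OF sm] s by (auto intro: has_field_derivative_at_within)
   show "norm (?g1 s) \<le> B" using g1 s by simp
  qed auto
  thus "\<bar>f w - f z\<bar> \<le> C' * cmod (w - z) ^ 3" by (simp add: B_def v_def)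
 qed
qed

text \<open>The square is cut into n^2 cells of side s/n. By the cubic estimate the critical values
  from one cell lie in an interval of length O(n^-3), so all of them together have measure
  O(1/n).\<close>

lemma sard_square:
 fixes f :: "complex => real"
 assumes sm: "smooth U f" and C: "cbox c (c + Complex s s) \<subseteq> U" and s: "0 < s"
 shows "negligible (f ` {z \<in> cbox c (c + Complex s s). \<forall>v. dd f z v = 0})"
proof -
 define Z where "Z = {z \<in> cbox c (c + Complex s s). \<forall>v. dd f z v = 0}"
 obtain C where C0: "0 \<le> C" and C: "\<And>z w. z \<in> Z ==> w \<in> Z ==> \<bar>f w - f z\<bar> \<le> C * cmod (w - z) ^ 3"
  by (rule critical_cubic[OF sm assms(2)]) (rule that, assumption, simp add: Z_def)
 show ?thesis
  unfolding Z_def[symmetric] negligible_outer_le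
 proof (intro allI impI)
  fix e :: real assume e: "e > 0"
  \<comment> \<open>The intervals have total length n^2 times 2 C (2 s/n)^3, which is B/n.\<close>
  define B where "B = 16 * C * s ^ 3"
  obtain n :: nat where n: "B / e < real n" "n > 0"
   using reals_Archimedean2[of "max (B/e) 1"] by (metis less_nat_zero_code max_less_iff_conj not_gr_zero of_nat_0 order_less_trans zero_less_one less_irrefl)
  define \<delta> where "\<delta> = s / real n"
  have d: "\<delta> > 0" using s n by (simp add: \<delta>_def)
  define S where "S i k = {z \<in> Z. real i * \<delta> \<le> Re (z - c) \<and> Re (z - c) \<le> real (Suc i) * \<delta> \<and> real k * \<delta> \<le> Im (z - c) \<and> Im (z - c) \<le> real (Suc k) * \<delta>}" for i k
  \<comment> \<open>For a cell without critical points this value is arbitrary; nothing has to be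
    covered there.\<close>
  define y where "y i k = f (SOME z. z \<in> S i k)" for i k
  define T where "T i k = cball (y i k) (C * (2 * \<delta>) ^ 3)" for i k
  have idx: "\<exists>i<n. real i * \<delta> \<le> x \<and> x \<le> real (Suc i) * \<delta>" if "0 \<le> x" "x \<le> s" for x
  \<comment> \<open>The floor would give the right end point the index n; it belongs to the last
    cell.\<close>
  proof (cases "x = s")
   case True
   thus ?thesis using n s by (intro exI[of _ "n - 1"]) (auto simp: \<delta>_def field_simps of_nat_diff)
  next
   case False
   define i where "i = nat \<lfloor>x / \<delta>\<rfloor>"
   have x0: "0 \<le> x / \<delta>" using that d by simp
   have i: "real i \<le> x / \<delta>" "x / \<delta> \<le> real (Suc i)" using x0 by (auto simp: i_def) linarith+
   have "x / \<delta> < real n" using False that s n by (simp add: \<delta>_def field_simps)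
   hence "i < n" using i(1) by linarith
   thus ?thesis using i d by (auto simp: field_simps)
  qed
  have cov: "f ` Z \<subseteq> (\<Union>i<n. \<Union>k<n. T i k)"
  proof clarify
   fix z assume z: "z \<in> Z"
   hence zc: "0 \<le> Re (z - c)" "Re (z - c) \<le> s" "0 \<le> Im (z - c)" "Im (z - c) \<le> s"
    by (auto simp: Z_def in_cbox_complex_iff)
   obtain i k where ik: "i < n" "k < n" "z \<in> S i k" using idx[OF zc(1,2)] idx[OF zc(3,4)] z unfolding S_def by blast
   define w where "w = (SOME z. z \<in> S i k)"
   have w: "w \<in> S i k" unfolding w_def by (rule someI[of "\<lambda>z. z \<in> S i k", OF ik(3)])
   have "\<bar>Re (z - w)\<bar> \<le> \<delta>" "\<bar>Im (z - w)\<bar> \<le> \<delta>" using ik(3) w by (auto simp: S_def algebra_simps)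
   hence "cmod (z - w) \<le> 2 * \<delta>" using cmod_le[of "z - w"] by linarith
   hence "C * cmod (z - w) ^ 3 \<le> C * (2 * \<delta>) ^ 3" using C0 by (intro mult_left_mono power_mono) auto
   moreover have "\<bar>f z - f w\<bar> \<le> C * cmod (z - w) ^ 3" using C[of w z] w ik(3) by (auto simp: S_def)
   ultimately have "f z \<in> T i k" by (auto simp: T_def y_def w_def dist_real_def abs_minus_commute)
   thus "f z \<in> (\<Union>i<n. \<Union>k<n. T i k)" using ik by blast
  qed
  have mT: "T i k \<in> lmeasurable" "measure lebesgue (T i k) = 2 * (C * (2 * \<delta>) ^ 3)" for i k
  using C0 d by (auto simp: T_def cball_eq_atLeastAtMost measure_completion)
  have "measure lebesgue (\<Union>i<n. \<Union>k<n. T i k) \<le> (\<Sum>i<n. measure lebesgue (\<Union>k<n. T i k))"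
   using mT by (intro measure_UNION_le fmeasurableD fmeasurable.finite_UN) auto
  also have "\<dots> \<le> (\<Sum>i<n. \<Sum>k<n. measure lebesgue (T i k))"
   using mT by (intro sum_mono measure_UNION_le fmeasurableD) auto
  also have "\<dots> = real n * real n * (2 * (C * (2 * \<delta>) ^ 3))" by (simp add: mT)
  also have "\<dots> = B / real n" using n by (simp add: \<delta>_def B_def field_simps power3_eq_cube)
  also have "\<dots> \<le> e" using n e by (simp add: field_simps)
  finally show "\<exists>T. f ` Z \<subseteq> T \<and> T \<in> lmeasurable \<and> Sigma_Algebra.measure lebesgue T \<le> e"
   using cov mT by (intro exI[of _ "\<Union>i<n. \<Union>k<n. T i k"]) (auto intro!: fmeasurable.finite_UN)
 qed
qed

subsection \<open>Branches of the argument\<close>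

lemma cis_eq_iff: "cis a = cis b \<longleftrightarrow> (\<exists>n::int. a = b + 2 * pi * of_int n)"
using exp_eq ex_cong1 by (auto simp: cis_conv_exp complex_eq_iff algebra_simps)

text \<open>The difference is continuous with values in the multiples of 2 \<pi>, a discrete
  set.\<close>

lemma arg_difference_const:
 fixes f g :: "'b::topological_space => real"
 assumes "connected S" "continuous_on S f" "continuous_on S g" "\<And>z. z \<in> S ==> cis (f z) = cis (g z)" "p \<in> S" "z \<in> S"
 shows "f z - g z = f p - g p"
proof -
 have "(\<lambda>z. f z - g z) constant_on S"
 proof (rule continuous_discrete_range_constant[OF assms(1)])
  show "continuous_on S (\<lambda>z. f z - g z)" by (intro continuous_intros assms)
  fix x assume x: "x \<in> S"
  show "\<exists>e>0. \<forall>y. y \<in> S \<and> f y - g y \<noteq> f x - g x --> e \<le> norm (f y - g y - (f x - g x))"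
  proof (intro exI[of _ "2*pi"] conjI allI impI)
   fix y assume y: "y \<in> S \<and> f y - g y \<noteq> f x - g x"
   obtain n m :: int where nm: "f x = g x + 2 * pi * of_int n" "f y = g y + 2 * pi * of_int m"
    using assms(4) x y cis_eq_iff by metis
   have "f y - g y - (f x - g x) = 2 * pi * of_int (m - n)" using nm by (simp add: algebra_simps)
   moreover have "m \<noteq> n" using y nm by auto
   hence "1 \<le> \<bar>real_of_int (m - n)\<bar>" by linarith
   ultimately show "2 * pi \<le> norm (f y - g y - (f x - g x))"
    by (simp add: abs_mult)
  qed simp
 qed
 thus ?thesis using assms(5,6) unfolding constant_on_def by metis
qed

text \<open>Only the argument of h matters, its modulus is arbitrary. The compact set
  \<open>Kc\<close> contains every level of the argument other than that of the value 1, so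
  compactness can be used although the surface need not be compact.\<close>

locale circ = osurf +
 fixes h :: "'a => complex" and Kc :: "'a set"
 assumes h_smooth: "(U, \<xi>) \<in> P ==> smooth U (\<lambda>p. h (\<xi> p))"
  and h_nz: "x \<in> topspace X ==> h x \<noteq> 0"
  and h_compact: "compactin X Kc"
  and h_out: "x \<in> topspace X - Kc ==> h x = 1"
begin

text \<open>A relation, since the argument is multivalued; its graph is the cyclic cover.\<close>

definition isarg :: "'a => real => bool" where
 "isarg x r \<longleftrightarrow> h x = of_real (cmod (h x)) * cis r"

lemma isarg_cis: "x \<in> topspace X ==> isarg x r ==> isarg x r' \<longleftrightarrow> cis r = cis r'"
 using h_nz[of x] unfolding isarg_def
 by (metis mult_cancel_left norm_eq_zero of_real_eq_0_iff)

lemma isarg_sgn: "x \<in> topspace X ==> isarg x r \<longleftrightarrow> cis r = sgn (h x)"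
 using h_nz[of x] unfolding isarg_def sgn_eq
 by (auto simp: field_simps)

lemma isarg_ex: "\<exists>r. isarg x r"
 unfolding isarg_def using rcis_cmod_Arg[of "h x"] by (metis rcis_def)

lemma branch:
 assumes "(U, \<xi>) \<in> P" "p \<in> U" "isarg (\<xi> p) r"
 obtains R f where "0 < R" "cball p R \<subseteq> U" "smooth (ball p R) f" "f p = r" "\<And>z. z \<in> ball p R ==> isarg (\<xi> z) (f z)"
proof -
 \<comment> \<open>Normalised to be 1 at p, so that the principal logarithm is smooth
   nearby.\<close>
 define g where "g = (\<lambda>z. h (\<xi> z) / h (\<xi> p))"
 have np: "h (\<xi> z) \<noteq> 0" if "z \<in> U" for z by (rule h_nz[OF par_in[OF assms(1) that]])
 have sg: "smooth U g" unfolding g_def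
  using np[OF assms(2)] by (intro smooth_divide h_smooth[OF assms(1)] smooth_const par_open[OF assms(1)])
 have "isCont g p"
  using smooth_cont[OF sg] par_open[OF assms(1)] assms(2) continuous_on_eq_continuous_at by blast
 then obtain d where d: "d > 0" "\<And>z. dist z p < d ==> dist (g z) (g p) < 1"
  unfolding continuous_at_eps_delta by (metis zero_less_one)
 have gp: "g p = 1" using np[OF assms(2)] by (simp add: g_def)
 obtain R0 where R0: "R0 > 0" "cball p R0 \<subseteq> U" using par_open[OF assms(1)] assms(2) open_contains_cball by blast
 define R where "R = min R0 d"
 have R: "R > 0" "cball p R \<subseteq> U" using R0 d by (auto simp: R_def)
 have bU: "ball p R \<subseteq> U" using R(2) by auto
 have slit: "g z \<notin> \<real>\<^sub>\<le>\<^sub>0" if "z \<in> ball p R" for z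
 proof -
  have "dist (g z) 1 < 1" using d(2)[of z] that gp by (auto simp: R_def dist_commute)
  hence "\<bar>Re (g z) - 1\<bar> < 1" using abs_Re_le_cmod[of "g z - 1"] by (simp add: dist_norm)
  thus ?thesis by (auto simp: complex_nonpos_Reals_iff)
 qed
 define f where "f = (\<lambda>z. r + Im (Ln (g z)))"
 have "smooth (ball p R) f" unfolding f_def
  by (intro smooth_add smooth_const smooth_Im smooth_Ln smooth_subset[OF sg] open_ball bU slit)
 moreover have "f p = r" by (simp add: f_def gp)
 moreover have "isarg (\<xi> z) (f z)" if "z \<in> ball p R" for z
 proof -
  have gz: "g z \<noteq> 0" using slit[OF that] by auto
  have "g z = of_real (cmod (g z)) * cis (Im (Ln (g z)))"
   using gz by (metis Arg_eq_Im_Ln rcis_cmod_Arg rcis_def)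
  hence "h (\<xi> z) = of_real (cmod (g z)) * cis (Im (Ln (g z))) * h (\<xi> p)"
   using np[OF assms(2)] by (simp add: g_def)
  also have "\<dots> = of_real (cmod (g z) * cmod (h (\<xi> p))) * cis (f z)"
   using assms(3) unfolding isarg_def f_def by (simp add: cis_mult[symmetric])
  also have "cmod (g z) * cmod (h (\<xi> p)) = cmod (h (\<xi> z))" using np[OF assms(2)] by (simp add: g_def norm_divide)
  finally show ?thesis by (simp add: isarg_def)
 qed
 ultimately show ?thesis using that R by blast
qed

lemma h_cont: "continuous_map X euclidean h"
 unfolding continuous_map_def
proof (intro conjI allI impI)
 fix O' :: "complex set" assume O': "openin euclidean O'"
 show "openin X {x \<in> topspace X. h x \<in> O'}"
 proof (subst openin_subopen, rule ballI)
  fix x assume x: "x \<in> {x \<in> topspace X. h x \<in> O'}"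
  then obtain U \<xi> p where U: "(U, \<xi>) \<in> P" "p \<in> U" "x = \<xi> p" using cover by blast
  have "open (U \<inter> (\<lambda>p. h (\<xi> p)) -` O')"
   using continuous_open_preimage[OF smooth_cont[OF h_smooth[OF U(1)]] par_open[OF U(1)]] O' by simp
  hence "openin X (\<xi> ` (U \<inter> (\<lambda>p. h (\<xi> p)) -` O'))" by (rule par_openmap[OF U(1)]) auto
  moreover have "x \<in> \<xi> ` (U \<inter> (\<lambda>p. h (\<xi> p)) -` O')" using U x by auto
  moreover have "\<xi> ` (U \<inter> (\<lambda>p. h (\<xi> p)) -` O') \<subseteq> {x \<in> topspace X. h x \<in> O'}"
   using par_in[OF U(1)] by auto
  ultimately show "\<exists>T. openin X T \<and> x \<in> T \<and> T \<subseteq> {x \<in> topspace X. h x \<in> O'}" by blast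
 qed
qed auto

text \<open>A flow box: area-preserving coordinates around the level \<theta> whose imaginary part
  is an argument of h. In them the Hamiltonian flow of a function of the argument moves points
  horizontally. The bound \<open>r \<le> 1\<close> keeps the imaginary parts less than 2 \<pi>
  apart.\<close>

definition fbox :: "real => real => (complex => 'a) => bool" where
 "fbox \<theta> r \<beta> \<longleftrightarrow> 0 < r \<and> r \<le> 1 \<and> dens (ball (Complex 0 \<theta>) r) \<beta> (\<lambda>_. 1) \<and> inj_on \<beta> (ball (Complex 0 \<theta>) r) \<and>
   (\<forall>w\<in>ball (Complex 0 \<theta>) r. isarg (\<beta> w) (Im w))"

text \<open>Sard's theorem on finitely many squares covering \<open>Kc\<close> leaves a \<theta>
  that is a regular value of the argument. At each point of this level \<open>darboux_box\<close>,
  with a branch of the argument as H and constant density, gives the box.\<close>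

lemma regular_boxes:
 obtains \<theta> where "cis \<theta> \<noteq> 1" "\<And>x. x \<in> topspace X ==> isarg x \<theta> ==> \<exists>r \<beta>. fbox \<theta> r \<beta> \<and> \<beta> (Complex 0 \<theta>) = x"
proof -
 define good where "good = (\<lambda>(V, \<xi>, c, s, U, f). (V, \<xi>) \<in> P \<and> 0 < (s::real) \<and> cbox c (c + Complex s s) \<subseteq> U \<and> U \<subseteq> V \<and> smooth U f \<and>
   (\<forall>z\<in>U. isarg (\<xi> z) (f z)))"
 define img where "img = (\<lambda>(V :: complex set, \<xi> :: complex => 'a, c, s, U :: complex set, f :: complex => real). \<xi> ` box c (c + Complex s s))"
 have ex: "\<exists>t. good t \<and> x \<in> img t" if x: "x \<in> topspace X" for x
 proof -
  obtain V \<xi> p where V: "(V, \<xi>) \<in> P" "p \<in> V" "x = \<xi> p" using cover[OF x] by blast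
  obtain r where "isarg (\<xi> p) r" using isarg_ex by blast
  from branch[OF V(1,2) this] obtain R f where R: "0 < R" "cball p R \<subseteq> V" "smooth (ball p R) f" "\<And>z. z \<in> ball p R ==> isarg (\<xi> z) (f z)"
   by metis
  define s where "s = R"
  define c where "c = p - Complex (s/2) (s/2)"
  have sub: "cbox c (c + Complex s s) \<subseteq> ball p R"
  proof
   fix z assume "z \<in> cbox c (c + Complex s s)"
   hence "\<bar>Re (z - p)\<bar> \<le> R/2" "\<bar>Im (z - p)\<bar> \<le> R/2" by (auto simp: c_def s_def in_cbox_complex_iff abs_if)
   hence "(cmod (z - p))\<^sup>2 \<le> (R/2)\<^sup>2 + (R/2)\<^sup>2"
    unfolding cmod_power2 by (intro add_mono) (metis power2_abs power_mono abs_ge_zero)+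
   also have "\<dots> < R\<^sup>2" using R(1) by (simp add: power2_eq_square)
   finally have "cmod (z - p) < R" using R(1) by (meson less_le power_less_imp_less_base)
   thus "z \<in> ball p R" by (simp add: dist_norm norm_minus_commute)
  qed
  have bV: "ball p R \<subseteq> V" using R(2) by auto
  have "good (V, \<xi>, c, s, ball p R, f)" unfolding good_def using V R sub bV by (auto simp: s_def)
  moreover have "x \<in> img (V, \<xi>, c, s, ball p R, f)"
  using R(1) V(3) by (auto simp: c_def s_def in_box_complex_iff img_def)
  ultimately show ?thesis by blast
 qed
 have opn: "openin X (img t)" if "good t" for t
 proof -
  obtain V \<xi> c s U f where t: "t = (V, \<xi>, c, s, U, f)" by (cases t) auto
  have "box c (c + Complex s s) \<subseteq> V" using that box_subset_cbox[of c "c + Complex s s"] unfolding t good_def by auto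
  thus ?thesis using that unfolding t good_def img_def by (auto intro!: par_openmap open_box)
 qed
 have KX: "Kc \<subseteq> topspace X" using h_compact compactin_subset_topspace by blast
 have "\<exists>\<F>. finite \<F> \<and> \<F> \<subseteq> img ` Collect good \<and> Kc \<subseteq> \<Union>\<F>"
 proof (rule compactinD[OF h_compact])
  show "openin X W" if "W \<in> img ` Collect good" for W using that opn by blast
  show "Kc \<subseteq> \<Union> (img ` Collect good)" using ex KX by blast
 qed
 then obtain T where T: "finite T" "T \<subseteq> Collect good" "Kc \<subseteq> \<Union>(img ` T)"
  by (metis finite_subset_image)
 define crit where "crit = (\<lambda>(V :: complex set, \<xi> :: complex => 'a, c, s, U :: complex set, f :: complex => real). f ` {z \<in> cbox c (c + Complex s s). \<forall>v. dd f z v = 0})"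
 have neg: "negligible (crit t)" if "t \<in> T" for t
 proof -
  obtain V \<xi> c s U f where t: "t = (V, \<xi>, c, s, U, f)" by (cases t) auto
  hence "smooth U f" "cbox c (c + Complex s s) \<subseteq> U" "0 < s" using that T(2) by (auto simp: good_def)
  from sard_square[OF this] show ?thesis by (simp add: t crit_def)
 qed
 \<comment> \<open>The translates by multiples of 2 \<pi> take care of the branches other than the
   chosen ones.\<close>
 define N where "N = (\<Union>n::int. \<Union>t\<in>T. (+) (2 * pi * of_int n) ` crit t)"
 have "negligible N" unfolding N_def
  using neg T(1) by (intro negligible_countable_Union) (auto intro!: negligible_Union negligible_translation)
 \<comment> \<open>On this interval the sine is positive, so cis \<theta> differs from 1, the value
   of h off \<open>Kc\<close>.\<close>
 moreover have "\<not> negligible {1<..<2::real}" using open_not_negligible[of "{1<..<2::real}"] by auto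
 ultimately obtain \<theta> where th: "1 < \<theta>" "\<theta> < 2" "\<theta> \<notin> N" using negligible_subset by (metis greaterThanLessThan_iff subsetI)
 have c1: "cis \<theta> \<noteq> 1"
 proof
  assume "cis \<theta> = 1"
  hence "sin \<theta> = 0" by (simp add: complex_eq_iff)
  moreover have "sin \<theta> > 0" using th pi_gt3 by (intro sin_gt_zero) auto
  ultimately show False by simp
 qed
 have "\<exists>r \<beta>. fbox \<theta> r \<beta> \<and> \<beta> (Complex 0 \<theta>) = x" if x: "x \<in> topspace X" and a: "isarg x \<theta>" for x
 proof -
  have "x \<in> Kc"
  using h_out x a c1 by (fastforce simp: isarg_def)
  then obtain t where t: "t \<in> T" "x \<in> img t" using T(3) by blast
  obtain V \<xi> c s U f where tt: "t = (V, \<xi>, c, s, U, f)" by (cases t) auto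
  hence g: "(V, \<xi>) \<in> P" "0 < s" "cbox c (c + Complex s s) \<subseteq> U" "U \<subseteq> V" "smooth U f" "\<forall>z\<in>U. isarg (\<xi> z) (f z)"
   using t T(2) by (auto simp: good_def)
  obtain p where p: "p \<in> cbox c (c + Complex s s)" "x = \<xi> p"
   using t(2) box_subset_cbox unfolding tt img_def by auto
  have pU: "p \<in> U" using p g by auto
  have "cis (f p) = cis \<theta>" using isarg_cis[OF x a] g(6) pU p by auto
  then obtain n :: int where n: "\<theta> = f p + 2 * pi * of_int n" using cis_eq_iff by metis
  have "\<exists>v. dd f p v \<noteq> 0"
  using p t(1) n th by (fastforce simp: N_def tt crit_def image_iff)
  then obtain v where v: "dd f p v \<noteq> 0" by blast
  define H where "H = (\<lambda>z. f z + 2 * pi * of_int n)"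
  have oU: "open U" using smooth_open g(5) by auto
  have sH: "smooth U H" unfolding H_def by (intro smooth_add g(5) smooth_const oU)
  have "dd H p v = dd f p v"
  proof -
   have "(H has_derivative (\<lambda>h. dd f p h + 0)) (at p)" unfolding H_def
    by (intro has_derivative_add has_derivative_const smooth_der[OF g(5) pU])
   from dd_eqI[OF this] show ?thesis by simp
  qed
  hence reg: "dd H p v \<noteq> 0" using v by simp
  have Hp: "H p = \<theta>" using n by (simp add: H_def)
  obtain r \<xi>0 where k: "0 < r" "smooth (ball (Complex 0 \<theta>) r) \<xi>0" "inj_on \<xi>0 (ball (Complex 0 \<theta>) r)"
   "\<xi>0 (Complex 0 \<theta>) = p" "\<xi>0 ` ball (Complex 0 \<theta>) r \<subseteq> U"
   "\<And>w. w \<in> ball (Complex 0 \<theta>) r ==> H (\<xi>0 w) = Im w \<and> 1 * jac \<xi>0 w = 1"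
   using darboux_box[OF smooth_const[OF oU, of 1] sH pU _ reg] unfolding Hp by (metis zero_less_one)
  define r' where "r' = min r 1"
  have sub: "ball (Complex 0 \<theta>) r' \<subseteq> ball (Complex 0 \<theta>) r" by (auto simp: r'_def)
  have k0U: "\<xi>0 ` ball (Complex 0 \<theta>) r' \<subseteq> V" using k(5) sub g(4) by blast
  have "dens (ball (Complex 0 \<theta>) r') (\<lambda>w. \<xi> (\<xi>0 w)) (\<lambda>w. 1 * jac \<xi>0 w)"
   by (rule dens_compose[OF dens_par[OF g(1)] smooth_subset[OF k(2) open_ball sub] k0U])
  hence d1: "dens (ball (Complex 0 \<theta>) r') (\<lambda>w. \<xi> (\<xi>0 w)) (\<lambda>_. 1)"
   by (rule dens_cong) (use k(6) sub in auto)
  have inj: "inj_on (\<lambda>w. \<xi> (\<xi>0 w)) (ball (Complex 0 \<theta>) r')"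
  proof (rule inj_onI)
   fix w w' assume w: "w \<in> ball (Complex 0 \<theta>) r'" "w' \<in> ball (Complex 0 \<theta>) r'" "\<xi> (\<xi>0 w) = \<xi> (\<xi>0 w')"
   hence "\<xi>0 w = \<xi>0 w'" using par_inj[OF g(1)] k0U by (meson image_subset_iff inj_onD)
   thus "w = w'" using k(3) w sub by (meson inj_onD subsetD)
  qed
  have "isarg (\<xi> (\<xi>0 w)) (Im w)" if w: "w \<in> ball (Complex 0 \<theta>) r'" for w
  proof -
   have wU: "\<xi>0 w \<in> U" using k(5) w sub by blast
   have "isarg (\<xi> (\<xi>0 w)) (f (\<xi>0 w))" using g(6) wU by blast
   moreover have "cis (f (\<xi>0 w)) = cis (Im w)"
    unfolding cis_eq_iff using k(6)[of w] w sub by (intro exI[of _ "-n"]) (auto simp: H_def)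
   moreover have "\<xi> (\<xi>0 w) \<in> topspace X" using par_in[OF g(1)] wU g(4) by blast
   ultimately show ?thesis using isarg_cis by blast
  qed
  hence "fbox \<theta> r' (\<lambda>w. \<xi> (\<xi>0 w))" unfolding fbox_def using d1 inj k(1) by (auto simp: r'_def)
  thus ?thesis using k(4) p(2) by blast
 qed
 thus ?thesis using that c1 by blast
qed

end

section \<open>Pairs of a map to the surface and a map to the plane\<close>

context osurf begin

text \<open>The map (Q, W) into the product of the surface and \<complex> pulls the product form
  back to the constant form \<Omega>. The local lifts may go through any injective area-preserving
  \<beta>, in particular through flow boxes, and not only through members of
  \<open>P\<close>.\<close>

definition ssymp :: "('e::euclidean_space => 'e => real) => 'e set => ('e => 'a) => ('e => complex) => bool" where
 "ssymp \<Omega> E Q W \<longleftrightarrow> (\<forall>z\<in>E. \<exists>\<beta> V l N. inj_on \<beta> V \<and> dens V \<beta> (\<lambda>_. 1) \<and> z \<in> N \<and> N \<subseteq> E \<and> smooth N l \<and> l ` N \<subseteq> V \<and>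
   smooth N W \<and> (\<forall>x\<in>N. Q x = \<beta> (l x) \<and>
    (\<forall>u v. area_form (dd l x u) (dd l x v) + area_form (dd W x u) (dd W x v) = \<Omega> u v)))"

lemma ssympE:
 assumes "ssymp \<Omega> E Q W" "z \<in> E"
 obtains \<beta> V l N where "inj_on \<beta> V" "dens V \<beta> (\<lambda>_. 1)" "z \<in> N" "N \<subseteq> E" "smooth N l" "l ` N \<subseteq> V" "smooth N W"
  "\<And>x. x \<in> N ==> Q x = \<beta> (l x)"
  "\<And>x u v. x \<in> N ==> area_form (dd l x u) (dd l x v) + area_form (dd W x u) (dd W x v) = \<Omega> u v"
using assms(1)[unfolded ssymp_def, THEN bspec, OF assms(2)] that that[of \<beta> V N l] by auto

lemma ssymp_lift:
 assumes S: "ssymp \<Omega> E Q W" "z \<in> E" and b: "inj_on \<beta>' V'" "dens V' \<beta>' (\<lambda>_. 1)" "Q z \<in> \<beta>' ` V'"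
 obtains l N where "z \<in> N" "N \<subseteq> E" "smooth N l" "l ` N \<subseteq> V'" "smooth N W"
  "\<And>x. x \<in> N ==> Q x = \<beta>' (l x)"
  "\<And>x u v. x \<in> N ==> area_form (dd l x u) (dd l x v) + area_form (dd W x u) (dd W x v) = \<Omega> u v"
proof -
 obtain \<beta> V l N where l: "inj_on \<beta> V" "dens V \<beta> (\<lambda>_. 1)" "z \<in> N" "N \<subseteq> E" "smooth N l" "l ` N \<subseteq> V" "smooth N W"
  "\<And>x. x \<in> N ==> Q x = \<beta> (l x)"
  "\<And>x u v. x \<in> N ==> area_form (dd l x u) (dd l x v) + area_form (dd W x u) (dd W x v) = \<Omega> u v"
  by (rule ssympE[OF S]) (rule that)
 have "openin X (\<beta>' ` V')" by (rule dens_openmap[OF b(2)]) (auto intro: dens_open[OF b(2)])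
 define M where "M = {v \<in> V. \<beta> v \<in> \<beta>' ` V'}"
 have oM: "open M" unfolding M_def by (rule dens_vimage[OF l(2)]) fact
 have dM: "dens M \<beta> (\<lambda>_. 1)" by (rule dens_subset[OF l(2) oM]) (auto simp: M_def)
 have bM: "\<beta> ` M \<subseteq> \<beta>' ` V'" by (auto simp: M_def)
 define t where "t = (\<lambda>v. inv_into V' \<beta>' (\<beta> v))"
 have st: "smooth M t" unfolding t_def by (rule emb_transition(1)[OF b(1,2) _ dM bM]) simp
 have jt: "jac t v = 1" if "v \<in> M" for v unfolding t_def using emb_transition(2)[OF b(1,2) _ dM bM that] by simp
 have tV: "t v \<in> V'" "\<beta>' (t v) = \<beta> v" if "v \<in> M" for v
  using bM that by (auto simp: t_def inv_into_into f_inv_into_f)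
 define N' where "N' = N \<inter> l -` M"
 have oN': "open N'" unfolding N'_def by (rule smooth_vimage[OF l(5) oM])
 have N'N: "N' \<subseteq> N" by (auto simp: N'_def)
 have sl: "smooth N' l" by (rule smooth_subset[OF l(5) oN' N'N])
 have lM: "l ` N' \<subseteq> M" by (auto simp: N'_def)
 show ?thesis
 proof (rule that[of N' "\<lambda>x. t (l x)"])
  show "z \<in> N'" using l(3,6) l(8)[OF l(3)] b(3) by (auto simp: N'_def M_def)
  show "N' \<subseteq> E" using N'N l(4) by blast
  show "smooth N' (\<lambda>x. t (l x))" by (rule smooth_compose[OF st sl lM])
  show "(\<lambda>x. t (l x)) ` N' \<subseteq> V'" using tV lM by blast
  show "smooth N' W" by (rule smooth_subset[OF l(7) oN' N'N])
  fix x assume x: "x \<in> N'"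
  have lx: "l x \<in> M" using x lM by blast
  show "Q x = \<beta>' (t (l x))" using tV(2)[OF lx] l(8)[of x] x N'N by auto
  fix u v
  have "dd (\<lambda>x. t (l x)) x = (\<lambda>v. dd t (l x) (dd l x v))"
   using dd_compose(2)[OF smooth_diff[OF sl x] smooth_diff[OF st lx]] by (simp add: o_def)
  thus "area_form (dd (\<lambda>x. t (l x)) x u) (dd (\<lambda>x. t (l x)) x v) + area_form (dd W x u) (dd W x v) = \<Omega> u v"
   using area_form_dd[OF smooth_diff[OF st lx]] jt[OF lx] l(9)[of x u v] x N'N by auto
 qed
qed

end

context circ begin

subsection \<open>The flow along the level sets\<close>

lemma fbox_dens: "fbox \<theta> r \<beta> ==> dens (ball (Complex 0 \<theta>) r) \<beta> (\<lambda>_. 1)"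
 and fbox_inj: "fbox \<theta> r \<beta> ==> inj_on \<beta> (ball (Complex 0 \<theta>) r)"
 and fbox_arg: "fbox \<theta> r \<beta> ==> w \<in> ball (Complex 0 \<theta>) r ==> isarg (\<beta> w) (Im w)"
 and fbox_r: "fbox \<theta> r \<beta> ==> 0 < r \<and> r \<le> 1"
 by (auto simp: fbox_def)

lemma fbox_in: "fbox \<theta> r \<beta> ==> w \<in> ball (Complex 0 \<theta>) r ==> \<beta> w \<in> topspace X"
 using dens_in[OF fbox_dens] by blast

text \<open>The imaginary parts differ by a multiple of 2 \<pi> and by less than 2.\<close>

lemma fbox_Im_eq:
 assumes "fbox \<theta> r \<beta>" "fbox \<theta> r' \<beta>'" "w \<in> ball (Complex 0 \<theta>) r" "w' \<in> ball (Complex 0 \<theta>) r'" "\<beta> w = \<beta>' w'"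
 shows "Im w = Im w'"
proof -
 have "cis (Im w) = cis (Im w')"
  using isarg_cis[OF fbox_in[OF assms(1,3)] fbox_arg[OF assms(1,3)]] fbox_arg[OF assms(2,4)] assms(5) by auto
 then obtain n :: int where n: "Im w = Im w' + 2 * pi * of_int n" using cis_eq_iff by metis
 have "\<bar>Im w - \<theta>\<bar> < 1" "\<bar>Im w' - \<theta>\<bar> < 1"
  using abs_Im_le_cmod[of "w - Complex 0 \<theta>"] abs_Im_le_cmod[of "w' - Complex 0 \<theta>"] assms fbox_r[OF assms(1)] fbox_r[OF assms(2)]
  by (auto simp: dist_norm norm_minus_commute)
 hence "\<bar>2 * pi * of_int n\<bar> < 2" using n by linarith
 hence "2 * pi * \<bar>real_of_int n\<bar> < 2" by (simp add: abs_mult)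
 moreover have "6 * \<bar>real_of_int n\<bar> \<le> 2 * pi * \<bar>real_of_int n\<bar>" using pi_gt3 by (intro mult_right_mono) auto
 ultimately have "\<bar>real_of_int n\<bar> < 1" by linarith
 hence "n = 0" by linarith
 thus ?thesis using n by simp
qed

text \<open>The transition between two boxes preserves area and imaginary part, so the derivative of
  its real part in the real direction is 1, and locally it commutes with horizontal translations.
  Hence the times at which the two translates agree form an open subset of the segment; it is closed
  because the space is Hausdorff.\<close>

lemma flow_agree:
 assumes b: "fbox \<theta> r \<beta>" "fbox \<theta> r' \<beta>'" and eq: "\<beta> w = \<beta>' w'"
  and seg: "\<And>s. s \<in> closed_segment 0 T ==> w + of_real s \<in> ball (Complex 0 \<theta>) r"
   "\<And>s. s \<in> closed_segment 0 T ==> w' + of_real s \<in> ball (Complex 0 \<theta>) r'"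
 shows "\<beta> (w + of_real T) = \<beta>' (w' + of_real T)"
proof -
 let ?I = "closed_segment 0 T" and ?B = "ball (Complex 0 \<theta>) r" and ?B' = "ball (Complex 0 \<theta>) r'"
 define S where "S = {s \<in> ?I. \<beta> (w + of_real s) = \<beta>' (w' + of_real s)}"
 have cw: "continuous_on ?I (\<lambda>s. w + complex_of_real s)" "continuous_on ?I (\<lambda>s. w' + complex_of_real s)"
  by (intro continuous_intros)+
 have c1: "continuous_map (top_of_set ?I) X (\<lambda>s. \<beta> (w + of_real s))"
  using continuous_map_compose[OF _ dens_cont[OF fbox_dens[OF b(1)]], of "top_of_set ?I" "\<lambda>s. w + of_real s"] seg(1) cw
  by (simp add: o_def continuous_map_in_subtopology image_subset_iff)
 have c2: "continuous_map (top_of_set ?I) X (\<lambda>s. \<beta>' (w' + of_real s))"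
  using continuous_map_compose[OF _ dens_cont[OF fbox_dens[OF b(2)]], of "top_of_set ?I" "\<lambda>s. w' + of_real s"] seg(2) cw
  by (simp add: o_def continuous_map_in_subtopology image_subset_iff)
 have "closedin (top_of_set ?I) S"
  using closedin_continuous_maps_eq[OF haus c1 c2] by (simp add: S_def)
 moreover have "openin (top_of_set ?I) S"
  unfolding openin_euclidean_subtopology_iff
 proof (intro conjI ballI)
  show "S \<subseteq> ?I" by (auto simp: S_def)
  fix s assume s: "s \<in> S"
  define v0 where "v0 = w + of_real s"
  define v0' where "v0' = w' + of_real s"
  have v0: "v0 \<in> ?B" "v0' \<in> ?B'" "\<beta> v0 = \<beta>' v0'" using s seg by (auto simp: S_def v0_def v0'_def)
  have oi: "openin X (\<beta>' ` ?B')" by (rule dens_openmap[OF fbox_dens[OF b(2)]]) auto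
  define M where "M = {v \<in> ?B. \<beta> v \<in> \<beta>' ` ?B'}"
  have oM: "open M" unfolding M_def by (rule dens_vimage[OF fbox_dens[OF b(1)] oi])
  have dM: "dens M \<beta> (\<lambda>_. 1)" by (rule dens_subset[OF fbox_dens[OF b(1)] oM]) (auto simp: M_def)
  have bM: "\<beta> ` M \<subseteq> \<beta>' ` ?B'" by (auto simp: M_def)
  define t where "t = (\<lambda>v. inv_into ?B' \<beta>' (\<beta> v))"
  have st: "smooth M t" unfolding t_def
   by (rule emb_transition(1)[OF fbox_inj[OF b(2)] fbox_dens[OF b(2)] _ dM bM]) simp
  have jt: "jac t v = 1" if "v \<in> M" for v unfolding t_def
   using emb_transition(2)[OF fbox_inj[OF b(2)] fbox_dens[OF b(2)] _ dM bM that] by simp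
  have tV: "t v \<in> ?B'" "\<beta>' (t v) = \<beta> v" if "v \<in> M" for v
   using inv_into_into[of "\<beta> v" \<beta>' ?B'] f_inv_into_f[of "\<beta> v" \<beta>' ?B'] bM that unfolding t_def by blast+
  have tI: "Im (t v) = Im v" if "v \<in> M" for v
   using fbox_Im_eq[OF b(1,2), of v "t v"] tV[OF that] that by (auto simp: M_def)
  have vM: "v0 \<in> M" using v0 by (auto simp: M_def)
  have t0: "t v0 = v0'"
   by (rule inj_onD[OF fbox_inj[OF b(2)] _ tV(1)[OF vM] v0(2)]) (simp add: tV(2)[OF vM] v0(3))
  obtain d where d: "d > 0" "ball v0 d \<subseteq> M" using oM vM openE by blast
  define a where "a = (\<lambda>v. Re (t v))"
  have sa: "smooth M a" unfolding a_def by (rule smooth_Re[OF st])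
  have da: "dd a v 1 = 1" if "v \<in> M" for v
  proof -
   have "jac t v = jac (\<lambda>v. Complex (a v) (Im v)) v"
    by (rule jac_cong[OF oM that]) (simp add: a_def tI complex_eq_iff)
   thus ?thesis using jac_graph(2)[OF sa that] jt[OF that] by simp
  qed
  have fl: "a (v0 + of_real e) = Re v0' + e" if e: "\<bar>e\<bar> < d" for e
  proof -
   have D: "((\<lambda>x. a (v0 + of_real x * 1) - x) has_real_derivative 0) (at x within {-d<..<d})" if "x \<in> {-d<..<d}" for x
   proof -
    have xM: "v0 + of_real x * 1 \<in> M" using d that by (auto simp: dist_norm)
    have "((\<lambda>x. a (v0 + of_real x * 1)) has_real_derivative 1) (at x)"
     using has_real_derivative_line[of a v0 x 1] smooth_diff[OF sa xM] da[OF xM] by simp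
    hence "((\<lambda>x. a (v0 + of_real x * 1) - x) has_real_derivative 1 - 1) (at x)"
     by (intro DERIV_diff DERIV_ident)
    thus ?thesis by (simp add: has_field_derivative_at_within)
   qed
   have "\<exists>c. \<forall>x\<in>{-d<..<d}. a (v0 + of_real x * 1) - x = c"
    by (rule has_field_derivative_zero_constant) (use D in auto)
   then obtain c where c: "\<And>x. x \<in> {-d<..<d} ==> a (v0 + of_real x * 1) - x = c" by blast
   have "a v0 = c" using c[of 0] d by simp
   moreover have "e \<in> {-d<..<d}" using e by auto
   ultimately show ?thesis using c[of e] t0 by (simp add: a_def)
  qed
  show "\<exists>e>0. \<forall>x'\<in>?I. dist x' s < e --> x' \<in> S"
  proof (intro exI[of _ d] conjI ballI impI)
   fix s' assume s': "s' \<in> ?I" "dist s' s < d"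
   define e where "e = s' - s"
   have e: "\<bar>e\<bar> < d" using s' by (simp add: e_def dist_real_def)
   have eM: "v0 + of_real e \<in> M" using d e by (auto simp: dist_norm)
   have "t (v0 + of_real e) = v0' + of_real e"
    using fl[OF e] tI[OF eM] tI[OF vM] t0 by (simp add: a_def complex_eq_iff)
   hence "\<beta> (v0 + of_real e) = \<beta>' (v0' + of_real e)" using tV(2)[OF eM] by simp
   thus "s' \<in> S" using s' by (simp add: S_def v0_def v0'_def e_def)
  qed (use d in auto)
 qed
 moreover have "0 \<in> S" using eq by (simp add: S_def)
 ultimately have "S = ?I" using connected_clopen[of ?I] by auto
 hence "T \<in> S" by simp
 thus ?thesis by (simp add: S_def)
qed

text \<open>Finitely many quarter boxes cover the compact level \<theta> and then, by compactness of
  the rest of \<open>Kc\<close>, all points whose argument is close to \<theta>. Finiteness gives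
  one \<sigma> by which points can be translated in every box.\<close>

lemma flow_data:
 obtains \<theta> Bx \<sigma> \<eta> where "finite Bx" "\<And>r \<beta>. (r, \<beta>) \<in> Bx ==> fbox \<theta> r \<beta> \<and> 8 * \<sigma> \<le> r" "0 < \<sigma>" "0 < \<eta>"
  "\<And>x. x \<in> topspace X ==> cmod (sgn (h x) - cis \<theta>) < \<eta> ==>
    \<exists>r \<beta> w. (r, \<beta>) \<in> Bx \<and> \<bar>Re w\<bar> < r/4 \<and> \<bar>Im w - \<theta>\<bar> < r/4 \<and> \<beta> w = x"
proof -
 obtain \<theta> where th: "cis \<theta> \<noteq> 1" "\<And>x. x \<in> topspace X ==> isarg x \<theta> ==> \<exists>r \<beta>. fbox \<theta> r \<beta> \<and> \<beta> (Complex 0 \<theta>) = x"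
  using regular_boxes by metis
 define sm where "sm r = {w. \<bar>Re w\<bar> < r/4 \<and> \<bar>Im w - \<theta>\<bar> < r/4}" for r
 have smo: "open (sm r)" for r unfolding sm_def
  by (intro open_Collect_conj open_Collect_less continuous_intros)
 have smb: "sm r \<subseteq> ball (Complex 0 \<theta>) r" if "0 < r" for r
 proof
  fix w assume "w \<in> sm r"
  hence "cmod (w - Complex 0 \<theta>) < r" using cmod_le[of "w - Complex 0 \<theta>"] that by (auto simp: sm_def)
  thus "w \<in> ball (Complex 0 \<theta>) r" by (simp add: dist_norm norm_minus_commute)
 qed
 define img where "img = (\<lambda>(r, \<beta> :: complex => 'a). \<beta> ` sm r)"
 define good where "good = {(r, \<beta>). fbox \<theta> r \<beta>}"
 have op: "openin X (img t)" if "t \<in> good" for t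
  using that smb fbox_r unfolding good_def img_def
  by (auto intro!: dens_openmap[OF fbox_dens] smo simp: split_beta)
 have cs: "continuous_map X euclidean (\<lambda>x. sgn (h x))"
 proof -
  have "continuous_map X (top_of_set (-{0})) h"
   using h_cont h_nz by (auto simp: continuous_map_in_subtopology)
  moreover have "continuous_map (top_of_set (-{0})) euclidean (sgn :: complex => complex)"
   unfolding continuous_map_iff_continuous by (auto simp: sgn_div_norm intro!: continuous_intros)
  ultimately show ?thesis using continuous_map_compose[of X "top_of_set (-{0})" h euclidean sgn] by (simp add: o_def)
 qed
 have cd: "continuous_map X euclideanreal (\<lambda>x. cmod (sgn (h x) - cis \<theta>))"
 proof -
  have "continuous_on UNIV (\<lambda>z. cmod (z - cis \<theta>))" by (intro continuous_intros)
  hence "continuous_map euclidean euclideanreal (\<lambda>z. cmod (z - cis \<theta>))" by simp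
  from continuous_map_compose[OF cs this] show ?thesis by (simp add: o_def)
 qed
 define L where "L = Kc \<inter> {x \<in> topspace X. sgn (h x) = cis \<theta>}"
 have KX: "Kc \<subseteq> topspace X" using h_compact compactin_subset_topspace by blast
 have "closedin X {x \<in> topspace X. sgn (h x) \<in> {cis \<theta>}}"
  by (rule closedin_continuous_map_preimage[OF cs]) simp
 moreover have "{x \<in> topspace X. sgn (h x) \<in> {cis \<theta>}} \<inter> Kc = L" by (auto simp: L_def)
 ultimately have "compactin X L" using closed_Int_compactin[OF _ h_compact] by metis
 moreover have "L \<subseteq> \<Union>(img ` good)"
 proof
  fix x assume x: "x \<in> L"
  hence "isarg x \<theta>" using isarg_sgn by (auto simp: L_def)
  then obtain r \<beta> where rb: "fbox \<theta> r \<beta>" "\<beta> (Complex 0 \<theta>) = x" using th(2)[of x] x unfolding L_def by blast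
  have "Complex 0 \<theta> \<in> sm r" using fbox_r[OF rb(1)] by (simp add: sm_def)
  thus "x \<in> \<Union>(img ` good)" using rb by (force simp: img_def good_def)
 qed
 ultimately have "\<exists>\<F>. finite \<F> \<and> \<F> \<subseteq> img ` good \<and> L \<subseteq> \<Union>\<F>"
  by (intro compactinD) (use op in blast)+
 then obtain Bx where Bx: "finite Bx" "Bx \<subseteq> good" "L \<subseteq> \<Union>(img ` Bx)" by (metis finite_subset_image)
 define \<sigma> where "\<sigma> = Min (insert 1 (fst ` Bx)) / 8"
 have s1: "8 * \<sigma> \<le> r" if "(r, \<beta>) \<in> Bx" for r \<beta>
 proof -
  have "Min (insert 1 (fst ` Bx)) \<le> r" using Bx(1) that by (intro Min_le) (auto simp: image_iff, force)
  thus ?thesis by (simp add: \<sigma>_def)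
 qed
 have s0: "0 < \<sigma>"
  unfolding \<sigma>_def using Bx(1,2) fbox_r by (auto simp: good_def)
 define G where "G = \<Union>(img ` Bx)"
 have oG: "openin X G" unfolding G_def using op Bx(2) by (intro openin_Union) auto
 have "closedin X (topspace X - G)" using oG by blast
 hence cK: "compactin X (Kc - G)"
 proof -
  have "(topspace X - G) \<inter> Kc = Kc - G" using KX by blast
  thus ?thesis using closed_Int_compactin[OF \<open>closedin X (topspace X - G)\<close> h_compact] by simp
 qed
 have "compact ((\<lambda>x. cmod (sgn (h x) - cis \<theta>)) ` (Kc - G))"
  using image_compactin[OF cK cd] by simp
 moreover have "0 \<notin> (\<lambda>x. cmod (sgn (h x) - cis \<theta>)) ` (Kc - G)"
 using Bx(3) KX by (auto simp: L_def G_def)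
 ultimately obtain \<eta>1 where e1: "0 < \<eta>1" "\<And>y. y \<in> (\<lambda>x. cmod (sgn (h x) - cis \<theta>)) ` (Kc - G) ==> \<eta>1 \<le> dist 0 y"
  using separate_point_closed[of _ "0::real"] compact_imp_closed by metis
 \<comment> \<open>Off \<open>Kc\<close> the value \<open>sgn (h x)\<close> is 1, so the second
   bound excludes these points.\<close>
 define \<eta> where "\<eta> = min \<eta>1 (cmod (1 - cis \<theta>))"
 have "\<exists>r \<beta> w. (r, \<beta>) \<in> Bx \<and> \<bar>Re w\<bar> < r/4 \<and> \<bar>Im w - \<theta>\<bar> < r/4 \<and> \<beta> w = x"
  if x: "x \<in> topspace X" and n: "cmod (sgn (h x) - cis \<theta>) < \<eta>" for x
 proof -
  have "x \<in> Kc"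
  using h_out x n by (fastforce simp: \<eta>_def)
  moreover have "x \<in> G"
  using e1(2) \<open>x \<in> Kc\<close> n by (fastforce simp: \<eta>_def)
  ultimately show ?thesis by (auto simp: G_def img_def sm_def)
 qed
 moreover have "0 < \<eta>" using e1 th(1) by (simp add: \<eta>_def)
 moreover have "\<And>r \<beta>. (r, \<beta>) \<in> Bx ==> fbox \<theta> r \<beta> \<and> 8 * \<sigma> \<le> r" using s1 Bx(2) by (auto simp: good_def)
 ultimately show ?thesis using that[of Bx \<theta> \<sigma> \<eta>] Bx(1) s0 by blast
qed

end

text \<open>The Hamiltonian is \<phi> of the argument, which is multivalued, but its derivative g is
  a function on the circle. As g vanishes from distance \<eta>/2 on and the boxes reach to distance
  \<eta>, translation in a box and the identity agree in between.\<close>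

locale flow = circ +
 fixes \<theta> :: real and Bx :: "(real \<times> (complex => 'a)) set" and \<sigma> \<eta> :: real and g :: "real => real" and \<phi> :: "real => real" and M :: real
 assumes Bx: "(r, \<beta>) \<in> Bx ==> fbox \<theta> r \<beta> \<and> 8 * \<sigma> \<le> r" and \<sigma>: "0 < \<sigma>" and \<eta>: "0 < \<eta>"
  and Bx_cover: "x \<in> topspace X ==> cmod (sgn (h x) - cis \<theta>) < \<eta> ==>
    \<exists>r \<beta> w. (r, \<beta>) \<in> Bx \<and> \<bar>Re w\<bar> < r/4 \<and> \<bar>Im w - \<theta>\<bar> < r/4 \<and> \<beta> w = x"
  and g_smooth: "smooth UNIV g" and g_per: "cis s = cis t ==> g s = g t"
  and g_supp: "\<eta>/2 \<le> cmod (cis s - cis \<theta>) ==> g s = 0" and g_bd: "\<bar>g s\<bar> \<le> M"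
  and \<phi>_smooth: "smooth UNIV \<phi>" and \<phi>_der: "(\<phi> has_real_derivative g s) (at s)"
begin

definition nearx :: "'a => bool" where "nearx x \<longleftrightarrow> cmod (sgn (h x) - cis \<theta>) < \<eta>"

text \<open>Lies between the covering quarter boxes and the full box: a translation by at most
  \<sigma> \<le> r/8 takes half-width r/4 into half-width 3 r/8, and the latter into the
  ball.\<close>

definition small :: "real => (complex => 'a) => complex => bool" where
 "small r \<beta> w \<longleftrightarrow> (r, \<beta>) \<in> Bx \<and> \<bar>Re w\<bar> < 3*r/8 \<and> \<bar>Im w - \<theta>\<bar> < r/4"

text \<open>The box is chosen arbitrarily; by \<open>flow_agree\<close> the result does not depend
  on it as long as d is at most \<sigma> in absolute value.\<close>

definition shift :: "'a => real => 'a" where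
 "shift x d = (case (SOME (r, \<beta>, w). small r \<beta> w \<and> \<beta> w = x) of (r, \<beta>, w) => \<beta> (w + of_real d))"

text \<open>The Hamiltonian flow for a short time \<tau>, with \<tau> times M at most \<sigma> in
  absolute value. The choice of the argument does not matter, since g depends only on the point of
  the circle.\<close>

definition stp :: "real => 'a => 'a" where
 "stp \<tau> x = (if nearx x then shift x (\<tau> * g (SOME s. isarg x s)) else x)"

lemma small_ball:
 assumes "small r \<beta> w" "\<bar>d\<bar> \<le> \<sigma>" shows "w + of_real d \<in> ball (Complex 0 \<theta>) r"
proof -
 have r: "8 * \<sigma> \<le> r" "0 < r" using Bx fbox_r assms by (auto simp: small_def)
 have "cmod (w + of_real d - Complex 0 \<theta>) \<le> \<bar>Re w + d\<bar> + \<bar>Im w - \<theta>\<bar>"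
  using cmod_le[of "w + of_real d - Complex 0 \<theta>"] by simp
 also have "\<dots> < r" using assms r abs_triangle_ineq[of "Re w" d] by (auto simp: small_def)
 finally show ?thesis by (simp add: dist_norm norm_minus_commute)
qed

lemma small_ball0: "small r \<beta> w ==> w \<in> ball (Complex 0 \<theta>) r"
 using small_ball[of r \<beta> w 0] \<sigma> by simp

lemma shift_eq:
 assumes "small r \<beta> w" "\<beta> w = x" "\<bar>d\<bar> \<le> \<sigma>"
 shows "shift x d = \<beta> (w + of_real d)"
proof -
 have "\<exists>t. case t of (r, \<beta>, w) => small r \<beta> w \<and> \<beta> w = x" using assms by (intro exI[of _ "(r,\<beta>,w)"]) auto
 from someI_ex[OF this] obtain r' \<beta>' w' where s: "(SOME (r, \<beta>, w). small r \<beta> w \<and> \<beta> w = x) = (r', \<beta>', w')" "small r' \<beta>' w'" "\<beta>' w' = x"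
  by (cases "SOME (r, \<beta>, w). small r \<beta> w \<and> \<beta> w = x") auto
 have b: "fbox \<theta> r' \<beta>'" "fbox \<theta> r \<beta>" using Bx s(2) assms(1) by (auto simp: small_def)
 have sd: "\<bar>s\<bar> \<le> \<sigma>" if "s \<in> closed_segment 0 d" for s
  using that assms(3) by (auto simp: closed_segment_eq_real_ivl split: if_splits)
 have "\<beta>' (w' + of_real d) = \<beta> (w + of_real d)"
  by (rule flow_agree[OF b]) (use s assms sd small_ball in auto)
 thus ?thesis by (simp add: shift_def s(1))
qed

lemma near_small: assumes "x \<in> topspace X" "nearx x" obtains r \<beta> w where "small r \<beta> w" "\<bar>Re w\<bar> < r/4" "\<beta> w = x"
proof -
 obtain r \<beta> w where w: "(r, \<beta>) \<in> Bx" "\<bar>Re w\<bar> < r/4" "\<bar>Im w - \<theta>\<bar> < r/4" "\<beta> w = x"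
  using Bx_cover[OF assms(1)] assms(2) unfolding nearx_def by blast
 moreover have "0 < r" using Bx[OF w(1)] fbox_r by blast
 ultimately show ?thesis by (intro that[of r \<beta> w]) (auto simp: small_def)
qed

lemma g_SOME: assumes "x \<in> topspace X" "isarg x s" shows "g (SOME s. isarg x s) = g s"
proof -
 have s: "isarg x (SOME s. isarg x s)" by (rule someI[of "isarg x", OF assms(2)])
 show ?thesis using isarg_cis[OF assms(1) s, of s] assms(2) by (intro g_per) simp
qed

lemma small_arg: "small r \<beta> w ==> isarg (\<beta> w) (Im w)" "small r \<beta> w ==> \<beta> w \<in> topspace X"
 using small_ball0 Bx fbox_arg fbox_in unfolding small_def by blast+

lemma stp_box:
 assumes s: "small r \<beta> w" and t: "\<bar>\<tau>\<bar> * M \<le> \<sigma>"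
 shows "stp \<tau> (\<beta> w) = \<beta> (w + of_real (\<tau> * g (Im w)))"
proof (cases "nearx (\<beta> w)")
 case True
 have "\<bar>\<tau> * g (Im w)\<bar> \<le> \<bar>\<tau>\<bar> * M" unfolding abs_mult by (intro mult_left_mono g_bd) auto
 hence "\<bar>\<tau> * g (Im w)\<bar> \<le> \<sigma>" using t by linarith
 thus ?thesis
  using True shift_eq[OF s refl] g_SOME[OF small_arg(2)[OF s] small_arg(1)[OF s]] by (simp add: stp_def)
next
 case False
 have "cis (Im w) = sgn (h (\<beta> w))" using isarg_sgn[OF small_arg(2)[OF s]] small_arg(1)[OF s] by simp
 hence "g (Im w) = 0" using False \<eta> by (intro g_supp) (simp add: nearx_def)
 thus ?thesis using False by (simp add: stp_def)
qed

lemma stp_off: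
 assumes x: "x \<in> topspace X" and far: "\<eta>/2 \<le> cmod (sgn (h x) - cis \<theta>)"
 shows "stp \<tau> x = x"
proof (cases "nearx x")
 case True
 obtain s where s: "isarg x s" using isarg_ex by blast
 have "g s = 0" using far isarg_sgn[OF x] s by (intro g_supp) simp
 moreover obtain r \<beta> w where "small r \<beta> w" "\<beta> w = x" using near_small[OF x True] by metis
 ultimately show ?thesis using shift_eq[of r \<beta> w x 0] \<sigma> g_SOME[OF x s] True by (simp add: stp_def)
qed (simp add: stp_def)

lemma stp_props:
 assumes x: "x \<in> topspace X" and t: "\<bar>\<tau>\<bar> * M \<le> \<sigma>"
 shows "stp \<tau> x \<in> topspace X" "sgn (h (stp \<tau> x)) = sgn (h x)" "stp (-\<tau>) (stp \<tau> x) = x"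
proof -
 have "stp \<tau> x \<in> topspace X \<and> sgn (h (stp \<tau> x)) = sgn (h x) \<and> stp (-\<tau>) (stp \<tau> x) = x"
 proof (cases "nearx x")
  case True
  obtain r \<beta> w where w: "small r \<beta> w" "\<bar>Re w\<bar> < r/4" "\<beta> w = x" using near_small[OF x True] by metis
  define d where "d = \<tau> * g (Im w)"
  have "\<bar>d\<bar> \<le> \<bar>\<tau>\<bar> * M" unfolding abs_mult d_def by (intro mult_left_mono g_bd) auto
  hence d: "\<bar>d\<bar> \<le> \<sigma>" using t by linarith
  have r: "8 * \<sigma> \<le> r" using Bx w(1) by (auto simp: small_def)
  have s': "small r \<beta> (w + of_real d)" using w d r abs_triangle_ineq[of "Re w" d] by (auto simp: small_def)
  have e: "stp \<tau> x = \<beta> (w + of_real d)" using stp_box[OF w(1) t] w(3) by (simp add: d_def)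
  have "sgn (h (\<beta> (w + of_real d))) = sgn (h x)"
   using isarg_sgn[OF small_arg(2)[OF s']] small_arg(1)[OF s'] isarg_sgn[OF small_arg(2)[OF w(1)]] small_arg(1)[OF w(1)] w(3) by simp
  moreover have "stp (-\<tau>) (\<beta> (w + of_real d)) = x"
   using stp_box[OF s', of "-\<tau>"] t w(3) by (simp add: d_def)
  ultimately show ?thesis using e small_arg(2)[OF s'] by simp
 next
  case False
  hence "stp \<tau> x = x" "stp (-\<tau>) x = x" by (auto simp: stp_def)
  thus ?thesis using x by simp
 qed
 thus "stp \<tau> x \<in> topspace X" "sgn (h (stp \<tau> x)) = sgn (h x)" "stp (-\<tau>) (stp \<tau> x) = x" by auto
qed

lemma ssymp_in: assumes "ssymp \<Omega> E Q W" "z \<in> E" shows "Q z \<in> topspace X"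
proof -
 obtain \<beta> V l N where l: "inj_on \<beta> V" "dens V \<beta> (\<lambda>_. 1)" "z \<in> N" "N \<subseteq> E" "smooth N l" "l ` N \<subseteq> V" "smooth N W"
  "\<And>x. x \<in> N ==> Q x = \<beta> (l x)"
  "\<And>x u v. x \<in> N ==> area_form (dd l x u) (dd l x v) + area_form (dd W x u) (dd W x v) = \<Omega> u v"
  by (rule ssympE[OF assms]) (rule that)
 thus ?thesis using dens_in[OF l(2)] by (metis image_subset_iff)
qed

text \<open>In a box the step replaces l by l + c y g (Im l) with y = Im W. This adds c g dy \<and>
  d(Im l) to the area form, as the part with the derivative of g is lost in the wedge with d(Im l).
  Adding c \<phi> f to Re W adds c g d(Im l) \<and> dy, because f and Im l have the same
  differential, and the two terms cancel.\<close>

lemma ssymp_step: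
 fixes Q :: "'e::euclidean_space => 'a"
 assumes S: "ssymp \<Omega> E Q W" and f: "smooth E f" and a: "\<And>z. z \<in> E ==> isarg (Q z) (f z)"
  and bd: "\<And>z. z \<in> E ==> \<bar>c * Im (W z)\<bar> * M \<le> \<sigma>"
 shows "ssymp \<Omega> E (\<lambda>z. stp (c * Im (W z)) (Q z)) (\<lambda>z. W z + of_real (c * \<phi> (f z)))"
 unfolding ssymp_def
proof
 fix z assume z: "z \<in> E"
 have oE: "open E" using f smooth_open by auto
 have QX: "Q x \<in> topspace X" if "x \<in> E" for x by (rule ssymp_in[OF S that])
 have sWf: "smooth N (\<lambda>z. W z + of_real (c * \<phi> (f z)))" if "smooth N W" "N \<subseteq> E" "open N" for N
  by (intro smooth_add smooth_of_real smooth_mult smooth_const that smooth_compose[OF \<phi>_smooth] smooth_subset[OF f]) auto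
 have dW: "dd (\<lambda>z. W z + of_real (c * \<phi> (f z))) x u = dd W x u + of_real (c * (g (f x) * dd f x u))"
  if "smooth N W" "x \<in> N" "x \<in> E" for N x u
 proof -
  have "((\<lambda>z. \<phi> (f z)) has_derivative (\<lambda>u. g (f x) * dd f x u)) (at x)"
   using diff_chain_at[OF smooth_der[OF f that(3)] \<phi>_der[of "f x", unfolded has_field_derivative_def]] by (simp add: o_def)
  hence "((\<lambda>z. W z + of_real (c * \<phi> (f z))) has_derivative (\<lambda>u. dd W x u + of_real (c * (g (f x) * dd f x u)))) (at x)"
   by (intro has_derivative_add smooth_der[OF that(1,2)] bounded_linear.has_derivative[OF bounded_linear_of_real] has_derivative_mult_right)
  from dd_eqI[OF this] show ?thesis by simp
 qed
 \<comment> \<open>Two overlapping open cases: within the range of the boxes, and where the step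
   does nothing.\<close>
 consider "cmod (sgn (h (Q z)) - cis \<theta>) < \<eta>" | "\<eta>/2 < cmod (sgn (h (Q z)) - cis \<theta>)" using \<eta> by linarith
 thus "\<exists>\<beta> V l N. inj_on \<beta> V \<and> dens V \<beta> (\<lambda>_. 1) \<and> z \<in> N \<and> N \<subseteq> E \<and> smooth N l \<and> l ` N \<subseteq> V \<and>
   smooth N (\<lambda>z. W z + of_real (c * \<phi> (f z))) \<and> (\<forall>x\<in>N. stp (c * Im (W x)) (Q x) = \<beta> (l x) \<and>
    (\<forall>u v. area_form (dd l x u) (dd l x v) + area_form (dd (\<lambda>z. W z + of_real (c * \<phi> (f z))) x u) (dd (\<lambda>z. W z + of_real (c * \<phi> (f z))) x v) = \<Omega> u v))"
 proof cases
  case 1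
  hence "nearx (Q z)" by (simp add: nearx_def)
  then obtain r \<beta> w where w: "small r \<beta> w" "\<bar>Re w\<bar> < r/4" "\<beta> w = Q z" using near_small[OF QX[OF z]] by metis
  have b: "fbox \<theta> r \<beta>" using w(1) Bx by (auto simp: small_def)
  let ?B = "ball (Complex 0 \<theta>) r"
  have wB: "Q z \<in> \<beta> ` ?B" using w small_ball0 by (metis image_eqI)
  obtain l N0 where l: "z \<in> N0" "N0 \<subseteq> E" "smooth N0 l" "l ` N0 \<subseteq> ?B" "smooth N0 W"
   "\<And>x. x \<in> N0 ==> Q x = \<beta> (l x)"
   "\<And>x u v. x \<in> N0 ==> area_form (dd l x u) (dd l x v) + area_form (dd W x u) (dd W x v) = \<Omega> u v"
   by (rule ssymp_lift[OF S z fbox_inj[OF b] fbox_dens[OF b] wB]) (rule that)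
  have lz: "l z = w" using fbox_inj[OF b] l(4,6) l(1) w small_ball0 by (metis image_subset_iff inj_onD)
  have osm: "open {v. small r \<beta> v}"
   using w(1) unfolding small_def by (auto intro!: open_Collect_conj open_Collect_less continuous_intros)
  have "open (N0 \<inter> l -` {v. small r \<beta> v})" by (rule smooth_vimage[OF l(3) osm])
  moreover have "z \<in> N0 \<inter> l -` {v. small r \<beta> v}" using l lz w by auto
  ultimately obtain e where e: "e > 0" "ball z e \<subseteq> N0 \<inter> l -` {v. small r \<beta> v}" using openE by blast
  let ?N = "ball z e"
  have NN: "?N \<subseteq> N0" using e by auto
  have sl: "smooth ?N l" and sW: "smooth ?N W" using smooth_subset[OF l(3) open_ball NN] smooth_subset[OF l(5) open_ball NN] by auto
  have sml: "small r \<beta> (l x)" if "x \<in> ?N" for x using e that by auto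
  define m where "m = (\<lambda>x. l x + of_real (c * Im (W x) * g (Im (l x))))"
  have smm: "smooth ?N m" unfolding m_def
   by (intro smooth_add smooth_of_real smooth_mult smooth_const smooth_Im sl sW open_ball smooth_compose[OF g_smooth]) auto
  have cisf: "cis (f x) = cis (Im (l x))" if "x \<in> ?N" for x
   using isarg_cis[OF QX[of x] a[of x]] small_arg(1)[OF sml[OF that]] l(6)[of x] that NN l(2) by (metis subsetD)
  \<comment> \<open>f and Im l are branches of the same argument on a ball, hence differ by a
    constant.\<close>
  have fl: "f x = Im (l x) + (f z - Im (l z))" if "x \<in> ?N" for x
   using arg_difference_const[of ?N f "\<lambda>x. Im (l x)" z x] cisf that e(1) NN l(2)
    continuous_on_subset[OF smooth_cont[OF f]] smooth_cont[OF smooth_Im[OF sl]] by (simp add: subset_trans)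
  have df: "dd f x u = Im (dd l x u)" if x: "x \<in> ?N" for x u
  proof -
   have "((\<lambda>x. Im (l x) + (f z - Im (l z))) has_derivative (\<lambda>u. Im (dd l x u) + 0)) (at x)"
    by (intro has_derivative_add has_derivative_const bounded_linear.has_derivative[OF bounded_linear_Im] smooth_der[OF sl x])
   moreover have "dd f x = dd (\<lambda>x. Im (l x) + (f z - Im (l z))) x" by (rule dd_cong(1)[OF open_ball x]) (rule fl)
   ultimately show ?thesis using dd_eqI by fastforce
  qed
  \<comment> \<open>\<gamma> is the derivative of g at the height Im l; its value is irrelevant for
    the area.\<close>
  have dm: "\<exists>\<gamma>. \<forall>u. dd m x u = dd l x u + of_real (c * (Im (dd W x u) * g (Im (l x)) + Im (W x) * (\<gamma> * Im (dd l x u))))" if x: "x \<in> ?N" for x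
  proof -
   have gd: "(g has_derivative (\<lambda>h. dd g (Im (l x)) 1 * h)) (at (Im (l x)))"
   proof -
    have "dd g (Im (l x)) = (\<lambda>h. dd g (Im (l x)) 1 * h)"
    proof
     fix h
     have "dd g (Im (l x)) (h *\<^sub>R 1) = h *\<^sub>R dd g (Im (l x)) 1"
      by (rule linear_scale[OF dd_linear[OF smooth_diff[OF g_smooth UNIV_I]]])
     thus "dd g (Im (l x)) h = dd g (Im (l x)) 1 * h" by simp
    qed
    thus ?thesis using smooth_der[OF g_smooth UNIV_I, of "Im (l x)"] by simp
   qed
   have D1: "((\<lambda>x. g (Im (l x))) has_derivative (\<lambda>u. dd g (Im (l x)) 1 * Im (dd l x u))) (at x)"
    using diff_chain_at[OF bounded_linear.has_derivative[OF bounded_linear_Im smooth_der[OF sl x]] gd] by (simp add: o_def)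
   have D2: "((\<lambda>x. c * Im (W x)) has_derivative (\<lambda>u. c * Im (dd W x u))) (at x)"
    by (intro has_derivative_mult_right bounded_linear.has_derivative[OF bounded_linear_Im] smooth_der[OF sW x])
   have "(m has_derivative (\<lambda>u. dd l x u + of_real (c * Im (W x) * (dd g (Im (l x)) 1 * Im (dd l x u)) + c * Im (dd W x u) * g (Im (l x))))) (at x)"
    unfolding m_def
    by (intro has_derivative_add smooth_der[OF sl x] bounded_linear.has_derivative[OF bounded_linear_of_real] has_derivative_mult[OF D2 D1])
   from dd_eqI[OF this] show ?thesis
    by (intro exI[of _ "dd g (Im (l x)) 1"]) (simp add: algebra_simps)
  qed
  have mB: "m x \<in> ?B \<and> stp (c * Im (W x)) (Q x) = \<beta> (m x)" if x: "x \<in> ?N" for x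
  proof
   have xE: "x \<in> E" using x NN l(2) by auto
   show "stp (c * Im (W x)) (Q x) = \<beta> (m x)"
    using stp_box[OF sml[OF x] bd[OF xE]] l(6)[of x] x NN by (auto simp: m_def)
   have "\<bar>c * Im (W x) * g (Im (l x))\<bar> \<le> \<bar>c * Im (W x)\<bar> * M" unfolding abs_mult[of "c * Im (W x)"] by (intro mult_left_mono g_bd) auto
   hence "\<bar>c * Im (W x) * g (Im (l x))\<bar> \<le> \<sigma>" using bd[OF xE] by linarith
   thus "m x \<in> ?B" unfolding m_def by (rule small_ball[OF sml[OF x]])
  qed
  show ?thesis
  proof (intro exI[of _ \<beta>] exI[of _ ?B] exI[of _ m] exI[of _ ?N] conjI ballI allI)
   show "?N \<subseteq> E" using NN l(2) by blast
   show "smooth ?N (\<lambda>z. W z + of_real (c * \<phi> (f z)))" by (rule sWf[OF sW]) (use NN l(2) in auto)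
   fix x u v assume x: "x \<in> ?N"
   have xE: "x \<in> E" using x NN l(2) by auto
   obtain \<gamma> where g: "\<And>u. dd m x u = dd l x u + of_real (c * (Im (dd W x u) * g (Im (l x)) + Im (W x) * (\<gamma> * Im (dd l x u))))"
    using dm[OF x] by blast
   have gf: "g (f x) = g (Im (l x))" by (rule g_per[OF cisf[OF x]])
   have "area_form (dd m x u) (dd m x v) + area_form (dd (\<lambda>z. W z + of_real (c * \<phi> (f z))) x u) (dd (\<lambda>z. W z + of_real (c * \<phi> (f z))) x v)
    = area_form (dd l x u) (dd l x v) + area_form (dd W x u) (dd W x v)"
    unfolding g dW[OF sW x xE] df[OF x] gf area_form_def by (simp add: algebra_simps)
   thus "area_form (dd m x u) (dd m x v) + area_form (dd (\<lambda>z. W z + of_real (c * \<phi> (f z))) x u) (dd (\<lambda>z. W z + of_real (c * \<phi> (f z))) x v) = \<Omega> u v"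
    using l(7)[of x u v] x NN by auto
  qed (use fbox_inj[OF b] fbox_dens[OF b] e smm mB in auto)
 next
  case 2
  obtain \<beta> V l N0 where l: "inj_on \<beta> V" "dens V \<beta> (\<lambda>_. 1)" "z \<in> N0" "N0 \<subseteq> E" "smooth N0 l" "l ` N0 \<subseteq> V" "smooth N0 W"
   "\<And>x. x \<in> N0 ==> Q x = \<beta> (l x)"
   "\<And>x u v. x \<in> N0 ==> area_form (dd l x u) (dd l x v) + area_form (dd W x u) (dd W x v) = \<Omega> u v"
   by (rule ssympE[OF S z]) (rule that)
  have cisf: "cis (f x) = sgn (h (Q x))" if "x \<in> E" for x using isarg_sgn[OF QX[OF that]] a[OF that] by simp
  define N where "N = N0 \<inter> {x \<in> E. \<eta>/2 < cmod (cis (f x) - cis \<theta>)}"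
  have "open (E \<inter> (\<lambda>x. cmod (cis (f x) - cis \<theta>)) -` {\<eta>/2<..})"
   by (rule continuous_open_preimage[OF _ oE]) (auto intro!: continuous_intros smooth_cont[OF f])
  moreover have "{x \<in> E. \<eta>/2 < cmod (cis (f x) - cis \<theta>)} = E \<inter> (\<lambda>x. cmod (cis (f x) - cis \<theta>)) -` {\<eta>/2<..}" by auto
  ultimately have oN: "open N" unfolding N_def using smooth_open[OF l(5)] by (simp add: open_Int)
  have NN: "N \<subseteq> N0" "N \<subseteq> E" by (auto simp: N_def)
  have sl: "smooth N l" and sW: "smooth N W" using smooth_subset[OF l(5) oN NN(1)] smooth_subset[OF l(7) oN NN(1)] by auto
  show ?thesis
  proof (intro exI[of _ \<beta>] exI[of _ V] exI[of _ l] exI[of _ N] conjI ballI allI)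
   show "z \<in> N" using l(3) z 2 cisf[OF z] by (simp add: N_def)
   show "smooth N (\<lambda>z. W z + of_real (c * \<phi> (f z)))" by (rule sWf[OF sW NN(2) oN])
   show "l ` N \<subseteq> V" using NN l(6) by blast
   fix x assume x: "x \<in> N"
   hence xE: "x \<in> E" and far: "\<eta>/2 < cmod (cis (f x) - cis \<theta>)" by (auto simp: N_def)
   show "stp (c * Im (W x)) (Q x) = \<beta> (l x)"
    using stp_off[OF QX[OF xE]] far cisf[OF xE] l(8)[of x] x NN by auto
   fix u v
   have "g (f x) = 0" by (rule g_supp) (use far in simp)
   thus "area_form (dd l x u) (dd l x v) + area_form (dd (\<lambda>z. W z + of_real (c * \<phi> (f z))) x u) (dd (\<lambda>z. W z + of_real (c * \<phi> (f z))) x v) = \<Omega> u v"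
    using l(9)[of x u v] x NN dW[OF sW x xE] by auto
  qed (use l sl NN in auto)
 qed
qed

end

definition sq :: "real => complex set" where "sq R = {z. \<bar>Re z\<bar> < R \<and> \<bar>Im z\<bar> < R}"

definition area2 :: "complex \<times> complex => complex \<times> complex => real" where
 "area2 u v = area_form (fst u) (fst v) + area_form (snd u) (snd v)"

lemma open_sq: "open (sq R)" unfolding sq_def
 by (intro open_Collect_conj open_Collect_less continuous_intros)

lemma smooth_cis: "smooth UNIV cis"
proof -
 have "smooth UNIV (\<lambda>s. exp (\<i> * of_real s))"
  by (intro smooth_exp smooth_mult smooth_const smooth_of_real smooth_ident open_UNIV)
 thus ?thesis by (rule smooth_cong) (simp add: cis_conv_exp)
qed

context circ begin

text \<open>\<phi> grows by exactly 2 R per turn. For points on different sheets over the same point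
  of the surface the real parts of W are thus shifted apart by at least 2 R, more than the square
  can compensate; on one sheet the assumption on j and f applies.\<close>

lemma flow_embedding:
 assumes dj: "dens B j (\<lambda>_. 1)" and sf: "smooth B f" and af: "\<And>q. q \<in> B ==> isarg (j q) (f q)"
  and inj: "\<And>q q'. q \<in> B ==> q' \<in> B ==> j q = j q' ==> f q = f q' ==> q = q'"
  and bf: "\<And>q. q \<in> B ==> \<bar>f q\<bar> \<le> Mf" and R: "0 < R"
 obtains Q W Rb where "ssymp area2 (B \<times> sq R) Q W" "inj_on (\<lambda>z. (Q z, W z)) (B \<times> sq R)" "\<And>z. z \<in> B \<times> sq R ==> cmod (W z) \<le> Rb"
proof -
 obtain \<theta> Bx \<sigma> \<eta> where fd: "finite Bx" "\<And>r \<beta>. (r, \<beta>) \<in> Bx ==> fbox \<theta> r \<beta> \<and> 8 * \<sigma> \<le> r" "0 < \<sigma>" "0 < \<eta>"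
  "\<And>x. x \<in> topspace X ==> cmod (sgn (h x) - cis \<theta>) < \<eta> ==>
    \<exists>r \<beta> w. (r, \<beta>) \<in> Bx \<and> \<bar>Re w\<bar> < r/4 \<and> \<bar>Im w - \<theta>\<bar> < r/4 \<and> \<beta> w = x"
  by (rule flow_data) (rule that)
 obtain \<psi> :: "complex => real" where ps: "smooth UNIV \<psi>" "\<And>z. 0 \<le> \<psi> z \<and> \<psi> z \<le> 1"
  "\<And>z. cmod (z - cis \<theta>) \<le> \<eta>/4 ==> \<psi> z = 1" "\<And>z. \<eta>/2 \<le> cmod (z - cis \<theta>) ==> \<psi> z = 0"
  using bump[of "\<eta>/4" "\<eta>/2" "cis \<theta>"] fd(4) by auto
 define g0 where "g0 = (\<lambda>s. \<psi> (cis s))"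
 have sg0: "smooth UNIV g0" unfolding g0_def by (rule smooth_compose[OF ps(1) smooth_cis]) auto
 \<comment> \<open>A smooth antiderivative of g0 is obtained from the planar
   \<open>fiber_integral\<close>, restricted to the real axis.\<close>
 define G where "G = (\<lambda>z. g0 (Re z))"
 have sG: "smooth UNIV G" unfolding G_def
  by (rule smooth_compose[OF sg0]) (auto intro!: smooth_Re smooth_ident)
 define T where "T = (\<lambda>v. Re v * integral {0..1} (\<lambda>t. G (Complex (t * Re v) (Im v))))"
 have sT: "smooth UNIV T" and dT: "\<And>v. dd T v 1 = G v"
  unfolding T_def using fiber_integral[OF sG open_UNIV] by auto
 define \<phi>0 where "\<phi>0 = (\<lambda>s. T (of_real s))"
 have sp0: "smooth UNIV \<phi>0" unfolding \<phi>0_def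
  by (rule smooth_compose[OF sT]) (auto intro!: smooth_of_real smooth_ident)
 have dp0: "(\<phi>0 has_real_derivative g0 s) (at s)" for s
  using has_real_derivative_line[of T 0 s 1] smooth_diff[OF sT] dT[of "of_real s"] by (simp add: \<phi>0_def[abs_def] G_def)
 have g0p: "g0 (s + 2*pi) = g0 s" for s
 proof -
  have "cis (s + 2*pi) = cis s" by (simp add: complex_eq_iff)
  thus ?thesis by (simp add: g0_def)
 qed
 define b0 where "b0 = \<phi>0 (\<theta> - pi + 2*pi) - \<phi>0 (\<theta> - pi)"
 have per0: "\<phi>0 (s + 2*pi) = \<phi>0 s + b0" for s
 proof -
  have "((\<lambda>s. \<phi>0 (s + 2*pi) - \<phi>0 s) has_real_derivative 0) (at s)" for s
  proof -
   have "((\<lambda>s. \<phi>0 (s + 2*pi)) has_real_derivative g0 (s + 2*pi) * 1) (at s)"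
    by (rule DERIV_chain2[OF dp0]) (auto intro!: derivative_eq_intros)
   from DERIV_diff[OF this dp0[of s]] show ?thesis by (simp add: g0p)
  qed
  hence "\<phi>0 (s + 2*pi) - \<phi>0 s = \<phi>0 (\<theta> - pi + 2*pi) - \<phi>0 (\<theta> - pi)" using DERIV_isconst_all[of "\<lambda>s. \<phi>0 (s + 2*pi) - \<phi>0 s"] by blast
  thus ?thesis by (simp add: b0_def)
 qed
 have mono0: "\<phi>0 s \<le> \<phi>0 t" if "s \<le> t" for s t
  by (rule DERIV_nonneg_imp_nondecreasing[OF that]) (use dp0 ps(2) in \<open>auto simp: g0_def\<close>)
 \<comment> \<open>Otherwise \<phi>0 would be constant on a period, but its derivative at \<theta>
   is 1.\<close>
 have b0: "0 < b0"
 proof (rule ccontr)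
  assume n: "\<not> 0 < b0"
  have c: "\<phi>0 s = \<phi>0 (\<theta> - pi)" if "\<theta> - pi \<le> s" "s \<le> \<theta> + pi" for s
   using mono0[of "\<theta> - pi" s] mono0[of s "\<theta> - pi + 2*pi"] that n by (auto simp: b0_def)
  have "((\<lambda>s. \<phi>0 (\<theta> - pi)) has_real_derivative g0 \<theta>) (at \<theta>)"
   by (rule has_field_derivative_transform_within[OF dp0, of pi]) (auto simp: dist_real_def intro!: c)
  hence "g0 \<theta> = 0" using DERIV_unique[OF _ DERIV_const] by blast
  moreover have "g0 \<theta> = 1" using ps(3)[of "cis \<theta>"] fd(4) by (simp add: g0_def)
  ultimately show False by simp
 qed
 \<comment> \<open>Scales the gain per turn from b0 to 2 R, the width of the square.\<close>
 define M where "M = 2 * R / b0"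
 have M: "M > 0" using R b0 by (simp add: M_def)
 define g where "g = (\<lambda>s. M * g0 s)"
 define \<phi> where "\<phi> = (\<lambda>s. M * \<phi>0 s)"
 interpret flow X P h Kc \<theta> Bx \<sigma> \<eta> g \<phi> M
 proof
  show "fbox \<theta> r \<beta> \<and> 8 * \<sigma> \<le> r" if "(r, \<beta>) \<in> Bx" for r \<beta> using fd(2)[OF that] .
  show "0 < \<sigma>" "0 < \<eta>" by fact+
  show "\<exists>r \<beta> w. (r, \<beta>) \<in> Bx \<and> \<bar>Re w\<bar> < r/4 \<and> \<bar>Im w - \<theta>\<bar> < r/4 \<and> \<beta> w = x"
   if "x \<in> topspace X" "cmod (sgn (h x) - cis \<theta>) < \<eta>" for x using fd(5)[OF that] .
  show "smooth UNIV g" unfolding g_def by (intro smooth_mult smooth_const sg0 open_UNIV)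
  show "g s = g t" if "cis s = cis t" for s t using that by (simp add: g_def g0_def)
  show "g s = 0" if "\<eta>/2 \<le> cmod (cis s - cis \<theta>)" for s using ps(4)[OF that] by (simp add: g_def g0_def)
  show "\<bar>g s\<bar> \<le> M" for s using ps(2)[of "cis s"] M by (simp add: g_def g0_def abs_mult)
  show "smooth UNIV \<phi>" unfolding \<phi>_def by (intro smooth_mult smooth_const sp0 open_UNIV)
  show "(\<phi> has_real_derivative g s) (at s)" for s unfolding \<phi>_def g_def by (rule DERIV_cmult[OF dp0])
 qed
 have per: "\<phi> (s + 2*pi) = \<phi> s + 2 * R" for s
 proof -
  have "M * b0 = 2 * R" using b0 by (simp add: M_def)
  thus ?thesis unfolding \<phi>_def per0 distrib_left by simp
 qed
 have pern: "\<phi> (s + 2 * pi * real n) = \<phi> s + 2 * R * real n" for s n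
 proof (induction n)
  case (Suc n)
  have e: "s + 2 * pi * real (Suc n) = (s + 2 * pi * real n) + 2*pi" by (simp add: algebra_simps)
  show ?case unfolding e per Suc by (simp add: algebra_simps)
 qed simp
 have peri: "\<phi> (s + 2*pi * of_int m) = \<phi> s + 2*R * of_int m" for s and m :: int
 proof (cases "0 \<le> m")
  case True thus ?thesis using pern[of s "nat m"] by simp
 next
  case False
  thus ?thesis using pern[of "s + 2*pi * of_int m" "nat (-m)"] by (simp add: algebra_simps)
 qed
 \<comment> \<open>The time Im (snd z) is divided into n steps, so short that each translates points
   by at most \<sigma>.\<close>
 obtain n :: nat where n: "R * M / \<sigma> < real n" using reals_Archimedean2 by blast
 have n0: "0 < real n" using n R M \<sigma> by (meson divide_pos_pos mult_pos_pos order_less_trans)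
 define c where "c = 1 / real n"
 have cb: "\<bar>c * y\<bar> * M \<le> \<sigma>" if "\<bar>y\<bar> < R" for y
 proof -
  have "\<bar>c * y\<bar> * M = (\<bar>y\<bar> * M) / real n" using n0 by (simp add: c_def abs_mult)
  also have "\<dots> \<le> (R * M) / real n" using that M n0 by (intro divide_right_mono mult_right_mono) auto
  also have "\<dots> \<le> \<sigma>" using n n0 \<sigma> by (simp add: field_simps)
  finally show ?thesis .
 qed
 let ?E = "B \<times> sq R"
 have oB: "open B" using sf smooth_open by auto
 have oE: "open ?E" by (intro open_Times oB open_sq)
 define F where "F = (\<lambda>z :: complex \<times> complex. f (fst z))"
 have sF: "smooth ?E F" unfolding F_def
  by (rule smooth_compose[OF sf smooth_fst[OF smooth_ident[OF oE]]]) auto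
 \<comment> \<open>All steps use the same time: W is only ever shifted by real numbers, so its
   imaginary part remains that of \<open>snd z\<close>.\<close>
 define Qk where "Qk k = (\<lambda>z :: complex \<times> complex. (stp (c * Im (snd z)) ^^ k) (j (fst z)))" for k
 define Wk where "Wk k = (\<lambda>z :: complex \<times> complex. snd z + of_real (real k * c * \<phi> (F z)))" for k
 have QX: "Qk k z \<in> topspace X \<and> isarg (Qk k z) (F z)" if z: "z \<in> ?E" for k z
 proof (induction k)
  case 0
  thus ?case using z dens_in[OF dj] af by (auto simp: Qk_def F_def)
 next
  case (Suc k)
  have y: "\<bar>c * Im (snd z)\<bar> * M \<le> \<sigma>" by (rule cb) (use z in \<open>auto simp: sq_def\<close>)
  have "Qk (Suc k) z = stp (c * Im (snd z)) (Qk k z)" by (simp add: Qk_def)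
  thus ?case using stp_props(1,2)[of "Qk k z", OF _ y] Suc isarg_sgn by auto
 qed
 have S: "ssymp area2 ?E (Qk k) (Wk k)" for k
 proof (induction k)
  case 0
  show ?case unfolding ssymp_def
  proof
   fix z assume z: "z \<in> ?E"
   hence fz: "fst z \<in> B" by auto
   obtain V \<xi> N l where l: "(V, \<xi>) \<in> P" "fst z \<in> N" "N \<subseteq> B" "smooth N l" "l ` N \<subseteq> V"
    "\<And>x. x \<in> N ==> j x = \<xi> (l x)" "\<And>x. x \<in> N ==> jac l x = 1"
    by (rule densE[OF dj fz]) (rule that)
   have oN: "open (N \<times> sq R)" by (intro open_Times open_sq smooth_open[OF l(4)])
   have sl: "smooth (N \<times> sq R) (\<lambda>x. l (fst x))"
    by (rule smooth_compose[OF l(4) smooth_fst[OF smooth_ident[OF oN]]]) auto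
   have sW: "smooth (N \<times> sq R) (Wk 0)" unfolding Wk_def using smooth_snd[OF smooth_ident[OF oN]] by simp
   have dfst: "dd (\<lambda>x :: complex \<times> complex. l (fst x)) x = (\<lambda>u. dd l (fst x) (fst u))" if "fst x \<in> N" for x
    using dd_eqI[OF diff_chain_at[OF bounded_linear_imp_has_derivative[OF bounded_linear_fst] smooth_der[OF l(4) that]]]
    by (simp add: o_def)
   have dsnd: "dd (Wk 0) x = snd" for x
    using dd_eqI[OF bounded_linear_imp_has_derivative[OF bounded_linear_snd], of x] by (simp add: Wk_def)
   show "\<exists>\<beta> V l N. inj_on \<beta> V \<and> dens V \<beta> (\<lambda>_. 1) \<and> z \<in> N \<and> N \<subseteq> ?E \<and> smooth N l \<and> l ` N \<subseteq> V \<and>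
     smooth N (Wk 0) \<and> (\<forall>x\<in>N. Qk 0 x = \<beta> (l x) \<and>
     (\<forall>u v. area_form (dd l x u) (dd l x v) + area_form (dd (Wk 0) x u) (dd (Wk 0) x v) = area2 u v))"
   proof (intro exI[of _ \<xi>] exI[of _ V] exI[of _ "\<lambda>x. l (fst x)"] exI[of _ "N \<times> sq R"] conjI ballI allI)
    show "inj_on \<xi> V" by (rule par_inj[OF l(1)])
    show "dens V \<xi> (\<lambda>_. 1)" by (rule dens_par[OF l(1)])
    show "z \<in> N \<times> sq R" "N \<times> sq R \<subseteq> ?E" "(\<lambda>x. l (fst x)) ` (N \<times> sq R) \<subseteq> V" using z l by auto
    fix x assume x: "x \<in> N \<times> sq R"
    hence xN: "fst x \<in> N" by auto
    show "Qk 0 x = \<xi> (l (fst x))" using l(6)[OF xN] by (simp add: Qk_def)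
    fix u v
    show "area_form (dd (\<lambda>x. l (fst x)) x u) (dd (\<lambda>x. l (fst x)) x v) + area_form (dd (Wk 0) x u) (dd (Wk 0) x v) = area2 u v"
     using area_form_dd[OF smooth_diff[OF l(4) xN]] l(7)[OF xN] by (simp add: dfst[OF xN] dsnd area2_def)
   qed (use sl sW in auto)
  qed
 next
  case (Suc k)
  have "ssymp area2 ?E (\<lambda>z. stp (c * Im (Wk k z)) (Qk k z)) (\<lambda>z. Wk k z + of_real (c * \<phi> (F z)))"
  proof (rule ssymp_step[OF Suc sF])
   show "isarg (Qk k z) (F z)" if "z \<in> ?E" for z using QX[OF that] by blast
   show "\<bar>c * Im (Wk k z)\<bar> * M \<le> \<sigma>" if "z \<in> ?E" for z by (rule cb) (use that in \<open>auto simp: Wk_def sq_def\<close>)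
  qed
  moreover have "(\<lambda>z. stp (c * Im (Wk k z)) (Qk k z)) = Qk (Suc k)" by (simp add: Qk_def Wk_def fun_eq_iff)
  moreover have "(\<lambda>z. Wk k z + of_real (c * \<phi> (F z))) = Wk (Suc k)" by (simp add: Wk_def fun_eq_iff algebra_simps)
  ultimately show ?case by simp
 qed
 define W where "W = Wk n"
 have W: "W z = snd z + of_real (\<phi> (F z))" for z using n0 by (simp add: W_def Wk_def c_def)
 \<comment> \<open>Equal values of W have equal imaginary parts, so both points were moved by the
   same steps, which can be undone.\<close>
 have undo: "(stp (-\<tau>) ^^ k) ((stp \<tau> ^^ k) x) = x \<and> (stp \<tau> ^^ k) x \<in> topspace X" if "x \<in> topspace X" "\<bar>\<tau>\<bar> * M \<le> \<sigma>" for \<tau> k x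
 proof (induction k)
  case (Suc k)
  have "(stp (-\<tau>) ^^ Suc k) ((stp \<tau> ^^ Suc k) x) = (stp (-\<tau>) ^^ k) (stp (-\<tau>) (stp \<tau> ((stp \<tau> ^^ k) x)))"
   by (simp add: funpow_swap1)
  thus ?case using Suc stp_props[of "(stp \<tau> ^^ k) x" \<tau>] that(2) by simp
 qed (use that in auto)
 have inj2: "inj_on (\<lambda>z. (Qk n z, W z)) ?E"
 proof (rule inj_onI)
  fix z z' assume z: "z \<in> ?E" "z' \<in> ?E" and eq: "(Qk n z, W z) = (Qk n z', W z')"
  have y: "Im (snd z) = Im (snd z')" using eq by (simp add: W complex_eq_iff)
  have "\<bar>c * Im (snd z)\<bar> * M \<le> \<sigma>" by (rule cb) (use z in \<open>auto simp: sq_def\<close>)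
  hence jj: "j (fst z) = j (fst z')"
   using undo[of "j (fst z)" "c * Im (snd z)" n] undo[of "j (fst z')" "c * Im (snd z)" n] eq y z dens_in[OF dj]
   unfolding Qk_def by (metis Pair_inject mem_Times_iff)
  have "cis (f (fst z)) = cis (f (fst z'))"
   using isarg_cis[OF dens_in[OF dj], of "fst z" "f (fst z)" "f (fst z')"] af[of "fst z"] af[of "fst z'"] jj z by auto
  then obtain m :: int where m: "f (fst z) = f (fst z') + 2 * pi * of_int m" using cis_eq_iff by metis
  have "Re (snd z) + \<phi> (f (fst z)) = Re (snd z') + \<phi> (f (fst z'))" using eq by (simp add: W F_def complex_eq_iff)
  hence "2 * R * of_int m = Re (snd z') - Re (snd z)" using m peri by simp
  moreover have "\<bar>Re (snd z') - Re (snd z)\<bar> < 2 * R" using z by (auto simp: sq_def)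
  ultimately have "\<bar>2 * R * of_int m\<bar> < 2 * R" by simp
  hence "\<bar>real_of_int m\<bar> < 1" using R by (simp add: abs_mult)
  hence "m = 0" by linarith
  hence "fst z = fst z'" using inj[of "fst z" "fst z'"] m jj z by auto
  moreover have "snd z = snd z'" using eq \<open>fst z = fst z'\<close> by (simp add: W F_def)
  ultimately show "z = z'" by (simp add: prod_eq_iff)
 qed
 have "\<exists>K. \<forall>s\<in>{-Mf..Mf}. \<bar>\<phi> s\<bar> \<le> K"
 proof -
  have "continuous_on {-Mf..Mf} \<phi>" using smooth_cont[OF \<phi>_smooth] continuous_on_subset by blast
  hence "bounded (\<phi> ` {-Mf..Mf})" by (intro compact_imp_bounded compact_continuous_image) auto
  thus ?thesis unfolding bounded_iff by auto
 qed
 then obtain K where K0: "\<forall>s\<in>{-Mf..Mf}. \<bar>\<phi> s\<bar> \<le> K" by blast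
 have K: "\<bar>\<phi> s\<bar> \<le> K" if "\<bar>s\<bar> \<le> Mf" for s
 proof -
  have "s \<in> {-Mf..Mf}" using that by auto
  thus ?thesis using K0 by blast
 qed
 have "cmod (W z) \<le> 2 * R + K" if "z \<in> ?E" for z
 proof -
  have "cmod (W z) \<le> cmod (snd z) + \<bar>\<phi> (F z)\<bar>" unfolding W using norm_triangle_ineq[of "snd z" "of_real (\<phi> (F z))"] by simp
  moreover have "cmod (snd z) \<le> 2 * R" using cmod_le[of "snd z"] that by (auto simp: sq_def)
  moreover have "\<bar>\<phi> (F z)\<bar> \<le> K" by (rule K) (use that bf in \<open>auto simp: F_def\<close>)
  ultimately show ?thesis by linarith
 qed
 thus ?thesis by (rule that[OF S[of n, folded W_def] inj2])
qed

subsection \<open>The cyclic covering\<close>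

text \<open>The pull-back along h of the covering of the circle by the line, realised as a subspace
  of the product.\<close>

definition covT :: "('a \<times> real) topology" where
 "covT = subtopology (prod_topology X euclideanreal) {(x, r). isarg x r}"

text \<open>Continuity of the branch f is enough: locally it differs from a smooth branch by a
  constant.\<close>

definition covP :: "(complex set \<times> (complex => 'a \<times> real)) set" where
 "covP = {(V, \<lambda>p. (\<xi> p, f p)) |V \<xi> f. \<exists>U. (U, \<xi>) \<in> P \<and> open V \<and> V \<subseteq> U \<and> continuous_on V f \<and> (\<forall>p\<in>V. isarg (\<xi> p) (f p))}"

lemma covT_topspace: "topspace covT = {(x, r). x \<in> topspace X \<and> isarg x r}"
 by (auto simp: covT_def)

lemma covP_I: "(U, \<xi>) \<in> P ==> open V ==> V \<subseteq> U ==> continuous_on V f ==> (\<And>p. p \<in> V ==> isarg (\<xi> p) (f p)) ==>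
  (V, \<lambda>p. (\<xi> p, f p)) \<in> covP"
 unfolding covP_def by blast

lemma covP_E:
 assumes "(V, k) \<in> covP"
 obtains U \<xi> f where "(U, \<xi>) \<in> P" "open V" "V \<subseteq> U" "continuous_on V f" "\<And>p. p \<in> V ==> isarg (\<xi> p) (f p)" "k = (\<lambda>p. (\<xi> p, f p))"
proof -
 from assms obtain \<xi> f U where "k = (\<lambda>p. (\<xi> p, f p)) \<and> (U, \<xi>) \<in> P \<and> open V \<and> V \<subseteq> U \<and> continuous_on V f \<and> (\<forall>p\<in>V. isarg (\<xi> p) (f p))"
  unfolding covP_def by blast
 thus ?thesis by (intro that[of U \<xi> f]) auto
qed

lemma isarg_close:
 assumes "x \<in> topspace X" "isarg x r" "isarg x r'" "\<bar>r - r'\<bar> < 6" shows "r = r'"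
proof -
 have "cis r = cis r'" using isarg_cis[OF assms(1,2)] assms(3) by blast
 then obtain n :: int where n: "r = r' + 2 * pi * of_int n" using cis_eq_iff by metis
 have "2 * pi * \<bar>real_of_int n\<bar> < 6" using n assms(4) by (simp add: abs_mult)
 moreover have "6 * \<bar>real_of_int n\<bar> \<le> 2 * pi * \<bar>real_of_int n\<bar>" using pi_gt3 by (intro mult_right_mono) auto
 ultimately have "\<bar>real_of_int n\<bar> < 1" by linarith
 hence "n = 0" by linarith
 thus ?thesis using n by simp
qed

lemma cov_osurf: "osurf covT covP"
proof
 show "Hausdorff_space covT"
  unfolding covT_def by (intro Hausdorff_space_subtopology) (simp add: Hausdorff_space_prod_topology haus)
 fix z :: "'a \<times> real" assume z: "z \<in> topspace covT"
 obtain x r where zx: "z = (x, r)" by (cases z)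
 hence x: "x \<in> topspace X" "isarg x r" using z by (auto simp: covT_topspace)
 obtain U \<xi> p where U: "(U, \<xi>) \<in> P" "p \<in> U" "x = \<xi> p" using cover[OF x(1)] by blast
 obtain R f where R: "0 < R" "cball p R \<subseteq> U" "smooth (ball p R) f" "f p = r" "\<And>z. z \<in> ball p R ==> isarg (\<xi> z) (f z)"
  using branch[OF U(1,2)] x(2) U(3) by metis
 have "(ball p R, \<lambda>p. (\<xi> p, f p)) \<in> covP"
  by (rule covP_I[OF U(1) open_ball _ smooth_cont[OF R(3)] R(5)]) (use R(2) in auto)
 moreover have "z \<in> (\<lambda>p. (\<xi> p, f p)) ` ball p R" using R(1,4) U(3) zx by auto
 ultimately show "\<exists>U \<xi>. (U, \<xi>) \<in> covP \<and> z \<in> \<xi> ` U" by blast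
next
 fix V k assume "(V, k) \<in> covP"
 then obtain U \<xi> f where k: "(U, \<xi>) \<in> P" "open V" "V \<subseteq> U" "continuous_on V f" "\<And>p. p \<in> V ==> isarg (\<xi> p) (f p)" "k = (\<lambda>p. (\<xi> p, f p))"
  by (rule covP_E) (rule that)
 show "open V" by fact
 show "inj_on k V" using par_inj[OF k(1)] k(3,6) by (auto simp: inj_on_def)
 have ck: "continuous_map (top_of_set V) X \<xi>"
  using continuous_map_from_subtopology_mono[OF par_cont[OF k(1)] k(3)] .
 show "continuous_map (top_of_set V) covT k"
  unfolding covT_def continuous_map_in_subtopology k(6)
  using ck k(4,5) by (auto simp: continuous_map_pairwise o_def)
 fix N assume N: "open N" "N \<subseteq> V"
 show "openin covT (k ` N)"
 proof (subst openin_subopen, rule ballI)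
  fix z assume "z \<in> k ` N"
  then obtain p where p: "p \<in> N" "z = (\<xi> p, f p)" using k(6) by auto
  have "isCont f p" using k(2,4) N p continuous_on_eq_continuous_at by blast
  then obtain d where d: "d > 0" "\<And>q. dist q p < d ==> dist (f q) (f p) < 1"
   unfolding continuous_at_eps_delta by (metis zero_less_one)
  define N' where "N' = N \<inter> ball p d"
  have oN': "open N'" "N' \<subseteq> U" "p \<in> N'" using N k(3) p d by (auto simp: N'_def)
  \<comment> \<open>A point over the small set whose argument is within 1 of \<open>f p\<close> lies
    on the same sheet, because different arguments of one point are at least 2 \<pi> apart.\<close>
  define T where "T = topspace covT \<inter> (\<xi> ` N' \<times> ball (f p) 1)"
  have "openin (prod_topology X euclideanreal) (\<xi> ` N' \<times> ball (f p) 1)"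
   unfolding openin_prod_Times_iff using par_openmap[OF k(1) oN'(1,2)] by auto
  hence "openin covT T" unfolding covT_def T_def by (auto simp: openin_subtopology covT_topspace[unfolded covT_def])
  moreover have "z \<in> T" using p oN' k(5)[of p] N par_in[OF k(1)] by (auto simp: T_def covT_topspace)
  moreover have "T \<subseteq> k ` N"
  proof
   fix y assume y: "y \<in> T"
   then obtain q r where q: "q \<in> N'" "y = (\<xi> q, r)" "\<bar>r - f p\<bar> < 1" by (auto simp: T_def dist_real_def abs_minus_commute)
   have qV: "q \<in> V" using q N by (auto simp: N'_def)
   have "\<bar>f q - f p\<bar> < 1" using d(2)[of q] q by (auto simp: N'_def dist_real_def dist_commute)
   moreover have "isarg (\<xi> q) r" using y q by (auto simp: T_def covT_topspace)
   ultimately have "r = f q"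
    using isarg_close[of "\<xi> q" r "f q"] par_in[OF k(1)] qV k(3,5) q(3) by auto
   thus "y \<in> k ` N" using q by (auto simp: N'_def k(6))
  qed
  ultimately show "\<exists>T. openin covT T \<and> z \<in> T \<and> T \<subseteq> k ` N" by blast
 qed
next
 fix V k V' k' p q assume k0: "(V, k) \<in> covP" "(V', k') \<in> covP" and pq: "p \<in> V" "q \<in> V'" "k p = k' q"
 obtain U \<xi> f where k: "(U, \<xi>) \<in> P" "open V" "V \<subseteq> U" "continuous_on V f" "\<And>p. p \<in> V ==> isarg (\<xi> p) (f p)" "k = (\<lambda>p. (\<xi> p, f p))"
  by (rule covP_E[OF k0(1)]) (rule that)
 obtain U' \<xi>' f' where k': "(U', \<xi>') \<in> P" "open V'" "V' \<subseteq> U'" "continuous_on V' f'" "\<And>p. p \<in> V' ==> isarg (\<xi>' p) (f' p)" "k' = (\<lambda>p. (\<xi>' p, f' p))"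
  by (rule covP_E[OF k0(2)]) (rule that)
 have eq: "\<xi> p = \<xi>' q" "f p = f' q" using pq k(6) k'(6) by auto
 have pqU: "p \<in> U" "q \<in> U'" using pq k k' by auto
 obtain N t where t: "p \<in> N" "N \<subseteq> U" "smooth N t" "t ` N \<subseteq> U'" "\<forall>x\<in>N. \<xi>' (t x) = \<xi> x \<and> jac t x = 1"
  using par_trans[OF k(1) k'(1) pqU eq(1)] by blast
 have tp: "t p = q" using par_inj[OF k'(1)] t(1,4,5) eq(1) pqU(2) by (metis image_subset_iff inj_onD)
 have "open (N \<inter> t -` V')" by (rule smooth_vimage[OF t(3) k'(2)])
 hence "open (N \<inter> t -` V' \<inter> V)" using k(2) by blast
 moreover have "p \<in> N \<inter> t -` V' \<inter> V" using t(1) tp pq by simp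
 ultimately obtain d where d: "d > 0" "ball p d \<subseteq> N \<inter> t -` V' \<inter> V" using openE by blast
 let ?B = "ball p d"
 have st: "smooth ?B t" by (rule smooth_subset[OF t(3) open_ball]) (use d in auto)
 have cf: "continuous_on ?B f" by (rule continuous_on_subset[OF k(4)]) (use d in auto)
 have cf': "continuous_on ?B (\<lambda>x. f' (t x))"
  by (rule continuous_on_compose2[OF k'(4) smooth_cont[OF st]]) (use d in auto)
 have "cis (f x) = cis (f' (t x))" if "x \<in> ?B" for x
 proof -
  have x: "x \<in> V" "t x \<in> V'" "x \<in> N" using that d by auto
  hence "\<xi>' (t x) = \<xi> x" using t(5) by blast
  thus ?thesis using isarg_cis[of "\<xi> x" "f x" "f' (t x)"] par_in[OF k(1)] k(3,5) k'(5)[OF x(2)] x by auto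
 qed
 \<comment> \<open>Both are arguments of the same point, and at p they agree.\<close>
 hence "f x - f' (t x) = f p - f' (t p)" if "x \<in> ?B" for x
  using arg_difference_const[OF connected_ball cf cf', of p x] that d(1) by simp
 hence ff: "f x = f' (t x)" if "x \<in> ?B" for x using that eq(2) tp by fastforce
 show "\<exists>N t. p \<in> N \<and> N \<subseteq> V \<and> smooth N t \<and> t ` N \<subseteq> V' \<and> (\<forall>x\<in>N. k' (t x) = k x \<and> jac t x = 1)"
 proof (intro exI[of _ ?B] exI[of _ t] conjI ballI)
  show "p \<in> ?B" "?B \<subseteq> V" "t ` ?B \<subseteq> V'" "smooth ?B t" using d st by auto
  fix x assume x: "x \<in> ?B"
  thus "k' (t x) = k x" using t(5) d(2) ff[OF x] by (auto simp: k(6) k'(6))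
  show "jac t x = 1" using t(5) d(2) x by auto
 qed
qed

end

section \<open>Open subsurfaces and connected components\<close>

context osurf begin

definition restr :: "'a set => (complex set \<times> (complex => 'a)) set" where
 "restr O' = {(V, \<xi>). \<exists>U. (U, \<xi>) \<in> P \<and> open V \<and> V \<subseteq> U \<and> \<xi> ` V \<subseteq> O'}"

lemma osurf_openin:
 assumes O': "openin X O'"
 shows "osurf (subtopology X O') (restr O')" (is "osurf ?X ?P")
proof
 show "Hausdorff_space ?X" by (rule Hausdorff_space_subtopology[OF haus])
 fix x assume "x \<in> topspace ?X"
 hence x: "x \<in> O'" by simp
 obtain V \<xi> c R where k: "(V, \<xi>) \<in> P" "0 < R" "cball c R \<subseteq> V" "\<xi> c = x" "\<xi> ` cball c R \<subseteq> O'"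
  using chart_ball[OF O' x] by metis
 have sub: "ball c R \<subseteq> cball c R" by auto
 have "(ball c R, \<xi>) \<in> ?P" unfolding restr_def using k sub by blast
 moreover have "x \<in> \<xi> ` ball c R" using k by auto
 ultimately show "\<exists>U \<xi>. (U, \<xi>) \<in> ?P \<and> x \<in> \<xi> ` U" by blast
next
 fix V \<xi> assume "(V, \<xi>) \<in> ?P"
 then obtain U where U: "(U, \<xi>) \<in> P" "open V" "V \<subseteq> U" "\<xi> ` V \<subseteq> O'" unfolding restr_def by blast
 show "open V" by fact
 show "inj_on \<xi> V" by (rule inj_on_subset[OF par_inj[OF U(1)] U(3)])
 show "continuous_map (top_of_set V) ?X \<xi>"
  using continuous_map_from_subtopology_mono[OF par_cont[OF U(1)] U(3)] U(4)
  by (auto simp: continuous_map_in_subtopology)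
 fix N assume "open N" "N \<subseteq> V"
 hence "openin X (\<xi> ` N)" "\<xi> ` N \<subseteq> O'" using par_openmap[OF U(1) \<open>open N\<close>] U(3,4) by blast+
 thus "openin ?X (\<xi> ` N)" using O' by (simp add: openin_open_subtopology)
next
 fix V \<xi> V' \<xi>' p q assume "(V, \<xi>) \<in> ?P" "(V', \<xi>') \<in> ?P" and pq: "p \<in> V" "q \<in> V'" "\<xi> p = \<xi>' q"
 then obtain U U' where U: "(U, \<xi>) \<in> P" "open V" "V \<subseteq> U" and U': "(U', \<xi>') \<in> P" "open V'" "V' \<subseteq> U'" unfolding restr_def by blast
 have "p \<in> U" "q \<in> U'" using pq U U' by auto
 from par_trans[OF U(1) U'(1) this pq(3)] obtain N t where
  t: "p \<in> N" "N \<subseteq> U" "smooth N t" "t ` N \<subseteq> U'" "\<forall>x\<in>N. \<xi>' (t x) = \<xi> x \<and> jac t x = 1" by blast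
 have "\<xi>' (t p) = \<xi>' q" using t(1,5) pq(3) by simp
 hence tp: "t p = q" using par_inj[OF U'(1)] t(1,4) \<open>q \<in> U'\<close> by (meson image_subset_iff inj_onD)
 let ?N = "N \<inter> t -` V' \<inter> V"
 have oN: "open ?N" using smooth_vimage[OF t(3) U'(2)] U(2) by blast
 have "smooth ?N t" by (rule smooth_subset[OF t(3) oN]) auto
 thus "\<exists>N t. p \<in> N \<and> N \<subseteq> V \<and> smooth N t \<and> t ` N \<subseteq> V' \<and> (\<forall>x\<in>N. \<xi>' (t x) = \<xi> x \<and> jac t x = 1)"
  using t tp pq by (intro exI[of _ ?N] exI[of _ t]) auto
qed

lemma dens_openin_D:
 assumes "osurf.dens (restr O') U j \<mu>" and "osurf Y (restr O')"
 shows "dens U j \<mu>"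
 unfolding dens_def
proof
 fix p assume "p \<in> U"
 from osurf.densE[OF assms(2,1) this] obtain V \<xi> N l where
  l: "(V, \<xi>) \<in> restr O'" "p \<in> N" "N \<subseteq> U" "smooth N l" "l ` N \<subseteq> V" "\<And>x. x \<in> N ==> j x = \<xi> (l x)" "\<And>x. x \<in> N ==> jac l x = \<mu> x"
  by metis
 from l(1) obtain U' where "(U', \<xi>) \<in> P" "V \<subseteq> U'" unfolding restr_def by blast
 thus "\<exists>V \<xi> N l. (V, \<xi>) \<in> P \<and> p \<in> N \<and> N \<subseteq> U \<and> smooth N l \<and> l ` N \<subseteq> V \<and> (\<forall>x\<in>N. j x = \<xi> (l x) \<and> jac l x = \<mu> x)"
  using l by (intro exI[of _ U'] exI[of _ \<xi>] exI[of _ N] exI[of _ l]) auto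
qed

text \<open>Images of balls under parametrizations make the surface locally connected.\<close>

lemma openin_component:
 "openin X (Collect (connected_component_of X x))"
proof (subst openin_subopen, rule ballI)
 fix y assume "y \<in> Collect (connected_component_of X x)"
 hence y: "connected_component_of X x y" by simp
 hence "y \<in> topspace X" by (meson connected_component_in_topspace)
 then obtain V \<xi> c R where k: "(V, \<xi>) \<in> P" "0 < R" "cball c R \<subseteq> V" "\<xi> c = y"
  using chart_ball[of "topspace X" y] by (metis openin_topspace)
 have bV: "ball c R \<subseteq> V" using k(3) by auto
 have "connectedin X (\<xi> ` ball c R)"
  by (rule connectedin_continuous_map_image[OF par_cont[OF k(1)]]) (use bV in \<open>simp add: connectedin_subtopology\<close>)
 hence "connected_component_of X y z" if "z \<in> \<xi> ` ball c R" for z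
  using that k(2,4) unfolding connected_component_of_def by (intro exI[of _ "\<xi> ` ball c R"]) auto
 hence "\<xi> ` ball c R \<subseteq> Collect (connected_component_of X x)"
  using y connected_component_of_trans by fastforce
 moreover have "openin X (\<xi> ` ball c R)" by (rule par_openmap[OF k(1) open_ball bV])
 moreover have "y \<in> \<xi> ` ball c R" using k(2,4) by auto
 ultimately show "\<exists>T. openin X T \<and> y \<in> T \<and> T \<subseteq> Collect (connected_component_of X x)" by blast
qed

end

section \<open>Deck transformations and a component of the cover\<close>

context circ begin

definition deck :: "int => 'a \<times> real => 'a \<times> real" where
 "deck k z = (fst z, snd z + 2 * pi * of_int k)"

lemma isarg_shift: "isarg x (r + 2 * pi * of_int k) \<longleftrightarrow> isarg x r"
proof -
 have "cis (r + 2 * pi * of_int k) = cis r" unfolding cis_eq_iff by blast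
 thus ?thesis by (simp add: isarg_def)
qed

lemma deck_cont: "continuous_map covT covT (deck k)"
proof -
 have "continuous_map covT X fst" "continuous_map covT euclideanreal snd"
  unfolding covT_def by (auto intro: continuous_map_from_subtopology continuous_map_fst continuous_map_snd)
 hence "continuous_map covT (prod_topology X euclideanreal) (deck k)"
  unfolding deck_def by (auto simp: continuous_map_pairwise o_def intro!: continuous_map_add)
 thus ?thesis
  by (subst (2) covT_def) (auto simp: continuous_map_in_subtopology covT_topspace deck_def isarg_shift)
qed

text \<open>The image of the component under a deck transformation is connected, so one point that
  stays in the component keeps all of it there.\<close>

lemma deck_component:
 assumes "connected_component_of covT z0 z" "connected_component_of covT z0 (deck k z)" "connected_component_of covT z0 w"
 shows "connected_component_of covT z0 (deck k w)"
proof -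
 have "connectedin covT (deck k ` Collect (connected_component_of covT z0))"
  by (rule connectedin_continuous_map_image[OF deck_cont connectedin_connected_component_of])
 hence "connected_component_of covT (deck k z) (deck k w)"
  unfolding connected_component_of_def[of covT "deck k z"] using assms(1,3) by blast
 thus ?thesis by (rule connected_component_of_trans[OF assms(2)])
qed

lemma sheet:
 assumes "(U, \<xi>) \<in> P" "cball c R \<subseteq> U" "0 < R" "continuous_on (ball c R) f" "\<And>p. p \<in> ball c R ==> isarg (\<xi> p) (f p)"
  "p \<in> ball c R" "q \<in> ball c R"
 shows "connected_component_of covT (\<xi> p, f p) (\<xi> q, f q)"
proof -
 have bU: "ball c R \<subseteq> U" using assms(2) by auto
 have "(ball c R, \<lambda>p. (\<xi> p, f p)) \<in> covP" by (rule covP_I[OF assms(1) open_ball bU assms(4,5)])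
 from osurf.par_cont[OF cov_osurf this] have "connectedin covT ((\<lambda>p. (\<xi> p, f p)) ` ball c R)"
  by (rule connectedin_continuous_map_image) simp
 thus ?thesis unfolding connected_component_of_def using assms(6,7) by blast
qed

text \<open>If the component met every fibre at most once, it would be the graph of a continuous
  argument L on its projection A. The projection is open and closed, hence everything, and ln |h| +
  \<i> L would be a logarithm of h.\<close>

lemma component_return:
 assumes conn: "connected_space X" and x0: "x0 \<in> topspace X" "isarg x0 r0"
  and nolog: "\<not> (\<exists>lg. continuous_map X euclidean lg \<and> (\<forall>x\<in>topspace X. h x = exp (lg x :: complex)))"
 obtains k :: int where "k \<noteq> 0" "connected_component_of covT (x0, r0) (x0, r0 + 2 * pi * of_int k)"
proof (rule ccontr)
 assume "\<not> thesis"
 hence none: "k = 0" if "connected_component_of covT (x0, r0) (x0, r0 + 2 * pi * of_int k)" for k :: int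
  using that \<open>\<And>k. k \<noteq> 0 ==> connected_component_of covT (x0, r0) (x0, r0 + 2 * pi * of_int k) ==> thesis\<close> by blast
 let ?C = "connected_component_of covT (x0, r0)"
 have z0: "?C (x0, r0)" using x0 by (simp add: connected_component_of_refl covT_topspace)
 have inT: "x \<in> topspace X \<and> isarg x r" if "?C (x, r)" for x r
  using connected_component_in_topspace[OF that] by (simp add: covT_topspace)
 have uniq: "r = r'" if C: "?C (x, r)" "?C (x, r')" for x r r'
 proof -
  have "cis r' = cis r" using isarg_cis[of x r' r] inT C by blast
  then obtain k :: int where k: "r' = r + 2 * pi * of_int k" using cis_eq_iff by metis
  hence "deck k (x, r) = (x, r')" by (simp add: deck_def)
  hence "?C (deck k (x0, r0))" using deck_component[OF C(1) _ z0, of k] C(2) by simp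
  hence "k = 0" using none[of k] by (simp add: deck_def)
  thus ?thesis using k by simp
 qed
 define A where "A = {x. \<exists>r. ?C (x, r)}"
 have loc: "\<exists>U \<xi> c R f. (U, \<xi>) \<in> P \<and> 0 < R \<and> cball c R \<subseteq> U \<and> smooth (ball c R) f \<and> f c = r \<and> (\<forall>z\<in>ball c R. isarg (\<xi> z) (f z)) \<and> \<xi> c = x"
  if x: "x \<in> topspace X" "isarg x r" for x r
 proof -
  obtain U \<xi> c where U: "(U, \<xi>) \<in> P" "c \<in> U" "x = \<xi> c" using cover[OF x(1)] by blast
  obtain R f where R: "0 < R" "cball c R \<subseteq> U" "smooth (ball c R) f" "f c = r" "\<And>z. z \<in> ball c R ==> isarg (\<xi> z) (f z)"
   using branch[OF U(1,2), of r] x(2) U(3) by blast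
  thus ?thesis using U by (intro exI[of _ U] exI[of _ \<xi>] exI[of _ c] exI[of _ R] exI[of _ f]) auto
 qed
 have oA: "openin X A"
 proof (subst openin_subopen, rule ballI)
  fix x assume "x \<in> A"
  then obtain r where r: "?C (x, r)" by (auto simp: A_def)
  then obtain U \<xi> c R f where k: "(U, \<xi>) \<in> P" "0 < R" "cball c R \<subseteq> U" "smooth (ball c R) f" "f c = r"
   "\<forall>z\<in>ball c R. isarg (\<xi> z) (f z)" "\<xi> c = x" using loc[OF conjunct1[OF inT[OF r]] conjunct2[OF inT[OF r]]] by (elim exE conjE) (rule that)
  have "?C (\<xi> q, f q)" if q: "q \<in> ball c R" for q
  proof -
   have "connected_component_of covT (\<xi> c, f c) (\<xi> q, f q)"
    by (rule sheet[OF k(1,3,2) smooth_cont[OF k(4)]]) (use k(2,6) q in auto)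
   thus ?thesis using r k(5,7) connected_component_of_trans[of covT "(x0,r0)" "(x,r)"] by simp
  qed
  hence "\<xi> ` ball c R \<subseteq> A" unfolding A_def by blast
  moreover have "openin X (\<xi> ` ball c R)" by (rule par_openmap[OF k(1) open_ball]) (use k(3) in auto)
  moreover have "x \<in> \<xi> ` ball c R" using k(2,7) by auto
  ultimately show "\<exists>T. openin X T \<and> x \<in> T \<and> T \<subseteq> A" by blast
 qed
 have oB: "openin X (topspace X - A)"
 proof (subst openin_subopen, rule ballI)
  fix x assume x: "x \<in> topspace X - A"
  obtain r where r: "isarg x r" using isarg_ex by blast
  obtain U \<xi> c R f where k: "(U, \<xi>) \<in> P" "0 < R" "cball c R \<subseteq> U" "smooth (ball c R) f" "f c = r"
   "\<forall>z\<in>ball c R. isarg (\<xi> z) (f z)" "\<xi> c = x" using loc[OF DiffD1[OF x] r] by (elim exE conjE) (rule that)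
  have bU: "ball c R \<subseteq> U" using k(3) by auto
  have "\<xi> q \<notin> A" if q: "q \<in> ball c R" for q
  proof
   assume "\<xi> q \<in> A"
   then obtain s where s: "?C (\<xi> q, s)" by (auto simp: A_def)
   have "cis s = cis (f q)" using isarg_cis[of "\<xi> q" s "f q"] inT[OF s] k(6) q by auto
   then obtain m :: int where m: "s = f q + 2 * pi * of_int m" using cis_eq_iff by metis
   have "connected_component_of covT (\<xi> q, f q + 2 * pi * of_int m) (\<xi> c, f c + 2 * pi * of_int m)"
    using k q by (intro sheet[OF k(1,3,2)]) (auto simp: isarg_shift intro!: continuous_intros smooth_cont[OF k(4)])
   hence "?C (\<xi> c, f c + 2 * pi * of_int m)" using s m connected_component_of_trans by metis
   thus False using x k(7) by (auto simp: A_def)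
  qed
  hence "\<xi> ` ball c R \<subseteq> topspace X - A" using par_in[OF k(1)] bU by auto
  moreover have "openin X (\<xi> ` ball c R)" by (rule par_openmap[OF k(1) open_ball bU])
  moreover have "x \<in> \<xi> ` ball c R" using k(2,7) by auto
  ultimately show "\<exists>T. openin X T \<and> x \<in> T \<and> T \<subseteq> topspace X - A" by blast
 qed
 have x0A: "x0 \<in> A" using z0 by (auto simp: A_def)
 have AX: "topspace X \<subseteq> A"
 proof -
  have "connectedin X (topspace X)" using conn by (simp add: connectedin_topspace)
  hence "(topspace X - A) \<inter> topspace X = {}"
   by (rule connectedin_split[OF _ oA oB]) (use x0A x0 in auto)
  thus ?thesis by blast
 qed
 define L where "L x = (THE r. ?C (x, r))" for x
 have Leq: "L x = r" if "?C (x, r)" for x r unfolding L_def using that uniq by blast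
 have LC: "?C (x, L x)" if "x \<in> topspace X" for x
  using AX that Leq by (auto simp: A_def)
 define lg where "lg x = of_real (ln (cmod (h x))) + \<i> * of_real (L x)" for x
 have cL: "continuous_map X euclidean lg"
  unfolding continuous_map_def
 proof (intro conjI allI impI)
  fix W :: "complex set" assume "openin euclidean W"
  hence W: "open W" by simp
  show "openin X {x \<in> topspace X. lg x \<in> W}"
  proof (subst openin_subopen, rule ballI)
   fix x assume x: "x \<in> {x \<in> topspace X. lg x \<in> W}"
   hence xT: "x \<in> topspace X" by simp
   obtain U \<xi> c R f where k: "(U, \<xi>) \<in> P" "0 < R" "cball c R \<subseteq> U" "smooth (ball c R) f" "f c = L x"
    "\<forall>z\<in>ball c R. isarg (\<xi> z) (f z)" "\<xi> c = x" using loc[OF conjunct1[OF inT[OF LC[OF xT]]] conjunct2[OF inT[OF LC[OF xT]]]] by (elim exE conjE) (rule that)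
   have bU: "ball c R \<subseteq> U" using k(3) by auto
   have "?C (\<xi> q, f q)" if q: "q \<in> ball c R" for q
   proof -
    have "connected_component_of covT (\<xi> c, f c) (\<xi> q, f q)"
     by (rule sheet[OF k(1,3,2) smooth_cont[OF k(4)]]) (use k(2,6) q in auto)
    thus ?thesis using LC[of x] x k(5,7) connected_component_of_trans[of covT "(x0,r0)" "(x,L x)"] by simp
   qed
   hence Lf: "L (\<xi> q) = f q" if "q \<in> ball c R" for q using Leq that by blast
   have nz: "h (\<xi> q) \<noteq> 0" if "q \<in> ball c R" for q using h_nz par_in[OF k(1)] bU that by blast
   have "continuous_on (ball c R) (\<lambda>q. of_real (ln (cmod (h (\<xi> q)))) + \<i> * of_real (f q))"
    by (intro continuous_intros continuous_on_subset[OF smooth_cont[OF h_smooth[OF k(1)]] bU] smooth_cont[OF k(4)]) (use nz in auto)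
   hence "continuous_on (ball c R) (\<lambda>q. lg (\<xi> q))"
    by (rule continuous_on_eq) (simp add: lg_def Lf)
   hence "open (ball c R \<inter> (\<lambda>q. lg (\<xi> q)) -` W)" by (rule continuous_open_preimage[OF _ open_ball W])
   hence "openin X (\<xi> ` (ball c R \<inter> (\<lambda>q. lg (\<xi> q)) -` W))" by (rule par_openmap[OF k(1)]) (use bU in auto)
   moreover have "x \<in> \<xi> ` (ball c R \<inter> (\<lambda>q. lg (\<xi> q)) -` W)" using k(2,7) x by auto
   moreover have "\<xi> ` (ball c R \<inter> (\<lambda>q. lg (\<xi> q)) -` W) \<subseteq> {x \<in> topspace X. lg x \<in> W}"
    using par_in[OF k(1)] bU by auto
   ultimately show "\<exists>T. openin X T \<and> x \<in> T \<and> T \<subseteq> {x \<in> topspace X. lg x \<in> W}" by blast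
  qed
 qed auto
 have "h x = exp (lg x)" if x: "x \<in> topspace X" for x
 proof -
  have "h x = of_real (cmod (h x)) * cis (L x)" using inT[OF LC[OF x]] by (simp add: isarg_def)
  also have "\<dots> = exp (lg x)" using h_nz[OF x] by (simp add: lg_def exp_add cis_conv_exp exp_of_real)
  finally show ?thesis .
 qed
 thus False using nolog cL by blast
qed

text \<open>A nontrivial deck transformation mapping the component into itself carries one small
  disc to infinitely many disjoint discs of the same radius, as \<open>big_rectangle\<close> needs.
  The first coordinate of the resulting rectangle in the cover is j and the second is f, which is
  bounded because the rectangle lies in a compact set.\<close>

lemma cover_rectangle:
 assumes conn: "connected_space X" and ne: "topspace X \<noteq> {}"
  and nolog: "\<not> (\<exists>lg. continuous_map X euclidean lg \<and> (\<forall>x\<in>topspace X. h x = exp (lg x :: complex)))"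
 obtains A j f Mf where "a \<le> A" "0 < A" "dens (box 0 (Complex 1 A)) j (\<lambda>_. 1)" "smooth (box 0 (Complex 1 A)) f"
  "\<And>q. q \<in> box 0 (Complex 1 A) ==> isarg (j q) (f q)"
  "\<And>q q'. q \<in> box 0 (Complex 1 A) ==> q' \<in> box 0 (Complex 1 A) ==> j q = j q' ==> f q = f q' ==> q = q'"
  "\<And>q. q \<in> box 0 (Complex 1 A) ==> \<bar>f q\<bar> \<le> Mf"
proof -
 obtain x0 where x0: "x0 \<in> topspace X" using ne by blast
 obtain r0 where r0: "isarg x0 r0" using isarg_ex by blast
 obtain k where k: "k \<noteq> 0" "connected_component_of covT (x0, r0) (x0, r0 + 2 * pi * of_int k)"
  by (rule component_return[OF conn x0 r0 nolog]) (rule that)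
 interpret c: osurf covT covP by (rule cov_osurf)
 define C where "C = Collect (connected_component_of covT (x0, r0))"
 have oC: "openin covT C" unfolding C_def by (rule c.openin_component)
 have z0: "(x0, r0) \<in> C" using x0 r0 by (simp add: C_def connected_component_of_refl covT_topspace)
 have dC: "deck k w \<in> C" if "w \<in> C" for w
  using deck_component[of "(x0,r0)" "(x0,r0)" k w] z0 k(2) that by (simp add: C_def deck_def)
 have dC': "(x, r + 2 * pi * of_int (k * int n)) \<in> C" if "(x, r) \<in> C" for x r n
 proof (induction n)
  case (Suc n)
  have "deck k (x, r + 2 * pi * of_int (k * int n)) = (x, r + 2 * pi * of_int (k * int (Suc n)))"
   by (simp add: deck_def algebra_simps)
  thus ?case using dC[OF Suc] by simp
 qed (use that in simp)
 let ?PC = "c.restr C"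
 have osC: "osurf (subtopology covT C) ?PC" by (rule c.osurf_openin[OF oC])
 interpret d: osurf "subtopology covT C" ?PC by (rule osC)
 have "connectedin covT C" unfolding C_def by (rule connectedin_connected_component_of)
 hence connC: "connected_space (subtopology covT C)" by (simp add: connectedin_def)
 obtain V kk c0 R where kk: "(V, kk) \<in> covP" "0 < R" "cball c0 R \<subseteq> V" "kk c0 = (x0, r0)" "kk ` cball c0 R \<subseteq> C"
  using c.chart_ball[OF oC z0] by metis
 obtain U \<xi> f where u: "(U, \<xi>) \<in> P" "open V" "V \<subseteq> U" "continuous_on V f" "\<And>p. p \<in> V ==> isarg (\<xi> p) (f p)" "kk = (\<lambda>p. (\<xi> p, f p))"
  by (rule covP_E[OF kk(1)]) (rule that)
 \<comment> \<open>Translates of one sheet by powers of the deck transformation, disjoint because k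
   is not 0.\<close>
 define K where "K i = (\<lambda>p. (\<xi> p, f p + 2 * pi * of_int (k * int i)))" for i :: nat
 have KP: "(ball c0 R, K i) \<in> ?PC" for i
 proof -
  have "(V, K i) \<in> covP" unfolding K_def
   by (rule covP_I[OF u(1,2,3)]) (intro continuous_intros u(4), simp only: isarg_shift u(5))
  moreover have "K i ` ball c0 R \<subseteq> C"
  proof (rule image_subsetI)
   fix p assume p: "p \<in> ball c0 R"
   hence "p \<in> cball c0 R" by simp
   hence "(\<xi> p, f p) \<in> C" using kk(5) u(6) by blast
   thus "K i p \<in> C" unfolding K_def by (rule dC')
  qed
  moreover have "ball c0 R \<subseteq> V" using kk(3) by auto
  ultimately show ?thesis unfolding c.restr_def by blast
 qed
 have many: "\<exists>V \<xi> c. (\<forall>i<n. (V i, \<xi> i) \<in> ?PC \<and> cball (c i) (R/2) \<subseteq> V i) \<and>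
    (\<forall>i<n. \<forall>k<n. i \<noteq> k --> \<xi> i ` cball (c i) (R/2) \<inter> \<xi> k ` cball (c k) (R/2) = {})" for n :: nat
 proof (intro exI[of _ "\<lambda>_. ball c0 R"] exI[of _ K] exI[of _ "\<lambda>_. c0"] conjI allI impI)
  fix i show "(ball c0 R, K i) \<in> ?PC" by (rule KP)
  show "cball c0 (R/2) \<subseteq> ball c0 R" using kk(2) by auto
  fix m assume im: "i \<noteq> m"
  show "K i ` cball c0 (R/2) \<inter> K m ` cball c0 (R/2) = {}"
  proof (rule ccontr)
   assume "\<not> ?thesis"
   then obtain p q where pq: "p \<in> cball c0 (R/2)" "q \<in> cball c0 (R/2)" "K i p = K m q" by blast
   have "cball c0 (R/2) \<subseteq> cball c0 R" using kk(2) by (intro subset_cball) simp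
   hence "p \<in> U" "q \<in> U" using pq(1,2) kk(3) u(3) by blast+
   hence "p = q" using pq(3) par_inj[OF u(1)] unfolding K_def by (meson Pair_inject inj_onD)
   hence "of_int (k * int i) = (of_int (k * int m) :: real)" using pq(3) by (simp add: K_def)
   hence "k * int i = k * int m" by (simp only: of_int_eq_iff)
   thus False using k(1) im by simp
  qed
 qed
 have R2: "0 < R/2" using kk(2) by simp
 obtain A J Kk where J: "a \<le> A" "0 < A" "inj_on J (box 0 (Complex 1 A))" "d.dens (box 0 (Complex 1 A)) J (\<lambda>_. 1)"
  "compactin (subtopology covT C) Kk" "J ` box 0 (Complex 1 A) \<subseteq> Kk"
  using d.big_rectangle[OF connC R2 many] by metis
 let ?B = "box 0 (Complex 1 A)"
 have dJ: "c.dens ?B J (\<lambda>_. 1)" by (rule c.dens_openin_D[OF J(4) osC])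
 define j where "j q = fst (J q)" for q
 define F where "F q = snd (J q)" for q
 have JT: "J q \<in> topspace covT" if "q \<in> ?B" for q by (rule c.dens_in[OF dJ that])
 have aF: "isarg (j q) (F q)" "j q \<in> topspace X" if "q \<in> ?B" for q
  using JT[OF that] by (auto simp: covT_topspace j_def F_def split: prod.splits)
 have loc: "\<exists>N. q \<in> N \<and> N \<subseteq> ?B \<and> dens N j (\<lambda>_. 1) \<and> smooth N F" if q: "q \<in> ?B" for q
 proof -
  obtain V kk N l where l: "(V, kk) \<in> covP" "q \<in> N" "N \<subseteq> ?B" "smooth N l" "l ` N \<subseteq> V"
   "\<And>x. x \<in> N ==> J x = kk (l x)" "\<And>x. x \<in> N ==> jac l x = 1"
   by (rule c.densE[OF dJ q]) (rule that)
  obtain U \<xi> f where u: "(U, \<xi>) \<in> P" "open V" "V \<subseteq> U" "continuous_on V f" "\<And>p. p \<in> V ==> isarg (\<xi> p) (f p)" "kk = (\<lambda>p. (\<xi> p, f p))"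
   by (rule covP_E[OF l(1)]) (rule that)
  have jl: "j x = \<xi> (l x)" "F x = f (l x)" if "x \<in> N" for x using l(6)[OF that] u(6) by (auto simp: j_def F_def)
  have lU: "l ` N \<subseteq> U" using l(5) u(3) by blast
  have dN: "dens N j (\<lambda>_. 1)"
   by (rule dens_cong[OF dens_compose[OF dens_par[OF u(1)] l(4) lU]]) (use jl l(7) in auto)
  have lq: "l q \<in> V" "l q \<in> U" using l(2,5) lU by auto
  have "isarg (\<xi> (l q)) (F q)" using aF[OF q] jl[OF l(2)] by simp
  then obtain R' f' where f': "0 < R'" "cball (l q) R' \<subseteq> U" "smooth (ball (l q) R') f'" "f' (l q) = F q"
   "\<And>z. z \<in> ball (l q) R' ==> isarg (\<xi> z) (f' z)" using branch[OF u(1) lq(2)] by blast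
  have "open (N \<inter> l -` ball (l q) R')" by (rule smooth_vimage[OF l(4) open_ball])
  moreover have "q \<in> N \<inter> l -` ball (l q) R'" using l(2) f'(1) by simp
  ultimately obtain e where e: "e > 0" "ball q e \<subseteq> N \<inter> l -` ball (l q) R'" using openE by blast
  have eN: "ball q e \<subseteq> N" using e by blast
  have sl: "smooth (ball q e) l" by (rule smooth_subset[OF l(4) open_ball eN])
  have sf: "smooth (ball q e) (\<lambda>x. f' (l x))" by (rule smooth_compose[OF f'(3) sl]) (use e in auto)
  have cF: "continuous_on (ball q e) F"
  proof (rule continuous_on_eq)
   show "continuous_on (ball q e) (\<lambda>x. f (l x))"
    by (rule continuous_on_compose2[OF u(4) smooth_cont[OF sl]]) (use eN l(5) in blast)
  qed (use jl eN in auto)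
  \<comment> \<open>F is continuous and f' is smooth; both are arguments along j, so they differ by
    a constant.\<close>
  have "cis (F x) = cis (f' (l x))" if x: "x \<in> ball q e" for x
  proof -
   have xN: "x \<in> N" and lx: "l x \<in> ball (l q) R'" using x e by auto
   have "isarg (j x) (f' (l x))" using f'(5)[OF lx] jl(1)[OF xN] by simp
   thus ?thesis using isarg_cis[of "j x" "F x" "f' (l x)"] aF[of x] xN l(3) by auto
  qed
  hence "F x - f' (l x) = F q - f' (l q)" if "x \<in> ball q e" for x
   using arg_difference_const[OF connected_ball cF smooth_cont[OF sf], of q x] that e(1) by simp
  hence "f' (l x) = F x" if "x \<in> ball q e" for x using that f'(4) by fastforce
  hence "smooth (ball q e) F" by (rule smooth_cong[OF sf])
  moreover have "dens (ball q e) j (\<lambda>_. 1)" by (rule dens_subset[OF dN open_ball eN])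
  ultimately show ?thesis using e(1) eN l(3) by (intro exI[of _ "ball q e"]) auto
 qed
 have "compactin covT Kk" using J(5) by (simp add: compactin_subtopology)
 moreover have "continuous_map covT euclideanreal snd"
  unfolding covT_def by (rule continuous_map_from_subtopology[OF continuous_map_snd])
 ultimately have "compactin euclideanreal (snd ` Kk)" by (rule image_compactin)
 hence "bounded (snd ` Kk)" using compact_imp_bounded by simp
 then obtain Mf where Mf: "\<And>y. y \<in> snd ` Kk ==> norm y \<le> Mf" using bounded_iff by metis
 show ?thesis
 proof (rule that[of A j F Mf])
  show "a \<le> A" "0 < A" by fact+
  show "dens ?B j (\<lambda>_. 1)" by (rule dens_local) (use loc in blast)
  show "smooth ?B F" by (rule smooth_local) (use loc in blast)
  show "isarg (j q) (F q)" if "q \<in> ?B" for q by (rule aF(1)[OF that])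
  show "q = q'" if "q \<in> ?B" "q' \<in> ?B" "j q = j q'" "F q = F q'" for q q'
   using J(3) that unfolding j_def F_def by (meson inj_onD prod_eq_iff)
  show "\<bar>F q\<bar> \<le> Mf" if "q \<in> ?B" for q
  proof -
   have "J q \<in> Kk" using J(6) that by blast
   thus ?thesis using Mf[of "F q"] by (auto simp: F_def)
  qed
 qed
qed

text \<open>The linear map \<open>(x, y) \<mapsto> (x / t, t y)\<close> carries a large square into a long rectangle of width 1.\<close>

lemma square_embedding:
 assumes conn: "connected_space X" and ne: "topspace X \<noteq> {}"
  and nolog: "\<not> (\<exists>lg. continuous_map X euclidean lg \<and> (\<forall>x\<in>topspace X. h x = exp (lg x :: complex)))" and R: "0 < R"
 obtains Q W Rb where "ssymp area2 (sq R \<times> sq R) Q W" "inj_on (\<lambda>z. (Q z, W z)) (sq R \<times> sq R)" "\<And>z. z \<in> sq R \<times> sq R ==> cmod (W z) \<le> Rb"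
proof -
 obtain A j f Mf where c: "4 * R * R \<le> A" "0 < A" "dens (box 0 (Complex 1 A)) j (\<lambda>_. 1)" "smooth (box 0 (Complex 1 A)) f"
  "\<And>q. q \<in> box 0 (Complex 1 A) ==> isarg (j q) (f q)"
  "\<And>q q'. q \<in> box 0 (Complex 1 A) ==> q' \<in> box 0 (Complex 1 A) ==> j q = j q' ==> f q = f q' ==> q = q'"
  "\<And>q. q \<in> box 0 (Complex 1 A) ==> \<bar>f q\<bar> \<le> Mf"
  using cover_rectangle[OF conn ne nolog, of "4 * R * R"] by blast
 define g where "g = (\<lambda>z. Complex ((Re z + R) / (2 * R)) (2 * R * (Im z + R)))"
 have sg: "smooth (sq R) g" unfolding g_def using R
  by (intro smooth_Complex smooth_divide_real smooth_add smooth_mult smooth_Re smooth_Im smooth_ident smooth_const open_sq) auto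
 have gB: "g ` sq R \<subseteq> box 0 (Complex 1 A)"
 proof clarify
  fix z assume "z \<in> sq R"
  hence z: "-R < Re z" "Re z < R" "-R < Im z" "Im z < R" by (auto simp: sq_def)
  have "2 * R * (Im z + R) < 2 * R * (2 * R)" using z R by (intro mult_strict_left_mono) auto
  hence "2 * R * (Im z + R) < A" using c(1) by (simp add: algebra_simps)
  moreover have "0 < 2 * R * (Im z + R)" "0 < (Re z + R) / (2 * R)" "(Re z + R) / (2 * R) < 1" using z R by simp_all
  ultimately show "g z \<in> box 0 (Complex 1 A)" by (simp add: g_def in_box_complex_iff)
 qed
 have jg: "jac g z = 1" for z
 proof -
  have D: "(g has_derivative (\<lambda>h. Complex (Re h / (2 * R)) (2 * R * Im h))) (at z)"
  proof -
   have "((\<lambda>z. of_real ((Re z + R) / (2 * R)) + of_real (2 * R * (Im z + R)) * \<i>) has_derivative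
     (\<lambda>h. of_real (Re h / (2 * R)) + of_real (2 * R * Im h) * \<i>)) (at z)"
    using R by (auto intro!: derivative_eq_intros bounded_linear.has_derivative[OF bounded_linear_of_real]
     bounded_linear.has_derivative[OF bounded_linear_Re] bounded_linear.has_derivative[OF bounded_linear_Im])
   thus ?thesis by (simp add: g_def Complex_eq mult.commute)
  qed
  show ?thesis unfolding jac_def dd_eqI[OF D] using R by (simp add: area_form_def)
 qed
 have gi: "z = w" if "g z = g w" for z w using that R by (simp add: g_def complex_eq_iff)
 have d: "dens (sq R) (\<lambda>z. j (g z)) (\<lambda>_. 1)"
  by (rule dens_cong[OF dens_compose[OF c(3) sg gB]]) (use jg in auto)
 have sf: "smooth (sq R) (\<lambda>z. f (g z))" by (rule smooth_compose[OF c(4) sg gB])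
 show ?thesis
 proof (rule flow_embedding[OF d sf _ _ _ R])
  show "isarg (j (g q)) (f (g q))" if "q \<in> sq R" for q using c(5) gB that by blast
  show "q = q'" if "q \<in> sq R" "q' \<in> sq R" "j (g q) = j (g q')" "f (g q) = f (g q')" for q q'
   using c(6)[of "g q" "g q'"] gB that gi by blast
  show "\<bar>f (g q)\<bar> \<le> Mf" if "q \<in> sq R" for q using c(7) gB that by blast
 qed (rule that)
qed

end

section \<open>A circle-valued function from a nonseparating curve\<close>

text \<open>If the ratio were -t, then z would be the convex combination of a and b with weights 1 /
  (1 + t) and t / (1 + t), hence in the ball.\<close>

lemma ratio_not_nonpos:
 fixes a b c z :: complex
 assumes "a \<in> ball c r" "b \<in> ball c r" "z \<notin> ball c r"
 shows "(z - a) / (z - b) \<notin> \<real>\<^sub>\<le>\<^sub>0"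
proof
 assume "(z - a) / (z - b) \<in> \<real>\<^sub>\<le>\<^sub>0"
 then obtain t where t: "t \<ge> 0" "(z - a) / (z - b) = - of_real t"
  unfolding nonpos_Reals_def by (auto intro: that[of "- x" for x])
 have zb: "z \<noteq> b" using assms by auto
 have t1: "1 + t > 0" using t by simp
 have nz: "(1 + of_real t :: complex) \<noteq> 0" using t1 by (metis of_real_1 of_real_add of_real_eq_0_iff less_irrefl)
 have "z - a = - of_real t * (z - b)" using t(2) zb by (simp add: divide_eq_eq)
 hence "(1 + of_real t) * z = a + of_real t * b" by (simp add: algebra_simps)
 hence "z = (a + of_real t * b) / (1 + of_real t)" using nz by (simp add: nonzero_eq_divide_eq mult.commute)
 also have "\<dots> = (1 / (1 + t)) *\<^sub>R a + (t / (1 + t)) *\<^sub>R b" by (simp add: scaleR_conv_of_real add_divide_distrib)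
 also have "\<dots> \<in> ball c r"
  by (rule convexD[OF convex_ball assms(1,2)]) (use t t1 in \<open>auto simp: add_divide_distrib[symmetric]\<close>)
 finally show False using assms(3) by simp
qed

text \<open>Outside the ball the ratio has a logarithm; multiplying it by a cut-off function and
  exponentiating again deforms the ratio to 1. L is the resulting logarithm of g outside the ball,
  along which logarithms on a curve will be compared.\<close>

lemma ratio_cutoff:
 fixes a b c :: complex
 assumes ab: "a \<in> ball c r" "b \<in> ball c r" and r: "r < R"
 obtains g L where "smooth (- {a, b}) g" "\<And>z. z \<notin> {a, b} ==> g z \<noteq> 0"
  "\<And>z. dist c z \<le> r ==> g z = (z - a) / (z - b)" "\<And>z. R \<le> dist c z ==> g z = 1 \<and> L z = 0"
  "\<And>z. z \<notin> ball c r ==> g z = exp (L z)" "continuous_on (- ball c r) L"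
  "\<And>z. dist c z = r ==> L z = Ln ((z - a) / (z - b))"
proof -
 have r0: "0 < r" using ab by (metis ball_empty empty_iff not_le)
 \<comment> \<open>The cut-off starts only beyond r, so g is the ratio on a neighbourhood of the
   closed disc.\<close>
 define s where "s = (r + R) / 2"
 have s: "r < s" "s < R" using r by (auto simp: s_def)
 obtain bm :: "complex => real" where chi: "smooth UNIV bm" "\<And>z. 0 \<le> bm z \<and> bm z \<le> 1"
  "\<And>z. cmod (z - c) \<le> s ==> bm z = 1" "\<And>z. R \<le> cmod (z - c) ==> bm z = 0"
  by (rule bump[of s R c]) (use s r0 in auto)
 have chi': "dist c z \<le> s ==> bm z = 1" "R \<le> dist c z ==> bm z = 0" for z
  using chi(3)[of z] chi(4)[of z] by (auto simp: dist_norm norm_minus_commute)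
 define q where "q z = (z - a) / (z - b)" for z
 define L where "L z = of_real (bm z) * Ln (q z)" for z
 define g where "g z = (if z \<in> ball c r then q z else exp (L z))" for z
 have np: "q z \<notin> \<real>\<^sub>\<le>\<^sub>0" if "z \<notin> ball c r" for z unfolding q_def by (rule ratio_not_nonpos[OF ab that])
 hence q0: "q z \<noteq> 0" if "z \<notin> ball c r" for z using np[OF that] by auto
 have gq: "g z = q z" if "dist c z \<le> s" for z
  using chi'(1)[OF that] q0 by (auto simp: g_def L_def exp_Ln)
 have sq': "smooth V q" if "open V" "b \<notin> V" for V
  unfolding q_def using that by (intro smooth_divide smooth_diff' smooth_ident smooth_const) auto
 have "smooth (ball c s - {a, b}) g"
  by (rule smooth_cong[OF sq']) (auto simp: gq open_Diff)
 moreover have L: "smooth (- cball c r) L" unfolding L_def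
  by (intro smooth_mult smooth_of_real smooth_subset[OF chi(1)] smooth_Ln sq') (use np ab in auto)
 have "smooth (- cball c r) g"
  by (rule smooth_cong[OF smooth_exp[OF L]]) (auto simp: g_def)
 ultimately have sm: "smooth ((ball c s - {a, b}) \<union> - cball c r) g" by (rule smooth_Un)
 moreover have eq: "(ball c s - {a, b}) \<union> - cball c r = - {a, b}" using ab s by auto
 have g: "g z \<noteq> 0" if "z \<notin> {a, b}" for z using that by (auto simp: g_def q_def)
 show ?thesis
 proof (rule that[of g L])
  show "smooth (- {a, b}) g" using sm eq by simp
  show "g z \<noteq> 0" if "z \<notin> {a, b}" for z by (rule g[OF that])
  show "g z = (z - a) / (z - b)" if "dist c z \<le> r" for z using gq[of z] that s by (simp add: q_def)
  show "g z = 1 \<and> L z = 0" if "R \<le> dist c z" for z using chi'(2)[OF that] that r by (simp add: g_def L_def)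
  show "g z = exp (L z)" if "z \<notin> ball c r" for z using that by (simp add: g_def)
  have "continuous_on (- ball c r) q" unfolding q_def using ab by (auto intro!: continuous_intros)
  thus "continuous_on (- ball c r) L" unfolding L_def
   by (intro continuous_intros continuous_on_Ln continuous_on_subset[OF smooth_cont[OF chi(1)]]) (use np in auto)
  show "L z = Ln ((z - a) / (z - b))" if "dist c z = r" for z using chi'(1)[of z] that s by (simp add: L_def q_def)
 qed
qed

text \<open>By Borsuk, the directions of x - a and x - b along the curve are homotopic only if a and
  b lie in one component of the complement; a logarithm of the ratio would make them
  homotopic.\<close>

lemma jordan_no_log:
 fixes a b :: complex
 assumes "simple_path g" "pathfinish g = pathstart g" "a \<in> inside (path_image g)" "b \<in> outside (path_image g)"
  and m: "continuous_on (path_image g) m" "\<And>z. z \<in> path_image g ==> (z - a) / (z - b) = exp (m z)"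
 shows False
proof -
 let ?J = "path_image g"
 have ab: "a \<notin> ?J" "b \<notin> ?J" using assms(3,4) inside_no_overlap outside_no_overlap by blast+
 have cp: "compact ?J" using assms(1) by (simp add: compact_simple_path_image)
 have eq: "(x - a) /\<^sub>R cmod (x - a) / ((x - b) /\<^sub>R cmod (x - b)) = exp (\<i> * of_real (Im (m x)))" if x: "x \<in> ?J" for x
 proof -
  have xa: "x \<noteq> a" "x \<noteq> b" using x ab by auto
  have "(x - a) /\<^sub>R cmod (x - a) / ((x - b) /\<^sub>R cmod (x - b)) = ((x - a) / (x - b)) / of_real (cmod ((x - a) / (x - b)))"
   using xa by (simp add: scaleR_conv_of_real norm_divide divide_simps)
  also have "\<dots> = exp (m x) / of_real (exp (Re (m x)))" using m(2)[OF x] by simp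
  also have "\<dots> = exp (\<i> * of_real (Im (m x)))" by (simp add: exp_eq_polar[of "m x"] cis_conv_exp exp_of_real)
  finally show ?thesis .
 qed
 have "continuous_on ?J (\<lambda>x. (x - a) /\<^sub>R cmod (x - a))" "continuous_on ?J (\<lambda>x. (x - b) /\<^sub>R cmod (x - b))"
  using ab by (auto intro!: continuous_intros)
 moreover have "(\<lambda>x. (x - a) /\<^sub>R cmod (x - a)) ` ?J \<subseteq> sphere 0 1" "(\<lambda>x. (x - b) /\<^sub>R cmod (x - b)) ` ?J \<subseteq> sphere 0 1"
  using ab by (auto simp: divide_simps)
 moreover have "\<exists>g. continuous_on ?J g \<and> (\<forall>x\<in>?J. (x - a) /\<^sub>R cmod (x - a) / ((x - b) /\<^sub>R cmod (x - b)) = exp (\<i> * complex_of_real (g x)))"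
  using eq m(1) by (intro exI[of _ "\<lambda>x. Im (m x)"]) (auto intro!: continuous_intros)
 ultimately have "homotopic_with_canon (\<lambda>x. True) ?J (sphere 0 1) (\<lambda>x. (x - a) /\<^sub>R cmod (x - a)) (\<lambda>x. (x - b) /\<^sub>R cmod (x - b))"
  by (subst homotopic_circlemaps_divide) (auto simp: inessential_eq_continuous_logarithm_circle)
 hence "connected_component (- ?J) a b"
  using cp ab Borsuk_maps_homotopic_in_connected_component_eq by fastforce
 hence "b \<in> inside ?J" using inside_same_component[of ?J a b] assms(3) by blast
 thus False using assms(4) inside_Int_outside by blast
qed

text \<open>Used for the difference of two logarithms of one function along an arc, which is
  continuous with discrete values.\<close>

lemma exp_one_const:
 fixes \<delta> :: "real => complex"
 assumes "connected S" "continuous_on S \<delta>" "\<And>t. t \<in> S ==> exp (\<delta> t) = 1" "s \<in> S" "t \<in> S"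
 shows "\<delta> s = \<delta> t"
proof -
 have e: "cis (Im (\<delta> u)) = cis 0" "Re (\<delta> u) = 0" if "u \<in> S" for u
 proof -
  have "cmod (exp (\<delta> u)) = 1" using assms(3)[OF that] by simp
  thus r: "Re (\<delta> u) = 0" by simp
  have "exp (\<delta> u) = cis (Im (\<delta> u))" using r by (simp add: exp_eq_polar)
  thus "cis (Im (\<delta> u)) = cis 0" using assms(3)[OF that] by simp
 qed
 have "cis (Im (\<delta> u)) = 1" if "u \<in> S" for u using e(1)[OF that] by simp
 have "Im (\<delta> s) - Im (\<delta> t) = 0"
 proof -
  have ci: "continuous_on S (\<lambda>u. Im (\<delta> u) / (2 * pi))" by (intro continuous_intros assms(2)) auto
  have "Im (\<delta> u) / (2 * pi) \<in> \<int>" if u: "u \<in> S" for u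
  proof -
   obtain n :: int where "Im (\<delta> u) = 0 + 2 * pi * of_int n" using e(1)[OF u] cis_eq_iff by metis
   thus ?thesis by simp
  qed
  hence sub: "(\<lambda>u. Im (\<delta> u) / (2 * pi)) ` S \<subseteq> \<int>" by blast
  have "(\<lambda>u. Im (\<delta> u) / (2 * pi)) constant_on S"
  proof (rule continuous_discrete_range_constant[OF assms(1) ci])
   fix x assume x: "x \<in> S"
   show "\<exists>e>0. \<forall>y. y \<in> S \<and> Im (\<delta> y) / (2 * pi) \<noteq> Im (\<delta> x) / (2 * pi) --> e \<le> norm (Im (\<delta> y) / (2 * pi) - Im (\<delta> x) / (2 * pi))"
   proof (intro exI[of _ 1] conjI allI impI)
    fix y assume y: "y \<in> S \<and> Im (\<delta> y) / (2 * pi) \<noteq> Im (\<delta> x) / (2 * pi)"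
    have "Im (\<delta> y) / (2 * pi) - Im (\<delta> x) / (2 * pi) \<in> \<int>" using sub x y by (intro Ints_diff) auto
    moreover have "Im (\<delta> y) / (2 * pi) - Im (\<delta> x) / (2 * pi) \<noteq> 0" using y by simp
    ultimately show "1 \<le> norm (Im (\<delta> y) / (2 * pi) - Im (\<delta> x) / (2 * pi))" unfolding real_norm_def by (rule Ints_nonzero_abs_ge1)
   qed simp
  qed
  hence "Im (\<delta> s) / (2 * pi) = Im (\<delta> t) / (2 * pi)" using assms(4,5) unfolding constant_on_def by metis
  thus ?thesis by simp
 qed
 thus ?thesis using e(2) assms(4,5) by (simp add: complex_eq_iff)
qed

text \<open>In Wirtinger form the derivative is \<alpha> v + \<beta> cnj v, and a positive Jacobian
  means |\<beta>| < |\<alpha>|. So near p the difference quotient stays in a disc around \<alpha>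
  that misses 0, where a logarithm exists.\<close>

lemma orient_log:
 assumes l: "smooth N l" "p \<in> N" "jac l p > 0"
 obtains e lam where "e > 0" "ball p e \<subseteq> N" "smooth (ball p e - {p}) lam"
  "\<And>z. z \<in> ball p e - {p} ==> (l z - l p) / (z - p) = exp (lam z)"
proof -
 let ?D = "dd l p"
 have D: "(l has_derivative ?D) (at p)" using smooth_diff[OF l(1,2)] by (simp add: frechet_derivative_works)
 hence lin: "linear ?D" by (rule has_derivative_linear)
 define \<alpha> where "\<alpha> = (?D 1 - \<i> * ?D \<i>) / 2"
 define \<beta> where "\<beta> = (?D 1 + \<i> * ?D \<i>) / 2"
 have Dv: "?D v = \<alpha> * v + \<beta> * cnj v" for v
 proof -
  have "?D v = Re v *\<^sub>R ?D 1 + Im v *\<^sub>R ?D \<i>"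
  proof -
   have "v = Re v *\<^sub>R 1 + Im v *\<^sub>R \<i>" by (simp add: complex_eq_iff)
   hence "?D v = ?D (Re v *\<^sub>R 1 + Im v *\<^sub>R \<i>)" by simp
   also have "\<dots> = Re v *\<^sub>R ?D 1 + Im v *\<^sub>R ?D \<i>" by (simp only: linear_add[OF lin] linear_cmul[OF lin])
   finally show ?thesis .
  qed
  also have "\<dots> = \<alpha> * v + \<beta> * cnj v" by (simp add: \<alpha>_def \<beta>_def complex_eq_iff field_simps)
  finally show ?thesis .
 qed
 have "area_form (?D 1) (?D \<i>) = (cmod \<alpha>)\<^sup>2 - (cmod \<beta>)\<^sup>2"
  unfolding Dv area_form_def by (simp add: cmod_power2) (simp add: power2_eq_square algebra_simps)
 hence "(cmod \<beta>)\<^sup>2 < (cmod \<alpha>)\<^sup>2" using l(3) by (simp add: jac_def)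
 hence ab: "cmod \<beta> < cmod \<alpha>" by (rule power_less_imp_less_base) simp
 \<comment> \<open>Half the gap, so that the error of the linear approximation cannot close
   it.\<close>
 define \<epsilon> where "\<epsilon> = (cmod \<alpha> - cmod \<beta>) / 2"
 have eps: "\<epsilon> > 0" "cmod \<beta> + \<epsilon> < cmod \<alpha>" using ab by (auto simp: \<epsilon>_def field_simps)
 obtain d where d: "d > 0" "\<And>z. norm (z - p) < d ==> norm (l z - l p - ?D (z - p)) \<le> \<epsilon> * norm (z - p)"
  using D eps(1) unfolding has_derivative_at_alt by blast
 obtain d' where d': "d' > 0" "ball p d' \<subseteq> N" using smooth_open[OF l(1)] l(2) openE by blast
 define e where "e = min d d'"
 have e: "e > 0" "ball p e \<subseteq> N" "\<And>z. z \<in> ball p e ==> norm (z - p) < d"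
  using d d' by (auto simp: e_def dist_norm norm_minus_commute)
 define q where "q z = (l z - l p) / (z - p) / \<alpha>" for z
 have a0: "\<alpha> \<noteq> 0" using ab by auto
 have np: "q z \<notin> \<real>\<^sub>\<le>\<^sub>0" if z: "z \<in> ball p e - {p}" for z
 proof -
  have zp: "z - p \<noteq> 0" "norm (z - p) < d" using z e(3) by auto
  have eq: "l z - l p - \<alpha> * (z - p) = (l z - l p - ?D (z - p)) + \<beta> * cnj (z - p)" by (simp add: Dv)
  have "cmod (l z - l p - \<alpha> * (z - p)) \<le> \<epsilon> * cmod (z - p) + cmod \<beta> * cmod (z - p)"
   unfolding eq using d(2)[OF zp(2)] by (intro order_trans[OF norm_triangle_ineq] add_mono) (auto simp: norm_mult simp del: complex_cnj_diff)
  also have "\<dots> < cmod \<alpha> * cmod (z - p)" using eps(2) zp(1) by (simp add: distrib_right[symmetric])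
  finally have "cmod (l z - l p - \<alpha> * (z - p)) / cmod (\<alpha> * (z - p)) < 1" using zp a0 by (simp add: norm_mult)
  moreover have "q z - 1 = (l z - l p - \<alpha> * (z - p)) / (\<alpha> * (z - p))" using zp a0 by (simp add: q_def divide_simps)
  ultimately have "cmod (q z - 1) < 1" by (simp add: norm_divide)
  hence "\<bar>Re (q z - 1)\<bar> < 1" by (rule le_less_trans[OF abs_Re_le_cmod])
  hence "Re (q z) > 0" by simp
  thus ?thesis by (auto simp: complex_nonpos_Reals_iff)
 qed
 have op: "open (ball p e - {p})" by auto
 have sl: "smooth (ball p e - {p}) l" by (rule smooth_subset[OF l(1) op]) (use e(2) in auto)
 have sq': "smooth (ball p e - {p}) q" unfolding q_def
  by (intro smooth_divide smooth_diff' sl smooth_ident smooth_const op) (auto simp: a0)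
 show ?thesis
 proof (rule that[of e "\<lambda>z. Ln \<alpha> + Ln (q z)"])
  show "smooth (ball p e - {p}) (\<lambda>z. Ln \<alpha> + Ln (q z))"
   by (intro smooth_add smooth_const op smooth_Ln sq' np)
  fix z assume z: "z \<in> ball p e - {p}"
  have "q z \<noteq> 0" using np[OF z] by auto
  thus "(l z - l p) / (z - p) = exp (Ln \<alpha> + Ln (q z))" using a0 by (simp add: exp_add q_def)
 qed (use e in auto)
qed

lemma value_log:
 fixes f :: "complex => complex"
 assumes f: "smooth N f" "p \<in> N" "f p \<noteq> 0"
 obtains e lam where "e > 0" "ball p e \<subseteq> N" "smooth (ball p e) lam" "\<And>z. z \<in> ball p e ==> f z = exp (lam z)"
proof -
 have sq': "smooth N (\<lambda>z. f z / f p)" by (intro smooth_divide f smooth_const smooth_open[OF f(1)])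
 have "open (N \<inter> (\<lambda>z. f z / f p) -` ball 1 1)" by (rule continuous_open_preimage[OF smooth_cont[OF sq'] smooth_open[OF f(1)] open_ball])
 moreover have "p \<in> N \<inter> (\<lambda>z. f z / f p) -` ball 1 1" using f by simp
 ultimately obtain e where e: "e > 0" "ball p e \<subseteq> N \<inter> (\<lambda>z. f z / f p) -` ball 1 1" using openE by blast
 have eN: "ball p e \<subseteq> N" using e by blast
 have np: "f z / f p \<notin> \<real>\<^sub>\<le>\<^sub>0" if "z \<in> ball p e" for z
 proof -
  have "cmod (1 - f z / f p) < 1" using e(2) that by (auto simp: dist_norm)
  hence "\<bar>Re (1 - f z / f p)\<bar> < 1" by (rule le_less_trans[OF abs_Re_le_cmod])
  hence "Re (f z / f p) > 0" by simp
  thus ?thesis by (auto simp: complex_nonpos_Reals_iff)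
 qed
 show ?thesis
 proof (rule that[of e "\<lambda>z. Ln (f p) + Ln (f z / f p)"])
  show "smooth (ball p e) (\<lambda>z. Ln (f p) + Ln (f z / f p))"
   by (intro smooth_add smooth_const open_ball smooth_Ln smooth_subset[OF sq' open_ball eN] np)
  fix z assume z: "z \<in> ball p e"
  have "f z / f p \<noteq> 0" using np[OF z] by auto
  thus "f z = exp (Ln (f p) + Ln (f z / f p))" using f(3) by (simp add: exp_add)
 qed (use e eN in auto)
qed

lemma simple_closed_curve_compact:
 assumes "simple_closed_curve X C" shows "compactin X C" "C \<noteq> {}"
proof -
 obtain f where f: "embedding_map (top_of_set (sphere (0::complex) 1)) X f" "C = f ` sphere 0 1"
  using assms unfolding simple_closed_curve_def by blast
 have "continuous_map (top_of_set (sphere 0 1)) X f"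
  using f(1) by (auto simp: embedding_map_def continuous_map_in_subtopology dest: homeomorphic_imp_continuous_map)
 moreover have "compactin (top_of_set (sphere (0::complex) 1)) (sphere 0 1)" by (simp add: compactin_subtopology)
 ultimately show "compactin X C" using f(2) image_compactin by blast
 show "C \<noteq> {}" using f(2) by simp
qed

section \<open>Smooth functions on open subsets of the surface\<close>

context osurf begin

definition sfun :: "'a set => ('a => complex) => bool" where
 "sfun A g \<longleftrightarrow> openin X A \<and> (\<forall>U \<xi>. (U, \<xi>) \<in> P --> smooth {p \<in> U. \<xi> p \<in> A} (\<lambda>p. g (\<xi> p)))"

lemma sfun_Un: assumes "sfun A g" "sfun B g" shows "sfun (A \<union> B) g"
proof -
 have "{p \<in> U. \<xi> p \<in> A \<union> B} = {p \<in> U. \<xi> p \<in> A} \<union> {p \<in> U. \<xi> p \<in> B}" for U and \<xi> :: "complex => 'a" by auto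
 thus ?thesis using assms by (simp add: sfun_def openin_Un smooth_Un)
qed

lemma sfun_cong: "sfun A g ==> (\<And>x. x \<in> A ==> g x = g' x) ==> sfun A g'"
 unfolding sfun_def by (auto intro: smooth_cong)

lemma sfun_subset: assumes "sfun A g" "openin X B" "B \<subseteq> A" shows "sfun B g"
proof -
 have "smooth {p \<in> U. \<xi> p \<in> B} (\<lambda>p. g (\<xi> p))" if "(U, \<xi>) \<in> P" for U \<xi>
  by (rule smooth_subset[of "{p \<in> U. \<xi> p \<in> A}"]) (use assms that par_vimage[OF that assms(2)] in \<open>auto simp: sfun_def\<close>)
 thus ?thesis using assms(2) by (simp add: sfun_def)
qed

lemma sfun_mult: "sfun A g ==> sfun A g' ==> sfun A (\<lambda>x. g x * g' x)"
 unfolding sfun_def by (auto intro: smooth_mult)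

lemma sfun_const: "openin X A ==> sfun A (\<lambda>x. c)"
 unfolding sfun_def by (auto intro!: smooth_const par_vimage)

lemma emb_par: "(U, \<xi>) \<in> P ==> emb U \<xi>"
 unfolding emb_def using dens_par par_inj by fastforce

lemma emb_trans:
 assumes "emb U j" "(V, \<xi>) \<in> P" "M \<subseteq> V" "open M" "\<xi> ` M \<subseteq> j ` U"
 shows "smooth M (\<lambda>x. inv_into U j (\<xi> x))" "\<And>x. x \<in> M ==> 0 < jac (\<lambda>x. inv_into U j (\<xi> x)) x"
proof -
 obtain \<mu> where mu: "inj_on j U" "dens U j \<mu>" "\<And>x. x \<in> U ==> 0 < \<mu> x" using assms(1) unfolding emb_def by blast
 have d: "dens M \<xi> (\<lambda>_. 1)" by (rule dens_subset[OF dens_par[OF assms(2)] assms(4,3)])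
 show "smooth M (\<lambda>x. inv_into U j (\<xi> x))" by (rule emb_transition(1)[OF mu d assms(5)]) simp_all
 fix x assume x: "x \<in> M"
 have "inv_into U j (\<xi> x) \<in> U" using assms(5) x by (intro inv_into_into) blast
 moreover have "jac (\<lambda>x. inv_into U j (\<xi> x)) x = 1 / \<mu> (inv_into U j (\<xi> x))"
  by (rule emb_transition(2)[OF mu d assms(5) x]) simp_all
 ultimately show "0 < jac (\<lambda>x. inv_into U j (\<xi> x)) x" using mu(3) by simp
qed

lemma sfun_emb:
 assumes j: "emb U j" and V: "V \<subseteq> U" and g: "smooth V g"
 shows "sfun (j ` V) (\<lambda>x. g (inv_into U j x))"
proof -
 have oj: "openin X (j ` V)" by (rule emb_openmap[OF j smooth_open[OF g] V])
 have ij: "inj_on j U" using j unfolding emb_def by blast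
 have "smooth {p \<in> W. \<xi> p \<in> j ` V} (\<lambda>p. g (inv_into U j (\<xi> p)))" if W: "(W, \<xi>) \<in> P" for W \<xi>
 proof (rule smooth_compose[OF g])
  show "smooth {p \<in> W. \<xi> p \<in> j ` V} (\<lambda>p. inv_into U j (\<xi> p))"
   by (rule emb_trans(1)[OF j W _ par_vimage[OF W oj]]) (use V in auto)
  show "(\<lambda>p. inv_into U j (\<xi> p)) ` {p \<in> W. \<xi> p \<in> j ` V} \<subseteq> V"
  proof (rule image_subsetI)
   fix p assume "p \<in> {p \<in> W. \<xi> p \<in> j ` V}"
   then obtain v where "v \<in> V" "\<xi> p = j v" by blast
   thus "inv_into U j (\<xi> p) \<in> V" using ij V by (simp add: inv_into_f_f subset_iff)
  qed
 qed
 thus ?thesis using oj by (simp add: sfun_def)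
qed

lemma emb_compact: assumes "emb U j" "compact K" "K \<subseteq> U" shows "compactin X (j ` K)" "closedin X (j ` K)"
proof -
 obtain \<mu> where "dens U j \<mu>" using assms(1) unfolding emb_def by blast
 thus "compactin X (j ` K)" "closedin X (j ` K)" using dens_compact[OF _ assms(2,3)] by auto
qed

text \<open>The image of the closed disc is closed in \<open>X\<close>, so the extension by 1 is
  smooth on its complement, and the two open sets cover.\<close>

lemma sfun_extend:
 assumes j: "emb U j" and R: "cball c R \<subseteq> U" and g: "smooth (- A) g" "A \<subseteq> cball c R" "\<And>z. R \<le> dist c z ==> g z = 1"
 shows "sfun (topspace X - j ` A) (\<lambda>x. if x \<in> j ` U then g (inv_into U j x) else 1)"
proof -
 have ij: "inj_on j U" and oU: "open U" using j dens_open unfolding emb_def by auto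
 let ?f = "\<lambda>x. if x \<in> j ` U then g (inv_into U j x) else 1"
 have oA: "open (- A)" by (rule smooth_open[OF g(1)])
 have sg: "smooth (U - A) g" by (rule smooth_subset[OF g(1)]) (use oU oA in \<open>auto simp: Diff_eq\<close>)
 have "sfun (j ` (U - A)) ?f"
  by (rule sfun_cong[OF sfun_emb[OF j Diff_subset sg]]) auto
 moreover have "sfun (topspace X - j ` cball c R) ?f"
 proof (rule sfun_cong)
  show "sfun (topspace X - j ` cball c R) (\<lambda>_. 1)"
   by (rule sfun_const) (use emb_compact(2)[OF j compact_cball R] in blast)
  fix x assume x: "x \<in> topspace X - j ` cball c R"
  have "R \<le> dist c (inv_into U j x)" if "x \<in> j ` U"
  proof -
   have "j (inv_into U j x) = x" using that by (rule f_inv_into_f)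
   hence "inv_into U j x \<notin> cball c R" using x by (metis DiffE imageI)
   thus ?thesis by simp
  qed
  thus "1 = ?f x" using g(3) by simp
 qed
 ultimately have "sfun (j ` (U - A) \<union> (topspace X - j ` cball c R)) ?f" by (rule sfun_Un)
 moreover have "j ` (U - A) \<union> (topspace X - j ` cball c R) = topspace X - j ` A"
 proof -
  have "j ` U \<subseteq> topspace X" using openin_subset[OF emb_openmap[OF j oU order_refl]] .
  moreover have "j ` (U - A) = j ` U - j ` A" by (rule inj_on_image_set_diff[OF ij]) (use g(2) R in auto)
  moreover have "j ` A \<subseteq> j ` cball c R" "j ` cball c R \<subseteq> j ` U" using g(2) R by auto
  moreover have "(u - a) \<union> (t - k) = t - a" if "u \<subseteq> t" "a \<subseteq> k" "k \<subseteq> u" for u t a k :: "'a set" using that by blast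
  ultimately show ?thesis by simp
 qed
 ultimately show ?thesis by simp
qed

text \<open>A point around which g has a logarithm can be filled in: the logarithm is multiplied by
  a function that vanishes near the point and is 1 from distance e/2 on, and then
  exponentiated.\<close>

lemma sfun_repair:
 assumes g: "sfun A g" "\<And>x. x \<in> A ==> g x \<noteq> 0" and U: "(U, \<xi>) \<in> P" and e: "0 < e" "ball c e \<subseteq> U"
  and A: "\<xi> ` (ball c e - {c}) \<subseteq> A"
  and lam: "smooth (ball c e - {c}) lam" "\<And>z. z \<in> ball c e - {c} ==> g (\<xi> z) = exp (lam z)"
 obtains g' where "sfun (insert (\<xi> c) A) g'" "\<And>x. x \<in> insert (\<xi> c) A ==> g' x \<noteq> 0"
  "\<And>x. x \<notin> \<xi> ` ball c e ==> g' x = g x"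
proof -
 have inj: "inj_on \<xi> U" by (rule par_inj[OF U])
 obtain bm :: "complex => real" where chi: "smooth UNIV bm" "\<And>z. 0 \<le> bm z \<and> bm z \<le> 1"
  "\<And>z. cmod (z - c) \<le> e/3 ==> bm z = 1" "\<And>z. e/2 \<le> cmod (z - c) ==> bm z = 0"
  by (rule bump[of "e/3" "e/2" c]) (use e in auto)
 define u where "u z = (if cmod (z - c) \<le> e/3 then 0 else of_real (1 - bm z) * lam z)" for z
 have "smooth (ball c (e/3)) u"
  by (rule smooth_cong[OF smooth_const[OF open_ball]]) (auto simp: u_def dist_norm norm_minus_commute)
 moreover have "smooth (ball c e - {c}) u"
 proof (rule smooth_cong)
  show "smooth (ball c e - {c}) (\<lambda>z. of_real (1 - bm z) * lam z)"
   by (intro smooth_mult smooth_of_real smooth_diff' smooth_const lam(1) smooth_subset[OF chi(1)]) auto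
 qed (auto simp: u_def chi(3))
 ultimately have "smooth (ball c (e/3) \<union> (ball c e - {c})) u" by (rule smooth_Un)
 moreover have "ball c (e/3) \<union> (ball c e - {c}) = ball c e" using e(1) by auto
 ultimately have su: "smooth (ball c e) u" by simp
 define g' where "g' x = (if x \<in> \<xi> ` ball c e then exp (u (inv_into U \<xi> x)) else g x)" for x
 have "sfun (\<xi> ` ball c e) g'"
  by (rule sfun_cong[OF sfun_emb[OF emb_par[OF U] e(2) smooth_exp[OF su]]]) (simp add: g'_def)
 moreover have cl: "closedin X (\<xi> ` cball c (e/2))" by (rule par_compact[OF U compact_cball]) (use e in force)
 have "sfun (A - \<xi> ` cball c (e/2)) g'"
 proof (rule sfun_cong)
  show "sfun (A - \<xi> ` cball c (e/2)) g"
   by (rule sfun_subset[OF g(1)]) (use g(1) cl in \<open>auto simp: sfun_def intro: openin_diff\<close>)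
  fix x assume x: "x \<in> A - \<xi> ` cball c (e/2)"
  show "g x = g' x"
  proof (cases "x \<in> \<xi> ` ball c e")
   case True
   then obtain z where z: "z \<in> ball c e" "x = \<xi> z" by blast
   hence "z \<notin> cball c (e/2)" using x by blast
   hence zz: "e/2 < cmod (z - c)" by (simp add: dist_norm norm_minus_commute)
   hence "z \<noteq> c" "u z = lam z" using chi(4)[of z] e(1) by (auto simp: u_def)
   moreover have "inv_into U \<xi> x = z" using z e(2) inj by (simp add: inv_into_f_f subset_iff)
   ultimately show ?thesis using True z lam(2)[of z] by (simp add: g'_def)
  qed (simp add: g'_def)
 qed
 ultimately have "sfun (\<xi> ` ball c e \<union> (A - \<xi> ` cball c (e/2))) g'" by (rule sfun_Un)
 moreover have "\<xi> ` ball c e \<union> (A - \<xi> ` cball c (e/2)) = insert (\<xi> c) A"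
 proof -
  have "ball c e = insert c (ball c e - {c})" using e(1) by auto
  hence "\<xi> ` ball c e \<subseteq> insert (\<xi> c) A" using A by (metis image_insert insert_mono)
  moreover have "\<xi> ` cball c (e/2) \<subseteq> \<xi> ` ball c e" using e(1) by (intro image_mono) auto
  moreover have "\<xi> c \<in> \<xi> ` ball c e" using e(1) by auto
  ultimately show ?thesis by blast
 qed
 ultimately have "sfun (insert (\<xi> c) A) g'" by simp
 thus ?thesis
 proof (rule that)
  show "g' x \<noteq> 0" if "x \<in> insert (\<xi> c) A" for x using that g(2) e(1) by (auto simp: g'_def)
 qed (simp add: g'_def)
qed


lemma par_inv_cont:
 assumes "(U, \<xi>) \<in> P"
 shows "continuous_map (subtopology X (\<xi> ` U)) euclidean (inv_into U \<xi>)"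
 unfolding continuous_map_def
proof (intro conjI allI impI)
 fix N :: "complex set" assume "openin euclidean N"
 hence N: "open N" by simp
 have "{x \<in> topspace (subtopology X (\<xi> ` U)). inv_into U \<xi> x \<in> N} = \<xi> ` (U \<inter> N)"
  using par_inj[OF assms] par_in[OF assms] by (auto simp: inv_into_f_f)
 moreover have "openin X (\<xi> ` (U \<inter> N))" by (rule par_openmap[OF assms]) (use N par_open[OF assms] in auto)
 ultimately show "openin (subtopology X (\<xi> ` U)) {x \<in> topspace (subtopology X (\<xi> ` U)). inv_into U \<xi> x \<in> N}"
  unfolding openin_subtopology by (intro exI[of _ "\<xi> ` (U \<inter> N)"]) auto
qed auto

end

section \<open>Winding between two points on either side of a curve\<close>

definition cutoff_ratio :: "complex => complex => complex => real => real => (complex => complex) => (complex => complex) => bool" where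
 "cutoff_ratio a b c r R g L \<longleftrightarrow>
   (\<forall>z. dist c z \<le> r --> g z = (z - a) / (z - b)) \<and> (\<forall>z. R \<le> dist c z --> g z = 1 \<and> L z = 0) \<and>
   (\<forall>z. z \<notin> ball c r --> g z = exp (L z)) \<and> continuous_on (- ball c r) L \<and>
   (\<forall>z. dist c z = r --> L z = Ln ((z - a) / (z - b)))"

context osurf begin

text \<open>Near p the curve is an arc in a disc. Closed up along the bounding circle it becomes a
  Jordan curve in the plane, with a inside and b outside. A logarithm of the cut-off ratio along
  \<open>C\<close> is converted into a logarithm of the ratio itself along this Jordan curve, which
  \<open>jordan_no_log\<close> excludes.\<close>

lemma winding_fun:
 assumes C: "simple_closed_curve X C" and O': "openin X O'" "p \<in> O'" "p \<in> C"
 obtains U \<xi> c R r a b where "(U, \<xi>) \<in> P" "r < R" "cball c R \<subseteq> U" "\<xi> ` cball c R \<subseteq> O'" "a \<in> ball c r" "b \<in> ball c r"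
  "\<xi> a \<notin> C" "\<xi> b \<notin> C" "a \<noteq> b"
  "\<forall>g L lg. cutoff_ratio a b c r R g L --> continuous_map (subtopology X C) euclidean lg -->
   (\<forall>z\<in>U. \<xi> z \<in> C --> exp (lg (\<xi> z)) = g z) --> (\<forall>x\<in>C. x \<notin> \<xi> ` U --> exp (lg x) = 1) --> False"
proof -
 obtain f where f: "embedding_map (top_of_set (sphere (0::complex) 1)) X f" "C = f ` sphere 0 1"
  using C unfolding simple_closed_curve_def by blast
 have fc: "continuous_map (top_of_set (sphere 0 1)) X f" and fi: "inj_on f (sphere 0 1)"
  using f(1) by (auto simp: embedding_map_def dest: homeomorphic_imp_continuous_map homeomorphic_imp_injective_map
    simp: continuous_map_in_subtopology)
 have CX: "C \<subseteq> topspace X" using f(2) continuous_map_image_subset_topspace[OF fc] by auto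
 obtain s0 where s0: "s0 \<in> sphere 0 1" "p = f s0" using O'(3) f(2) by blast
 have ms0: "- s0 \<in> sphere 0 1" "- s0 \<noteq> s0" using s0(1) by auto
 \<comment> \<open>The point opposite to p. The disc is chosen to miss it, so the curve has to leave
   the disc on both sides of p.\<close>
 define q where "q = f (- s0)"
 have qp: "q \<noteq> p" using fi s0 ms0 unfolding q_def by (metis inj_onD)
 have qX: "q \<in> topspace X" using CX f(2) ms0 by (auto simp: q_def)
 have "closedin X {q}" using haus qX by (simp add: closedin_Hausdorff_singleton)
 hence "openin X (O' - {q})" using O'(1) by (simp add: openin_diff)
 moreover have "p \<in> O' - {q}" using O'(2) qp by simp
 ultimately obtain U \<xi> c R where k: "(U, \<xi>) \<in> P" "0 < R" "cball c R \<subseteq> U" "\<xi> c = p" "\<xi> ` cball c R \<subseteq> O' - {q}"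
  by (rule chart_ball) (rule that)
 have inj: "inj_on \<xi> U" by (rule par_inj[OF k(1)])
 have bU: "ball c R \<subseteq> U" using k(3) by auto
 define \<gamma> where "\<gamma> t = f (- s0 * cis t)" for t
 have sph: "- s0 * cis t \<in> sphere 0 1" for t using s0(1) by (simp add: norm_mult)
 have gC: "\<gamma> t \<in> C" for t using sph f(2) by (simp add: \<gamma>_def)
 have cg: "continuous_map euclideanreal X \<gamma>"
 proof -
  have "continuous_map euclideanreal (top_of_set (sphere 0 1)) (\<lambda>t. - s0 * cis t)"
   using sph by (auto simp: continuous_map_in_subtopology simp del: mult_minus_left intro!: continuous_intros)
  moreover have "\<gamma> = f \<circ> (\<lambda>t. - s0 * cis t)" by (rule ext) (simp add: \<gamma>_def)
  ultimately show ?thesis using continuous_map_compose fc by metis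
 qed
 have giq: "\<exists>n::int. t = s + 2 * pi * of_int n" if "\<gamma> t = \<gamma> s" for s t
 using inj_onD[OF fi, of "- s0 * cis t" "- s0 * cis s"] sph that s0(1) cis_eq_iff by (auto simp: \<gamma>_def)
 have ginj: "t = s" if ts: "\<gamma> t = \<gamma> s" "\<bar>t - s\<bar> < 2 * pi" for s t
 using giq[OF ts(1)] ts(2) by (auto simp: abs_mult)
 have g0: "\<gamma> 0 = q" "\<gamma> (2 * pi) = q" "\<gamma> pi = p" unfolding \<gamma>_def q_def s0(2) by simp_all
 have Crange: "\<exists>t\<in>{0..2 * pi}. x = \<gamma> t" if x: "x \<in> C" for x
 proof -
  obtain w where w: "w \<in> sphere 0 1" "x = f w" using x f(2) by blast
  have "- w / s0 = cis (Arg2pi (- w / s0))"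
   using Arg2pi_eq[of "- w / s0"] w(1) s0(1) by (simp add: norm_divide cis_conv_exp)
  hence "w = - s0 * cis (Arg2pi (- w / s0))" using s0(1) by (auto simp: field_simps)
  hence "x = \<gamma> (Arg2pi (- w / s0))" using w(2) by (simp add: \<gamma>_def)
  thus ?thesis using Arg2pi_ge_0 Arg2pi_lt_2pi by (intro bexI[of _ "Arg2pi (- w / s0)"]) (auto intro: less_imp_le)
 qed
 define D where "D = \<xi> ` ball c R"
 define D' where "D' = \<xi> ` cball c R"
 have oD: "openin X D" unfolding D_def by (rule par_openmap[OF k(1) open_ball bU])
 have cD': "closedin X D'" unfolding D'_def by (rule par_compact[OF k(1) compact_cball k(3)])
 have oT: "open {t. \<gamma> t \<in> G}" if "openin X G" for G
  using openin_continuous_map_preimage[OF cg that] by simp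
 have cT: "closed {t. \<gamma> t \<in> G}" if "closedin X G" for G
  using closedin_continuous_map_preimage[OF cg that] by simp
 have cnT: "closed {t. \<gamma> t \<notin> D}" using oT[OF oD] by (simp add: closed_def Collect_neg_eq)
 have q': "q \<notin> D'" "q \<notin> D" using k(5) image_mono[OF ball_subset_cball, of \<xi> c R] unfolding D'_def D_def by blast+
 have pD: "p \<in> D" using k(2,4) by (auto simp: D_def)
 \<comment> \<open>The arc through p is bounded by the last time before \<pi> and the first time
   after \<pi> at which the curve is outside the open disc.\<close>
 have "0 \<in> {0..pi} \<inter> {t. \<gamma> t \<notin> D}" using g0 q'(2) by simp
 hence "compact ({0..pi} \<inter> {t. \<gamma> t \<notin> D})" "{0..pi} \<inter> {t. \<gamma> t \<notin> D} \<noteq> {}"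
  using cnT by (blast intro!: compact_Int_closed)+
 then obtain \<alpha> where al: "\<alpha> \<in> {0..pi} \<inter> {t. \<gamma> t \<notin> D}" "\<And>t. t \<in> {0..pi} \<inter> {t. \<gamma> t \<notin> D} ==> t \<le> \<alpha>"
  using compact_attains_sup by metis
 have "2 * pi \<in> {pi..2 * pi} \<inter> {t. \<gamma> t \<notin> D}" using g0 q'(2) by simp
 hence "compact ({pi..2 * pi} \<inter> {t. \<gamma> t \<notin> D})" "{pi..2 * pi} \<inter> {t. \<gamma> t \<notin> D} \<noteq> {}"
  using cnT by (blast intro!: compact_Int_closed)+
 then obtain \<beta> where be: "\<beta> \<in> {pi..2 * pi} \<inter> {t. \<gamma> t \<notin> D}" "\<And>t. t \<in> {pi..2 * pi} \<inter> {t. \<gamma> t \<notin> D} ==> \<beta> \<le> t"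
  using compact_attains_inf by metis
 have ab: "0 \<le> \<alpha>" "\<alpha> < pi" "pi < \<beta>" "\<beta> \<le> 2 * pi" "\<gamma> \<alpha> \<notin> D" "\<gamma> \<beta> \<notin> D"
  using al(1) be(1) g0(3) pD by (auto simp: less_le)
 have inD: "\<gamma> t \<in> D" if "\<alpha> < t" "t < \<beta>" for t
  using al(2)[of t] be(2)[of t] that ab by (cases "t \<le> pi") fastforce+
 have inD': "\<gamma> t \<in> D'" if "t \<in> {\<alpha>..\<beta>}" for t
 proof -
  have "D \<subseteq> D'" by (auto simp: D_def D'_def)
  hence "{\<alpha><..<\<beta>} \<subseteq> {t. \<gamma> t \<in> D'}" using inD by auto
  hence "closure {\<alpha><..<\<beta>} \<subseteq> {t. \<gamma> t \<in> D'}" by (rule closure_minimal[OF _ cT[OF cD']])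
  moreover have "closure {\<alpha><..<\<beta>} = {\<alpha>..\<beta>}" using ab by (intro closure_greaterThanLessThan) simp
  ultimately show ?thesis using that by blast
 qed
 have ab': "0 < \<alpha>" "\<beta> < 2 * pi"
 proof -
  have "\<alpha> \<noteq> 0" using inD'[of \<alpha>] g0(1) q'(1) ab by auto
  thus "0 < \<alpha>" using ab(1) by simp
  have "\<beta> \<noteq> 2 * pi" using inD'[of \<beta>] g0(2) q'(1) ab by auto
  thus "\<beta> < 2 * pi" using ab(4) by simp
 qed
 define \<sigma> where "\<sigma> t = inv_into U \<xi> (\<gamma> t)" for t
 have D'U: "D' \<subseteq> \<xi> ` U" using k(3) by (auto simp: D'_def)
 have sig: "\<xi> (\<sigma> t) = \<gamma> t" "\<sigma> t \<in> U" if "\<gamma> t \<in> \<xi> ` U" for t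
  using that by (auto simp: \<sigma>_def f_inv_into_f inv_into_into)
 have invk: "inv_into U \<xi> (\<xi> z) = z" if "z \<in> U" for z using inj that by (rule inv_into_f_f)
 have sigc: "\<sigma> t \<in> cball c R" if "\<gamma> t \<in> D'" for t using that k(3) by (auto simp: D'_def \<sigma>_def invk subset_iff)
 have sigo: "\<sigma> t \<in> ball c R" if "\<gamma> t \<in> D" for t using that bU by (auto simp: D_def \<sigma>_def invk subset_iff)
 have signo: "\<sigma> t \<notin> ball c s" if "\<gamma> t \<notin> \<xi> ` ball c s" "\<gamma> t \<in> \<xi> ` U" for t s using sig[OF that(2)] that(1) by (metis imageI)
 have csig: "continuous_on I \<sigma>" if "\<And>t. t \<in> I ==> \<gamma> t \<in> \<xi> ` U" for I
 proof -
  have "continuous_map (top_of_set I) (subtopology X (\<xi> ` U)) \<gamma>"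
   using that by (auto simp: continuous_map_in_subtopology intro: continuous_map_from_subtopology[OF cg])
  from continuous_map_compose[OF this par_inv_cont[OF k(1)]] show ?thesis by (simp add: o_def \<sigma>_def)
 qed
 have gU: "\<gamma> t \<in> \<xi> ` U" if "t \<in> {\<alpha>..\<beta>}" for t using inD'[OF that] D'U by blast
 have sinj: "t = s" if "t \<in> {\<alpha>..\<beta>}" "s \<in> {\<alpha>..\<beta>}" "\<sigma> t = \<sigma> s" for t s
 using sig(1)[OF gU[OF that(1)]] sig(1)[OF gU[OF that(2)]] that(3) that ab ab' ginj by auto
 have abI: "\<alpha> \<in> {\<alpha>..\<beta>}" "\<beta> \<in> {\<alpha>..\<beta>}" "pi \<in> {\<alpha>..\<beta>}" using ab by auto
 have ends: "dist c (\<sigma> \<alpha>) = R" "dist c (\<sigma> \<beta>) = R"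
  using sigc[OF inD'[OF abI(1)]] signo[of \<alpha> R] ab(5) gU[OF abI(1)] sigc[OF inD'[OF abI(2)]] signo[of \<beta> R] ab(6) gU[OF abI(2)]
  by (auto simp: D_def)
 have sigpi: "\<sigma> pi = c" using invk[of c] subsetD[OF k(3), of c] k(2,4) g0(3) by (simp add: \<sigma>_def)
 \<comment> \<open>close the arc up along the circle\<close>
 define \<theta>1 where "\<theta>1 = Arg (\<sigma> \<alpha> - c)"
 define \<theta>2 where "\<theta>2 = Arg (\<sigma> \<beta> - c)"
 have nR: "cmod (\<sigma> \<alpha> - c) = R" "cmod (\<sigma> \<beta> - c) = R" using ends by (simp_all add: dist_norm norm_minus_commute)
 hence ne: "\<sigma> \<alpha> - c \<noteq> 0" "\<sigma> \<beta> - c \<noteq> 0" using k(2) by (metis norm_zero less_irrefl)+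
 have "\<sigma> \<alpha> - c = of_real R * exp (\<i> * of_real \<theta>1)" unfolding \<theta>1_def nR(1)[symmetric] by (rule Arg_eq[OF ne(1)])
 moreover have "\<sigma> \<beta> - c = of_real R * exp (\<i> * of_real \<theta>2)" unfolding \<theta>2_def nR(2)[symmetric] by (rule Arg_eq[OF ne(2)])
 ultimately have th: "\<sigma> \<alpha> = c + of_real R * exp (\<i> * of_real \<theta>1)" "\<sigma> \<beta> = c + of_real R * exp (\<i> * of_real \<theta>2)"
  by (simp_all add: diff_eq_eq add.commute)
 have thne: "\<theta>1 \<noteq> \<theta>2" using th sinj[OF abI(1,2)] ab by auto
 \<comment> \<open>Less than a full turn, so that the circular arc closing the curve is
   simple.\<close>
 have thb: "\<bar>\<theta>2 - \<theta>1\<bar> < 2 * pi"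
  using Arg_bounded[of "\<sigma> \<alpha> - c"] Arg_bounded[of "\<sigma> \<beta> - c"] by (auto simp: \<theta>1_def \<theta>2_def)
 define g1 where "g1 s = \<sigma> (\<alpha> + s * (\<beta> - \<alpha>))" for s
 define g2 where "g2 = part_circlepath c R \<theta>2 \<theta>1"
 have lin: "(\<lambda>s. \<alpha> + s * (\<beta> - \<alpha>)) ` {0..1} = {\<alpha>..\<beta>}"
 proof
  show "(\<lambda>s. \<alpha> + s * (\<beta> - \<alpha>)) ` {0..1} \<subseteq> {\<alpha>..\<beta>}"
  proof (rule image_subsetI)
   fix s :: real assume "s \<in> {0..1}"
   hence "0 \<le> s * (\<beta> - \<alpha>)" "s * (\<beta> - \<alpha>) \<le> 1 * (\<beta> - \<alpha>)" using ab by (auto intro!: mult_nonneg_nonneg mult_right_mono)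
   thus "\<alpha> + s * (\<beta> - \<alpha>) \<in> {\<alpha>..\<beta>}" by simp
  qed
  show "{\<alpha>..\<beta>} \<subseteq> (\<lambda>s. \<alpha> + s * (\<beta> - \<alpha>)) ` {0..1}"
  proof
   fix t assume t: "t \<in> {\<alpha>..\<beta>}"
   hence "t = \<alpha> + ((t - \<alpha>) / (\<beta> - \<alpha>)) * (\<beta> - \<alpha>)" "(t - \<alpha>) / (\<beta> - \<alpha>) \<in> {0..1}" using ab by (auto simp: divide_simps)
   thus "t \<in> (\<lambda>s. \<alpha> + s * (\<beta> - \<alpha>)) ` {0..1}" by blast
  qed
 qed
 have arc1: "arc g1"
  unfolding arc_def path_def
 proof
  show "continuous_on {0..1} g1" unfolding g1_def
   by (rule continuous_on_compose2[OF csig[of "{\<alpha>..\<beta>}"]]) (auto intro!: continuous_intros gU simp del: atLeastAtMost_iff simp: lin)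
  show "inj_on g1 {0..1}"
  proof (rule inj_onI)
   fix s t assume st: "s \<in> {0..1}" "t \<in> {0..1::real}" "g1 s = g1 t"
   hence "\<alpha> + s * (\<beta> - \<alpha>) = \<alpha> + t * (\<beta> - \<alpha>)"
    using sinj[of "\<alpha> + s * (\<beta> - \<alpha>)" "\<alpha> + t * (\<beta> - \<alpha>)"] lin unfolding g1_def by blast
   thus "s = t" using ab by simp
  qed
 qed
 have im1: "path_image g1 = \<sigma> ` {\<alpha>..\<beta>}" unfolding path_image_def g1_def lin[symmetric] image_image ..
 have arc2: "arc g2" unfolding g2_def by (rule arc_part_circlepath) (use k(2) thne thb in auto)
 have im2: "path_image g2 \<subseteq> {z. dist c z = R}"
  unfolding g2_def path_image_def using k(2) by (auto simp: part_circlepath_def dist_norm norm_mult)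
 have se: "pathstart g1 = \<sigma> \<alpha>" "pathfinish g1 = \<sigma> \<beta>" "pathstart g2 = \<sigma> \<beta>" "pathfinish g2 = \<sigma> \<alpha>"
  using th by (auto simp: pathstart_def pathfinish_def g1_def g2_def part_circlepath_def linepath_def)
 \<comment> \<open>Except for its end points the arc stays inside the circle, so it meets the
   closing arc only there.\<close>
 have J1R: "z = \<sigma> \<alpha> \<or> z = \<sigma> \<beta>" if z: "z \<in> \<sigma> ` {\<alpha>..\<beta>}" "dist c z = R" for z
 proof -
  obtain t where t: "t \<in> {\<alpha>..\<beta>}" "z = \<sigma> t" using z by blast
  show ?thesis
  using sigo[OF inD[of t]] t z(2) t(1) t(2) by fastforce
 qed
 let ?J = "path_image (g1 +++ g2)"
 have J: "?J = \<sigma> ` {\<alpha>..\<beta>} \<union> path_image g2" using path_image_join[of g1 g2] se im1 by simp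
 have sp: "simple_path (g1 +++ g2)"
  by (rule simple_path_join_loop[OF arc1 arc2]) (use se im1 im2 J1R in auto)
 have loop: "pathfinish (g1 +++ g2) = pathstart (g1 +++ g2)" using se by simp
 have cJ: "c \<in> ?J" using J sigpi abI(3) by (metis UnI1 imageI)
 have fr: "frontier (inside ?J) = ?J" "frontier (outside ?J) = ?J" using Jordan_inside_outside[OF sp loop] by auto
 \<comment> \<open>a small disc around the chosen point that meets the curve only in the arc\<close>
 define C' where "C' = \<gamma> ` ({0..\<alpha>} \<union> {\<beta>..2 * pi})"
 have "compactin X C'" unfolding C'_def by (rule image_compactin[OF _ cg]) auto
 hence "closedin X C'" using haus compactin_imp_closedin by blast
 hence oC': "open {z \<in> U. \<xi> z \<in> topspace X - C'}" by (intro par_vimage[OF k(1)]) auto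
 have pC': "p \<notin> C'"
 proof
  assume "p \<in> C'"
  then obtain t where t: "t \<in> {0..\<alpha>} \<union> {\<beta>..2 * pi}" "p = \<gamma> t" unfolding C'_def by blast
  hence t: "t \<in> {0..\<alpha>} \<union> {\<beta>..2 * pi}" "\<gamma> pi = \<gamma> t" using g0(3) by auto
  have "pi = t" by (rule ginj[OF t(2)]) (use t(1) ab ab' in auto)
  thus False using t(1) ab by auto
 qed
 have "c \<in> {z \<in> U. \<xi> z \<in> topspace X - C'}" using pC' k(4) subsetD[OF k(3), of c] par_in[OF k(1), of c] k(2) by simp
 then obtain r0 where r0: "r0 > 0" "ball c r0 \<subseteq> {z \<in> U. \<xi> z \<in> topspace X - C'}" using oC' openE by blast
 define r where "r = min r0 (R / 2)"
 have r: "0 < r" "r < R" and rC': "\<And>z. z \<in> ball c r ==> \<xi> z \<notin> C'" using r0 k(2) by (auto simp: r_def)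
 have "c \<in> closure (inside ?J)" "c \<in> closure (outside ?J)" using cJ fr by (auto simp: frontier_def)
 then obtain a b where a: "a \<in> inside ?J" "dist a c < r" and b: "b \<in> outside ?J" "dist b c < r"
  using r(1) unfolding closure_approachable by meson
 have abr: "a \<in> ball c r" "b \<in> ball c r" using a b by (auto simp: dist_commute)
 have aJ: "a \<notin> ?J" "b \<notin> ?J" using a b inside_no_overlap outside_no_overlap by blast+
 have nC: "\<xi> z \<notin> C" if z: "z \<in> ball c r" "z \<notin> ?J" for z
 proof
  assume "\<xi> z \<in> C"
  then obtain t where t: "t \<in> {0..2 * pi}" "\<xi> z = \<gamma> t" using Crange by blast
  have zU: "z \<in> U" using z(1) r bU by auto
  show False
  using invk[OF zU] t(2) z(2) J t(1) rC'[OF z(1)] by (fastforce simp: \<sigma>_def C'_def)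
 qed
 show thesis
 proof (rule that[of U \<xi> r R c a b])
  show "(U, \<xi>) \<in> P" "r < R" "cball c R \<subseteq> U" "a \<in> ball c r" "b \<in> ball c r" by fact+
  show "\<xi> ` cball c R \<subseteq> O'" using k(5) by blast
  show "\<xi> a \<notin> C" "\<xi> b \<notin> C" using nC abr aJ by auto
  show "a \<noteq> b" using a(1) b(1) inside_Int_outside by blast
  show "\<forall>g L lg. cutoff_ratio a b c r R g L --> continuous_map (subtopology X C) euclidean lg -->
   (\<forall>z\<in>U. \<xi> z \<in> C --> exp (lg (\<xi> z)) = g z) --> (\<forall>x\<in>C. x \<notin> \<xi> ` U --> exp (lg x) = 1) --> False"
  proof (intro allI impI)
  fix g L :: "complex => complex" and lg :: "'a => complex"
  assume cr: "cutoff_ratio a b c r R g L" and clg: "continuous_map (subtopology X C) euclidean lg"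
   and lgU': "\<forall>z\<in>U. \<xi> z \<in> C --> exp (lg (\<xi> z)) = g z" and lgn': "\<forall>x\<in>C. x \<notin> \<xi> ` U --> exp (lg x) = 1"
  have gr: "\<And>z. dist c z \<le> r ==> g z = (z - a) / (z - b)" and g1': "\<And>z. R \<le> dist c z ==> g z = 1 \<and> L z = 0"
   and gL: "\<And>z. z \<notin> ball c r ==> g z = exp (L z)" and cL: "continuous_on (- ball c r) L"
   and Lr: "\<And>z. dist c z = r ==> L z = Ln ((z - a) / (z - b))"
   using cr unfolding cutoff_ratio_def by blast+
  have lgU: "\<And>z. z \<in> U ==> \<xi> z \<in> C ==> exp (lg (\<xi> z)) = g z" and lgn: "\<And>x. x \<in> C ==> x \<notin> \<xi> ` U ==> exp (lg x) = 1"
   using lgU' lgn' by blast+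
  \<comment> \<open>A continuous logarithm of g along the rest of the curve: this rest stays outside
    the ball of radius r, where L is a logarithm, and g is 1 from radius R on and off the
    parametrization.\<close>
  define \<Lambda> where "\<Lambda> t = (if \<gamma> t \<in> \<xi> ` U then L (\<sigma> t) else 0)" for t
  have clgg: "continuous_on I (\<lambda>t. lg (\<gamma> t))" for I
  proof -
   have "continuous_map euclideanreal (subtopology X C) \<gamma>" using cg gC by (auto simp: continuous_map_in_subtopology)
   from continuous_map_compose[OF this clg] have "continuous_on UNIV (\<lambda>t. lg (\<gamma> t))" by (simp add: o_def)
   thus ?thesis by (rule continuous_on_subset) simp
  qed
  have off: "\<gamma> t \<notin> \<xi> ` ball c r" if "t \<in> {0..\<alpha>} \<union> {\<beta>..2 * pi}" for t
   using that rC' unfolding C'_def by (metis imageE imageI)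
  have c\<Lambda>: "continuous_on I \<Lambda>" if I: "closed I" "I \<subseteq> {0..\<alpha>} \<union> {\<beta>..2 * pi}" for I
  proof -
   have cl1: "closed (I \<inter> {t. \<gamma> t \<in> D'})" by (intro closed_Int I cT cD')
   have cl2: "closed (I \<inter> {t. \<gamma> t \<notin> D})" by (intro closed_Int I cnT)
   have "continuous_on (I \<inter> {t. \<gamma> t \<in> D'}) (\<lambda>t. L (\<sigma> t))"
   proof (rule continuous_on_compose2[OF cL csig])
    show "\<gamma> t \<in> \<xi> ` U" if "t \<in> I \<inter> {t. \<gamma> t \<in> D'}" for t using that D'U by blast
    show "\<sigma> ` (I \<inter> {t. \<gamma> t \<in> D'}) \<subseteq> - ball c r" using signo off I(2) D'U by blast
   qed
   hence c1: "continuous_on (I \<inter> {t. \<gamma> t \<in> D'}) \<Lambda>" by (rule continuous_on_eq) (use D'U in \<open>auto simp: \<Lambda>_def\<close>)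
   have c2: "continuous_on (I \<inter> {t. \<gamma> t \<notin> D}) \<Lambda>"
   proof (rule continuous_on_eq[OF continuous_on_const[of _ 0]])
    fix t assume t: "t \<in> I \<inter> {t. \<gamma> t \<notin> D}"
    thus "0 = \<Lambda> t" using signo[of t R] g1'[of "\<sigma> t"] by (auto simp: \<Lambda>_def D_def not_less)
   qed
   have "D \<subseteq> D'" by (auto simp: D_def D'_def)
   hence "I = (I \<inter> {t. \<gamma> t \<in> D'}) \<union> (I \<inter> {t. \<gamma> t \<notin> D})" by blast
   thus ?thesis using continuous_on_closed_Un[OF cl1 cl2 c1 c2] by simp
  qed
  have exp1: "exp (lg (\<gamma> t) - \<Lambda> t) = 1" if t: "t \<in> {0..\<alpha>} \<union> {\<beta>..2 * pi}" for t
  proof (cases "\<gamma> t \<in> \<xi> ` U")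
   case True
   have "exp (lg (\<gamma> t)) = g (\<sigma> t)" using lgU[OF sig(2)[OF True]] sig(1)[OF True] gC by simp
   also have "\<dots> = exp (L (\<sigma> t))" by (rule gL[OF signo[OF off[OF t] True]])
   finally show ?thesis using True by (simp add: \<Lambda>_def exp_diff)
  next
   case False thus ?thesis using lgn[OF gC False] by (simp add: \<Lambda>_def)
  qed
  \<comment> \<open>The rest of the curve is connected through q, at the parameters 0 and 2 \<pi>,
    so lg and \<Lambda> differ by one constant on it. As \<Lambda> is 0 at both ends of the arc, lg
    has the same value \<open>k0\<close> there.\<close>
  have e1: "lg (\<gamma> 0) - \<Lambda> 0 = lg (\<gamma> \<alpha>) - \<Lambda> \<alpha>"
   by (rule exp_one_const[of "{0..\<alpha>}" "\<lambda>t. lg (\<gamma> t) - \<Lambda> t"]) (use ab exp1 in \<open>auto intro!: continuous_on_diff clgg c\<Lambda>\<close>)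
  have e2: "lg (\<gamma> \<beta>) - \<Lambda> \<beta> = lg (\<gamma> (2 * pi)) - \<Lambda> (2 * pi)"
   by (rule exp_one_const[of "{\<beta>..2 * pi}" "\<lambda>t. lg (\<gamma> t) - \<Lambda> t"]) (use ab exp1 in \<open>auto intro!: continuous_on_diff clgg c\<Lambda>\<close>)
  have e3: "\<Lambda> 0 = \<Lambda> (2 * pi)" using g0 by (simp add: \<Lambda>_def \<sigma>_def)
  have e4: "\<Lambda> \<alpha> = 0" "\<Lambda> \<beta> = 0" using ends g1' by (auto simp: \<Lambda>_def)
  define k0 where "k0 = lg (\<gamma> \<alpha>)"
  have k0: "lg (\<gamma> \<alpha>) = k0" "lg (\<gamma> \<beta>) = k0" using e1 e2 e3 e4 g0 by (auto simp: k0_def)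
  have ek0: "exp k0 = 1" using exp1[of \<alpha>] ab e4 k0 by simp
  define Q where "Q z = Ln ((z - a) / (z - b))" for z
  \<comment> \<open>A logarithm of the ratio: in the small disc g is the ratio; in the annulus exp
    lg = exp L, so lg - L changes Q by a multiple of 2 \<pi> \<i>; on the circle L is 0 and this
    multiple is \<open>k0\<close>.\<close>
  define m where "m z = (if dist c z \<le> r then lg (\<xi> z) else if dist c z < R then lg (\<xi> z) + Q z - L z else Q z + k0)" for z
  have Qe: "exp (Q z) = (z - a) / (z - b)" if "z \<notin> ball c r" for z
  proof -
   have "(z - a) / (z - b) \<noteq> 0" using that abr by auto
   thus ?thesis by (simp add: Q_def)
  qed
  have cQ: "continuous_on (- ball c r) Q" unfolding Q_def
   by (intro continuous_intros continuous_on_Ln) (use abr ratio_not_nonpos[OF abr] in auto)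
  let ?A = "\<sigma> ` {\<alpha>..\<beta>}"
  have AU: "?A \<subseteq> U" and AC: "\<And>z. z \<in> ?A ==> \<xi> z \<in> C" and AR: "?A \<subseteq> cball c R" using sig gU gC sigc inD' by auto
  have ccA: "compact ?A" by (rule compact_continuous_image[OF csig[OF gU] compact_Icc])
  have clk: "continuous_on ?A (\<lambda>z. lg (\<xi> z))"
  proof -
   have "continuous_map (top_of_set ?A) (subtopology X C) \<xi>"
    using continuous_map_from_subtopology_mono[OF par_cont[OF k(1)] AU] AC by (auto simp: continuous_map_in_subtopology)
   from continuous_map_compose[OF this clg] show ?thesis by (simp add: o_def)
  qed
  have m1: "continuous_on (?A \<inter> cball c r) m"
   by (rule continuous_on_eq[OF continuous_on_subset[OF clk]]) (auto simp: m_def)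
  have m2: "continuous_on (?A - ball c r) m"
  proof (rule continuous_on_eq)
   show "continuous_on (?A - ball c r) (\<lambda>z. lg (\<xi> z) + Q z - L z)"
    by (intro continuous_on_diff continuous_on_add continuous_on_subset[OF clk] continuous_on_subset[OF cQ] continuous_on_subset[OF cL]) auto
   fix z assume z: "z \<in> ?A - ball c r"
   consider "dist c z = r" | "r < dist c z" "dist c z < R" | "dist c z = R" using z AR by fastforce
   thus "lg (\<xi> z) + Q z - L z = m z"
   proof cases
    case 1 thus ?thesis using Lr[of z] by (simp add: m_def Q_def)
   next
    case 2 thus ?thesis by (simp add: m_def)
   next
    case 3
    have "lg (\<xi> z) = k0" using J1R[OF _ 3] z k0 sig(1)[OF gU[OF abI(1)]] sig(1)[OF gU[OF abI(2)]] by auto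
    thus ?thesis using 3 r g1'[of z] by (simp add: m_def)
   qed
  qed
  have m3: "continuous_on (path_image g2) m"
  proof (rule continuous_on_eq)
   show "continuous_on (path_image g2) (\<lambda>z. Q z + k0)"
    by (intro continuous_on_add continuous_on_const continuous_on_subset[OF cQ]) (use im2 r in auto)
  qed (use im2 r in \<open>auto simp: m_def\<close>)
  have JJ: "?J = ((?A \<inter> cball c r) \<union> (?A - ball c r)) \<union> path_image g2" unfolding J by auto
  have "compact (path_image g2)" using arc2 by (simp add: compact_arc_image)
  hence cm: "continuous_on ?J m" unfolding JJ
   by (intro continuous_on_closed_Un closed_Un closed_Int closed_Diff m1 m2 m3 compact_imp_closed ccA) auto
  have em: "(z - a) / (z - b) = exp (m z)" if z: "z \<in> ?J" for z
  proof -
   consider "z \<in> ?A" "dist c z \<le> r" | "z \<in> ?A" "r < dist c z" "dist c z < R" | "dist c z = R"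
    using z AR im2 r unfolding J by fastforce
   thus ?thesis
   proof cases
    case 1
    thus ?thesis using lgU[of z] AU AC gr[of z] by (auto simp: m_def)
   next
    case 2
    have "exp (lg (\<xi> z)) = exp (L z)" using lgU[of z] AU AC gL[of z] 2 by auto
    thus ?thesis using 2 Qe[of z] by (simp add: m_def exp_add exp_diff)
   next
    case 3
    thus ?thesis using Qe[of z] r ek0 by (simp add: m_def exp_add)
   qed
  qed
  show False by (rule jordan_no_log[OF sp loop a(1) b(1) cm em])
  qed
 qed
qed

end

section \<open>The function dual to a nonseparating curve\<close>

context osurf begin

lemma emb_openin:
 assumes "openin X O'" "osurf.emb (restr O') U j"
 shows "emb U j" "j ` U \<subseteq> O'"
proof -
 interpret s: osurf "subtopology X O'" "restr O'" by (rule osurf_openin[OF assms(1)])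
 obtain \<mu> where mu: "inj_on j U" "s.dens U j \<mu>" "\<And>x. x \<in> U ==> 0 < \<mu> x" using assms(2) unfolding s.emb_def by blast
 have "dens U j \<mu>" by (rule dens_openin_D[OF mu(2) s.osurf_axioms])
 thus "emb U j" unfolding emb_def using mu by blast
 show "j ` U \<subseteq> O'" using s.dens_in[OF mu(2)] by auto
qed

text \<open>Small disjoint discs around the two points are engulfed by the unit disc. The radius 3
  of the whole disc leaves room for cutting off between radius 1 and radius 2.\<close>

lemma disc_through_two_points:
 assumes O': "openin X O'" "connectedin X O'" and U: "(U, \<xi>) \<in> P" "a \<in> U" "b \<in> U" "a \<noteq> b" "\<xi> a \<in> O'" "\<xi> b \<in> O'"
 obtains j where "emb (ball 0 3) j" "j ` ball 0 3 \<subseteq> O'" "\<xi> a \<in> j ` ball 0 1" "\<xi> b \<in> j ` ball 0 1"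
proof -
 interpret s: osurf "subtopology X O'" "restr O'" by (rule osurf_openin[OF O'(1)])
 define W where "W = {p \<in> U. \<xi> p \<in> O'}"
 have oW: "open W" unfolding W_def by (rule par_vimage[OF U(1) O'(1)])
 have WP: "(W, \<xi>) \<in> restr O'" unfolding restr_def using U(1) oW by (auto simp: W_def)
 have "a \<in> W" "b \<in> W" using U by (auto simp: W_def)
 then obtain e1 e2 where e: "e1 > 0" "cball a e1 \<subseteq> W" "e2 > 0" "cball b e2 \<subseteq> W" using oW by (meson open_contains_cball)
 define \<epsilon> where "\<epsilon> = min (min e1 e2) (dist a b / 3)"
 have eps: "\<epsilon> > 0" "cball a \<epsilon> \<subseteq> W" "cball b \<epsilon> \<subseteq> W"
  using e U(4) by (auto simp: \<epsilon>_def)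
 have dj: "cball a \<epsilon> \<inter> cball b \<epsilon> = {}"
 proof (rule ccontr)
  assume "\<not> ?thesis"
  then obtain z where "dist a z \<le> \<epsilon>" "dist b z \<le> \<epsilon>" by auto
  hence "dist a b \<le> \<epsilon> + \<epsilon>" using dist_triangle2[of a b z] by linarith
  moreover have "\<epsilon> \<le> dist a b / 3" "0 < dist a b" using U(4) by (auto simp: \<epsilon>_def)
  ultimately show False by linarith
 qed
 define cc where "cc i = (if i = (0::nat) then a else b)" for i
 have inj: "inj_on \<xi> W" by (rule s.par_inj[OF WP])
 have dk: "\<xi> ` cball a \<epsilon> \<inter> \<xi> ` cball b \<epsilon> = {}"
  using inj_on_image_Int[OF inj eps(2,3)] dj by simp
 have "\<exists>j. s.emb (ball 0 3) j \<and> (\<forall>i<2. \<xi> ` cball (cc i) (\<epsilon>/2) \<subseteq> j ` ball 0 1)"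
 proof (rule s.engulf[where V = "\<lambda>_. W" and \<xi> = "\<lambda>_. \<xi>" and R = "\<lambda>_. \<epsilon>" and c = cc])
  show "connected_space (subtopology X O')" using O'(2) by (simp add: connectedin_def)
  show "topspace (subtopology X O') \<noteq> {}" using U(5) O'(1) openin_subset by fastforce
  show "(W, \<xi>) \<in> restr O' \<and> 0 < \<epsilon> \<and> cball (cc i) \<epsilon> \<subseteq> W" for i using WP eps by (simp add: cc_def)
  show "\<xi> ` cball (cc i) \<epsilon> \<inter> \<xi> ` cball (cc k) \<epsilon> = {}" if "i < 2" "k < 2" "i \<noteq> k" for i k
  proof -
   have "i = 0 \<and> k = 1 \<or> i = 1 \<and> k = 0" using that by linarith
   thus ?thesis using dk by (auto simp: cc_def Int_commute)
  qed
 qed (auto intro: subset_ball)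
 then obtain j where j: "s.emb (ball 0 3) j" "\<forall>i<2. \<xi> ` cball (cc i) (\<epsilon>/2) \<subseteq> j ` ball 0 1" by blast
 have "\<xi> a \<in> j ` ball 0 1" using j(2)[rule_format, of 0] eps(1) by (auto simp: cc_def image_subset_iff)
 moreover have "\<xi> b \<in> j ` ball 0 1" using j(2)[rule_format, of 1] eps(1) by (auto simp: cc_def image_subset_iff)
 ultimately show ?thesis using that[of j] emb_openin[OF O'(1) j(1)] by blast
qed

text \<open>Near \<open>\<xi> x\<close> the quotient below has a logarithm: its zero and its pole cancel, as both coordinates
 induce the same orientation.\<close>

lemma cross_ratio_log:
 assumes j: "emb U' j" and U: "(U, \<xi>) \<in> P" "open M" "M \<subseteq> U" "\<xi> ` M \<subseteq> j ` U'"
  and x: "x \<in> M" "j x' = \<xi> x" "x' \<in> U'" and y: "y \<in> U" "j y' = \<xi> y" "y' \<in> U'" "x \<noteq> y"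
 obtains e lam where "e > 0" "ball x e \<subseteq> M" "y \<notin> ball x e" "smooth (ball x e - {x}) lam"
  "\<And>z. z \<in> ball x e - {x} ==>
    ((z - x) / (z - y)) * ((inv_into U' j (\<xi> z) - y') / (inv_into U' j (\<xi> z) - x')) = exp (lam z)"
proof -
 define l where "l z = inv_into U' j (\<xi> z)" for z
 have ij: "inj_on j U'" using j unfolding emb_def by blast
 have sl: "smooth M l" and jl: "jac l x > 0"
  unfolding l_def using emb_trans[OF j U(1,3,2,4)] x(1) by auto
 have lx: "l x = x'" using inv_into_f_f[OF ij x(3)] x(2) by (simp add: l_def)
 have xy': "x' \<noteq> y'"
 proof
  assume "x' = y'"
  hence "\<xi> x = \<xi> y" using x(2) y(2) by simp
  thus False using inj_onD[OF par_inj[OF U(1)]] x(1) y(1,4) U(3) by blast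
 qed
 obtain e1 l1 where l1: "e1 > 0" "ball x e1 \<subseteq> M" "smooth (ball x e1 - {x}) l1"
  "\<And>z. z \<in> ball x e1 - {x} ==> (l z - l x) / (z - x) = exp (l1 z)"
  by (rule orient_log[OF sl x(1) jl]) (rule that)
 have oM: "open (M - {y})" using U(2) by auto
 have sf: "smooth (M - {y}) (\<lambda>z. (l z - y') / (z - y))"
  by (intro smooth_divide smooth_diff' smooth_ident smooth_const oM smooth_subset[OF sl]) auto
 obtain e2 l2 where l2: "e2 > 0" "ball x e2 \<subseteq> M - {y}" "smooth (ball x e2) l2"
  "\<And>z. z \<in> ball x e2 ==> (l z - y') / (z - y) = exp (l2 z)"
  by (rule value_log[OF sf, of x]) (use x(1) y(4) lx xy' in auto)
 define e where "e = min e1 e2"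
 have e: "e > 0" "ball x e \<subseteq> ball x e1" "ball x e \<subseteq> ball x e2" using l1 l2 by (auto simp: e_def)
 show ?thesis
 proof (rule that[of e "\<lambda>z. l2 z - l1 z"])
  show "ball x e \<subseteq> M" "y \<notin> ball x e" using e l2(2) by blast+
  show "smooth (ball x e - {x}) (\<lambda>z. l2 z - l1 z)"
   by (intro smooth_diff' smooth_subset[OF l1(3)] smooth_subset[OF l2(3)]) (use e in auto)
  fix z assume z: "z \<in> ball x e - {x}"
  have 1: "(l z - x') / (z - x) = exp (l1 z)" using l1(4)[of z] z e(2) lx by auto
  have 2: "(l z - y') / (z - y) = exp (l2 z)" using l2(4)[of z] z e(3) by auto
  have "((z - x) / (z - y)) * ((l z - y') / (l z - x')) = ((l z - y') / (z - y)) / ((l z - x') / (z - x))" by simp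
  also have "\<dots> = exp (l2 z - l1 z)" unfolding 1 2 by (simp add: exp_diff)
  finally show "((z - x) / (z - y)) * ((inv_into U' j (\<xi> z) - y') / (inv_into U' j (\<xi> z) - x')) = exp (l2 z - l1 z)"
   by (simp only: l_def)
 qed (use e in auto)
qed

text \<open>G has a zero at \<xi> a and a pole at \<xi> b, on either side of C, and winds along C.
  As the complement of the curves is connected, these points also lie in a disc that meets no curve;
  there H has the opposite zero and pole. After the cancellation the product becomes smooth and
  nonvanishing, and on C it equals G, so \<open>winding_fun\<close> excludes a logarithm.\<close>

lemma circle_function:
 assumes F: "finite F" "disjoint F" "\<And>C. C \<in> F ==> simple_closed_curve X C"
  and conn: "connectedin X (topspace X - \<Union>F)" and C: "C \<in> F"
 obtains h Kc where "circ X P h Kc" "\<not> (\<exists>lg. continuous_map X euclidean lg \<and> (\<forall>x\<in>topspace X. h x = exp (lg x)))"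
proof -
 have comp: "compactin X D" "D \<noteq> {}" if "D \<in> F" for D
  using simple_closed_curve_compact[OF F(3)[OF that]] by auto
 have cl: "closedin X (\<Union>F')" if "F' \<subseteq> F" for F'
  using that finite_subset[OF that F(1)] comp haus compactin_imp_closedin by (intro closedin_Union) blast+
 define O1 where "O1 = topspace X - \<Union>(F - {C})"
 define O2 where "O2 = topspace X - \<Union>F"
 have oO: "openin X O1" "openin X O2" unfolding O1_def O2_def using cl by (auto intro!: openin_diff)
 obtain p where pC: "p \<in> C" using comp(2)[OF C] by blast
 have CX: "C \<subseteq> topspace X" using comp(1)[OF C] compactin_subset_topspace by blast
 have disjC: "C \<inter> D = {}" if "D \<in> F - {C}" for D using F(2) C that by (auto simp: disjoint_def pairwise_def disjnt_def)
 have pO1: "p \<in> O1" using pC CX disjC by (auto simp: O1_def)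
 obtain U \<xi> c R r a b where w: "(U, \<xi>) \<in> P" "r < R" "cball c R \<subseteq> U" "\<xi> ` cball c R \<subseteq> O1" "a \<in> ball c r" "b \<in> ball c r"
  "\<xi> a \<notin> C" "\<xi> b \<notin> C" "a \<noteq> b" and wno:
  "\<forall>g L lg. cutoff_ratio a b c r R g L --> continuous_map (subtopology X C) euclidean lg -->
   (\<forall>z\<in>U. \<xi> z \<in> C --> exp (lg (\<xi> z)) = g z) --> (\<forall>x\<in>C. x \<notin> \<xi> ` U --> exp (lg x) = 1) --> False"
  by (rule winding_fun[OF F(3)[OF C] oO(1) pO1 pC]) (rule that)
 have br: "ball c r \<subseteq> cball c R" "ball c r \<subseteq> U" using w(2,3) by auto
 have abU: "a \<in> U" "b \<in> U" using w(5,6) br by auto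
 have inj: "inj_on \<xi> U" by (rule par_inj[OF w(1)])
 have O2I: "\<xi> z \<in> O2" if "z \<in> ball c r" "\<xi> z \<notin> C" for z
 proof -
  have "\<xi> z \<in> O1" using that(1) br w(4) by blast
  thus ?thesis using that(2) C by (auto simp: O1_def O2_def)
 qed
 obtain j where j: "emb (ball 0 3) j" "j ` ball 0 3 \<subseteq> O2" "\<xi> a \<in> j ` ball 0 1" "\<xi> b \<in> j ` ball 0 1"
  by (rule disc_through_two_points[OF oO(2) _ w(1) abU w(9) O2I[OF w(5,7)] O2I[OF w(6,8)]])
   (use conn in \<open>simp add: O2_def\<close>, rule that)
 let ?B = "ball (0::complex) 3"
 obtain a' b' where ab': "a' \<in> ball 0 1" "b' \<in> ball 0 1" "j a' = \<xi> a" "j b' = \<xi> b" using j(3,4) by (metis imageE)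
 have B: "a' \<in> ?B" "b' \<in> ?B" using ab' by auto
 have ij: "inj_on j ?B" using j(1) unfolding emb_def by blast
 obtain g L where g: "smooth (- {a, b}) g" "\<And>z. z \<notin> {a, b} ==> g z \<noteq> 0"
  "\<And>z. dist c z \<le> r ==> g z = (z - a) / (z - b)" "\<And>z. R \<le> dist c z ==> g z = 1 \<and> L z = 0"
  "\<And>z. z \<notin> ball c r ==> g z = exp (L z)" "continuous_on (- ball c r) L"
  "\<And>z. dist c z = r ==> L z = Ln ((z - a) / (z - b))"
  by (rule ratio_cutoff[OF w(5,6,2)]) (rule that)
 \<comment> \<open>The points are exchanged, so that the zero of H falls on the pole of G and
   conversely.\<close>
 obtain k M where k: "smooth (- {b', a'}) k" "\<And>z. z \<notin> {b', a'} ==> k z \<noteq> 0"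
  "\<And>z. dist 0 z \<le> 1 ==> k z = (z - b') / (z - a')" "\<And>z. 2 \<le> dist 0 z ==> k z = 1 \<and> M z = 0"
  "\<And>z. z \<notin> ball 0 1 ==> k z = exp (M z)" "continuous_on (- ball 0 1) M"
  "\<And>z. dist 0 z = 1 ==> M z = Ln ((z - b') / (z - a'))"
  by (rule ratio_cutoff[OF ab'(2,1), of 2]) (simp, rule that)
 define G where "G x = (if x \<in> \<xi> ` U then g (inv_into U \<xi> x) else 1)" for x
 define H where "H x = (if x \<in> j ` ?B then k (inv_into ?B j x) else 1)" for x
 define A where "A = topspace X - {\<xi> a, \<xi> b}"
 have "sfun (topspace X - \<xi> ` {a, b}) G" unfolding G_def
  by (rule sfun_extend[OF emb_par[OF w(1)] w(3) g(1)]) (use g(4) w(5,6) br in auto)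
 hence sG: "sfun A G" by (simp add: A_def)
 have "cball 0 2 \<subseteq> ?B" by auto
 hence "sfun (topspace X - j ` {b', a'}) H" unfolding H_def
  by (rule sfun_extend[OF j(1) _ k(1)]) (use k(4) ab' in auto)
 hence sH: "sfun A H" using ab'(3,4) by (simp add: A_def insert_commute)
 have Gk: "G (\<xi> z) = g z" if "z \<in> U" for z using that inj by (simp add: G_def inv_into_f_f)
 have Gnz: "G x \<noteq> 0" if "x \<in> A" for x
 proof (cases "x \<in> \<xi> ` U")
  case True
  then obtain z where z: "z \<in> U" "x = \<xi> z" by blast
  hence "z \<notin> {a, b}" using that by (auto simp: A_def)
  thus ?thesis using Gk z g(2) by simp
 qed (simp add: G_def)
 have Hnz: "H x \<noteq> 0" if "x \<in> A" for x
 proof (cases "x \<in> j ` ?B")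
  case True
  then obtain z where z: "z \<in> ?B" "x = j z" by blast
  hence "z \<notin> {b', a'}" using that ab' by (auto simp: A_def)
  thus ?thesis using True z k(2) ij by (simp add: H_def inv_into_f_f)
 qed (simp add: H_def)
 define h0 where "h0 x = G x * H x" for x
 have s0: "sfun A h0" unfolding h0_def by (rule sfun_mult[OF sG sH])
 have nz0: "h0 x \<noteq> 0" if "x \<in> A" for x using Gnz Hnz that by (simp add: h0_def)
 \<comment> \<open>Here neither cut-off is active, so h0 is the product of the two pure
   ratios.\<close>
 define N where "N = {z \<in> U. \<xi> z \<in> j ` ball 0 1} \<inter> ball c r"
 have oN: "open N" unfolding N_def
  by (intro open_Int open_ball par_vimage[OF w(1)] emb_openmap[OF j(1)]) auto
 have NU: "N \<subseteq> U" "\<xi> ` N \<subseteq> j ` ?B" "N \<subseteq> ball c r" by (auto simp: N_def)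
 have abN: "a \<in> N" "b \<in> N" using abU j(3,4) w(5,6) by (auto simp: N_def)
 have h0N: "h0 (\<xi> z) = ((z - a) / (z - b)) * ((inv_into ?B j (\<xi> z) - b') / (inv_into ?B j (\<xi> z) - a'))" if z: "z \<in> N" for z
 proof -
  obtain v where v: "v \<in> ball 0 1" "\<xi> z = j v" using z by (auto simp: N_def)
  hence "v \<in> ?B" by auto
  hence "inv_into ?B j (\<xi> z) = v" "\<xi> z \<in> j ` ?B" using ij v by (simp_all add: inv_into_f_f)
  hence "H (\<xi> z) = (v - b') / (v - a')" "inv_into ?B j (\<xi> z) = v" using v(1) k(3)[of v] by (simp_all add: H_def)
  moreover have "G (\<xi> z) = (z - a) / (z - b)" using Gk[of z] z g(3)[of z] by (auto simp: N_def)
  ultimately show ?thesis by (simp add: h0_def)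
 qed
 obtain ea la where la: "ea > 0" "ball a ea \<subseteq> N" "b \<notin> ball a ea" "smooth (ball a ea - {a}) la"
  "\<And>z. z \<in> ball a ea - {a} ==> ((z - a) / (z - b)) * ((inv_into ?B j (\<xi> z) - b') / (inv_into ?B j (\<xi> z) - a')) = exp (la z)"
  by (rule cross_ratio_log[OF j(1) w(1) oN NU(1,2) abN(1) ab'(3) B(1) abU(2) ab'(4) B(2) w(9)]) (rule that)
 \<comment> \<open>At b the lemma concerns the inverse of h0, whence the sign of lb below.\<close>
 obtain eb lb where lb: "eb > 0" "ball b eb \<subseteq> N" "a \<notin> ball b eb" "smooth (ball b eb - {b}) lb"
  "\<And>z. z \<in> ball b eb - {b} ==> ((z - b) / (z - a)) * ((inv_into ?B j (\<xi> z) - a') / (inv_into ?B j (\<xi> z) - b')) = exp (lb z)"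
  by (rule cross_ratio_log[OF j(1) w(1) oN NU(1,2) abN(2) ab'(4) B(2) abU(1) ab'(3) B(1) w(9)[symmetric]]) (rule that)
 define e where "e = min (min ea eb) (dist a b / 2)"
 have e: "e > 0" "e \<le> ea" "e \<le> eb" "ball a e \<subseteq> N" "ball b e \<subseteq> N" "a \<notin> ball b e" "b \<notin> ball a e"
  using la lb w(9) by (auto simp: e_def)
 have edisj: "ball a e \<inter> ball b e = {}"
 proof (rule ccontr)
  assume "\<not> ?thesis"
  then obtain z where "dist a z < e" "dist b z < e" by auto
  hence "dist a b < e + e" using dist_triangle2[of a b z] by linarith
  thus False by (simp add: e_def)
 qed
 have inA: "\<xi> z \<in> A" if "z \<in> U" "z \<noteq> a" "z \<noteq> b" for z
  using that abU par_in[OF w(1)] inj by (auto simp: A_def inj_on_eq_iff)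
 obtain h1 where h1: "sfun (insert (\<xi> a) A) h1" "\<And>x. x \<in> insert (\<xi> a) A ==> h1 x \<noteq> 0" "\<And>x. x \<notin> \<xi> ` ball a e ==> h1 x = h0 x"
 proof (rule sfun_repair[OF s0 nz0 w(1) e(1), of a la])
  show "ball a e \<subseteq> U" using e(4) NU by blast
  show "\<xi> ` (ball a e - {a}) \<subseteq> A" using inA e(4,7) NU(1) by blast
  show "smooth (ball a e - {a}) la" by (rule smooth_subset[OF la(4)]) (use e(2) in auto)
  fix z assume z: "z \<in> ball a e - {a}"
  hence "z \<in> N" "z \<in> ball a ea - {a}" using e by auto
  thus "h0 (\<xi> z) = exp (la z)" using h0N la(5) by simp
 qed (assumption, rule that)
 obtain h where h: "sfun (insert (\<xi> b) (insert (\<xi> a) A)) h" "\<And>x. x \<in> insert (\<xi> b) (insert (\<xi> a) A) ==> h x \<noteq> 0"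
  "\<And>x. x \<notin> \<xi> ` ball b e ==> h x = h1 x"
 proof (rule sfun_repair[OF h1(1,2) w(1) e(1), of b "\<lambda>z. - lb z"])
  show "ball b e \<subseteq> U" using e(5) NU by blast
  show "\<xi> ` (ball b e - {b}) \<subseteq> insert (\<xi> a) A" using inA e(5,6) NU(1) by blast
  show "smooth (ball b e - {b}) (\<lambda>z. - lb z)" by (intro smooth_minus smooth_subset[OF lb(4)]) (use e(3) in auto)
  fix z assume z: "z \<in> ball b e - {b}"
  hence zN: "z \<in> N" "z \<in> ball b eb - {b}" using e by auto
  have "\<xi> z \<notin> \<xi> ` ball a e"
  proof
   assume "\<xi> z \<in> \<xi> ` ball a e"
   then obtain v where v: "v \<in> ball a e" "\<xi> z = \<xi> v" by blast
   have "z \<in> U" "v \<in> U" using zN(1) v(1) e(4) NU(1) by auto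
   hence "z = v" using inj v(2) by (simp add: inj_on_eq_iff)
   thus False using v(1) z edisj by blast
  qed
  hence "h1 (\<xi> z) = h0 (\<xi> z)" by (rule h1(3))
  also have "\<dots> = inverse (((z - b) / (z - a)) * ((inv_into ?B j (\<xi> z) - a') / (inv_into ?B j (\<xi> z) - b')))"
   unfolding h0N[OF zN(1)] by (simp add: divide_inverse)
  also have "\<dots> = exp (- lb z)" unfolding lb(5)[OF zN(2)] by (simp add: exp_minus)
  finally show "h1 (\<xi> z) = exp (- lb z)" .
 qed (assumption, rule that)
 have topA: "insert (\<xi> b) (insert (\<xi> a) A) = topspace X" using par_in[OF w(1)] abU by (auto simp: A_def)
 have h_h0: "h x = h0 x" if "x \<notin> \<xi> ` N" for x
 proof -
  have "x \<notin> \<xi> ` ball a e" "x \<notin> \<xi> ` ball b e" using that e(4,5) by blast+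
  thus ?thesis using h(3) h1(3) by simp
 qed
 define Kc where "Kc = \<xi> ` cball c R \<union> j ` cball 0 2"
 have cir: "circ X P h Kc"
 proof
  show "smooth V (\<lambda>p. h (\<eta> p))" if V: "(V, \<eta>) \<in> P" for V \<eta>
  proof -
   have "smooth {p \<in> V. \<eta> p \<in> topspace X} (\<lambda>p. h (\<eta> p))" using h(1) V unfolding topA sfun_def by blast
   moreover have "{p \<in> V. \<eta> p \<in> topspace X} = V" using par_in[OF V] by blast
   ultimately show ?thesis by simp
  qed
  show "h x \<noteq> 0" if "x \<in> topspace X" for x using h(2) that unfolding topA .
  have "cball 0 2 \<subseteq> ?B" by auto
  thus "compactin X Kc" unfolding Kc_def
   by (intro compactin_Un emb_compact(1)[OF emb_par[OF w(1)]] emb_compact(1)[OF j(1)] compact_cball w(3))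
  fix x assume x: "x \<in> topspace X - Kc"
  have "x \<notin> \<xi> ` N" using x NU(3) br(1) unfolding Kc_def by blast
  hence "h x = h0 x" by (rule h_h0)
  moreover have "G x = 1"
  proof (cases "x \<in> \<xi> ` U")
   case True
   then obtain z where z: "z \<in> U" "x = \<xi> z" by blast
   hence "z \<notin> cball c R" using x by (auto simp: Kc_def)
   thus ?thesis using Gk[OF z(1)] z(2) g(4)[of z] by simp
  qed (simp add: G_def)
  moreover have "H x = 1"
  proof (cases "x \<in> j ` ?B")
   case True
   then obtain z where z: "z \<in> ?B" "x = j z" by blast
   hence "z \<notin> cball 0 2" using x by (auto simp: Kc_def)
   thus ?thesis using z True k(4)[of z] ij by (simp add: H_def inv_into_f_f)
  qed (simp add: H_def)
  ultimately show "h x = 1" by (simp add: h0_def)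
 qed
 have CO2: "C \<inter> O2 = {}" using C by (auto simp: O2_def)
 have hC: "h x = G x" if x: "x \<in> C" for x
 proof -
  have nj: "x \<notin> j ` ?B" using x CO2 j(2) by blast
  hence "x \<notin> \<xi> ` N" using NU(2) by blast
  thus ?thesis using h_h0[of x] nj by (simp add: h0_def H_def)
 qed
 show ?thesis
 proof (rule that[OF cir], rule notI, elim exE conjE)
  fix lg assume lg: "continuous_map X euclidean lg" "\<forall>x\<in>topspace X. h x = exp (lg x)"
  have lgC: "exp (lg x) = G x" if "x \<in> C" for x using lg(2) hC[OF that] CX that by auto
  have "cutoff_ratio a b c r R g L" unfolding cutoff_ratio_def using g(3-7) by blast
  moreover have "continuous_map (subtopology X C) euclidean lg" by (rule continuous_map_from_subtopology[OF lg(1)])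
  moreover have "exp (lg (\<xi> z)) = g z" if "z \<in> U" "\<xi> z \<in> C" for z using lgC[OF that(2)] Gk[OF that(1)] by simp
  moreover have "exp (lg x) = 1" if "x \<in> C" "x \<notin> \<xi> ` U" for x using lgC[OF that(1)] that(2) by (simp add: G_def)
  ultimately show False using wno[rule_format, of g L lg] by blast
 qed
qed

end

section \<open>Symplectic surfaces\<close>

lemma smooth_on_open:
 assumes "smooth_on S f" "open V" "V \<subseteq> S" shows "smooth V f"
proof (rule smooth_local)
 fix x assume x: "x \<in> V"
 hence "x \<in> S" using assms(3) by blast
 from assms(1)[unfolded smooth_on_def, rule_format, OF this]
 obtain U g where U: "open U" "x \<in> U" "\<forall>k. Ck_on k U g" "\<forall>y\<in>U \<inter> S. g y = f y" by blast
 have "smooth (U \<inter> V) g" by (rule smooth_subset[of U]) (use U assms(2) in \<open>auto simp: smooth_def\<close>)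
 hence "smooth (U \<inter> V) f" by (rule smooth_cong) (use U(4) assms(3) in auto)
 thus "\<exists>W. x \<in> W \<and> W \<subseteq> V \<and> smooth W f" using U(2) x by (intro exI[of _ "U \<inter> V"]) auto
qed

lemma smooth_imp_smooth_on: assumes "smooth U f" shows "smooth_on U f"
 using assms unfolding smooth_on_def smooth_def by blast

lemma alternating_area:
 assumes "bilinear b" "\<And>v. b v v = (0::real)"
 shows "b v w = b 1 \<i> * area_form v w"
proof -
 have l: "linear (\<lambda>v. b v w)" "linear (b v)" for v w using assms(1) unfolding bilinear_def by auto
 have a: "b (x + y) z = b x z + b y z" "b x (y + z) = b x y + b x z" "b (r *\<^sub>R x) y = r * b x y" "b x (r *\<^sub>R y) = r * b x y" for x y z r
  using linear_add[OF l(1)] linear_add[OF l(2)] linear_scale[OF l(1)] linear_scale[OF l(2)] by auto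
 have s: "b \<i> 1 = - b 1 \<i>"
 proof -
  have "0 = b (1 + \<i>) (1 + \<i>)" using assms(2) by simp
  also have "\<dots> = b 1 1 + b 1 \<i> + (b \<i> 1 + b \<i> \<i>)" by (simp only: a)
  finally show ?thesis using assms(2)[of 1] assms(2)[of \<i>] by simp
 qed
 have "b v w = b (Re v *\<^sub>R 1 + Im v *\<^sub>R \<i>) (Re w *\<^sub>R 1 + Im w *\<^sub>R \<i>)"
 proof -
  have "v = Re v *\<^sub>R 1 + Im v *\<^sub>R \<i>" for v by (simp add: complex_eq_iff)
  thus ?thesis by metis
 qed
 also have "\<dots> = b 1 \<i> * area_form v w"
  unfolding a s assms(2) by (simp add: area_form_def algebra_simps)
 finally show ?thesis .
qed

lemma jac_cnj: assumes "f differentiable (at z)" shows "jac (\<lambda>w. cnj (f w)) z = - jac f z"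
proof -
 have "((\<lambda>w. cnj (f w)) has_derivative (\<lambda>v. cnj (dd f z v))) (at z)"
  using bounded_linear.has_derivative[OF bounded_linear_cnj] assms by (simp add: frechet_derivative_works)
 from dd_eqI[OF this] show ?thesis by (simp add: jac_def area_form_def)
qed

text \<open>Where \<rho> is negative the parametrization has to reverse the orientation of the
  chart; complex conjugation reduces this to the positive case.\<close>

lemma darboux_chart:
 assumes rho: "smooth G \<rho>" "\<And>z. z \<in> G ==> \<rho> z \<noteq> 0" and p: "p \<in> G"
 obtains c r \<xi> where "0 < r" "smooth (ball c r) \<xi>" "inj_on \<xi> (ball c r)" "\<xi> c = p" "\<xi> ` ball c r \<subseteq> G"
  "\<And>w. w \<in> ball c r ==> \<rho> (\<xi> w) * jac \<xi> w = 1"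
proof -
 have pos: thesis if p0: "smooth G' \<rho>'" "p' \<in> G'" "\<rho>' p' > 0"
  and out: "\<And>c r \<xi>. [|0 < r; smooth (ball c r) \<xi>; inj_on \<xi> (ball c r); \<xi> c = p'; \<xi> ` ball c r \<subseteq> G';
   \<forall>w\<in>ball c r. \<rho>' (\<xi> w) * jac \<xi> w = 1|] ==> thesis" for G' \<rho>' p'
 proof -
  define W where "W = G' \<inter> \<rho>' -` {0<..}"
  have oW: "open W" unfolding W_def
   by (rule smooth_vimage[OF p0(1)]) simp
  have sW: "smooth W \<rho>'" by (rule smooth_subset[OF p0(1) oW]) (auto simp: W_def)
  \<comment> \<open>Any function without critical points will do as H.\<close>
  have sI: "smooth W Im" using smooth_Im[OF smooth_ident[OF oW]] .
  have pW: "p' \<in> W" using p0 by (simp add: W_def)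
  have dI: "dd Im p' \<i> \<noteq> 0"
   using dd_eqI[OF bounded_linear.has_derivative[OF bounded_linear_Im has_derivative_ident], of p'] by simp
  obtain r \<xi> where "0 < r" "smooth (ball (Complex 0 (Im p')) r) \<xi>" "inj_on \<xi> (ball (Complex 0 (Im p')) r)"
   "\<xi> (Complex 0 (Im p')) = p'" "\<xi> ` ball (Complex 0 (Im p')) r \<subseteq> W"
   "\<And>w. w \<in> ball (Complex 0 (Im p')) r ==> Im (\<xi> w) = Im w \<and> \<rho>' (\<xi> w) * jac \<xi> w = 1"
   by (rule darboux_box[OF sW sI pW _ dI]) (simp add: W_def, rule that)
  thus thesis by (intro out[of r "Complex 0 (Im p')" \<xi>]) (auto simp: W_def)
 qed
 show thesis
 proof (cases "\<rho> p > 0")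
  case True
  show thesis by (rule pos[OF rho(1) p True]) (rule that, auto)
 next
  case False
  hence neg: "\<rho> p < 0" using rho(2)[OF p] by linarith
  define G' where "G' = cnj -` G"
  have oG': "open G'" unfolding G'_def by (rule open_vimage[OF smooth_open[OF rho(1)]]) (intro continuous_intros)
  have s: "smooth G' (\<lambda>z. - \<rho> (cnj z))"
   by (intro smooth_minus smooth_compose[OF rho(1)] smooth_cnj smooth_ident oG') (auto simp: G'_def)
  show thesis
  proof (rule pos[OF s, of "cnj p"])
   show "cnj p \<in> G'" "- \<rho> (cnj (cnj p)) > 0" using p neg by (auto simp: G'_def)
   fix c r \<xi> assume k: "0 < r" "smooth (ball c r) \<xi>" "inj_on \<xi> (ball c r)" "\<xi> c = cnj p" "\<xi> ` ball c r \<subseteq> G'"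
    "\<forall>w\<in>ball c r. - \<rho> (cnj (\<xi> w)) * jac \<xi> w = 1"
   show thesis
   proof (rule that[of r c "\<lambda>w. cnj (\<xi> w)"])
    show "smooth (ball c r) (\<lambda>w. cnj (\<xi> w))" by (intro smooth_cnj k(2))
    show "inj_on (\<lambda>w. cnj (\<xi> w)) (ball c r)" using k(3) by (auto simp: inj_on_def)
    show "(\<lambda>w. cnj (\<xi> w)) ` ball c r \<subseteq> G" using k(5) by (auto simp: G'_def)
    show "\<rho> (cnj (\<xi> w)) * jac (\<lambda>w. cnj (\<xi> w)) w = 1" if "w \<in> ball c r" for w
     using k(6) that jac_cnj[OF smooth_diff[OF k(2) that]] by simp
   qed (use k in auto)
  qed
 qed
qed

locale ssurf =
 fixes S :: "('a, 'c, complex) mfd" and \<omega> :: "('c, complex) form2"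
 assumes surf: "symplectic_surface S \<omega>"
begin

abbreviation "T \<equiv> mtop S"
abbreviation "I \<equiv> mfd_interior S"

lemma man: "smooth_manifold 1 S" and form: "smooth_form2 S \<omega>" and conn: "connected_space T"
 and nondeg: "c \<in> charts S ==> p \<in> cimg S c ==> v \<noteq> 0 ==> \<exists>w. \<omega> c p v w \<noteq> 0"
 using surf unfolding symplectic_surface_def symplectic_form_def by blast+

lemma hausT: "Hausdorff_space T" using man unfolding smooth_manifold_def by blast

lemma cover_charts: "x \<in> topspace T ==> \<exists>c\<in>charts S. x \<in> cdom S c"
 using man unfolding smooth_manifold_def by blast

lemma
 assumes "c \<in> charts S"
 shows cdom_open: "openin T (cdom S c)"
  and cmap_homeo: "homeomorphic_map (subtopology T (cdom S c)) (top_of_set (cimg S c)) (cmap S c)"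
  and cimg_sector: "\<exists>B\<subseteq>Basis. card B \<le> 1 \<and> openin (top_of_set (sector B)) (cimg S c)"
 using man assms unfolding smooth_manifold_def by blast+

lemma cdom_top: "c \<in> charts S ==> cdom S c \<subseteq> topspace T" by (rule openin_subset[OF cdom_open])

lemma cmap_cont: assumes "c \<in> charts S" shows "continuous_map (subtopology T (cdom S c)) euclidean (cmap S c)"
 using homeomorphic_imp_continuous_map[OF cmap_homeo[OF assms]] by (simp add: continuous_map_in_subtopology)

lemma cmap_inj: assumes "c \<in> charts S" shows "inj_on (cmap S c) (cdom S c)"
proof -
 have "topspace (subtopology T (cdom S c)) = cdom S c" using cdom_top[OF assms] by auto
 thus ?thesis using homeomorphic_imp_injective_map[OF cmap_homeo[OF assms]] by simp
qed

lemma cmap_vimage: assumes "c \<in> charts S" "open G" shows "openin T {x \<in> cdom S c. cmap S c x \<in> G}"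
proof -
 have "topspace (subtopology T (cdom S c)) = cdom S c" using cdom_top[OF assms(1)] by auto
 hence "openin (subtopology T (cdom S c)) {x \<in> cdom S c. cmap S c x \<in> G}"
  using openin_continuous_map_preimage[OF cmap_cont[OF assms(1)], of G] assms(2) by (simp del: topspace_subtopology)
 thus ?thesis by (rule openin_trans_full[OF _ cdom_open[OF assms(1)]])
qed

lemma cmap_openmap: assumes "c \<in> charts S" "openin T N" "N \<subseteq> cdom S c" shows "openin (top_of_set (cimg S c)) (cmap S c ` N)"
using assms(2,3) homeomorphic_imp_open_map[OF cmap_homeo[OF assms(1)]] by (auto simp: open_map_def openin_subset_topspace_eq openin_open_subtopology[OF cdom_open[OF assms(1)]])

definition cinv :: "'c => complex => 'a" where "cinv c = inv_into (cdom S c) (cmap S c)"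

lemma cinv: "c \<in> charts S ==> x \<in> cdom S c ==> cinv c (cmap S c x) = x"
 unfolding cinv_def by (rule inv_into_f_f[OF cmap_inj])

lemma cinv_in: "z \<in> cimg S c ==> cinv c z \<in> cdom S c" "z \<in> cimg S c ==> cmap S c (cinv c z) = z"
 unfolding cinv_def cimg_def by (auto simp: inv_into_into f_inv_into_f)

lemma cinv_cont: assumes "c \<in> charts S" shows "continuous_map (top_of_set (cimg S c)) T (cinv c)"
 unfolding continuous_map_def
proof (intro conjI allI impI)
 show "cinv c \<in> topspace (top_of_set (cimg S c)) \<rightarrow> topspace T" using cinv_in(1) cdom_top[OF assms] by auto
 fix N assume N: "openin T N"
 have "openin (top_of_set (cimg S c)) (cmap S c ` (N \<inter> cdom S c))"
  by (rule cmap_openmap[OF assms openin_Int[OF N cdom_open[OF assms]]]) auto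
 moreover have "cmap S c ` (N \<inter> cdom S c) = {x \<in> topspace (top_of_set (cimg S c)). cinv c x \<in> N}"
 using cinv[OF assms] IntI imageI by (auto simp: cimg_def)
 ultimately show "openin (top_of_set (cimg S c)) {x \<in> topspace (top_of_set (cimg S c)). cinv c x \<in> N}" by simp
qed

lemma interior_open: "openin T I"
proof -
 have "I = (\<Union>c\<in>charts S. {x \<in> cdom S c. cmap S c x \<in> interior (cimg S c)})" by (auto simp: mfd_interior_def)
 thus ?thesis using cmap_vimage by auto
qed

text \<open>By invariance of domain for the transition map, a boundary point of one chart cannot be
  an interior point in another.\<close>

lemma interior_chart:
 assumes c: "c \<in> charts S" and x: "x \<in> cdom S c" shows "x \<in> I \<longleftrightarrow> cmap S c x \<in> interior (cimg S c)"
proof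
 show "cmap S c x \<in> interior (cimg S c) ==> x \<in> I" using c x by (auto simp: mfd_interior_def)
 assume "x \<in> I"
 then obtain d where d: "d \<in> charts S" "x \<in> cdom S d" "cmap S d x \<in> interior (cimg S d)" by (auto simp: mfd_interior_def)
 define N where "N = {y \<in> cdom S d. cmap S d y \<in> interior (cimg S d)} \<inter> cdom S c"
 have oN: "openin T N" unfolding N_def by (intro openin_Int cmap_vimage d cdom_open c) simp
 have xN: "x \<in> N" using d x by (simp add: N_def)
 have "openin (top_of_set (cimg S d)) (cmap S d ` N)" by (rule cmap_openmap[OF d(1) oN]) (auto simp: N_def)
 then obtain G where G: "open G" "cmap S d ` N = cimg S d \<inter> G" by (auto simp: openin_open)
 have oG: "open (cmap S d ` N)"
 proof -
  have "cmap S d ` N \<subseteq> interior (cimg S d)" by (auto simp: N_def)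
  hence "cmap S d ` N = interior (cimg S d) \<inter> G" using G(2) interior_subset[of "cimg S d"] by blast
  thus ?thesis using G(1) by (simp add: open_Int)
 qed
 let ?t = "\<lambda>z. cmap S c (cinv d z)"
 have Nd: "N \<subseteq> cdom S d" "N \<subseteq> cdom S c" by (auto simp: N_def)
 have tN: "?t (cmap S d y) = cmap S c y" if "y \<in> N" for y using cinv[OF d(1)] Nd that by auto
 have "continuous_on (cmap S d ` N) ?t"
 proof -
  have "cinv d ` cmap S d ` N \<subseteq> cdom S c" using cinv[OF d(1)] Nd by (auto simp: subset_iff)
  hence "continuous_map (top_of_set (cmap S d ` N)) (subtopology T (cdom S c)) (cinv d)"
   using continuous_map_from_subtopology_mono[OF cinv_cont[OF d(1)], of "cmap S d ` N"] Nd cinv[OF d(1)]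
   by (auto simp: continuous_map_in_subtopology cimg_def)
  from continuous_map_compose[OF this cmap_cont[OF c]] show ?thesis by (simp add: o_def)
 qed
 moreover have "inj_on ?t (cmap S d ` N)"
 proof (rule inj_onI)
  fix z w assume "z \<in> cmap S d ` N" "w \<in> cmap S d ` N" and eq: "?t z = ?t w"
  then obtain y y' where y: "y \<in> N" "z = cmap S d y" "y' \<in> N" "w = cmap S d y'" by blast
  hence "cmap S c y = cmap S c y'" using eq tN by simp
  hence "y = y'" using inj_onD[OF cmap_inj[OF c]] y Nd by blast
  thus "z = w" using y by simp
 qed
 ultimately have "open (?t ` cmap S d ` N)" using oG invariance_of_domain by blast
 moreover have "?t ` cmap S d ` N = cmap S c ` N" using tN by (auto simp: image_image)
 moreover have "cmap S c ` N \<subseteq> cimg S c" using Nd by (auto simp: cimg_def)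
 ultimately show "cmap S c x \<in> interior (cimg S c)" using xN interiorI by blast
qed

subsection \<open>The interior of a bordered surface\<close>

text \<open>A ball meets the interior of a sector in a convex set, which is nonempty if the centre
  lies in the sector.\<close>

lemma small_connected:
 assumes O': "openin T O'" "y \<in> O'"
 obtains N where "openin T N" "y \<in> N" "N \<subseteq> O'" "connectedin T (N \<inter> I)" "N \<inter> I \<noteq> {}"
proof -
 obtain c where c: "c \<in> charts S" "y \<in> cdom S c" using cover_charts O' openin_subset by blast
 obtain B where B: "B \<subseteq> Basis" "openin (top_of_set (sector B)) (cimg S c)" using cimg_sector[OF c(1)] by blast
 let ?O = "O' \<inter> cdom S c"
 have "openin (top_of_set (cimg S c)) (cmap S c ` ?O)"
  by (rule cmap_openmap[OF c(1) openin_Int[OF O'(1) cdom_open[OF c(1)]]]) auto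
 hence "openin (top_of_set (sector B)) (cmap S c ` ?O)" using B(2) by (rule openin_trans)
 then obtain G where G: "open G" "cmap S c ` ?O = sector B \<inter> G" by (auto simp: openin_open)
 let ?p = "cmap S c y"
 have "?p \<in> cmap S c ` ?O" using O'(2) c(2) by blast
 hence pG: "?p \<in> G" "?p \<in> sector B" using G(2) by auto
 obtain e where e: "e > 0" "ball ?p e \<subseteq> G" using G(1) pG(1) openE by blast
 have cs: "cimg S c \<subseteq> sector B" using openin_imp_subset[OF B(2)] .
 have bs: "ball ?p e \<inter> sector B \<subseteq> cmap S c ` ?O" using G(2) e(2) by blast
 have Oc: "cmap S c ` ?O \<subseteq> cimg S c" by (auto simp: cimg_def)
 define N where "N = {x \<in> cdom S c. cmap S c x \<in> ball ?p e}"
 have oN: "openin T N" unfolding N_def by (rule cmap_vimage[OF c(1) open_ball])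
 have NO: "N \<subseteq> O'"
 proof
  fix x assume "x \<in> N"
  hence x: "x \<in> cdom S c" "cmap S c x \<in> ball ?p e" by (auto simp: N_def)
  have "cmap S c x \<in> cimg S c" using x(1) by (simp add: cimg_def)
  hence "cmap S c x \<in> cmap S c ` ?O" using x(2) cs bs by blast
  then obtain x' where "x' \<in> ?O" "cmap S c x = cmap S c x'" by blast
  thus "x \<in> O'" using inj_onD[OF cmap_inj[OF c(1)]] x(1) by blast
 qed
 let ?K = "ball ?p e \<inter> interior (sector B)"
 have Ksub: "?K \<subseteq> interior (cimg S c)"
 proof (rule interior_maximal)
  show "?K \<subseteq> cimg S c" using bs Oc interior_subset[of "sector B"] by blast
 qed (intro open_Int open_ball open_interior)
 have NI: "N \<inter> I = cinv c ` ?K"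
 proof
  show "N \<inter> I \<subseteq> cinv c ` ?K"
  proof
   fix x assume x: "x \<in> N \<inter> I"
   hence "x \<in> cdom S c" "cmap S c x \<in> ball ?p e" by (auto simp: N_def)
   moreover have "cmap S c x \<in> interior (sector B)"
    using x interior_chart[OF c(1) \<open>x \<in> cdom S c\<close>] interior_mono[OF cs] by blast
   ultimately have "cmap S c x \<in> ?K" "cinv c (cmap S c x) = x" using cinv[OF c(1)] by auto
   thus "x \<in> cinv c ` ?K" by (metis imageI)
  qed
  show "cinv c ` ?K \<subseteq> N \<inter> I"
  proof (rule image_subsetI)
   fix z assume z: "z \<in> ?K"
   hence zi: "z \<in> interior (cimg S c)" using Ksub by blast
   hence "z \<in> cimg S c" using interior_subset by blast
   note zz = cinv_in[OF this]
   show "cinv c z \<in> N \<inter> I" using zz z zi interior_chart[OF c(1) zz(1)] by (auto simp: N_def)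
  qed
 qed
 have cvs: "convex (sector B)" unfolding sector_def convex_def by (auto simp: inner_add_left intro!: add_nonneg_nonneg)
 have "connected ?K" by (intro convex_connected convex_Int convex_ball convex_interior cvs)
 moreover have "?K \<subseteq> cimg S c" using Ksub interior_subset by blast
 ultimately have "connectedin (top_of_set (cimg S c)) ?K" by (simp add: connectedin_subtopology)
 hence con: "connectedin T (N \<inter> I)" unfolding NI by (rule connectedin_continuous_map_image[OF cinv_cont[OF c(1)]])
 have "?K \<noteq> {}"
 proof -
  define G0 where "G0 = {x::complex. \<forall>b\<in>B. 0 < x \<bullet> b}"
  have fB: "finite B" using B(1) finite_subset finite_Basis by blast
  have "G0 = (\<Inter>b\<in>B. {x. 0 < x \<bullet> b})" by (auto simp: G0_def)
  moreover have "open {x. 0 < x \<bullet> b}" for b :: complex by (intro open_Collect_less continuous_intros)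
  ultimately have "open G0" using fB by (simp add: open_INT)
  moreover have "G0 \<subseteq> sector B" by (auto simp: G0_def sector_def less_imp_le)
  ultimately have Gi: "G0 \<subseteq> interior (sector B)" by (rule interior_maximal[rotated])
  \<comment> \<open>Moving along 1 + \<i> makes all constrained coordinates positive.\<close>
  define q where "q = ?p + (e / 2 / cmod (1 + \<i>)) *\<^sub>R (1 + \<i>)"
  have n0: "cmod (1 + \<i>) > 0" by (simp add: complex_eq_iff)
  have "dist ?p q = e / 2" using n0 e(1) by (simp add: q_def dist_norm)
  hence "q \<in> ball ?p e" using e(1) by simp
  moreover have "q \<in> G0" unfolding G0_def
  using B(1) pG(2) n0 e(1) by (fastforce simp: Basis_complex_def inner_complex_def sector_def q_def inner_add_left add_nonneg_pos)
  ultimately show ?thesis using Gi by blast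
 qed
 hence "N \<inter> I \<noteq> {}" unfolding NI by blast
 thus ?thesis using that[OF oN _ NO con] c(2) e(1) by (auto simp: N_def)
qed

text \<open>A separation of the interior would extend across the boundary: by
  \<open>small_connected\<close> a boundary point has a small neighbourhood whose interior part lies
  in one of the two sets, and it is assigned to that set. So curves that do not separate the
  surface, as in \<open>genus\<close>, do not separate its interior either.\<close>

lemma interior_minus_connected:
 assumes K: "closedin T K" and con: "connectedin T (topspace T - K)"
 shows "connectedin T (I - K)"
proof (rule ccontr)
 let ?Y = "topspace T - K"
 have oY: "openin T ?Y" using K by blast
 have IT: "I \<subseteq> topspace T" by (rule openin_subset[OF interior_open])
 assume "\<not> ?thesis"
 then obtain E1 E2 where E: "openin T E1" "openin T E2" "I - K \<subseteq> E1 \<union> E2" "E1 \<inter> E2 \<inter> (I - K) = {}" "E1 \<inter> (I - K) \<noteq> {}" "E2 \<inter> (I - K) \<noteq> {}"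
  unfolding connectedin using IT by blast
 define A where "A E = \<Union>{N. openin T N \<and> N \<subseteq> ?Y \<and> N \<inter> I \<subseteq> E}" for E
 have oA: "openin T (A E)" for E unfolding A_def by blast
 have cov: "?Y \<subseteq> A E1 \<union> A E2"
 proof
  fix y assume y: "y \<in> ?Y"
  obtain N where N: "openin T N" "y \<in> N" "N \<subseteq> ?Y" "connectedin T (N \<inter> I)" "N \<inter> I \<noteq> {}"
   by (rule small_connected[OF oY y]) (rule that)
  have sub: "N \<inter> I \<subseteq> E1 \<union> E2" "E1 \<inter> E2 \<inter> (N \<inter> I) = {}" using E(3,4) N(3) by blast+
  have "N \<inter> I \<subseteq> E1 \<or> N \<inter> I \<subseteq> E2"
  using sub(1) connectedin_split[OF N(4) E(1,2) sub] by auto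
  thus "y \<in> A E1 \<union> A E2" using N(1-3) unfolding A_def by blast
 qed
 have dis: "A E1 \<inter> A E2 \<inter> ?Y = {}"
 proof (rule ccontr)
  assume "\<not> ?thesis"
  then obtain y N1 N2 where N: "openin T N1" "N1 \<subseteq> ?Y" "N1 \<inter> I \<subseteq> E1" "openin T N2" "N2 \<inter> I \<subseteq> E2" "y \<in> N1 \<inter> N2"
   unfolding A_def by blast
  obtain M where M: "M \<subseteq> N1 \<inter> N2" "M \<inter> I \<noteq> {}"
   by (rule small_connected[OF openin_Int[OF N(1,4)] N(6)]) (rule that)
  then obtain x where "x \<in> M" "x \<in> I" by blast
  thus False using M N E(4) by blast
 qed
 have AI: "E \<inter> (I - K) \<noteq> {} ==> openin T E ==> A E \<inter> ?Y \<noteq> {}" for E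
 proof -
  assume "E \<inter> (I - K) \<noteq> {}" "openin T E"
  then obtain x where x: "x \<in> E" "x \<in> I" "x \<in> ?Y" using IT by blast
  have "openin T (E \<inter> ?Y)" using \<open>openin T E\<close> oY by blast
  hence "x \<in> A E" unfolding A_def using x by blast
  thus ?thesis using x(3) by blast
 qed
 have "A E2 \<inter> ?Y = {}"
  by (rule connectedin_split[OF con oA oA cov dis AI[OF E(5,1)]])
 thus False using AI[OF E(6,2)] by blast
qed

subsection \<open>Darboux parametrizations\<close>

definition XI :: "'a topology" where "XI = subtopology T I"

text \<open>The equation says that \<xi> pulls the symplectic form back to dx \<and> dy. The
  Jacobian may be negative, as charts are not assumed to be compatibly oriented.\<close>

definition PI :: "(complex set \<times> (complex => 'a)) set" where
 "PI = {(V, \<xi>). open V \<and> inj_on \<xi> V \<and> (\<exists>c\<in>charts S. \<xi> ` V \<subseteq> cdom S c \<inter> I \<and> smooth V (\<lambda>p. cmap S c (\<xi> p)) \<and>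
   (\<forall>p\<in>V. \<omega> c (cmap S c (\<xi> p)) 1 \<i> * jac (\<lambda>p. cmap S c (\<xi> p)) p = 1))}"

lemma form_area:
 assumes "c \<in> charts S" "p \<in> cimg S c" shows "\<omega> c p v w = \<omega> c p 1 \<i> * area_form v w"
 by (rule alternating_area) (use form assms in \<open>auto simp: smooth_form2_def\<close>)

lemma transition_form:
 assumes c: "c \<in> charts S" and d: "d \<in> charts S" and x: "x \<in> cdom S c" "x \<in> cdom S d" "x \<in> I"
 obtains N t where "cmap S c x \<in> N" "smooth N t" "\<And>y. y \<in> cdom S c ==> cmap S c y \<in> N ==> y \<in> cdom S d \<and> cmap S d y = t (cmap S c y)"
  "\<And>p. p \<in> N ==> p \<in> cimg S c" "\<And>p. p \<in> N ==> \<omega> c p 1 \<i> = \<omega> d (t p) 1 \<i> * jac t p"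
proof -
 define M where "M = {y \<in> cdom S c. cmap S c y \<in> interior (cimg S c)} \<inter> cdom S d"
 have oM: "openin T M" unfolding M_def by (intro openin_Int cmap_vimage c cdom_open d) simp
 have Mc: "M \<subseteq> cdom S c" "M \<subseteq> cdom S d" by (auto simp: M_def)
 define N where "N = cmap S c ` M"
 have "openin (top_of_set (cimg S c)) N" unfolding N_def by (rule cmap_openmap[OF c oM Mc(1)])
 then obtain G where G: "open G" "N = cimg S c \<inter> G" by (auto simp: openin_open)
 have oN: "open N"
 proof -
  have "N \<subseteq> interior (cimg S c)" by (auto simp: N_def M_def)
  hence "N = interior (cimg S c) \<inter> G" using G(2) interior_subset[of "cimg S c"] by blast
  thus ?thesis using G(1) by (simp add: open_Int)
 qed
 let ?t = "transition S c d"
 have Nov: "N \<subseteq> overlap S c d" using Mc by (auto simp: N_def overlap_def)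
 have "smooth_on (overlap S c d) ?t" using man c d unfolding smooth_manifold_def by blast
 hence st: "smooth N ?t" by (rule smooth_on_open[OF _ oN Nov])
 have tt: "?t (cmap S c y) = cmap S d y" if "y \<in> cdom S c" for y
  using cinv[OF c that] by (simp add: transition_def cinv_def)
 show ?thesis
 proof (rule that[of N ?t])
  show "cmap S c x \<in> N" using x interior_chart[OF c x(1)] by (auto simp: N_def M_def)
  show "smooth N ?t" by fact
  show "y \<in> cdom S d \<and> cmap S d y = ?t (cmap S c y)" if y: "y \<in> cdom S c" "cmap S c y \<in> N" for y
  using y(2) inj_onD[OF cmap_inj[OF c]] y(1) Mc(1) Mc(2) tt[OF y(1)] by (auto simp: N_def)
  show Nc: "p \<in> cimg S c" if "p \<in> N" for p using that G(2) by blast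
  fix p assume p: "p \<in> N"
  have "p \<in> interior (overlap S c d)" using p Nov oN interiorI by blast
  \<comment> \<open>The transformation rule of the form uses derivatives within the overlap; at
    interior points they are the ordinary ones.\<close>
  hence at: "at p within overlap S c d = at p" by (rule at_within_interior)
  obtain y where y: "y \<in> M" "p = cmap S c y" using p unfolding N_def by blast
  have tp: "?t p \<in> cimg S d" using tt[of y] y Mc by (auto simp: cimg_def)
  have "\<omega> c p 1 \<i> = \<omega> d (?t p) (dd ?t p 1) (dd ?t p \<i>)"
  proof -
   have "\<forall>c\<in>charts S. \<forall>d\<in>charts S. \<forall>p\<in>overlap S c d. \<forall>v w.
    let T = transition S c d; T' = frechet_derivative T (at p within overlap S c d)
    in \<omega> c p v w = \<omega> d (T p) (T' v) (T' w)" using form unfolding smooth_form2_def by blast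
   from this[rule_format, OF c d subsetD[OF Nov p], of 1 \<i>] show ?thesis by (simp add: Let_def at)
  qed
  also have "\<dots> = \<omega> d (?t p) 1 \<i> * jac ?t p" unfolding jac_def by (rule form_area[OF d tp])
  finally show "\<omega> c p 1 \<i> = \<omega> d (?t p) 1 \<i> * jac ?t p" .
 qed
qed

text \<open>\<open>PI\<close> demands a single chart; the transformation rule of the form carries
  the equation over to all others.\<close>

lemma PI_chart:
 assumes V: "(V, \<xi>) \<in> PI" and d: "d \<in> charts S"
 shows "open {u \<in> V. \<xi> u \<in> cdom S d}" "smooth {u \<in> V. \<xi> u \<in> cdom S d} (\<lambda>p. cmap S d (\<xi> p))"
  "\<And>u. u \<in> V ==> \<xi> u \<in> cdom S d ==> \<omega> d (cmap S d (\<xi> u)) 1 \<i> * jac (\<lambda>p. cmap S d (\<xi> p)) u = 1"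
proof -
 obtain c where c: "open V" "c \<in> charts S" "\<xi> ` V \<subseteq> cdom S c \<inter> I" "smooth V (\<lambda>p. cmap S c (\<xi> p))"
  "\<forall>p\<in>V. \<omega> c (cmap S c (\<xi> p)) 1 \<i> * jac (\<lambda>p. cmap S c (\<xi> p)) p = 1"
  using V unfolding PI_def by blast
 have loc: "\<exists>M. u \<in> M \<and> M \<subseteq> {u \<in> V. \<xi> u \<in> cdom S d} \<and> smooth M (\<lambda>p. cmap S d (\<xi> p)) \<and>
   \<omega> d (cmap S d (\<xi> u)) 1 \<i> * jac (\<lambda>p. cmap S d (\<xi> p)) u = 1"
  if u: "u \<in> V" "\<xi> u \<in> cdom S d" for u
 proof -
  have ku: "\<xi> u \<in> cdom S c" "\<xi> u \<in> I" using u(1) c(3) by auto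
  obtain N t where t: "cmap S c (\<xi> u) \<in> N" "smooth N t" "\<And>y. y \<in> cdom S c ==> cmap S c y \<in> N ==> y \<in> cdom S d \<and> cmap S d y = t (cmap S c y)"
   "\<And>p. p \<in> N ==> p \<in> cimg S c" "\<And>p. p \<in> N ==> \<omega> c p 1 \<i> = \<omega> d (t p) 1 \<i> * jac t p"
   by (rule transition_form[OF c(2) d ku(1) u(2) ku(2)]) (rule that)
  define M where "M = V \<inter> (\<lambda>p. cmap S c (\<xi> p)) -` N"
  have oM: "open M" unfolding M_def
   by (rule continuous_open_preimage[OF smooth_cont[OF c(4)] c(1) smooth_open[OF t(2)]])
  have sM: "smooth M (\<lambda>p. cmap S c (\<xi> p))" by (rule smooth_subset[OF c(4) oM]) (auto simp: M_def)
  have eq: "\<xi> p \<in> cdom S d \<and> cmap S d (\<xi> p) = t (cmap S c (\<xi> p))" if "p \<in> M" for p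
   using t(3)[of "\<xi> p"] that c(3) by (auto simp: M_def)
  have uM: "u \<in> M" using u t(1) by (simp add: M_def)
  have "smooth M (\<lambda>p. t (cmap S c (\<xi> p)))" by (rule smooth_compose[OF t(2) sM]) (auto simp: M_def)
  hence s: "smooth M (\<lambda>p. cmap S d (\<xi> p))" by (rule smooth_cong) (simp add: eq)
  have "jac (\<lambda>p. cmap S d (\<xi> p)) u = jac (\<lambda>p. t (cmap S c (\<xi> p))) u"
   by (rule jac_cong[OF oM uM]) (simp add: eq)
  also have "\<dots> = jac t (cmap S c (\<xi> u)) * jac (\<lambda>p. cmap S c (\<xi> p)) u"
   by (rule jac_compose[OF smooth_diff[OF sM uM] smooth_diff[OF t(2,1)]])
  finally have "\<omega> d (cmap S d (\<xi> u)) 1 \<i> * jac (\<lambda>p. cmap S d (\<xi> p)) u = 1"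
   using c(5)[rule_format, OF u(1)] t(5)[OF t(1)] eq[OF uM] by (simp add: mult.assoc)
  moreover have "M \<subseteq> {u \<in> V. \<xi> u \<in> cdom S d}" using eq by (auto simp: M_def)
  ultimately show ?thesis using uM s by blast
 qed
 show "smooth {u \<in> V. \<xi> u \<in> cdom S d} (\<lambda>p. cmap S d (\<xi> p))"
  by (rule smooth_local) (use loc in blast)
 thus "open {u \<in> V. \<xi> u \<in> cdom S d}" by (rule smooth_open)
 show "\<omega> d (cmap S d (\<xi> u)) 1 \<i> * jac (\<lambda>p. cmap S d (\<xi> p)) u = 1" if "u \<in> V" "\<xi> u \<in> cdom S d" for u
  using loc[OF that] by blast
qed

lemma PI_cont: assumes V: "(V, \<xi>) \<in> PI" shows "continuous_map (top_of_set V) XI \<xi>"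
proof -
 obtain c where c: "c \<in> charts S" "\<xi> ` V \<subseteq> cdom S c \<inter> I" "smooth V (\<lambda>p. cmap S c (\<xi> p))"
  using V unfolding PI_def by blast
 have "continuous_map (top_of_set V) (top_of_set (cimg S c)) (\<lambda>p. cmap S c (\<xi> p))"
  using smooth_cont[OF c(3)] c(2) by (auto simp: continuous_map_in_subtopology cimg_def)
 from continuous_map_compose[OF this cinv_cont[OF c(1)]]
 have "continuous_map (top_of_set V) T (\<lambda>p. cinv c (cmap S c (\<xi> p)))" by (simp add: o_def)
 hence "continuous_map (top_of_set V) T \<xi>"
  by (rule continuous_map_eq) (use c(1,2) cinv in auto)
 thus ?thesis using c(2) by (auto simp: XI_def continuous_map_in_subtopology)
qed

lemma PI_open: assumes V: "(V, \<xi>) \<in> PI" and N: "open N" "N \<subseteq> V" shows "openin XI (\<xi> ` N)"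
proof -
 obtain c where c: "inj_on \<xi> V" "c \<in> charts S" "\<xi> ` V \<subseteq> cdom S c \<inter> I" "smooth V (\<lambda>p. cmap S c (\<xi> p))"
  using V unfolding PI_def by blast
 let ?A = "\<lambda>p. cmap S c (\<xi> p)"
 have "inj_on ?A N"
 proof (rule inj_onI)
  fix p q assume pq: "p \<in> N" "q \<in> N" "?A p = ?A q"
  hence "\<xi> p = \<xi> q" using inj_onD[OF cmap_inj[OF c(2)]] c(3) N(2) by blast
  thus "p = q" using inj_onD[OF c(1)] pq N(2) by blast
 qed
 hence "open (?A ` N)" by (rule invariance_of_domain[OF continuous_on_subset[OF smooth_cont[OF c(4)] N(2)] N(1)])
 hence "openin T {x \<in> cdom S c. cmap S c x \<in> ?A ` N}" by (rule cmap_vimage[OF c(2)])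
 moreover have "{x \<in> cdom S c. cmap S c x \<in> ?A ` N} = \<xi> ` N"
 proof
  show "\<xi> ` N \<subseteq> {x \<in> cdom S c. cmap S c x \<in> ?A ` N}" using c(3) N(2) by blast
  show "{x \<in> cdom S c. cmap S c x \<in> ?A ` N} \<subseteq> \<xi> ` N"
  using inj_onD[OF cmap_inj[OF c(2)]] c(3) N(2) by blast
 qed
 ultimately have "openin T (\<xi> ` N)" by simp
 moreover have "\<xi> ` N \<subseteq> I" using c(3) N(2) by blast
 ultimately show ?thesis unfolding XI_def by (simp add: openin_open_subtopology[OF interior_open])
qed

lemma osurf_interior: "osurf XI PI"
proof
 show "Hausdorff_space XI" unfolding XI_def by (rule Hausdorff_space_subtopology[OF hausT])
 show "open U" "inj_on \<xi> U" if "(U, \<xi>) \<in> PI" for U \<xi> using that unfolding PI_def by auto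
 show "continuous_map (top_of_set U) XI \<xi>" if "(U, \<xi>) \<in> PI" for U \<xi> by (rule PI_cont[OF that])
 show "openin XI (\<xi> ` N)" if "(U, \<xi>) \<in> PI" "open N" "N \<subseteq> U" for U \<xi> N by (rule PI_open[OF that])
next
 fix x assume "x \<in> topspace XI"
 hence xI: "x \<in> I" by (simp add: XI_def)
 then obtain c where c: "c \<in> charts S" "x \<in> cdom S c" "cmap S c x \<in> interior (cimg S c)" by (auto simp: mfd_interior_def)
 let ?G = "interior (cimg S c)"
 have "smooth_on (cimg S c) (\<lambda>p. \<omega> c p 1 \<i>)" using form c(1) unfolding smooth_form2_def by blast
 hence s: "smooth ?G (\<lambda>p. \<omega> c p 1 \<i>)" by (rule smooth_on_open[OF _ open_interior interior_subset])
 have nz: "\<omega> c z 1 \<i> \<noteq> 0" if "z \<in> ?G" for z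
 proof -
  have zc: "z \<in> cimg S c" using that interior_subset by blast
  have "(1::complex) \<noteq> 0" by simp
  from nondeg[OF c(1) zc this] obtain w where "\<omega> c z 1 w \<noteq> 0" by blast
  thus ?thesis using form_area[OF c(1) zc, of 1 w] by auto
 qed
 obtain a r \<xi> where k: "0 < r" "smooth (ball a r) \<xi>" "inj_on \<xi> (ball a r)" "\<xi> a = cmap S c x" "\<xi> ` ball a r \<subseteq> ?G"
  "\<And>w. w \<in> ball a r ==> \<omega> c (\<xi> w) 1 \<i> * jac \<xi> w = 1"
  by (rule darboux_chart[OF s nz c(3)]) (assumption, rule that)
 have kc: "\<xi> w \<in> cimg S c" "\<xi> w \<in> ?G" if "w \<in> ball a r" for w using that k(5) interior_subset[of "cimg S c"] by blast+
 define \<eta> where "\<eta> w = cinv c (\<xi> w)" for w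
 have eta: "\<eta> w \<in> cdom S c" "cmap S c (\<eta> w) = \<xi> w" if "w \<in> ball a r" for w using cinv_in[OF kc(1)[OF that]] by (auto simp: \<eta>_def)
 have "(ball a r, \<eta>) \<in> PI" unfolding PI_def
 proof (clarify, intro conjI bexI[of _ c] ballI)
  show "inj_on \<eta> (ball a r)" by (rule inj_onI) (metis eta(2) inj_onD k(3))
  show "\<eta> ` ball a r \<subseteq> cdom S c \<inter> I" using eta kc(2) interior_chart[OF c(1)] by (auto simp del: mem_ball)
  show "smooth (ball a r) (\<lambda>p. cmap S c (\<eta> p))" by (rule smooth_cong[OF k(2)]) (simp add: eta)
  fix p assume p: "p \<in> ball a r"
  have "jac (\<lambda>p. cmap S c (\<eta> p)) p = jac \<xi> p" by (rule jac_cong[OF open_ball p]) (simp add: eta)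
  thus "\<omega> c (cmap S c (\<eta> p)) 1 \<i> * jac (\<lambda>p. cmap S c (\<eta> p)) p = 1" using k(6)[OF p] eta(2)[OF p] by simp
 qed (use c in auto)
 moreover have "x \<in> \<eta> ` ball a r" using k(1,4) cinv[OF c(1,2)] by (intro image_eqI[of _ _ a]) (auto simp: \<eta>_def)
 ultimately show "\<exists>U \<xi>. (U, \<xi>) \<in> PI \<and> x \<in> \<xi> ` U" by blast
next
 fix U \<xi> V \<xi>' p q assume U: "(U, \<xi>) \<in> PI" and V: "(V, \<xi>') \<in> PI" and pq: "p \<in> U" "q \<in> V" "\<xi> p = \<xi>' q"
 obtain d where d: "open V" "inj_on \<xi>' V" "d \<in> charts S" "\<xi>' ` V \<subseteq> cdom S d \<inter> I" "smooth V (\<lambda>p. cmap S d (\<xi>' p))"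
  "\<forall>p\<in>V. \<omega> d (cmap S d (\<xi>' p)) 1 \<i> * jac (\<lambda>p. cmap S d (\<xi>' p)) p = 1"
  using V unfolding PI_def by blast
 let ?A = "\<lambda>p. cmap S d (\<xi> p)" and ?B = "\<lambda>p. cmap S d (\<xi>' p)"
 have iB: "inj_on ?B V"
 proof (rule inj_onI)
  fix p q assume pq: "p \<in> V" "q \<in> V" "?B p = ?B q"
  hence "\<xi>' p = \<xi>' q" using inj_onD[OF cmap_inj[OF d(3)]] d(4) by blast
  thus "p = q" using inj_onD[OF d(2)] pq by blast
 qed
 have jB: "jac ?B z \<noteq> 0" if "z \<in> V" for z using d(6) that by auto
 define H where "H = inv_into V ?B"
 have HB: "H (?B z) = z" if "z \<in> V" for z using inv_into_f_f[OF iB that] by (simp add: H_def)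
 have sH: "smooth (?B ` V) H" and jH: "\<And>z. z \<in> V ==> jac H (?B z) = 1 / jac ?B z"
  using smooth_inverse[OF d(5) iB jB HB] by auto
 let ?M = "{u \<in> U. \<xi> u \<in> cdom S d}"
 define N where "N = ?M \<inter> ?A -` (?B ` V)"
 have sA: "smooth ?M ?A" by (rule PI_chart(2)[OF U d(3)])
 have oN: "open N" unfolding N_def
  by (rule smooth_vimage[OF sA smooth_open[OF sH]])
 have sN: "smooth N ?A" by (rule smooth_subset[OF sA oN]) (auto simp: N_def)
 define t where "t u = H (?A u)" for u
 have st: "smooth N t" unfolding t_def by (rule smooth_compose[OF sH sN]) (auto simp: N_def)
 have tN: "t u \<in> V \<and> \<xi>' (t u) = \<xi> u \<and> jac t u = 1" if u: "u \<in> N" for u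
 proof -
  obtain v where v: "v \<in> V" "?A u = ?B v" using u unfolding N_def by blast
  have uU: "u \<in> U" "\<xi> u \<in> cdom S d" using u by (auto simp: N_def)
  have tu: "t u = v" using HB[OF v(1)] v(2) by (simp add: t_def)
  have "\<xi> u = \<xi>' v" using inj_onD[OF cmap_inj[OF d(3)] v(2) uU(2)] d(4) v(1) by blast
  moreover have "jac t u = jac H (?A u) * jac ?A u" unfolding t_def
   by (rule jac_compose[OF smooth_diff[OF sN u] smooth_diff[OF sH]]) (use v in auto)
  moreover have "jac H (?A u) = 1 / jac ?B v" using jH[OF v(1)] v(2) by simp
  \<comment> \<open>Both parametrizations pull the form back to dx \<and> dy, so at this point their
    Jacobians are inverse to the same coefficient and the transition has Jacobian 1.\<close>
  moreover have "\<omega> d (?A u) 1 \<i> * jac ?A u = 1" by (rule PI_chart(3)[OF U d(3) uU])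
  moreover have "\<omega> d (?A u) 1 \<i> * jac ?B v = 1" using d(6) v by auto
  moreover have "a = b" if "w * a = 1" "w * b = 1" for a b w :: real using that by (metis mult_left_cancel mult_zero_left zero_neq_one)
  ultimately have "jac t u = 1 / jac ?B v * jac ?B v" by metis
  thus ?thesis using \<open>\<xi> u = \<xi>' v\<close> tu v(1) jB[OF v(1)] by simp
 qed
 have "p \<in> N" using pq d(4) by (auto simp: N_def)
 thus "\<exists>N t. p \<in> N \<and> N \<subseteq> U \<and> smooth N t \<and> t ` N \<subseteq> V \<and> (\<forall>x\<in>N. \<xi>' (t x) = \<xi> x \<and> jac t x = 1)"
  using st tN by (intro exI[of _ N] exI[of _ t]) (auto simp: N_def)
qed

end

sublocale ssurf \<subseteq> os: osurf XI PI by (rule osurf_interior)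

context ssurf begin

lemma dens_chart:
 assumes be: "os.dens V \<beta> (\<lambda>_. 1)" and d: "d \<in> charts S" and p: "p \<in> V" "\<beta> p \<in> cdom S d"
 obtains N where "p \<in> N" "N \<subseteq> V" "\<beta> ` N \<subseteq> cdom S d" "smooth N (\<lambda>x. cmap S d (\<beta> x))"
  "\<And>x. x \<in> N ==> \<omega> d (cmap S d (\<beta> x)) 1 \<i> * jac (\<lambda>x. cmap S d (\<beta> x)) x = 1"
proof -
 obtain U \<xi> N l where l: "(U, \<xi>) \<in> PI" "p \<in> N" "N \<subseteq> V" "smooth N l" "l ` N \<subseteq> U"
  "\<And>x. x \<in> N ==> \<beta> x = \<xi> (l x)" "\<And>x. x \<in> N ==> jac l x = 1"
  by (rule os.densE[OF be p(1)]) (rule that)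
 let ?M = "{u \<in> U. \<xi> u \<in> cdom S d}" and ?A = "\<lambda>p. cmap S d (\<xi> p)"
 note A = PI_chart[OF l(1) d]
 define N' where "N' = N \<inter> l -` ?M"
 have oN: "open N'" unfolding N'_def by (rule smooth_vimage[OF l(4) A(1)])
 have sl: "smooth N' l" by (rule smooth_subset[OF l(4) oN]) (auto simp: N'_def)
 have eq: "cmap S d (\<beta> x) = ?A (l x)" if "x \<in> N'" for x using l(6)[of x] that by (simp add: N'_def)
 have "smooth N' (\<lambda>x. ?A (l x))" by (rule smooth_compose[OF A(2) sl]) (auto simp: N'_def)
 hence s: "smooth N' (\<lambda>x. cmap S d (\<beta> x))" by (rule smooth_cong) (simp add: eq)
 have j: "\<omega> d (cmap S d (\<beta> x)) 1 \<i> * jac (\<lambda>x. cmap S d (\<beta> x)) x = 1" if x: "x \<in> N'" for x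
 proof -
  have lx: "l x \<in> ?M" "x \<in> N" using x by (auto simp: N'_def)
  have "jac (\<lambda>x. cmap S d (\<beta> x)) x = jac (\<lambda>x. ?A (l x)) x" by (rule jac_cong[OF oN x]) (simp add: eq)
  also have "\<dots> = jac ?A (l x) * jac l x"
   by (rule jac_compose[OF smooth_diff[OF sl x] smooth_diff[OF A(2) lx(1)]])
  finally show ?thesis using A(3)[of "l x"] lx l(7)[OF lx(2)] eq[OF x] by simp
 qed
 show ?thesis
  by (rule that[of N']) (use l p s j in \<open>auto simp: N'_def\<close>)
qed

lemma ssymp_chart:
 assumes Q: "os.ssymp \<Omega> E Q W" and z: "z \<in> E" and d: "d \<in> charts S" "Q z \<in> cdom S d"
 obtains N where "z \<in> N" "N \<subseteq> E" "Q ` N \<subseteq> cdom S d" "smooth N (\<lambda>x. cmap S d (Q x))" "smooth N W"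
  "\<And>x u v. x \<in> N ==> \<omega> d (cmap S d (Q x)) (dd (\<lambda>x. cmap S d (Q x)) x u) (dd (\<lambda>x. cmap S d (Q x)) x v)
    + area_form (dd W x u) (dd W x v) = \<Omega> u v"
proof -
 obtain \<beta> V l N where l: "inj_on \<beta> V" "os.dens V \<beta> (\<lambda>_. 1)" "z \<in> N" "N \<subseteq> E" "smooth N l" "l ` N \<subseteq> V" "smooth N W"
  "\<And>x. x \<in> N ==> Q x = \<beta> (l x)"
  "\<And>x u v. x \<in> N ==> area_form (dd l x u) (dd l x v) + area_form (dd W x u) (dd W x v) = \<Omega> u v"
  by (rule os.ssympE[OF Q z]) (rule that)
 have lz: "l z \<in> V" "\<beta> (l z) \<in> cdom S d" using l(3,6,8) d(2) by auto
 obtain M where M: "l z \<in> M" "M \<subseteq> V" "\<beta> ` M \<subseteq> cdom S d" "smooth M (\<lambda>x. cmap S d (\<beta> x))"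
  "\<And>x. x \<in> M ==> \<omega> d (cmap S d (\<beta> x)) 1 \<i> * jac (\<lambda>x. cmap S d (\<beta> x)) x = 1"
  by (rule dens_chart[OF l(2) d(1) lz]) (rule that)
 let ?A = "\<lambda>x. cmap S d (\<beta> x)" and ?f = "\<lambda>x. cmap S d (Q x)"
 define N' where "N' = N \<inter> l -` M"
 have oN: "open N'" unfolding N'_def
  by (rule smooth_vimage[OF l(5) smooth_open[OF M(4)]])
 have N'N: "N' \<subseteq> N" by (auto simp: N'_def)
 have sl: "smooth N' l" by (rule smooth_subset[OF l(5) oN N'N])
 have eq: "?f x = ?A (l x)" "l x \<in> M" if "x \<in> N'" for x using l(8)[of x] that by (auto simp: N'_def)
 have "smooth N' (\<lambda>x. ?A (l x))" by (rule smooth_compose[OF M(4) sl]) (auto simp: N'_def)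
 hence s: "smooth N' ?f" by (rule smooth_cong) (simp add: eq)
 show ?thesis
 proof (rule that[of N'])
  show "z \<in> N'" "N' \<subseteq> E" "smooth N' ?f" using l M(1) s by (auto simp: N'_def)
  show "smooth N' W" by (rule smooth_subset[OF l(7) oN N'N])
  show "Q ` N' \<subseteq> cdom S d" using l(8) M(3) by (auto simp: N'_def)
  fix x u v assume x: "x \<in> N'"
  have dA: "?A differentiable (at (l x))" by (rule smooth_diff[OF M(4) eq(2)[OF x]])
  have "dd ?f x = dd (?A \<circ> l) x" by (rule dd_cong(1)[OF oN x]) (simp add: eq)
  also have "\<dots> = (\<lambda>v. dd ?A (l x) (dd l x v))" by (rule dd_compose(2)[OF smooth_diff[OF sl x] dA])
  finally have df: "dd ?f x = (\<lambda>v. dd ?A (l x) (dd l x v))" .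
  have "?f x \<in> cimg S d" using eq[OF x] M(3) by (auto simp: cimg_def)
  hence "\<omega> d (?f x) (dd ?f x u) (dd ?f x v) = \<omega> d (?f x) 1 \<i> * area_form (dd ?f x u) (dd ?f x v)"
   by (rule form_area[OF d(1)])
  also have "\<dots> = (\<omega> d (?A (l x)) 1 \<i> * jac ?A (l x)) * area_form (dd l x u) (dd l x v)"
   unfolding df area_form_dd[OF dA] using eq[OF x] by simp
  also have "\<dots> = area_form (dd l x u) (dd l x v)" using M(5)[OF eq(2)[OF x]] by simp
  finally show "\<omega> d (?f x) (dd ?f x u) (dd ?f x v) + area_form (dd W x u) (dd W x v) = \<Omega> u v"
   using l(9)[of x u v] x N'N by auto
 qed
qed

text \<open>Positive genus provides a nonempty family of curves in the interior that together do not
  separate; one of them gives the circle-valued function on the interior.\<close>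

lemma surface_square:
 assumes g: "genus S > 0" and R: "0 < R"
 obtains Q W Rb where "os.ssymp area2 (sq R \<times> sq R) Q W" "inj_on (\<lambda>z. (Q z, W z)) (sq R \<times> sq R)"
  "\<And>z. z \<in> sq R \<times> sq R ==> cmod (W z) \<le> Rb"
proof -
 obtain F where F: "finite F" "disjoint F" "\<forall>C\<in>F. simple_closed_curve T C \<and> C \<subseteq> I"
  "connectedin T (topspace T - \<Union>F)" "0 < enat (card F)"
  using g unfolding genus_def less_Sup_iff by blast
 hence "F \<noteq> {}" by (auto simp: zero_enat_def)
 then obtain C where C: "C \<in> F" by blast
 have IT: "I \<subseteq> topspace T" by (rule openin_subset[OF interior_open])
 have XT: "topspace XI = I" using IT by (auto simp: XI_def)
 have cur: "simple_closed_curve XI D" if D: "D \<in> F" for D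
 using F(3) D by (auto simp: simple_closed_curve_def XI_def embedding_map_in_subtopology)
 have cT: "closedin T (\<Union>F)"
  using F(3) simple_closed_curve_compact(1) hausT compactin_imp_closedin by (intro closedin_Union[OF F(1)]) blast
 have "connectedin T (I - \<Union>F)" by (rule interior_minus_connected[OF cT F(4)])
 hence cF: "connectedin XI (topspace XI - \<Union>F)" unfolding XT unfolding XI_def by (simp add: connectedin_subtopology)
 have "connectedin T (I - {})" by (rule interior_minus_connected) (use conn in \<open>simp_all add: connectedin_topspace\<close>)
 hence cX: "connected_space XI" unfolding XI_def by (simp add: connectedin_def)
 have ne: "topspace XI \<noteq> {}"
 using cur[OF C] F(3) C by (auto simp: simple_closed_curve_def XT)
 obtain h Kc where h: "circ XI PI h Kc" "\<not> (\<exists>lg. continuous_map XI euclidean lg \<and> (\<forall>x\<in>topspace XI. h x = exp (lg x)))"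
  by (rule os.circle_function[OF F(1,2) cur cF C]) (assumption, rule that)
 interpret ci: circ XI PI h Kc by (rule h(1))
 show ?thesis by (rule ci.square_embedding[OF cX ne h(2) R]) (rule that)
qed

end

section \<open>Products of surfaces\<close>

text \<open>The conclusion of \<open>surface_square\<close> in terms of the charts of
  \<open>S\<close>, free of Darboux parametrizations, so that factors can be combined.\<close>

definition semb :: "('a, 'c, complex) mfd => ('c, complex) form2 => real => (complex \<times> complex => 'a) => (complex \<times> complex => complex) => real => bool" where
 "semb S \<omega> R Q W Rb \<longleftrightarrow> inj_on (\<lambda>z. (Q z, W z)) (sq R \<times> sq R) \<and>
   (\<forall>z\<in>sq R \<times> sq R. Q z \<in> mfd_interior S \<and> cmod (W z) \<le> Rb) \<and>
   (\<forall>z\<in>sq R \<times> sq R. \<forall>d\<in>charts S. Q z \<in> cdom S d -->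
    (\<exists>N. z \<in> N \<and> N \<subseteq> sq R \<times> sq R \<and> Q ` N \<subseteq> cdom S d \<and> smooth N (\<lambda>x. cmap S d (Q x)) \<and> smooth N W \<and>
     (\<forall>x\<in>N. \<forall>u v. \<omega> d (cmap S d (Q x)) (dd (\<lambda>x. cmap S d (Q x)) x u) (dd (\<lambda>x. cmap S d (Q x)) x v)
      + area_form (dd W x u) (dd W x v) = area2 u v)))"

lemma semb_exists:
 assumes "symplectic_surface S \<omega>" "genus S > 0" "0 < R"
 obtains Q W Rb where "semb S \<omega> R Q W Rb"
proof -
 interpret ssurf S \<omega> by standard (rule assms(1))
 obtain Q W Rb where Q: "os.ssymp area2 (sq R \<times> sq R) Q W" "inj_on (\<lambda>z. (Q z, W z)) (sq R \<times> sq R)"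
  "\<And>z. z \<in> sq R \<times> sq R ==> cmod (W z) \<le> Rb"
  by (rule surface_square[OF assms(2,3)]) (rule that)
 have QI: "Q z \<in> mfd_interior S" if z: "z \<in> sq R \<times> sq R" for z
 proof -
  obtain \<beta> V l N where l: "os.dens V \<beta> (\<lambda>_. 1)" "z \<in> N" "l ` N \<subseteq> V" "\<And>x. x \<in> N ==> Q x = \<beta> (l x)"
   by (rule os.ssympE[OF Q(1) z]) (rule that)
  have "\<beta> (l z) \<in> topspace XI" by (rule os.dens_in[OF l(1)]) (use l in blast)
  thus ?thesis using l(2,4) by (simp add: XI_def)
 qed
 show thesis
 proof (rule that[of Q W Rb], unfold semb_def, intro conjI ballI impI)
  fix z d assume z: "z \<in> sq R \<times> sq R" "d \<in> charts S" "Q z \<in> cdom S d"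
  obtain N where N: "z \<in> N" "N \<subseteq> sq R \<times> sq R" "Q ` N \<subseteq> cdom S d" "smooth N (\<lambda>x. cmap S d (Q x))" "smooth N W"
   "\<And>x u v. x \<in> N ==> \<omega> d (cmap S d (Q x)) (dd (\<lambda>x. cmap S d (Q x)) x u) (dd (\<lambda>x. cmap S d (Q x)) x v)
    + area_form (dd W x u) (dd W x v) = area2 u v"
   by (rule ssymp_chart[OF Q(1) z]) (rule that)
  show "\<exists>N. z \<in> N \<and> N \<subseteq> sq R \<times> sq R \<and> Q ` N \<subseteq> cdom S d \<and> smooth N (\<lambda>x. cmap S d (Q x)) \<and> smooth N W \<and>
     (\<forall>x\<in>N. \<forall>u v. \<omega> d (cmap S d (Q x)) (dd (\<lambda>x. cmap S d (Q x)) x u) (dd (\<lambda>x. cmap S d (Q x)) x v)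
      + area_form (dd W x u) (dd W x v) = area2 u v)"
   by (intro exI[of _ N] conjI N ballI allI)
 qed (use Q QI in auto)
qed

section \<open>Induction over the factors\<close>

definition cube :: "real => (complex ^ 'm) set" where "cube R = {z. \<forall>j. z $ j \<in> sq R}"

lemma open_cube: "open (cube R :: (complex ^ 'm::finite) set)"
proof -
 have "cube R = (\<Inter>j\<in>UNIV. (\<lambda>z::complex^'m. z $ j) -` sq R)" by (auto simp: cube_def)
 thus ?thesis by (simp add: open_INT open_vimage open_sq continuous_on_component)
qed

definition lifted :: "('n::finite => ('a, 'c, complex) mfd) => ('n => ('c, complex) form2) => real => 'n set =>
  ('n => complex ^ 'n option => 'a) => (complex ^ 'n option => complex) => real => bool" where
 "lifted S \<omega> R A p w B \<longleftrightarrow> smooth (cube R) w \<and> (\<forall>z\<in>cube R. cmod (w z) \<le> B) \<and>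
   (\<forall>i\<in>A. \<forall>z\<in>cube R. p i z \<in> mfd_interior (S i)) \<and>
   (\<forall>z\<in>cube R. \<forall>z'\<in>cube R. (\<forall>i\<in>A. p i z = p i z') --> w z = w z' --> (\<forall>i. i \<notin> A --> z $ Some i = z' $ Some i) --> z = z') \<and>
   (\<forall>i\<in>A. \<forall>z\<in>cube R. \<forall>d\<in>charts (S i). p i z \<in> cdom (S i) d -->
    (\<exists>N. z \<in> N \<and> N \<subseteq> cube R \<and> p i ` N \<subseteq> cdom (S i) d \<and> smooth N (\<lambda>x. cmap (S i) d (p i x)))) \<and>
   (\<forall>z\<in>cube R. \<forall>d. (\<forall>i\<in>A. d i \<in> charts (S i) \<and> p i z \<in> cdom (S i) (d i)) -->
    (\<forall>u v. (\<Sum>i\<in>A. \<omega> i (d i) (cmap (S i) (d i) (p i z)) (dd (\<lambda>x. cmap (S i) (d i) (p i x)) z u) (dd (\<lambda>x. cmap (S i) (d i) (p i x)) z v))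
      + area_form (dd w z u) (dd w z v)
      = (\<Sum>i\<in>A. area_form (u $ Some i) (v $ Some i)) + area_form (u $ None) (v $ None)))"

lemma smooth_nth: "open U ==> smooth U (\<lambda>z::complex^'m::finite. z $ j)"
 by (rule smooth_lin_comp[OF bounded_linear_vec_nth smooth_ident])

lemma dd_nth: "dd (\<lambda>z::complex^'m::finite. z $ j) x = (\<lambda>v. v $ j)"
 by (rule dd_eqI[OF bounded_linear_imp_has_derivative[OF bounded_linear_vec_nth]])

lemma dd_Pair:
 assumes "f differentiable (at x)" "g differentiable (at x)"
 shows "dd (\<lambda>x. (f x, g x)) x = (\<lambda>v. (dd f x v, dd g x v))"
 by (rule dd_eqI) (intro has_derivative_Pair assms[unfolded frechet_derivative_works])

lemma lifted_empty:
 fixes S :: "'n::finite => ('a, 'c, complex) mfd"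
 shows "\<exists>p w B. lifted S \<omega> R {} p w B"
proof (intro exI)
 have "cmod (z $ None) \<le> 2 * R" if "z \<in> cube R" for z :: "complex ^ 'n option"
 proof -
  have "z $ None \<in> sq R" using that by (simp add: cube_def)
  thus ?thesis using cmod_le[of "z $ None"] by (auto simp: sq_def)
 qed
 thus "lifted S \<omega> R {} (\<lambda>_ _. undefined) (\<lambda>z. z $ None) (2 * R)"
  unfolding lifted_def dd_nth by (auto intro: smooth_nth open_cube simp: vec_eq_iff) (metis not_None_eq)
qed

text \<open>The pair of the i-th coordinate and the current w is fed into the embedding for the new
  factor. This trades the area forms of the pair for that of the surface and of the new w, so the
  identity for \<open>A\<close> turns into the one for \<open>insert i A\<close>.\<close>

lemma lifted_insert:
 fixes S :: "'n::finite => ('a, 'c, complex) mfd"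
 assumes L: "lifted S \<omega> R A p w B" and i: "i \<notin> A" and S: "\<And>i. symplectic_surface (S i) (\<omega> i)" "genus (S i) > 0" and R: "0 < R"
 shows "\<exists>p w B. lifted S \<omega> R (insert i A) p w B"
proof -
 note L1 = L[unfolded lifted_def, THEN conjunct1]
  and L2 = L[unfolded lifted_def, THEN conjunct2, THEN conjunct1, rule_format]
  and L3 = L[unfolded lifted_def, THEN conjunct2, THEN conjunct2, THEN conjunct1, rule_format]
  and L4 = L[unfolded lifted_def, THEN conjunct2, THEN conjunct2, THEN conjunct2, THEN conjunct1, rule_format]
  and L5 = L[unfolded lifted_def, THEN conjunct2, THEN conjunct2, THEN conjunct2, THEN conjunct2, THEN conjunct1, THEN bspec, THEN bspec, THEN bspec, THEN mp]
  and L6 = L[unfolded lifted_def, THEN conjunct2, THEN conjunct2, THEN conjunct2, THEN conjunct2, THEN conjunct2, THEN bspec, THEN spec, THEN mp, THEN spec, THEN spec]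
 have sw: "smooth (cube R) w" and wB: "\<And>z. z \<in> cube R ==> cmod (w z) \<le> B" by (rule L1, rule L2)
 \<comment> \<open>Since w is bounded on the cube, a square of this size has room for both
   inputs.\<close>
 define R' where "R' = max R (B + 1)"
 have R': "R \<le> R'" "B < R'" "0 < R'" using R by (auto simp: R'_def)
 obtain Q W Rb where Q: "semb (S i) (\<omega> i) R' Q W Rb" by (rule semb_exists[OF S R'(3)]) (rule that)
 note Q1 = Q[unfolded semb_def, THEN conjunct1] and Q2 = Q[unfolded semb_def, THEN conjunct2, THEN conjunct1, THEN bspec]
  and Q3 = Q[unfolded semb_def, THEN conjunct2, THEN conjunct2, THEN bspec, THEN bspec, THEN mp]
 define \<zeta> where "\<zeta> = (\<lambda>z::complex ^ 'n option. (z $ Some i, w z))"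
 have zE: "\<zeta> z \<in> sq R' \<times> sq R'" if z: "z \<in> cube R" for z
 proof -
  have "z $ Some i \<in> sq R" using z by (simp add: cube_def)
  hence "z $ Some i \<in> sq R'" using R'(1) by (auto simp: sq_def)
  moreover have "w z \<in> sq R'"
   using wB[OF z] R'(2) abs_Re_le_cmod[of "w z"] abs_Im_le_cmod[of "w z"] by (auto simp: sq_def)
  ultimately show ?thesis by (simp add: \<zeta>_def)
 qed
 have sz: "smooth (cube R) \<zeta>" unfolding \<zeta>_def by (intro smooth_Pair smooth_nth open_cube sw)
 have dz: "dd \<zeta> z = (\<lambda>v. (v $ Some i, dd w z v))" if "z \<in> cube R" for z
  unfolding \<zeta>_def using dd_Pair[OF smooth_diff[OF smooth_nth[OF open_cube] that] smooth_diff[OF sw that]]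
  by (simp add: dd_nth)
 have loc: "\<exists>N. z \<in> N \<and> N \<subseteq> cube R \<and> (\<lambda>z. Q (\<zeta> z)) ` N \<subseteq> cdom (S i) d \<and> smooth N (\<lambda>x. cmap (S i) d (Q (\<zeta> x))) \<and>
   smooth N (\<lambda>x. W (\<zeta> x)) \<and>
   (\<forall>u v. \<omega> i d (cmap (S i) d (Q (\<zeta> z))) (dd (\<lambda>x. cmap (S i) d (Q (\<zeta> x))) z u) (dd (\<lambda>x. cmap (S i) d (Q (\<zeta> x))) z v)
    + area_form (dd (\<lambda>x. W (\<zeta> x)) z u) (dd (\<lambda>x. W (\<zeta> x)) z v)
    = area_form (u $ Some i) (v $ Some i) + area_form (dd w z u) (dd w z v))"
  if z: "z \<in> cube R" and d: "d \<in> charts (S i)" "Q (\<zeta> z) \<in> cdom (S i) d" for z :: "complex ^ 'n option" and d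
 proof -
  obtain N where N: "\<zeta> z \<in> N" "N \<subseteq> sq R' \<times> sq R'" "Q ` N \<subseteq> cdom (S i) d" "smooth N (\<lambda>x. cmap (S i) d (Q x))" "smooth N W"
   "\<forall>x\<in>N. \<forall>u v. \<omega> i d (cmap (S i) d (Q x)) (dd (\<lambda>x. cmap (S i) d (Q x)) x u) (dd (\<lambda>x. cmap (S i) d (Q x)) x v)
      + area_form (dd W x u) (dd W x v) = area2 u v"
   using Q3[OF zE[OF z] d] by (elim exE conjE) (rule that)
  define M where "M = cube R \<inter> \<zeta> -` N"
  have oM: "open M" unfolding M_def
   by (rule continuous_open_preimage[OF smooth_cont[OF sz] open_cube smooth_open[OF N(5)]])
  have sM: "smooth M \<zeta>" by (rule smooth_subset[OF sz oM]) (auto simp: M_def)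
  have zM: "z \<in> M" using z N(1) by (simp add: M_def)
  have s1: "smooth M (\<lambda>x. cmap (S i) d (Q (\<zeta> x)))" by (rule smooth_compose[OF N(4) sM]) (auto simp: M_def)
  have s2: "smooth M (\<lambda>x. W (\<zeta> x))" by (rule smooth_compose[OF N(5) sM]) (auto simp: M_def)
  have d1: "dd (\<lambda>x. cmap (S i) d (Q (\<zeta> x))) z = (\<lambda>v. dd (\<lambda>x. cmap (S i) d (Q x)) (\<zeta> z) (dd \<zeta> z v))"
   using dd_compose(2)[OF smooth_diff[OF sM zM] smooth_diff[OF N(4,1)]] by (simp add: o_def)
  have d2: "dd (\<lambda>x. W (\<zeta> x)) z = (\<lambda>v. dd W (\<zeta> z) (dd \<zeta> z v))"
   using dd_compose(2)[OF smooth_diff[OF sM zM] smooth_diff[OF N(5,1)]] by (simp add: o_def)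
  have "\<omega> i d (cmap (S i) d (Q (\<zeta> z))) (dd (\<lambda>x. cmap (S i) d (Q (\<zeta> x))) z u) (dd (\<lambda>x. cmap (S i) d (Q (\<zeta> x))) z v)
    + area_form (dd (\<lambda>x. W (\<zeta> x)) z u) (dd (\<lambda>x. W (\<zeta> x)) z v)
    = area_form (u $ Some i) (v $ Some i) + area_form (dd w z u) (dd w z v)" for u v
   unfolding d1 d2 N(6)[rule_format, OF N(1)] by (simp add: area2_def dz[OF z])
  moreover have "M \<subseteq> cube R" "(\<lambda>z. Q (\<zeta> z)) ` M \<subseteq> cdom (S i) d" using N(3) by (auto simp: M_def)
  ultimately show ?thesis using zM s1 s2 by (intro exI[of _ M]) simp
 qed
 define p' where "p' = p(i := (\<lambda>z. Q (\<zeta> z)))"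
 define w' where "w' z = W (\<zeta> z)" for z
 have p'A: "p' k = p k" if "k \<in> A" for k using i that by (auto simp: p'_def)
 have p'i: "p' i = (\<lambda>z. Q (\<zeta> z))" by (simp add: p'_def)
 have QI: "Q (\<zeta> z) \<in> mfd_interior (S i)" if "z \<in> cube R" for z :: "complex ^ 'n option" using Q2[OF zE[OF that]] by blast
 have sw': "smooth (cube R) w'"
 proof (rule smooth_local)
  fix z :: "complex ^ 'n option" assume z: "z \<in> cube R"
  obtain d where "d \<in> charts (S i)" "Q (\<zeta> z) \<in> cdom (S i) d" using QI[OF z] unfolding mfd_interior_def by blast
  from loc[OF z this] show "\<exists>N. z \<in> N \<and> N \<subseteq> cube R \<and> smooth N w'" unfolding w'_def by blast
 qed
 have "lifted S \<omega> R (insert i A) p' w' Rb"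
  unfolding lifted_def
 proof (intro conjI ballI allI impI)
  show "smooth (cube R) w'" by (rule sw')
  show "cmod (w' z) \<le> Rb" if "z \<in> cube R" for z using Q2[OF zE[OF that]] by (simp add: w'_def)
  show "p' k z \<in> mfd_interior (S k)" if "k \<in> insert i A" "z \<in> cube R" for k z
  using QI that L3[of k z] p'A[of k] by (auto simp: p'i)
 next
  fix z z' assume z: "z \<in> cube R" "z' \<in> cube R" and eq: "\<forall>k\<in>insert i A. p' k z = p' k z'" "w' z = w' z'"
   "\<forall>k. k \<notin> insert i A --> z $ Some k = z' $ Some k"
  have "Q (\<zeta> z) = Q (\<zeta> z')" using eq(1) p'i by simp
  hence "\<zeta> z = \<zeta> z'" using inj_onD[OF Q1 _ zE[OF z(1)] zE[OF z(2)]] eq(2) by (simp add: w'_def)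
  hence "z $ Some i = z' $ Some i" "w z = w z'" by (auto simp: \<zeta>_def)
  moreover have "\<forall>k\<in>A. p k z = p k z'" using eq(1) p'A by auto
  moreover have "\<forall>k. k \<notin> A --> z $ Some k = z' $ Some k" using eq(3) \<open>z $ Some i = z' $ Some i\<close> by auto
  ultimately show "z = z'" by (intro L4[OF z]) blast+
 next
  fix k z d assume k: "k \<in> insert i A" "z \<in> cube R" "d \<in> charts (S k)" "p' k z \<in> cdom (S k) d"
  show "\<exists>N. z \<in> N \<and> N \<subseteq> cube R \<and> p' k ` N \<subseteq> cdom (S k) d \<and> smooth N (\<lambda>x. cmap (S k) d (p' k x))"
  proof (cases "k = i")
   case True
   hence "d \<in> charts (S i)" "Q (\<zeta> z) \<in> cdom (S i) d" using k by (simp_all add: p'i)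
   from loc[OF k(2) this] show ?thesis unfolding True p'i by blast
  next
   case False
   hence kA: "k \<in> A" using k(1) by simp
   thus ?thesis using L5[OF kA k(2,3)] k(4) unfolding p'A[OF kA] by blast
  qed
 next
  fix z d u v assume z: "z \<in> cube R" and d: "\<forall>k\<in>insert i A. d k \<in> charts (S k) \<and> p' k z \<in> cdom (S k) (d k)"
  let ?t = "\<lambda>p k. \<omega> k (d k) (cmap (S k) (d k) (p k z)) (dd (\<lambda>x. cmap (S k) (d k) (p k x)) z u) (dd (\<lambda>x. cmap (S k) (d k) (p k x)) z v)"
  have di: "d i \<in> charts (S i)" "Q (\<zeta> z) \<in> cdom (S i) (d i)" using d by (simp_all add: p'i)
  have 1: "?t p' i + area_form (dd w' z u) (dd w' z v) = area_form (u $ Some i) (v $ Some i) + area_form (dd w z u) (dd w z v)"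
   unfolding p'i w'_def[abs_def] using loc[OF z di] by blast
  have dA: "\<forall>k\<in>A. d k \<in> charts (S k) \<and> p k z \<in> cdom (S k) (d k)" using d p'A by auto
  have 2: "(\<Sum>k\<in>A. ?t p k) + area_form (dd w z u) (dd w z v) = (\<Sum>k\<in>A. area_form (u $ Some k) (v $ Some k)) + area_form (u $ None) (v $ None)"
   by (rule L6[OF z dA])
  have 3: "(\<Sum>k\<in>A. ?t p' k) = (\<Sum>k\<in>A. ?t p k)" by (rule sum.cong) (simp_all add: p'A)
  show "(\<Sum>k\<in>insert i A. ?t p' k) + area_form (dd w' z u) (dd w' z v)
    = (\<Sum>k\<in>insert i A. area_form (u $ Some k) (v $ Some k)) + area_form (u $ None) (v $ None)"
   using 1 2 3 i by (simp add: sum.insert)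
 qed
 thus ?thesis by blast
qed

lemma lifted_exists:
 fixes S :: "'n::finite => ('a, 'c, complex) mfd"
 assumes S: "\<And>i. symplectic_surface (S i) (\<omega> i)" "\<And>i. genus (S i) > 0" and R: "0 < R"
 shows "\<exists>p w B. lifted S \<omega> R A p w B"
proof (induction A rule: finite_induct[OF finite])
 case 1 show ?case by (rule lifted_empty)
next
 case (2 i A)
 then obtain p w B where L: "lifted S \<omega> R A p w B" by blast
 show ?case by (rule lifted_insert[where S = S and \<omega> = \<omega>, OF L 2(2) S R])
qed

subsection \<open>Charts of the product\<close>

lemma vec_axis_sum: "((\<chi> i. g i) :: complex ^ 'm::finite) = (\<Sum>i\<in>UNIV. axis i (g i))"
 by (simp add: vec_eq_iff axis_def sum.delta)

lemma bounded_linear_axis: "bounded_linear (axis i :: complex => complex ^ 'm::finite)"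
 by (intro linear_conv_bounded_linear[THEN iffD1] linearI) (auto simp: axis_def vec_eq_iff)

lemma smooth_vec:
 assumes "open U" "\<And>i. smooth U (g i)"
 shows "smooth U (\<lambda>z. (\<chi> i. g i z) :: complex ^ 'm::finite)"
 unfolding vec_axis_sum by (intro smooth_sum assms(1) smooth_lin_comp[OF bounded_linear_axis] assms(2))

lemma continuous_map_vec:
 assumes "\<And>i. continuous_map X euclidean (g i)"
 shows "continuous_map X euclidean (\<lambda>z. (\<chi> i. g i z) :: complex ^ 'm::finite)"
 unfolding vec_axis_sum
proof (rule continuous_map_sum)
 fix i
 have "continuous_map euclidean euclidean (axis i :: complex => complex ^ 'm)"
  by (simp add: linear_continuous_on[OF bounded_linear_axis])
 from continuous_map_compose[OF assms this] show "continuous_map X euclidean (\<lambda>z. axis i (g i z))" by (simp add: o_def)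
qed simp

lemma dd_vec:
 assumes "\<And>i. g i differentiable (at z)"
 shows "dd (\<lambda>z. (\<chi> i. g i z) :: complex ^ 'm::finite) z = (\<lambda>v. \<chi> i. dd (g i) z v)"
proof (rule dd_eqI)
 have "((\<lambda>z. \<Sum>i\<in>UNIV. axis i (g i z)) has_derivative (\<lambda>v. \<Sum>i\<in>UNIV. axis i (dd (g i) z v))) (at z)"
  by (intro has_derivative_sum bounded_linear.has_derivative[OF bounded_linear_axis] assms[unfolded frechet_derivative_works])
 thus "((\<lambda>z. \<chi> i. g i z) has_derivative (\<lambda>v. \<chi> i. dd (g i) z v)) (at z)" by (simp add: vec_axis_sum)
qed

lemma (in ssurf) chart_continuous:
 assumes E: "open E" and f: "\<And>z. z \<in> E ==> f z \<in> topspace T"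
  and loc: "\<And>z d. z \<in> E ==> d \<in> charts S ==> f z \<in> cdom S d ==>
   \<exists>N. z \<in> N \<and> N \<subseteq> E \<and> f ` N \<subseteq> cdom S d \<and> smooth N (\<lambda>x. cmap S d (f x))"
 shows "continuous_map (top_of_set E) T f"
 unfolding continuous_map_def
proof (intro conjI allI impI)
 show "f \<in> topspace (top_of_set E) \<rightarrow> topspace T" using f by auto
 fix G assume G: "openin T G"
 have "open {x \<in> E. f x \<in> G}"
 proof (subst open_subopen, rule ballI)
  fix z assume z: "z \<in> {x \<in> E. f x \<in> G}"
  then obtain d where d: "d \<in> charts S" "f z \<in> cdom S d" using cover_charts f by blast
  obtain N where N: "z \<in> N" "N \<subseteq> E" "f ` N \<subseteq> cdom S d" "smooth N (\<lambda>x. cmap S d (f x))"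
   using loc[OF _ d] z by blast
  have "openin (top_of_set (cimg S d)) (cmap S d ` (G \<inter> cdom S d))"
   by (rule cmap_openmap[OF d(1) openin_Int[OF G cdom_open[OF d(1)]]]) auto
  then obtain H where H: "open H" "cmap S d ` (G \<inter> cdom S d) = cimg S d \<inter> H" by (auto simp: openin_open)
  have "open (N \<inter> (\<lambda>x. cmap S d (f x)) -` H)"
   by (rule smooth_vimage[OF N(4) H(1)])
  moreover have "cmap S d (f z) \<in> H" using H(2) z d(2) by blast
  moreover have "f x \<in> G" if x: "x \<in> N" "cmap S d (f x) \<in> H" for x
  proof -
   have fx: "f x \<in> cdom S d" using N(3) x(1) by blast
   hence "cmap S d (f x) \<in> cmap S d ` (G \<inter> cdom S d)" unfolding H(2) using x(2) by (simp add: cimg_def)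
   then obtain y where "y \<in> G \<inter> cdom S d" "cmap S d (f x) = cmap S d y" by blast
   thus ?thesis using inj_onD[OF cmap_inj[OF d(1)]] fx by blast
  qed
  ultimately show "\<exists>T. open T \<and> z \<in> T \<and> T \<subseteq> {x \<in> E. f x \<in> G}"
   using N(1,2) by (intro exI[of _ "N \<inter> (\<lambda>x. cmap S d (f x)) -` H"]) auto
 qed
 thus "openin (top_of_set E) {x \<in> topspace (top_of_set E). f x \<in> G}" using E by (simp add: openin_open_eq)
qed

context
 fixes S :: "'n::finite => ('a, 'c, complex) mfd" and \<omega> :: "'n => ('c, complex) form2"
 assumes S: "\<And>i. symplectic_surface (S i) (\<omega> i)"
begin

abbreviation "M \<equiv> prod_mfd (Pi_mfd S) complex_mfd"

lemma ss: "ssurf (S i) (\<omega> i)" by standard (rule S)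

lemma M_simps:
 "mtop M = prod_topology (product_topology (\<lambda>i. mtop (S i)) UNIV) euclidean"
 "(d, e) \<in> charts M \<longleftrightarrow> (\<forall>i. d i \<in> charts (S i))"
 "cdom M (d, e) = {x. \<forall>i. x i \<in> cdom (S i) (d i)} \<times> UNIV"
 "cmap M (d, e) x = ((\<chi> i. cmap (S i) (d i) (fst x i)), snd x)"
 by (auto simp: prod_mfd_def Pi_mfd_def complex_mfd_def split: prod.splits)

lemma M_cdom_open: assumes "\<And>i. d i \<in> charts (S i)" shows "openin (mtop M) (cdom M (d, e))"
proof -
 have eq: "{x. \<forall>i. x i \<in> cdom (S i) (d i)} = (\<Pi>\<^sub>E i\<in>UNIV. cdom (S i) (d i))" by (auto simp: PiE_def)
 have "openin (product_topology (\<lambda>i. mtop (S i)) UNIV) (\<Pi>\<^sub>E i\<in>UNIV. cdom (S i) (d i))"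
  using ssurf.cdom_open[OF ss assms] by (simp add: openin_PiE)
 thus ?thesis unfolding M_simps eq by (simp add: openin_prod_Times_iff)
qed

lemma M_vimage:
 assumes d: "\<And>i. d i \<in> charts (S i)" and G: "open G"
 shows "openin (mtop M) {x \<in> cdom M (d, e). cmap M (d, e) x \<in> G}"
proof -
 let ?X = "subtopology (mtop M) (cdom M (d, e))"
 have top: "topspace ?X = cdom M (d, e)" using openin_subset[OF M_cdom_open[OF d, of e]] by auto
 have c: "continuous_map ?X euclidean (\<lambda>x. cmap (S i) (d i) (fst x i))" for i
 proof -
  have "continuous_map (mtop M) (mtop (S i)) (\<lambda>x. fst x i)"
   unfolding M_simps using continuous_map_compose[OF continuous_map_fst continuous_map_product_projection[of i UNIV "\<lambda>i. mtop (S i)"]]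
   by (simp add: o_def)
  hence "continuous_map ?X (subtopology (mtop (S i)) (cdom (S i) (d i))) (\<lambda>x. fst x i)"
   by (auto simp: continuous_map_in_subtopology M_simps intro: continuous_map_from_subtopology)
  from continuous_map_compose[OF this ssurf.cmap_cont[OF ss d]] show ?thesis by (simp add: o_def)
 qed
 have "continuous_map ?X euclidean snd"
  unfolding M_simps by (rule continuous_map_from_subtopology[OF continuous_map_snd])
 hence "continuous_map ?X (prod_topology euclidean euclidean) (\<lambda>x. ((\<chi> i. cmap (S i) (d i) (fst x i)), snd x))"
  unfolding continuous_map_paired using continuous_map_vec[of ?X "\<lambda>i x. cmap (S i) (d i) (fst x i)", OF c] by (intro conjI)
 moreover have "cmap M (d, e) = (\<lambda>x. ((\<chi> i. cmap (S i) (d i) (fst x i)), snd x))" by (rule ext) (rule M_simps)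
 ultimately have "continuous_map ?X euclidean (cmap M (d, e))" by (simp only: prod_topology_euclidean)
 from openin_continuous_map_preimage[OF this, of G] have "openin ?X {x \<in> cdom M (d, e). cmap M (d, e) x \<in> G}"
  using G unfolding top by simp
 thus ?thesis by (rule openin_trans_full[OF _ M_cdom_open[OF d]])
qed

lemma M_inj: assumes d: "\<And>i. d i \<in> charts (S i)" shows "inj_on (cmap M (d, e)) (cdom M (d, e))"
proof (rule inj_onI)
 fix x y assume xy: "x \<in> cdom M (d, e)" "y \<in> cdom M (d, e)" "cmap M (d, e) x = cmap M (d, e) y"
 have "fst x i = fst y i" for i
 using xy xy(3) inj_onD[OF ssurf.cmap_inj[OF ss d[of i]]] by (auto simp: M_simps vec_eq_iff)
 thus "x = y" using xy(3) by (auto simp: M_simps intro!: prod_eqI)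
qed

lemma M_interior:
 assumes x: "\<And>i. x i \<in> mfd_interior (S i)" shows "(x, y) \<in> mfd_interior M"
proof -
 have "\<forall>i. \<exists>c. c \<in> charts (S i) \<and> x i \<in> cdom (S i) c \<and> cmap (S i) c (x i) \<in> interior (cimg (S i) c)"
  using x by (auto simp: mfd_interior_def)
 then obtain d where d: "\<And>i. d i \<in> charts (S i)" "\<And>i. x i \<in> cdom (S i) (d i)"
  "\<And>i. cmap (S i) (d i) (x i) \<in> interior (cimg (S i) (d i))" by metis
 let ?G = "{v :: complex ^ 'n. \<forall>i. v $ i \<in> interior (cimg (S i) (d i))}"
 have "?G = (\<Inter>i\<in>UNIV. (\<lambda>v. v $ i) -` interior (cimg (S i) (d i)))" by auto
 hence "open ?G" by (simp add: open_INT open_vimage continuous_on_component)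
 hence oG: "open (?G \<times> (UNIV :: complex set))" by (intro open_Times) simp_all
 have sub: "?G \<times> UNIV \<subseteq> cimg M (d, ())"
 proof clarify
  fix v :: "complex ^ 'n" and b assume v: "\<forall>i. v $ i \<in> interior (cimg (S i) (d i))"
  have "v $ i \<in> cimg (S i) (d i)" for i using interior_subset v[rule_format, of i] by (rule subsetD)
  hence "\<forall>i. \<exists>a. a \<in> cdom (S i) (d i) \<and> cmap (S i) (d i) a = v $ i" unfolding cimg_def by (metis imageE)
  then obtain a where "\<And>i. a i \<in> cdom (S i) (d i)" "\<And>i. cmap (S i) (d i) (a i) = v $ i" by metis
  thus "(v, b) \<in> cimg M (d, ())" unfolding cimg_def
   by (intro image_eqI[of _ _ "(a, b)"]) (auto simp: M_simps vec_eq_iff)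
 qed
 have "cmap M (d, ()) (x, y) \<in> ?G \<times> UNIV" using d(3) by (simp add: M_simps)
 hence "cmap M (d, ()) (x, y) \<in> interior (cimg M (d, ()))" by (rule subsetD[OF interior_maximal[OF sub oG]])
 thus ?thesis unfolding mfd_interior_def using d(1,2) by (intro CollectI bexI[of _ "(d, ())"]) (auto simp: M_simps)
qed

text \<open>Testing with u = \<i> (v - v') gives the squared norm of v - v'.\<close>

lemma std_form_nondeg: fixes v :: "complex ^ 'm::finite" assumes "\<And>u. std_form v u = std_form v' u" shows "v = v'"
proof -
 let ?u = "\<chi> j. \<i> * (v $ j - v' $ j)"
 have "area_form (v $ j) (?u $ j) - area_form (v' $ j) (?u $ j) = (cmod (v $ j - v' $ j))\<^sup>2" for j
  by (simp add: area_form_def cmod_power2) (simp add: power2_eq_square algebra_simps)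
 hence "(\<Sum>j\<in>UNIV. (cmod (v $ j - v' $ j))\<^sup>2) = std_form v ?u - std_form v' ?u"
  by (simp add: std_form_def sum_subtractf[symmetric])
 also have "\<dots> = 0" using assms by simp
 finally have "\<forall>j. (cmod (v $ j - v' $ j))\<^sup>2 = 0" by (subst (asm) sum_nonneg_eq_0_iff) auto
 thus ?thesis by (simp add: vec_eq_iff)
qed

text \<open>The ball lies in a cube, on which \<open>lifted\<close> with all factors treated is an
  injective symplectic map into the interior. Its continuity and openness are checked in
  charts.\<close>

lemma ball_embedding:
 assumes g: "\<And>i. genus (S i) > 0" and a: "0 < a"
 shows "\<exists>f :: complex ^ 'n option => _. symplectic_ball_embedding a M (prod_form2 (Pi_form2 \<omega>) complex_form2) f"
proof -
 \<comment> \<open>As \<pi> \<ge> 1, each coordinate of a point in the ball satisfies |z_j|^2 < a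
   \<le> (a + 1)^2.\<close>
 define R where "R = a + 1"
 have R: "0 < R" using a by (simp add: R_def)
 obtain p w B where L: "lifted S \<omega> R UNIV p w B" using lifted_exists[where S = S and \<omega> = \<omega> and A = UNIV, OF S g R] by blast
 note L1 = L[unfolded lifted_def, THEN conjunct1]
  and L2 = L[unfolded lifted_def, THEN conjunct2, THEN conjunct1, rule_format]
  and L3 = L[unfolded lifted_def, THEN conjunct2, THEN conjunct2, THEN conjunct1, rule_format]
  and L4 = L[unfolded lifted_def, THEN conjunct2, THEN conjunct2, THEN conjunct2, THEN conjunct1, rule_format]
  and L5 = L[unfolded lifted_def, THEN conjunct2, THEN conjunct2, THEN conjunct2, THEN conjunct2, THEN conjunct1, THEN bspec, THEN bspec, THEN bspec, THEN mp]
  and L6 = L[unfolded lifted_def, THEN conjunct2, THEN conjunct2, THEN conjunct2, THEN conjunct2, THEN conjunct2, THEN bspec, THEN spec, THEN mp, THEN spec, THEN spec]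
 let ?E = "std_ball a :: (complex ^ 'n option) set"
 have EC: "?E \<subseteq> cube R"
 proof
  fix z :: "complex ^ 'n option" assume z: "z \<in> ?E"
  have "z $ j \<in> sq R" for j
  proof -
   have "(cmod (z $ j))\<^sup>2 \<le> (\<Sum>j\<in>UNIV. (cmod (z $ j))\<^sup>2)" by (rule member_le_sum) auto
   hence "pi * (cmod (z $ j))\<^sup>2 \<le> pi * (\<Sum>j\<in>UNIV. (cmod (z $ j))\<^sup>2)" by (rule mult_left_mono) simp
   also have "\<dots> < a" using z by (simp add: std_ball_def)
   finally have "pi * (cmod (z $ j))\<^sup>2 < a" .
   moreover have "1 * (cmod (z $ j))\<^sup>2 \<le> pi * (cmod (z $ j))\<^sup>2" using pi_gt3 by (intro mult_right_mono) auto
   ultimately have "(cmod (z $ j))\<^sup>2 < a" by simp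
   also have "a \<le> R\<^sup>2" using a by (simp add: R_def power2_eq_square algebra_simps)
   finally have "cmod (z $ j) < R" using R power_less_imp_less_base[of "cmod (z $ j)" 2 R] by simp
   thus ?thesis using abs_Re_le_cmod[of "z $ j"] abs_Im_le_cmod[of "z $ j"] by (auto simp: sq_def)
  qed
  thus "z \<in> cube R" by (simp add: cube_def)
 qed
 have oE: "open ?E" unfolding std_ball_def by (intro open_Collect_less continuous_intros)
 define f where "f z = ((\<lambda>i. p i z), w z)" for z
 have pI: "p i z \<in> mfd_interior (S i)" if "z \<in> ?E" for i z by (rule L3) (use EC that in auto)
 have fI: "f z \<in> mfd_interior M" if "z \<in> ?E" for z unfolding f_def by (rule M_interior) (use pI that in blast)
 have finj: "inj_on f ?E"
 proof (rule inj_onI)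
  fix z z' assume z: "z \<in> ?E" "z' \<in> ?E" "f z = f z'"
  have "\<forall>i. p i z = p i z'" "w z = w z'" using z(3) by (auto simp: f_def fun_eq_iff)
  thus "z = z'" using EC z(1,2) by (intro L4) auto
 qed
 have ploc: "\<exists>N. z \<in> N \<and> N \<subseteq> ?E \<and> p i ` N \<subseteq> cdom (S i) c \<and> smooth N (\<lambda>x. cmap (S i) c (p i x))"
  if z: "z \<in> ?E" and c: "c \<in> charts (S i)" "p i z \<in> cdom (S i) c" for i z c
 proof -
  obtain N where N: "z \<in> N" "p i ` N \<subseteq> cdom (S i) c" "smooth N (\<lambda>x. cmap (S i) c (p i x))"
   using L5[OF UNIV_I subsetD[OF EC z] c] by blast
  have "open (N \<inter> ?E)" using smooth_open[OF N(3)] oE by blast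
  from smooth_subset[OF N(3) this] show ?thesis using N z by (intro exI[of _ "N \<inter> ?E"]) auto
 qed
 have pcont: "continuous_map (top_of_set ?E) (mtop (S i)) (p i)" for i
 using openin_subset[OF ssurf.interior_open[OF ss]] ssurf.chart_continuous[OF ss oE] pI ploc by blast
 have sw: "smooth ?E w" by (rule smooth_subset[OF L1 oE EC])
 have fcont: "continuous_map (top_of_set ?E) (mtop M) f"
  unfolding M_simps f_def using pcont smooth_cont[OF sw] by (simp add: continuous_map_paired continuous_map_componentwise_UNIV)
 define \<Phi> where "\<Phi> d z = ((\<chi> i. cmap (S i) (d i) (p i z)), w z)" for d z
 have cf: "cmap M (d, e) (f z) = \<Phi> d z" for d e z by (simp add: M_simps f_def \<Phi>_def)
 have floc: "\<exists>N. z \<in> N \<and> N \<subseteq> ?E \<and> f ` N \<subseteq> cdom M (d, e) \<and> (\<forall>i. smooth N (\<lambda>x. cmap (S i) (d i) (p i x))) \<and> smooth N (\<Phi> d)"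
  if z: "z \<in> ?E" and d: "\<And>i. d i \<in> charts (S i)" "f z \<in> cdom M (d, e)" for z d e
 proof -
  have "\<forall>i. \<exists>N. z \<in> N \<and> N \<subseteq> ?E \<and> p i ` N \<subseteq> cdom (S i) (d i) \<and> smooth N (\<lambda>x. cmap (S i) (d i) (p i x))"
   using ploc[OF z d(1)] d(2) by (auto simp: M_simps f_def)
  then obtain N where N: "\<And>i. z \<in> N i" "\<And>i. N i \<subseteq> ?E" "\<And>i. p i ` N i \<subseteq> cdom (S i) (d i)"
   "\<And>i. smooth (N i) (\<lambda>x. cmap (S i) (d i) (p i x))" by metis
  let ?N = "\<Inter>i\<in>UNIV. N i"
  have oN: "open ?N" using smooth_open[OF N(4)] by (intro open_INT) auto
  have s: "smooth ?N (\<lambda>x. cmap (S i) (d i) (p i x))" for i by (rule smooth_subset[OF N(4) oN]) auto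
  have NE: "?N \<subseteq> ?E" using N(2) by blast
  have "smooth ?N (\<Phi> d)" unfolding \<Phi>_def
   by (intro smooth_Pair smooth_vec oN s smooth_subset[OF sw oN NE])
  moreover have "p i x \<in> cdom (S i) (d i)" if "x \<in> ?N" for i x using N(3)[of i] that by blast
  hence "f ` ?N \<subseteq> cdom M (d, e)" by (simp add: M_simps f_def image_subset_iff)
  moreover have "z \<in> ?N" using N(1) by blast
  ultimately show ?thesis using NE s by (intro exI[of _ ?N] conjI allI)
 qed
 have fopen: "openin (mtop M) (f ` N)" if N: "open N" "N \<subseteq> ?E" for N
 proof (subst openin_subopen, rule ballI)
  fix y assume "y \<in> f ` N"
  then obtain z where z: "z \<in> N" "y = f z" by blast
  have zE: "z \<in> ?E" using z N by blast
  have "\<forall>i. \<exists>c. c \<in> charts (S i) \<and> p i z \<in> cdom (S i) c" using pI[OF zE] unfolding mfd_interior_def by blast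
  then obtain d where d: "\<And>i. d i \<in> charts (S i)" "\<And>i. p i z \<in> cdom (S i) (d i)" by metis
  hence "f z \<in> cdom M (d, ())" by (simp add: M_simps f_def)
  from floc[OF zE d(1) this] obtain N0 where N0: "z \<in> N0" "f ` N0 \<subseteq> cdom M (d, ())" "smooth N0 (\<Phi> d)" by blast
  let ?N = "N \<inter> N0"
  have oN: "open ?N" using N(1) smooth_open[OF N0(3)] by blast
  have "inj_on (\<Phi> d) ?N"
  proof (rule inj_onI)
   fix u v assume uv: "u \<in> ?N" "v \<in> ?N" "\<Phi> d u = \<Phi> d v"
   have "f u = f v" by (rule inj_onD[OF M_inj[OF d(1), of "()"]]) (use uv N0(2) in \<open>auto simp: cf\<close>)
   thus "u = v" using inj_onD[OF finj] uv N(2) by blast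
  qed
  moreover have "continuous_on ?N (\<Phi> d)" by (rule continuous_on_subset[OF smooth_cont[OF N0(3)]]) auto
  \<comment> \<open>Invariance of domain applies, because both spaces have real dimension 2 n + 2,
    where n is the number of factors.\<close>
  ultimately have oP: "open (\<Phi> d ` ?N)" by (intro invariance_of_domain_gen oN) simp_all
  have "openin (mtop M) {x \<in> cdom M (d, ()). cmap M (d, ()) x \<in> \<Phi> d ` ?N}" by (rule M_vimage[OF d(1) oP])
  moreover have "{x \<in> cdom M (d, ()). cmap M (d, ()) x \<in> \<Phi> d ` ?N} = f ` ?N"
  proof
   show "f ` ?N \<subseteq> {x \<in> cdom M (d, ()). cmap M (d, ()) x \<in> \<Phi> d ` ?N}" using N0(2) cf by blast
   show "{x \<in> cdom M (d, ()). cmap M (d, ()) x \<in> \<Phi> d ` ?N} \<subseteq> f ` ?N"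
   proof
    fix x assume "x \<in> {x \<in> cdom M (d, ()). cmap M (d, ()) x \<in> \<Phi> d ` ?N}"
    then obtain u where u: "x \<in> cdom M (d, ())" "u \<in> ?N" "cmap M (d, ()) x = \<Phi> d u" by blast
    have "x = f u" by (rule inj_onD[OF M_inj[OF d(1), of "()"]]) (use u N0(2) cf in auto)
    thus "x \<in> f ` ?N" using u(2) by blast
   qed
  qed
  ultimately have "openin (mtop M) (f ` ?N)" by simp
  thus "\<exists>T. openin (mtop M) T \<and> y \<in> T \<and> T \<subseteq> f ` N" using z N0(1) by (intro exI[of _ "f ` ?N"]) auto
 qed
 have emb: "embedding_map (top_of_set ?E) (subtopology (mtop M) (mfd_interior M)) f"
  unfolding embedding_map_in_subtopology
 proof
  show "embedding_map (top_of_set ?E) (mtop M) f"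
  using fopen oE injective_open_imp_embedding_map[OF fcont] by (auto simp: open_map_def openin_open_eq finj)
  show "f ` topspace (top_of_set ?E) \<subseteq> mfd_interior M" using fI by auto
 qed
 have main: "smooth_on {z \<in> ?E. f z \<in> cdom M c} (cmap M c \<circ> f) \<and>
    (\<forall>z\<in>?E. f z \<in> cdom M c -->
      (let D = frechet_derivative (cmap M c \<circ> f) (at z)
      in inj D \<and> (\<forall>v u. prod_form2 (Pi_form2 \<omega>) complex_form2 c (cmap M c (f z)) (D v) (D u) = std_form v u)))"
  if c: "c \<in> charts M" for c
 proof -
  obtain d e where de: "c = (d, e)" by (cases c)
  have d: "d i \<in> charts (S i)" for i using c unfolding de M_simps by blast
  have cfo: "cmap M c \<circ> f = \<Phi> d" by (rule ext) (simp add: de cf)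
  have "smooth {z \<in> ?E. f z \<in> cdom M c} (\<Phi> d)"
  proof (rule smooth_local)
   fix z assume z: "z \<in> {z \<in> ?E. f z \<in> cdom M c}"
   hence "z \<in> ?E" "f z \<in> cdom M (d, e)" by (auto simp: de)
   from floc[OF this(1) d this(2)] show "\<exists>V. z \<in> V \<and> V \<subseteq> {z \<in> ?E. f z \<in> cdom M c} \<and> smooth V (\<Phi> d)"
    unfolding de by blast
  qed
  hence s: "smooth_on {z \<in> ?E. f z \<in> cdom M c} (cmap M c \<circ> f)" unfolding cfo by (rule smooth_imp_smooth_on)
  have "inj (dd (\<Phi> d) z) \<and> (\<forall>v u. prod_form2 (Pi_form2 \<omega>) complex_form2 c (\<Phi> d z) (dd (\<Phi> d) z v) (dd (\<Phi> d) z u) = std_form v u)"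
   if z: "z \<in> ?E" "f z \<in> cdom M c" for z
  proof -
   have z': "f z \<in> cdom M (d, e)" using z(2) by (simp add: de)
   obtain N where N: "z \<in> N" "\<forall>i. smooth N (\<lambda>x. cmap (S i) (d i) (p i x))"
    using floc[OF z(1) d z'] by blast
   have df: "(\<lambda>x. cmap (S i) (d i) (p i x)) differentiable (at z)" for i by (rule smooth_diff[OF N(2)[rule_format] N(1)])
   have dw: "w differentiable (at z)" by (rule smooth_diff[OF sw z(1)])
   have D: "dd (\<Phi> d) z = (\<lambda>v. ((\<chi> i. dd (\<lambda>x. cmap (S i) (d i) (p i x)) z v), dd w z v))"
   proof -
    have dv: "(\<lambda>x. \<chi> i. cmap (S i) (d i) (p i x)) differentiable (at z)"
     by (rule smooth_diff[OF smooth_vec[OF smooth_open N(2)[rule_format]] N(1)]) (use N(2) in blast)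
    show ?thesis unfolding \<Phi>_def dd_Pair[OF dv dw] dd_vec[OF df] ..
   qed
   have form: "prod_form2 (Pi_form2 \<omega>) complex_form2 c (\<Phi> d z) (dd (\<Phi> d) z v) (dd (\<Phi> d) z u) = std_form v u" for v u
   proof -
    have cond: "\<forall>i\<in>UNIV. d i \<in> charts (S i) \<and> p i z \<in> cdom (S i) (d i)" using d z' by (auto simp: M_simps f_def)
    have "prod_form2 (Pi_form2 \<omega>) complex_form2 c (\<Phi> d z) (dd (\<Phi> d) z v) (dd (\<Phi> d) z u)
     = (\<Sum>i\<in>UNIV. \<omega> i (d i) (cmap (S i) (d i) (p i z)) (dd (\<lambda>x. cmap (S i) (d i) (p i x)) z v) (dd (\<lambda>x. cmap (S i) (d i) (p i x)) z u))
      + area_form (dd w z v) (dd w z u)"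
     unfolding D by (simp add: de prod_form2_def Pi_form2_def complex_form2_def \<Phi>_def)
    also have "\<dots> = (\<Sum>i\<in>UNIV. area_form (v $ Some i) (u $ Some i)) + area_form (v $ None) (u $ None)"
     by (rule L6[OF subsetD[OF EC z(1)] cond])
    also have "\<dots> = std_form v u" by (simp add: std_form_def UNIV_option_conv sum.reindex)
    finally show ?thesis .
   qed
   have "inj (dd (\<Phi> d) z)"
   proof (rule injI)
    fix v v' assume "dd (\<Phi> d) z v = dd (\<Phi> d) z v'"
    hence "std_form v u = std_form v' u" for u using form[of v u] form[of v' u] by simp
    thus "v = v'" by (rule std_form_nondeg)
   qed
   thus ?thesis using form by blast
  qed
  thus ?thesis using s unfolding cfo Let_def by (simp add: de cf)
 qed
 show ?thesis unfolding symplectic_ball_embedding_def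
  by (rule exI[of _ f]) (use emb main in blast)
qed

end

theorem corollary1p29:
  fixes S :: "'n::finite \<Rightarrow> ('a, 'c, complex) mfd"
    and \<omega> :: "'n \<Rightarrow> ('c, complex) form2"
  assumes "\<And>i. symplectic_surface (S i) (\<omega> i)"
    and "\<And>i. genus (S i) > 0"
  shows "gromov_width TYPE('n option)
           (prod_mfd (Pi_mfd S) complex_mfd)
           (prod_form2 (Pi_form2 \<omega>) complex_form2) = \<infinity>"
proof (rule ccontr)
  let ?w = "gromov_width TYPE('n option) (prod_mfd (Pi_mfd S) complex_mfd) (prod_form2 (Pi_form2 \<omega>) complex_form2)"
  assume "?w \<noteq> \<infinity>"
  then obtain r where r: "?w = ennreal r" "0 \<le> r" by (cases ?w) auto
  have "ennreal (r + 1) \<le> ?w" unfolding gromov_width_def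
    proof (rule Sup_upper)
    have "0 < r + 1" using r(2) by simp
    from ball_embedding[where S = S and \<omega> = \<omega> and a = "r + 1", OF assms this] this
    show "ennreal (r + 1) \<in> {ennreal a | a. 0 < a \<and> (\<exists>f :: complex ^ 'n option \<Rightarrow> _.
        symplectic_ball_embedding a (prod_mfd (Pi_mfd S) complex_mfd) (prod_form2 (Pi_form2 \<omega>) complex_form2) f)}" by blast
  qed
  then show False using r by (simp add: ennreal_le_iff)
qed

end
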